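(* Let $\dot X$ be a symmetric pure jump Lévy white noise on a Borel set $S\subset\mathbb{R}^d$ with characteristic triplet $(0,0,\nu)$, and let $\mathcal{L}$ be a partial differential operator on $\mathbb{R}^d$ with a fixed fundamental solution $\rho\in\mathcal{D}'(\mathbb{R}^d)$. Assume that for any $\varphi\in\mathcal{D}(\mathbb{R}^d)$ the convolution $\varphi*\check\rho$ belongs to $L(\dot X,S)$. Let $u_{\text{gen}}$ be the generalized solution to $\mathcal{L}u=\dot X$, defined by $\langle u_{\text{gen}},\varphi\rangle=\langle\dot X,\varphi*\check\rho\rangle$, $\varphi\in\mathcal{D}(\mathbb{R}^d)$. Suppose that $u_{\text{gen}}$ has a random field representation $Y$, that is, there exists a jointly measurable random field $(Y_t)_{t\in\mathbb{R}^d}$ such that $Y$ has almost surely locally integrable sample paths, and for any $\varphi\in\mathcal{D}(\mathbb{R}^d)$, $$\langle u_{\text{gen}},\varphi\rangle=\int_{\mathbb{R}^d}Y_t\,\varphi(t)\,\mathrm{d}t\qquad\text{a.s.}$$ Then, for almost all $t\in\mathbb{R}^d$, $\rho(t-\cdot)\in L(\dot X,S)$, and for almost all $t\in\mathbb{R}^d$, $$Y_t=\langle\dot X,\rho(t-\cdot)\rangle=u_{\text{mild}}(t)\qquad\text{a.s.}$$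
   Context: $\mathcal{D}(\mathbb{R}^d)$ is the space of $C^\infty$ compactly supported functions and $\mathcal{D}'(\mathbb{R}^d)$ the space of Schwartz distributions. A fundamental solution of $\mathcal{L}$ is a distribution $\rho\in\mathcal{D}'(\mathbb{R}^d)$ with $\mathcal{L}\rho=\delta_0$; one choice of $\rho$ is fixed. For $\varphi\in\mathcal{D}(\mathbb{R}^d)$, $\check\varphi(t)=\varphi(-t)$, $\langle\check\rho,\varphi\rangle=\langle\rho,\check\varphi\rangle$, and $(\varphi*\check\rho)(s)=\langle\rho,\varphi(s+\cdot)\rangle$, a $C^\infty$ function of $s$ (restricted to $S$ when integrated against the noise). Symmetric pure jump Lévy white noise with characteristic triplet $(0,0,\nu)$ on $S$: $\nu$ is a symmetric Lévy measure on $\mathbb{R}$ (i.e. $\nu(\{0\})=0$, $\int_{\mathbb{R}}(z^2\wedge1)\,\nu(\mathrm{d}z)<\infty$), $J$ is a Poisson random measure on $S\times\mathbb{R}$ with intensity measure $\mathrm{d}s\,\nu(\mathrm{d}z)$, $\tilde J=J-\mathrm{d}s\,\nu(\mathrm{d}z)$ is its compensated version, and $$X(\mathrm{d}s)=\int_{|z|\le1}z\,\tilde J(\mathrm{d}s,\mathrm{d}z)+\int_{|z|>1}z\,J(\mathrm{d}s,\mathrm{d}z).$$ The space of deterministic functions integrable with respect to it (Rajput–Rosiński) is $$L(\dot X,S)=\left\{f:S\to\mathbb{R}\text{ measurable}:\int_{S\times\mathbb{R}}\left(|f(s)z|^2\wedge1\right)\mathrm{d}s\,\nu(\mathrm{d}z)<+\infty\right\},$$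 and for $f\in L(\dot X,S)$ the stochastic integral is denoted $\langle\dot X,f\rangle$ (extension, by limits in probability, of $\sum_ia_i\mathbf{1}_{A_i}\mapsto\sum_ia_iX(A_i)$; a.s. linear in $f$). For the distribution $\rho$, the assertion "$\rho(t-\cdot)\in L(\dot X,S)$ for almost all $t$" is understood as saying that $\rho$ is a function (still denoted $\rho$) such that, for almost all $t\in\mathbb{R}^d$, $s\mapsto\rho(t-s)$ belongs to $L(\dot X,S)$. The mild solution is $u_{\text{mild}}(t):=\langle\dot X,\rho(t-\cdot)\rangle$, for those $t$ with $\rho(t-\cdot)\in L(\dot X,S)$. "Almost all $t$" refers to Lebesgue measure on $\mathbb{R}^d$.
   Formalization: The noise is assumed not to vanish identically: S has positive Lebesgue measure and ν ≠ 0. Otherwise the claim fails, e.g. for L the identity, ρ = δ_0 and Y = 0, where ρ is not a function. *)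

theory Defs
  imports "HOL-Probability.Probability"
begin

section \<open>Test functions and Schwartz distributions on \<open>real ^ 'd\<close>\<close>

definition partial_deriv :: "'d \<Rightarrow> (real ^ 'd::finite \<Rightarrow> real) \<Rightarrow> real ^ 'd \<Rightarrow> real" where
  "partial_deriv i f x = frechet_derivative f (at x) (axis i 1)"

text \<open>A partial derivative of order \<open>k\<close> is indexed by the word of length \<open>k\<close> that lists the
  directions of differentiation; for smooth functions the order of the letters is irrelevant.\<close>

definition partial_derivs :: "'d list \<Rightarrow> (real ^ 'd::finite \<Rightarrow> real) \<Rightarrow> real ^ 'd \<Rightarrow> real" where
  "partial_derivs js f = foldr partial_deriv js f"

definition smooth :: "(real ^ 'd::finite \<Rightarrow> real) \<Rightarrow> bool" where
  "smooth f \<longleftrightarrow> (\<forall>js x. partial_derivs js f differentiable (at x))"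

definition test_function :: "(real ^ 'd::finite \<Rightarrow> real) \<Rightarrow> bool" where
  "test_function \<phi> \<longleftrightarrow> smooth \<phi> \<and> compact (closure {x. \<phi> x \<noteq> 0})"

definition test_converges :: "(nat \<Rightarrow> real ^ 'd::finite \<Rightarrow> real) \<Rightarrow> (real ^ 'd \<Rightarrow> real) \<Rightarrow> bool" where
  "test_converges \<phi>s \<phi> \<longleftrightarrow>
     (\<exists>K. compact K \<and> (\<forall>n. {x. \<phi>s n x \<noteq> 0} \<subseteq> K)) \<and>
     (\<forall>js. uniform_limit UNIV (\<lambda>n. partial_derivs js (\<phi>s n)) (partial_derivs js \<phi>) sequentially)"

text \<open>Distributions are represented by functionals on all functions, of which only the values
  at test functions are relevant.\<close>

type_synonym 'd functional = "(real ^ 'd \<Rightarrow> real) \<Rightarrow> real"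

definition schwartz_distribution :: "'d::finite functional \<Rightarrow> bool" where
  "schwartz_distribution u \<longleftrightarrow>
     (\<forall>\<phi> \<psi>. test_function \<phi> \<longrightarrow> test_function \<psi> \<longrightarrow> u (\<lambda>x. \<phi> x + \<psi> x) = u \<phi> + u \<psi>) \<and>
     (\<forall>c \<phi>. test_function \<phi> \<longrightarrow> u (\<lambda>x. c * \<phi> x) = c * u \<phi>) \<and>
     (\<forall>\<phi>s \<phi>. (\<forall>n. test_function (\<phi>s n)) \<longrightarrow> test_function \<phi> \<longrightarrow> test_converges \<phi>s \<phi> \<longrightarrow>
        (\<lambda>n. u (\<phi>s n)) \<longlonglongrightarrow> u \<phi>)"

definition distr_partial_deriv :: "'d \<Rightarrow> 'd::finite functional \<Rightarrow> 'd functional" where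
  "distr_partial_deriv i u = (\<lambda>\<phi>. - u (partial_deriv i \<phi>))"

definition distr_mult :: "(real ^ 'd::finite \<Rightarrow> real) \<Rightarrow> 'd functional \<Rightarrow> 'd functional" where
  "distr_mult a u = (\<lambda>\<phi>. u (\<lambda>x. a x * \<phi> x))"

text \<open>A linear partial differential operator of order at most \<open>m\<close> with smooth (not necessarily
  constant) coefficients \<open>a\<close>, and its action on distributions.\<close>

definition pdo_coeffs :: "nat \<Rightarrow> ('d list \<Rightarrow> real ^ 'd::finite \<Rightarrow> real) \<Rightarrow> bool" where
  "pdo_coeffs m a \<longleftrightarrow> (\<forall>js. length js \<le> m \<longrightarrow> smooth (a js))"

definition pdo :: "nat \<Rightarrow> ('d list \<Rightarrow> real ^ 'd::finite \<Rightarrow> real) \<Rightarrow> 'd functional \<Rightarrow> 'd functional" where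
  "pdo m a u = (\<lambda>\<phi>. \<Sum>js | length js \<le> m. distr_mult (a js) (foldr distr_partial_deriv js u) \<phi>)"

definition fundamental_solution ::
    "nat \<Rightarrow> ('d list \<Rightarrow> real ^ 'd::finite \<Rightarrow> real) \<Rightarrow> 'd functional \<Rightarrow> bool" where
  "fundamental_solution m a \<rho> \<longleftrightarrow>
     schwartz_distribution \<rho> \<and> (\<forall>\<phi>. test_function \<phi> \<longrightarrow> pdo m a \<rho> \<phi> = \<phi> 0)"

definition conv_check :: "(real ^ 'd::finite \<Rightarrow> real) \<Rightarrow> 'd functional \<Rightarrow> real ^ 'd \<Rightarrow> real" where
  "conv_check \<phi> \<rho> s = \<rho> (\<lambda>x. \<phi> (s + x))"

definition locally_integrable :: "(real ^ 'd::finite \<Rightarrow> real) \<Rightarrow> bool" where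
  "locally_integrable g \<longleftrightarrow> (\<forall>K. compact K \<longrightarrow> set_integrable lborel K g)"

definition distribution_is_function :: "'d::finite functional \<Rightarrow> (real ^ 'd \<Rightarrow> real) \<Rightarrow> bool" where
  "distribution_is_function u r \<longleftrightarrow>
     locally_integrable r \<and> (\<forall>\<phi>. test_function \<phi> \<longrightarrow> u \<phi> = (\<integral>x. r x * \<phi> x \<partial>lborel))"


section \<open>Poisson random measures\<close>

definition poisson_distributed :: "'w measure \<Rightarrow> ('w \<Rightarrow> ennreal) \<Rightarrow> ennreal \<Rightarrow> bool" where
  "poisson_distributed M N l \<longleftrightarrow>
     (if l = \<top> then (AE \<omega> in M. N \<omega> = \<top>)
      else (\<forall>k::nat. measure M {\<omega> \<in> space M. N \<omega> = of_nat k}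
                      = exp (- enn2real l) * enn2real l ^ k / fact k))"

definition poisson_random_measure :: "'w measure \<Rightarrow> 'e measure \<Rightarrow> ('w \<Rightarrow> 'e measure) \<Rightarrow> bool" where
  "poisson_random_measure M \<mu> J \<longleftrightarrow>
     (\<forall>\<omega> \<in> space M. sets (J \<omega>) = sets \<mu>) \<and>
     (\<forall>B \<in> sets \<mu>. (\<lambda>\<omega>. emeasure (J \<omega>) B) \<in> borel_measurable M \<and>
        poisson_distributed M (\<lambda>\<omega>. emeasure (J \<omega>) B) (emeasure \<mu> B)) \<and>
     (\<forall>B :: nat \<Rightarrow> 'e set. range B \<subseteq> sets \<mu> \<longrightarrow> disjoint_family B \<longrightarrow>
        prob_space.indep_vars M (\<lambda>_. borel) (\<lambda>i \<omega>. emeasure (J \<omega>) (B i)) UNIV)"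

text \<open>\<open>Z\<close> is a version of the integral of the square integrable function \<open>h\<close> with respect to the
  compensated measure \<open>J - \<mu>\<close>, i.e. the \<open>L\<^sup>2\<close> limit of the pathwise compensated integrals of
  functions in \<open>L\<^sup>1 \<inter> L\<^sup>2\<close> that approximate \<open>h\<close> in \<open>L\<^sup>2\<close>. By the isometry property the limit does
  not depend on the approximating sequence.\<close>

definition has_compensated_integral ::
    "'w measure \<Rightarrow> 'e measure \<Rightarrow> ('w \<Rightarrow> 'e measure) \<Rightarrow> ('e \<Rightarrow> real) \<Rightarrow> ('w \<Rightarrow> real) \<Rightarrow> bool" where
  "has_compensated_integral M \<mu> J h Z \<longleftrightarrow>
     h \<in> borel_measurable \<mu> \<and> integrable \<mu> (\<lambda>e. (h e)\<^sup>2) \<and> Z \<in> borel_measurable M \<and>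
     (\<exists>hs :: nat \<Rightarrow> 'e \<Rightarrow> real.
        (\<forall>n. integrable \<mu> (hs n) \<and> integrable \<mu> (\<lambda>e. (hs n e)\<^sup>2)) \<and>
        (\<lambda>n. \<integral>\<^sup>+e. ennreal ((hs n e - h e)\<^sup>2) \<partial>\<mu>) \<longlonglongrightarrow> 0 \<and>
        (\<lambda>n. \<integral>\<^sup>+\<omega>. ennreal ((((\<integral>e. hs n e \<partial>J \<omega>) - (\<integral>e. hs n e \<partial>\<mu>)) - Z \<omega>)\<^sup>2) \<partial>M) \<longlonglongrightarrow> 0)"


section \<open>Symmetric pure jump Levy white noise\<close>

definition levy_measure :: "real measure \<Rightarrow> bool" where
  "levy_measure \<nu> \<longleftrightarrow> sets \<nu> = sets borel \<and> emeasure \<nu> {0} = 0 \<and>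
     (\<integral>\<^sup>+z. ennreal (min (z\<^sup>2) 1) \<partial>\<nu>) < \<top>"

definition symmetric_measure :: "real measure \<Rightarrow> bool" where
  "symmetric_measure \<nu> \<longleftrightarrow> distr \<nu> borel uminus = \<nu>"

definition jump_intensity :: "(real ^ 'd::finite) set \<Rightarrow> real measure \<Rightarrow> ((real ^ 'd) \<times> real) measure" where
  "jump_intensity S \<nu> = restrict_space lborel S \<Otimes>\<^sub>M \<nu>"

text \<open>The noise is a set function on the Borel subsets of \<open>S\<close> of finite Lebesgue measure, with
  values in the random variables.\<close>

definition noise_sets :: "(real ^ 'd::finite) set \<Rightarrow> (real ^ 'd) set set" where
  "noise_sets S = {A. A \<in> sets borel \<and> A \<subseteq> S \<and> emeasure lborel A < \<top>}"

definition symmetric_pure_jump_levy_noise ::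
    "'w measure \<Rightarrow> (real ^ 'd::finite) set \<Rightarrow> real measure \<Rightarrow> ('w \<Rightarrow> ((real ^ 'd) \<times> real) measure) \<Rightarrow>
     ((real ^ 'd) set \<Rightarrow> 'w \<Rightarrow> real) \<Rightarrow> bool" where
  "symmetric_pure_jump_levy_noise M S \<nu> J X \<longleftrightarrow>
     levy_measure \<nu> \<and> symmetric_measure \<nu> \<and>
     poisson_random_measure M (jump_intensity S \<nu>) J \<and>
     (\<forall>A \<in> noise_sets S. X A \<in> borel_measurable M \<and>
        (\<exists>Z. has_compensated_integral M (jump_intensity S \<nu>) J
                (\<lambda>(s, z). z * indicator A s * indicator {z. \<bar>z\<bar> \<le> 1} z) Z \<and>
             (AE \<omega> in M. X A \<omega> = Z \<omega> +
                (\<integral>(s, z). z * indicator A s * indicator {z. \<bar>z\<bar> > 1} z \<partial>J \<omega>))))"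


section \<open>Integration of deterministic functions with respect to the noise\<close>

text \<open>Integrands are functions on all of \<open>real ^ 'd\<close>, of which only the restriction to \<open>S\<close>
  is relevant.\<close>

definition L_noise :: "(real ^ 'd::finite) set \<Rightarrow> real measure \<Rightarrow> (real ^ 'd \<Rightarrow> real) set" where
  "L_noise S \<nu> = {f. f \<in> borel_measurable (restrict_space lborel S) \<and>
     (\<integral>\<^sup>+(s, z). ennreal (min (\<bar>f s * z\<bar>\<^sup>2) 1) \<partial>jump_intensity S \<nu>) < \<top>}"

definition converges_in_prob :: "'w measure \<Rightarrow> (nat \<Rightarrow> 'w \<Rightarrow> real) \<Rightarrow> ('w \<Rightarrow> real) \<Rightarrow> bool" where
  "converges_in_prob M Zs Z \<longleftrightarrow>
     (\<forall>\<epsilon>>0. (\<lambda>n. measure M {\<omega> \<in> space M. \<bar>Zs n \<omega> - Z \<omega>\<bar> > \<epsilon>}) \<longlonglongrightarrow> 0)"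

text \<open>Lists of pairs \<open>(c, A)\<close> represent simple functions.\<close>

definition simple_fun :: "(real \<times> 'e set) list \<Rightarrow> 'e \<Rightarrow> real" where
  "simple_fun cs s = (\<Sum>(c, A)\<leftarrow>cs. c * indicator A s)"

definition simple_integral ::
    "('e set \<Rightarrow> 'w \<Rightarrow> real) \<Rightarrow> (real \<times> 'e set) list \<Rightarrow> 'e set \<Rightarrow> 'w \<Rightarrow> real" where
  "simple_integral X cs B \<omega> = (\<Sum>(c, A)\<leftarrow>cs. c * X (A \<inter> B) \<omega>)"

text \<open>The definition of Rajput and Rosinski: \<open>f\<close> is an almost everywhere limit of simple functions
  whose integrals over every Borel subset of \<open>S\<close> converge in probability. The integral of \<open>f\<close> is
  unique up to almost sure equality, and \<open>stoch_integral\<close> selects a version of it.\<close>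

definition has_stoch_integral ::
    "'w measure \<Rightarrow> (real ^ 'd::finite) set \<Rightarrow> ((real ^ 'd) set \<Rightarrow> 'w \<Rightarrow> real) \<Rightarrow>
     (real ^ 'd \<Rightarrow> real) \<Rightarrow> ('w \<Rightarrow> real) \<Rightarrow> bool" where
  "has_stoch_integral M S X f Z \<longleftrightarrow> Z \<in> borel_measurable M \<and>
     (\<exists>F :: nat \<Rightarrow> (real \<times> (real ^ 'd) set) list.
        (\<forall>n. \<forall>(c, A) \<in> set (F n). A \<in> noise_sets S) \<and>
        (AE s in restrict_space lborel S. (\<lambda>n. simple_fun (F n) s) \<longlonglongrightarrow> f s) \<and>
        (\<forall>B \<in> sets borel. B \<subseteq> S \<longrightarrow>
           (\<exists>W \<in> borel_measurable M. converges_in_prob M (\<lambda>n. simple_integral X (F n) B) W)) \<and>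
        converges_in_prob M (\<lambda>n. simple_integral X (F n) S) Z)"

definition stoch_integral ::
    "'w measure \<Rightarrow> (real ^ 'd::finite) set \<Rightarrow> ((real ^ 'd) set \<Rightarrow> 'w \<Rightarrow> real) \<Rightarrow>
     (real ^ 'd \<Rightarrow> real) \<Rightarrow> 'w \<Rightarrow> real" where
  "stoch_integral M S X f = (SOME Z. has_stoch_integral M S X f Z)"


section \<open>Generalized and mild solutions\<close>

definition u_gen ::
    "'w measure \<Rightarrow> (real ^ 'd::finite) set \<Rightarrow> ((real ^ 'd) set \<Rightarrow> 'w \<Rightarrow> real) \<Rightarrow> 'd functional \<Rightarrow>
     (real ^ 'd \<Rightarrow> real) \<Rightarrow> 'w \<Rightarrow> real" where
  "u_gen M S X \<rho> \<phi> = stoch_integral M S X (conv_check \<phi> \<rho>)"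

definition u_mild ::
    "'w measure \<Rightarrow> (real ^ 'd::finite) set \<Rightarrow> ((real ^ 'd) set \<Rightarrow> 'w \<Rightarrow> real) \<Rightarrow>
     (real ^ 'd \<Rightarrow> real) \<Rightarrow> real ^ 'd \<Rightarrow> 'w \<Rightarrow> real" where
  "u_mild M S X r t = stoch_integral M S X (\<lambda>s. r (t - s))"

definition random_field_representation ::
    "'w measure \<Rightarrow> ((real ^ 'd::finite \<Rightarrow> real) \<Rightarrow> 'w \<Rightarrow> real) \<Rightarrow> (real ^ 'd \<Rightarrow> 'w \<Rightarrow> real) \<Rightarrow> bool" where
  "random_field_representation M u Y \<longleftrightarrow>
     (\<lambda>(t, \<omega>). Y t \<omega>) \<in> borel_measurable (borel \<Otimes>\<^sub>M M) \<and>
     (AE \<omega> in M. locally_integrable (\<lambda>t. Y t \<omega>)) \<and>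
     (\<forall>\<phi>. test_function \<phi> \<longrightarrow> (AE \<omega> in M. u \<phi> \<omega> = (\<integral>t. Y t \<omega> * \<phi> t \<partial>lborel)))"

end

theory Submission
  imports Defs
begin

text \<open>By symmetry, the characteristic function of \<open>\<langle>X, f\<rangle>\<close> is \<open>exp (- Q f)\<close> with
  \<open>Q f = \<integral> (1 - cos (f s z)) ds \<nu>(dz)\<close>; hence \<open>\<langle>X, f\<rangle>\<close> is small in probability if and only if
  \<open>\<integral> min 1 (f s z)\<^sup>2 ds \<nu>(dz)\<close> is small.

  Let \<open>Y_q\<close> and \<open>\<rho>_q\<close> be the mollifications of \<open>Y\<close> and \<open>\<rho>\<close> at radius \<open>q\<close>, so that
  \<open>Y_q(t) = \<langle>X, \<rho>_q(t - \<cdot>)\<rangle>\<close>. Test the identity for the characteristic function with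
  \<open>\<Sum>\<^sub>j (\<rho>_p - \<rho>_q)(t\<^sub>j - \<cdot>) / (n w\<^sub>j)\<close>, \<open>j < n\<close>, where the \<open>t\<^sub>j\<close> are independent and uniform on a ball and
  the \<open>w\<^sub>j\<close> on \<open>[-1, 1]\<close>, and average over the \<open>t\<^sub>j\<close> and \<open>w\<^sub>j\<close>. Since \<open>1 / w\<^sub>j\<close> has Cauchy-like tails, for
  \<open>n \<rightarrow> \<infinity>\<close> both sides turn into exponentials of local \<open>L\<^sup>1\<close> norms, and \<open>\<rho>_p - \<rho>_q\<close> is small in
  \<open>L\<^sup>1\<close> locally because the pathwise \<open>L\<^sup>1\<close> norm of \<open>Y_p - Y_q\<close> is small in probability. So \<open>\<rho>_q\<close> converges in
  \<open>L\<^sup>1\<close> locally to a function \<open>r\<close> along a sequence of radii.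

  For a test function \<open>\<psi>\<close>, Riemann sums for \<open>\<integral> \<psi>(t) \<kappa>_q(\<cdot> - t) dt\<close>, with \<open>\<kappa>_q\<close> the mollifier, approximate
  \<open>\<psi>\<close> uniformly. Pairing the difference with \<open>Y\<close> gives \<open>\<psi> * \<rho>(- \<cdot>) = \<integral> \<psi>(t) r(t - \<cdot>) dt\<close> almost everywhere on
  \<open>S\<close>, hence by continuity at some point of \<open>S\<close>; replacing \<open>\<psi>\<close> by its translates shows that \<open>\<rho>\<close> is \<open>r\<close>.
  Finally, for almost every \<open>t\<close>, \<open>\<langle>X, \<rho>_q(t - \<cdot>)\<rangle> = Y_q(t)\<close> tends to \<open>Y t\<close> in probability, so
  \<open>\<rho>_q(t - \<cdot>)\<close> is a Cauchy sequence for the above functional, and its limit is \<open>r(t - \<cdot>)\<close>.\<close>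

section \<open>Test functions and mollification\<close>

text \<open>\<rho> has no values at points, Y is tied to the noise only through test functions, and
  the noise controls an integrand only on S and only through a truncated square, which says nothing
  about L1 norms. The random centres and weights close these gaps. Centres uniform on a ball of
  radius R + a let t - s sweep the ball of radius R for every s of norm at most a, so a bounded
  piece of S of positive measure, paired with jumps bounded away from 0 and infinity, sees all of
  \<rho>_p - \<rho>_q on that ball; nondegeneracy of S and \<nu> supplies the piece. The linear
  decay at 0 of the characteristic function of 1 / w turns a product of n factors into the
  exponential of an L1 norm. One large n, depending on the radii, suffices because n cancels from
  both bounds. The radii carry errors of order 4^-j, so increments are summable and almost
  everywhere convergence holds along the chosen sequence itself. The Riemann sums approach \<psi>
  only uniformly, without control of derivatives, so continuity of \<rho> cannot carry the limit;
  the representation by Y does.\<close>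

lemma partial_derivs_Nil [simp]: "partial_derivs [] f = f"
  by (simp add: partial_derivs_def)

lemma partial_derivs_Cons: "partial_derivs (j # js) f = partial_deriv j (partial_derivs js f)"
  by (simp add: partial_derivs_def)

lemma smoothD: "smooth f \<Longrightarrow> partial_derivs js f differentiable (at x)"
  by (simp add: smooth_def)

lemma partial_deriv_eqI: "(f has_derivative f') (at x) \<Longrightarrow> partial_deriv i f x = f' (axis i 1)"
  unfolding partial_deriv_def using frechet_derivative_at by metis

lemma partial_deriv_has_derivative:
  "f differentiable (at x) \<Longrightarrow> (f has_derivative frechet_derivative f (at x)) (at x)"
  using frechet_derivative_works by blast

lemma partial_deriv_add:
  assumes "f differentiable (at x)" "g differentiable (at x)"
  shows "partial_deriv i (\<lambda>x. f x + g x) x = partial_deriv i f x + partial_deriv i g x"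
  unfolding partial_deriv_def[of i f] partial_deriv_def[of i g]
  by (rule partial_deriv_eqI) (intro has_derivative_add partial_deriv_has_derivative assms)

lemma partial_deriv_cmult:
  assumes "f differentiable (at x)"
  shows "partial_deriv i (\<lambda>x. c * f x) x = c * partial_deriv i f x"
  unfolding partial_deriv_def[of i f]
  by (rule partial_deriv_eqI) (intro has_derivative_mult_right partial_deriv_has_derivative assms)

lemma partial_deriv_translate:
  assumes "f differentiable (at (y + x))"
  shows "partial_deriv i (\<lambda>x. f (y + x)) x = partial_deriv i f (y + x)"
proof -
  have "((\<lambda>x. y + x) has_derivative (\<lambda>h. h)) (at x)"
    by (auto intro!: derivative_eq_intros)
  from has_derivative_compose[OF this partial_deriv_has_derivative[OF assms]]
  have "((\<lambda>x. f (y + x)) has_derivative frechet_derivative f (at (y + x))) (at x)" .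
  then show ?thesis
    unfolding partial_deriv_def[of i f] by (rule partial_deriv_eqI)
qed

lemma partial_derivs_add:
  assumes "smooth f" "smooth g"
  shows "partial_derivs js (\<lambda>x. f x + g x) = (\<lambda>x. partial_derivs js f x + partial_derivs js g x)"
  by (induction js) (auto simp: partial_derivs_Cons partial_deriv_add assms smoothD)

lemma partial_derivs_cmult:
  assumes "smooth f"
  shows "partial_derivs js (\<lambda>x. c * f x) = (\<lambda>x. c * partial_derivs js f x)"
  by (induction js) (auto simp: partial_derivs_Cons partial_deriv_cmult assms smoothD)

lemma partial_derivs_translate:
  assumes "smooth f"
  shows "partial_derivs js (\<lambda>x. f (y + x)) = (\<lambda>x. partial_derivs js f (y + x))"
  by (induction js) (auto simp: partial_derivs_Cons partial_deriv_translate assms smoothD)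

lemma smooth_add: "smooth f \<Longrightarrow> smooth g \<Longrightarrow> smooth (\<lambda>x. f x + g x)"
  unfolding smooth_def by (simp add: partial_derivs_add smooth_def)

lemma smooth_cmult: "smooth f \<Longrightarrow> smooth (\<lambda>x. c * f x)"
  unfolding smooth_def by (simp add: partial_derivs_cmult smooth_def)

lemma smooth_translate:
  assumes "smooth f" shows "smooth (\<lambda>x. f (y + x))"
  unfolding smooth_def
proof (intro allI)
  fix js x
  show "partial_derivs js (\<lambda>x. f (y + x)) differentiable at x"
    unfolding partial_derivs_translate[OF assms]
    by (rule differentiable_compose[of "partial_derivs js f" "\<lambda>x. y + x"]) (auto simp: smoothD[OF assms])
qed

lemma partial_derivs_continuous: "smooth f \<Longrightarrow> continuous_on A (partial_derivs js f)"
  by (meson continuous_at_imp_continuous_on differentiable_imp_continuous_within smoothD)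

lemma smooth_continuous: "smooth f \<Longrightarrow> continuous_on A f"
  using partial_derivs_continuous[of f A "[]"] by simp

lemma test_function_smooth: "test_function f \<Longrightarrow> smooth f"
  by (simp add: test_function_def)

lemma test_functionI:
  assumes "smooth f" "bounded K" "\<And>x. f x \<noteq> 0 \<Longrightarrow> x \<in> K"
  shows "test_function f"
  using assms unfolding test_function_def
  by (metis (mono_tags, lifting) bounded_subset compact_closure mem_Collect_eq subsetI)

lemma test_function_support:
  assumes "test_function f"
  obtains R where "R > 0" "\<And>x. f x \<noteq> 0 \<Longrightarrow> norm x \<le> R"
proof -
  have "bounded {x. f x \<noteq> 0}"
    using assms compact_closure unfolding test_function_def by blast
  then show ?thesis using that unfolding bounded_pos by auto
qed

lemma test_function_add:
  assumes "test_function f" "test_function g" shows "test_function (\<lambda>x. f x + g x)"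
proof -
  obtain R1 where R1: "\<And>x. f x \<noteq> 0 \<Longrightarrow> norm x \<le> R1" using test_function_support[OF assms(1)] by blast
  obtain R2 where R2: "\<And>x. g x \<noteq> 0 \<Longrightarrow> norm x \<le> R2" using test_function_support[OF assms(2)] by blast
  show ?thesis
  proof (rule test_functionI)
    show "smooth (\<lambda>x. f x + g x)" using assms by (simp add: smooth_add test_function_smooth)
    show "bounded (cball 0 (max R1 R2) :: (real^'a) set)" by simp
    fix x assume "f x + g x \<noteq> 0"
    then have "f x \<noteq> 0 \<or> g x \<noteq> 0" by auto
    then show "x \<in> cball 0 (max R1 R2)" using R1[of x] R2[of x] by auto
  qed
qed

lemma test_function_cmult:
  assumes "test_function f" shows "test_function (\<lambda>x. c * f x)"
proof -
  obtain R1 where R1: "\<And>x. f x \<noteq> 0 \<Longrightarrow> norm x \<le> R1" using test_function_support[OF assms(1)] by blast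
  show ?thesis
    by (rule test_functionI[where K = "cball 0 R1"]) (auto simp: R1 smooth_cmult test_function_smooth assms)
qed

lemma test_function_diff:
  assumes "test_function f" "test_function g" shows "test_function (\<lambda>x. f x - g x)"
  using test_function_add[OF assms(1) test_function_cmult[OF assms(2), of "-1"]] by simp

lemma test_function_translate:
  assumes "test_function f" shows "test_function (\<lambda>x. f (y + x))"
proof -
  obtain R1 where R1: "\<And>x. f x \<noteq> 0 \<Longrightarrow> norm x \<le> R1" using test_function_support[OF assms(1)] by blast
  show ?thesis
  proof (rule test_functionI[where K = "cball (-y) R1"])
    fix x assume "f (y + x) \<noteq> 0"
    from R1[OF this] show "x \<in> cball (-y) R1"
      by (simp add: dist_norm norm_minus_commute[of "-y"] algebra_simps)
  qed (auto simp: smooth_translate test_function_smooth assms)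
qed

lemma test_function_zero: "test_function (\<lambda>x. 0)"
proof (rule test_functionI[where K = "{}"])
  have "partial_deriv j (\<lambda>x. 0) = (\<lambda>x::real^'a. 0)" for j
    by (rule ext) (rule partial_deriv_eqI[OF has_derivative_const])
  then have "partial_derivs js (\<lambda>x. 0) = (\<lambda>x::real^'a. 0)" for js
    by (induction js) (simp_all add: partial_derivs_Cons)
  then show "smooth (\<lambda>x::real^'a. 0)" unfolding smooth_def by simp
qed auto

lemma test_function_sum:
  assumes "\<And>i. i \<in> I \<Longrightarrow> test_function (f i)"
  shows "test_function (\<lambda>x. \<Sum>i\<in>I. f i x)"
proof (cases "finite I")
  case True
  then show ?thesis using assms
    by (induction I rule: finite_induct) (auto simp: test_function_zero test_function_add)
qed (simp add: test_function_zero)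

section \<open>Linearity of distributions and continuity along translates\<close>

lemma distribution_add:
  "schwartz_distribution \<rho> \<Longrightarrow> test_function f \<Longrightarrow> test_function g \<Longrightarrow> \<rho> (\<lambda>x. f x + g x) = \<rho> f + \<rho> g"
  by (simp add: schwartz_distribution_def)

lemma distribution_cmult:
  "schwartz_distribution \<rho> \<Longrightarrow> test_function f \<Longrightarrow> \<rho> (\<lambda>x. c * f x) = c * \<rho> f"
  by (simp add: schwartz_distribution_def)

lemma distribution_zero: "schwartz_distribution \<rho> \<Longrightarrow> \<rho> (\<lambda>x. 0) = 0"
  using distribution_cmult[of \<rho> "\<lambda>x. 0" 0] test_function_zero by simp

lemma distribution_diff:
  assumes "schwartz_distribution \<rho>" "test_function f" "test_function g"
  shows "\<rho> (\<lambda>x. f x - g x) = \<rho> f - \<rho> g"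
  using distribution_add[OF assms(1,2) test_function_cmult[OF assms(3), of "-1"]]
    distribution_cmult[OF assms(1,3), of "-1"] by simp

lemma distribution_sum:
  assumes "schwartz_distribution \<rho>" "\<And>i. i \<in> I \<Longrightarrow> test_function (f i)"
  shows "\<rho> (\<lambda>x. \<Sum>i\<in>I. f i x) = (\<Sum>i\<in>I. \<rho> (f i))"
proof (cases "finite I")
  case True
  then show ?thesis using assms(2)
    by (induction I rule: finite_induct)
      (auto simp: distribution_zero[OF assms(1)] distribution_add[OF assms(1)] test_function_sum)
qed (simp add: distribution_zero[OF assms(1)])

text \<open>The complement of K is open, so near each of its points the function, and by induction
  each derivative, agrees with the zero function.\<close>

lemma partial_derivs_support:
  assumes "smooth f" "closed K" "\<And>x. x \<notin> K \<Longrightarrow> f x = 0" "x \<notin> K"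
  shows "partial_derivs js f x = 0"
  using assms(4)
proof (induction js arbitrary: x)
  case Nil then show ?case using assms(3) by simp
next
  case (Cons j js)
  have "((\<lambda>_. 0) has_derivative (\<lambda>_. 0)) (at x)" by simp
  then have "(partial_derivs js f has_derivative (\<lambda>_. 0)) (at x)"
    by (rule has_derivative_transform_within_open[where s = "- K"]) (use Cons assms(2) in auto)
  then show ?case unfolding partial_derivs_Cons by (rule partial_deriv_eqI)
qed

text \<open>Heine-Cantor is applied on the ball of radius R + 1. The unit margin guarantees that two
  points closer than 1 either both lie in that ball or both lie where g vanishes.\<close>

lemma compact_support_uniformly_continuous:
  fixes g :: "'a::euclidean_space \<Rightarrow> real"
  assumes "continuous_on UNIV g" "\<And>x. norm x > R \<Longrightarrow> g x = 0"
  shows "uniformly_continuous_on UNIV g"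
proof -
  have "continuous_on (cball 0 (R + 1)) g" using assms(1) continuous_on_subset by blast
  from compact_uniformly_continuous[OF this compact_cball]
  have uc: "uniformly_continuous_on (cball 0 (R + 1)) g" .
  show ?thesis unfolding uniformly_continuous_on_def
  proof (intro allI impI)
    fix e :: real assume "e > 0"
    from uniformly_continuous_onE[OF uc this] obtain d where d: "d > 0"
      "\<And>x y. norm x \<le> R + 1 \<Longrightarrow> norm y \<le> R+1 \<Longrightarrow> dist y x < d \<Longrightarrow> dist (g y) (g x) < e"
      by (metis mem_cball_0)
    have "dist (g y) (g x) < e" if "dist y x < min d 1" for x y
    proof (cases "norm x \<le> R + 1 \<and> norm y \<le> R + 1")
      case True then show ?thesis using d that by auto
    next
      case False
      have "norm x \<le> norm y + dist y x" "norm y \<le> norm x + dist y x"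
        by (metis dist_norm norm_minus_commute norm_triangle_sub)+
      then have "norm x > R" "norm y > R" using False that by auto
      then show ?thesis using assms(2) \<open>e > 0\<close> by simp
    qed
    then show "\<exists>d>0. \<forall>x\<in>UNIV. \<forall>y\<in>UNIV. dist y x < d \<longrightarrow> dist (g y) (g x) < e"
      using d(1) by (intro exI[of _ "min d 1"]) auto
  qed
qed

text \<open>A convergent sequence of shifts is bounded, which gives one compact set for all
  supports; each derivative is uniformly continuous, which gives uniform convergence.\<close>

lemma test_converges_translate:
  fixes \<phi> :: "real ^ 'd::finite \<Rightarrow> real"
  assumes "test_function \<phi>" "ys \<longlonglongrightarrow> y"
  shows "test_converges (\<lambda>n x. \<phi> (ys n + x)) (\<lambda>x. \<phi> (y + x))"
proof -
  obtain R where R: "\<And>x. \<phi> x \<noteq> 0 \<Longrightarrow> norm x \<le> R" using test_function_support[OF assms(1)] by blast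
  have sm: "smooth \<phi>" using assms(1) test_function_smooth by blast
  have "Bseq ys" using assms(2) convergentI convergent_imp_Bseq by blast
  then obtain B where B: "\<And>n. norm (ys n) \<le> B" unfolding Bseq_def by auto
  have supp: "{x. \<phi> (ys n + x) \<noteq> 0} \<subseteq> cball 0 (R + B)" for n
  proof
    fix x assume "x \<in> {x. \<phi> (ys n + x) \<noteq> 0}"
    then have "norm (ys n + x) \<le> R" using R by auto
    then have "norm x \<le> R + B" using B[of n] norm_triangle_ineq4[of "ys n + x" "ys n"] by simp
    then show "x \<in> cball 0 (R + B)" by simp
  qed
  have lim: "uniform_limit UNIV (\<lambda>n. partial_derivs js (\<lambda>x. \<phi> (ys n + x))) (partial_derivs js (\<lambda>x. \<phi> (y + x))) sequentially" for js
  proof -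
    have "uniformly_continuous_on UNIV (partial_derivs js \<phi>)"
    proof (rule compact_support_uniformly_continuous[of _ R])
      show "continuous_on UNIV (partial_derivs js \<phi>)" using partial_derivs_continuous[OF sm] .
      show "partial_derivs js \<phi> x = 0" if "R < norm x" for x
        by (rule partial_derivs_support[OF sm, of "cball 0 R"]) (use R that in force)+
    qed
    note uc = this[unfolded uniformly_continuous_on_def, rule_format]
    show ?thesis unfolding partial_derivs_translate[OF sm] uniform_limit_iff
    proof (intro allI impI)
      fix e :: real assume "e > 0"
      from uc[OF this] obtain d where d: "d > 0" "\<And>x x'. dist x' x < d \<Longrightarrow> dist (partial_derivs js \<phi> x') (partial_derivs js \<phi> x) < e"
        by auto
      have "\<forall>\<^sub>F n in sequentially. dist (ys n) y < d" using assms(2) d(1) tendstoD by blast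
      then show "\<forall>\<^sub>F n in sequentially. \<forall>x\<in>UNIV. dist (partial_derivs js \<phi> (ys n + x)) (partial_derivs js \<phi> (y + x)) < e"
        by eventually_elim (auto intro!: d(2))
    qed
  qed
  have "compact (cball 0 (R + B) :: (real ^ 'd) set) \<and> (\<forall>n. {x. \<phi> (ys n + x) \<noteq> 0} \<subseteq> cball 0 (R + B))"
    using supp by simp
  with lim show ?thesis unfolding test_converges_def by blast
qed

text \<open>Sequential continuity of the distribution along translates. This continuity later
  upgrades an identity almost everywhere on a piece of S to one at a point.\<close>

lemma conv_check_continuous:
  fixes \<phi> :: "real ^ 'd::finite \<Rightarrow> real"
  assumes "schwartz_distribution \<rho>" "test_function \<phi>"
  shows "continuous_on UNIV (conv_check \<phi> \<rho>)"
  unfolding continuous_on_sequentially conv_check_def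
proof (intro allI ballI impI, unfold comp_def)
  fix x :: "nat \<Rightarrow> real ^ 'd" and y assume "(\<forall>n. x n \<in> UNIV) \<and> x \<longlonglongrightarrow> y"
  then show "(\<lambda>n. \<rho> (\<lambda>xa. \<phi> (x n + xa))) \<longlonglongrightarrow> \<rho> (\<lambda>x. \<phi> (y + x))"
    using assms(1) test_converges_translate[OF assms(2), of x y] test_function_translate[OF assms(2)]
    unfolding schwartz_distribution_def by simp
qed


section \<open>Flat functions and smooth bumps\<close>

definition expinv :: "nat \<Rightarrow> real \<Rightarrow> real" where
  "expinv k t = (if t > 0 then exp (- 1 / t) / t ^ k else 0)"

lemma expinv_tendsto_0: "(expinv k \<longlongrightarrow> 0) (at 0)"
proof -
  have "((\<lambda>t. (inverse t) ^ k / exp (inverse t)) \<longlongrightarrow> 0) (at_right (0::real))"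
    by (rule filterlim_compose[OF tendsto_power_div_exp_0 filterlim_inverse_at_top_right])
  then have "(expinv k \<longlongrightarrow> 0) (at_right 0)"
    by (rule Lim_transform_eventually)
      (auto simp: eventually_at_filter expinv_def divide_simps exp_minus power_inverse)
  moreover have "(expinv k \<longlongrightarrow> 0) (at_left 0)"
    by (rule Lim_transform_eventually[OF tendsto_const]) (auto simp: eventually_at_filter expinv_def)
  ultimately show ?thesis using filterlim_at_split by blast
qed

text \<open>The power of t in the denominator of \<open>expinv\<close> keeps the family closed under
  differentiation: the derivative of member k combines members k + 1 and k + 2.\<close>

lemma expinv_derivative:
  "(expinv k has_field_derivative expinv (k + 2) t - real k * expinv (k + 1) t) (at t)"
proof (cases t "0::real" rule: linorder_cases)
  case less
  have "((\<lambda>_. 0) has_field_derivative 0) (at t)" by simp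
  then have "(expinv k has_field_derivative 0) (at t)"
    by (rule has_field_derivative_transform_within_open[where S = "{..<0}"]) (use less in \<open>auto simp: expinv_def\<close>)
  then show ?thesis using less by (simp add: expinv_def)
next
  case equal
  \<comment> \<open>The difference quotient of member k at 0 is member k + 1, which tends to
    0.\<close>
  have "((\<lambda>h. (expinv k (0 + h) - expinv k 0) / h) \<longlongrightarrow> 0) (at 0)"
    by (rule Lim_transform_eventually[OF expinv_tendsto_0[of "Suc k"]])
      (auto simp: eventually_at_filter expinv_def)
  then show ?thesis unfolding equal DERIV_def by (simp add: expinv_def)
next
  case greater
  have "((\<lambda>t. exp (- 1 / t) / t ^ k) has_field_derivative expinv (k + 2) t - real k * expinv (k + 1) t) (at t)"
    using greater
    apply (auto intro!: derivative_eq_intros simp: expinv_def)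
    apply (cases k)
     apply (auto simp: field_simps power2_eq_square)
    done
  then show ?thesis
    by (rule has_field_derivative_transform_within_open[where S = "{0<..}"]) (use greater in \<open>auto simp: expinv_def\<close>)
qed

text \<open>The class contains the bump functions and is closed under partial differentiation, so that
  its members are smooth.\<close>

inductive elementary :: "(real ^ 'd::finite \<Rightarrow> real) \<Rightarrow> bool" where
  const: "elementary (\<lambda>x. c)"
| coord: "elementary (\<lambda>x. x $ i)"
| add: "elementary f \<Longrightarrow> elementary g \<Longrightarrow> elementary (\<lambda>x. f x + g x)"
| mult: "elementary f \<Longrightarrow> elementary g \<Longrightarrow> elementary (\<lambda>x. f x * g x)"
| expinv: "elementary f \<Longrightarrow> elementary (\<lambda>x. expinv k (f x))"

lemma elementary_derivative:
  assumes "elementary f"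
  shows "\<exists>f'. (\<forall>x. (f has_derivative f' x) (at x)) \<and> (\<forall>i. elementary (\<lambda>x. f' x (axis i 1)))"
  using assms
proof induction
  case (const c)
  show ?case by (intro exI[of _ "\<lambda>x h. 0"]) (auto intro: elementary.const)
next
  case (coord i)
  show ?case
    by (intro exI[of _ "\<lambda>x h. h $ i"]) (auto simp: axis_def intro: elementary.const
       bounded_linear_imp_has_derivative bounded_linear_vec_nth)
next
  case (add f g)
  then obtain f' g' where f: "\<And>x. (f has_derivative f' x) (at x)" "\<And>i. elementary (\<lambda>x. f' x (axis i 1))"
    and g: "\<And>x. (g has_derivative g' x) (at x)" "\<And>i. elementary (\<lambda>x. g' x (axis i 1))" by blast
  show ?case
    by (rule exI[of _ "\<lambda>x h. f' x h + g' x h"]) (auto intro: elementary.add f g has_derivative_add)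
next
  case (mult f g)
  then obtain f' g' where f: "\<And>x. (f has_derivative f' x) (at x)" "\<And>i. elementary (\<lambda>x. f' x (axis i 1))"
    and g: "\<And>x. (g has_derivative g' x) (at x)" "\<And>i. elementary (\<lambda>x. g' x (axis i 1))" by blast
  show ?case
    by (rule exI[of _ "\<lambda>x h. f x * g' x h + f' x h * g x"])
      (intro conjI allI has_derivative_mult f g elementary.add elementary.mult[OF mult.hyps(1) g(2)]
        elementary.mult[OF f(2) mult.hyps(2)])
next
  case (expinv f k)
  then obtain f' where f: "\<And>x. (f has_derivative f' x) (at x)" "\<And>i. elementary (\<lambda>x. f' x (axis i 1))" by blast
  define e where "e = (\<lambda>x. expinv (k + 2) (f x) + (- real k) * expinv (k + 1) (f x))"
  have "((\<lambda>x. expinv k (f x)) has_derivative (\<lambda>h. e x * f' x h)) (at x)" for x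
    using has_derivative_compose[OF f(1) expinv_derivative[unfolded has_field_derivative_def], of k x]
    by (simp add: e_def algebra_simps)
  moreover have "elementary e" unfolding e_def
    by (intro elementary.intros expinv.hyps)
  ultimately show ?case
    by (intro exI[of _ "\<lambda>x h. e x * f' x h"]) (auto intro: elementary.mult f)
qed

lemma elementary_smooth:
  assumes "elementary f" shows "smooth f"
proof -
  have *: "elementary g \<Longrightarrow> elementary (partial_deriv i g)" for g :: "real ^ 'a \<Rightarrow> real" and i
  proof -
    assume "elementary g"
    from elementary_derivative[OF this] obtain g' where g: "\<And>x. (g has_derivative g' x) (at x)"
      "\<And>i. elementary (\<lambda>x. g' x (axis i 1))" by blast
    have "partial_deriv i g = (\<lambda>x. g' x (axis i 1))" using partial_deriv_eqI[OF g(1)] by blast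
    then show ?thesis using g by simp
  qed
  have "elementary (partial_derivs js f)" for js
    by (induction js) (auto simp: partial_derivs_Cons assms *)
  then show ?thesis unfolding smooth_def differentiable_def using elementary_derivative by blast
qed

text \<open>A function of the squared norm, which is a polynomial in the coordinates; this places
  the bump in the class \<open>elementary\<close>.\<close>

definition bump :: "real \<Rightarrow> real ^ 'd::finite \<Rightarrow> real" where
  "bump r x = expinv 0 (r\<^sup>2 - (norm x)\<^sup>2)"

lemma bump_nonneg: "bump r x \<ge> 0" by (simp add: bump_def expinv_def)

lemma bump_le_1: "bump r x \<le> 1" by (simp add: bump_def expinv_def)

lemma bump_pos: "norm x < r \<Longrightarrow> bump r x > 0"
  by (simp add: bump_def expinv_def power_strict_mono)

lemma bump_eq_0: "norm x \<ge> r \<Longrightarrow> r > 0 \<Longrightarrow> bump r x = 0"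
  by (simp add: bump_def expinv_def not_less power_mono)

lemma smooth_bump: "smooth (bump r)"
proof (rule elementary_smooth)
  have sum: "elementary (\<lambda>x. \<Sum>i\<in>I. f i x)" if "finite I" "\<And>i. elementary (f i)" for I :: "'a set" and f :: "'a \<Rightarrow> real ^ 'a \<Rightarrow> real"
    using that(1) by (induction I rule: finite_induct) (auto intro: elementary.intros that(2))
  have "bump r = (\<lambda>x::real^'a. expinv 0 (r\<^sup>2 + (-1) * (\<Sum>i\<in>UNIV. x $ i * x $ i)))" (is "_ = ?f")
    by (simp add: bump_def fun_eq_iff norm_eq_sqrt_inner inner_vec_def sum_nonneg)
  moreover have "elementary ?f" by (intro elementary.intros sum) auto
  ultimately show "elementary (bump r :: real ^ 'a \<Rightarrow> real)" by simp
qed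

lemma test_function_bump: "r > 0 \<Longrightarrow> test_function (bump r)"
  by (rule test_functionI[where K = "cball 0 r"]) (auto simp: smooth_bump, meson bump_eq_0 linear)

section \<open>Mollifiers of unit mass\<close>

definition mollifier :: "real \<Rightarrow> real ^ 'd::finite \<Rightarrow> real" where
  "mollifier r x = bump r x / (\<integral>x. bump r x \<partial>(lborel :: (real ^ 'd) measure))"

lemma integrable_test_function:
  fixes f :: "real ^ 'd::finite \<Rightarrow> real"
  assumes "test_function f" shows "integrable lborel f"
proof -
  obtain R where R: "\<And>x. f x \<noteq> 0 \<Longrightarrow> norm x \<le> R" using test_function_support[OF assms] by blast
  have "integrable lborel (\<lambda>x. indicator (cball 0 R) x *\<^sub>R f x)"
    by (intro borel_integrable_compact smooth_continuous test_function_smooth assms) auto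
  also have "(\<lambda>x. indicator (cball 0 R) x *\<^sub>R f x) = f"
    using R by (auto simp: fun_eq_iff indicator_def)
  finally show ?thesis .
qed

text \<open>A nonnegative function with zero integral vanishes almost everywhere, but the bump is
  positive on an open ball, which is not a null set.\<close>

lemma integral_bump_pos:
  assumes "r > 0" shows "(\<integral>x. bump r x \<partial>(lborel :: (real ^ 'd::finite) measure)) > 0"
proof -
  have "\<not> (AE x in lborel. bump r (x :: real^'d) = 0)"
  proof
    assume "AE x in lborel. bump r (x :: real^'d) = 0"
    then have "AE x in lborel. x \<notin> ball (0::real^'d) r"
      by eventually_elim (use bump_pos in force)
    then have "emeasure lborel {x \<in> space lborel. \<not> x \<notin> ball (0::real^'d) r} = 0"
      by (subst (asm) AE_iff_measurable[OF _ refl]) simp_all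
    then have "emeasure lborel (ball (0::real^'d) r) = 0"
      by (simp add: ball_def)
    then show False using assms open_not_negligible[of "ball (0::real^'d) r"]
      by (auto simp: negligible_iff_null_sets null_sets_def)
  qed
  then have "(\<integral>x. bump r x \<partial>(lborel :: (real ^ 'd) measure)) \<noteq> 0"
    by (subst integral_nonneg_eq_0_iff_AE[OF integrable_test_function[OF test_function_bump[OF assms]]])
      (auto simp: bump_nonneg)
  moreover have "(\<integral>x. bump r x \<partial>(lborel :: (real ^ 'd) measure)) \<ge> 0"
    by (rule integral_nonneg_AE) (simp add: bump_nonneg)
  ultimately show ?thesis by simp
qed

lemma mollifier_nonneg: "mollifier r x \<ge> 0"
  unfolding mollifier_def by (intro divide_nonneg_nonneg bump_nonneg integral_nonneg_AE) (simp add: bump_nonneg)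

lemma mollifier_eq_0: "norm x \<ge> r \<Longrightarrow> r > 0 \<Longrightarrow> mollifier r x = 0"
  by (simp add: mollifier_def bump_eq_0)

lemma test_function_mollifier:
  assumes "r > 0" shows "test_function (mollifier r)"
  unfolding mollifier_def divide_inverse mult.commute[of "bump _ _"]
  by (intro test_function_cmult test_function_bump assms)

lemma integral_mollifier:
  "r > 0 \<Longrightarrow> (\<integral>x. mollifier r x \<partial>(lborel :: (real ^ 'd::finite) measure)) = 1"
  using integral_bump_pos[of r, where 'd = 'd] by (simp add: mollifier_def)

lemma measurable_translate [measurable]: "(\<lambda>x. c + x) \<in> borel_measurable borel" for c :: "'a::euclidean_space"
  by (intro borel_measurable_continuous_onI continuous_intros)

lemma nn_integral_lborel_translate:
  fixes f :: "'a::euclidean_space \<Rightarrow> ennreal"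
  assumes "f \<in> borel_measurable borel"
  shows "(\<integral>\<^sup>+x. f (c + x) \<partial>lborel) = (\<integral>\<^sup>+x. f x \<partial>lborel)"
  by (subst lborel_distr_plus[of c, symmetric], subst nn_integral_distr) (use assms in simp_all)

lemma integral_lborel_translate:
  fixes f :: "'a::euclidean_space \<Rightarrow> real"
  assumes "f \<in> borel_measurable borel"
  shows "(\<integral>x. f (c + x) \<partial>lborel) = (\<integral>x. f x \<partial>lborel)"
  by (subst lborel_distr_plus[of c, symmetric], subst integral_distr) (use assms in simp_all)

lemma mollifier_measurable [measurable]: "mollifier r \<in> borel_measurable borel" if "r > 0"
  using that by (intro borel_measurable_continuous_onI smooth_continuous test_function_smooth test_function_mollifier)

lemma mollifier_minus_commute: "mollifier r (x - t) = mollifier r (t - x)"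
  by (simp add: mollifier_def bump_def norm_minus_commute)

lemma integrable_mollifier: "r > 0 \<Longrightarrow> integrable lborel (mollifier r)"
  by (simp add: integrable_test_function test_function_mollifier)

lemma nn_integral_mollifier:
  fixes t :: "real ^ 'd::finite"
  assumes "r > 0"
  shows "(\<integral>\<^sup>+x. ennreal (mollifier r (x - t)) \<partial>lborel) = 1"
    and "(\<integral>\<^sup>+x. ennreal (mollifier r (t - x)) \<partial>lborel) = 1"
proof -
  have "(\<integral>\<^sup>+x. ennreal (mollifier r (x - t)) \<partial>lborel) = (\<integral>\<^sup>+x. ennreal (mollifier r (x :: real ^ 'd)) \<partial>lborel)"
    using nn_integral_lborel_translate[of "\<lambda>x. ennreal (mollifier r x)" "-t"] assms by simp
  also have "\<dots> = 1"
    by (subst nn_integral_eq_integral) (auto simp: integrable_mollifier integral_mollifier mollifier_nonneg assms)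
  finally show *: "(\<integral>\<^sup>+x. ennreal (mollifier r (x - t)) \<partial>lborel) = 1" .
  show "(\<integral>\<^sup>+x. ennreal (mollifier r (t - x)) \<partial>lborel) = 1"
    using * by (simp add: mollifier_minus_commute)
qed

lemma integral_mollifier_translate:
  fixes t :: "real ^ 'd::finite"
  assumes "r > 0"
  shows "integrable lborel (\<lambda>x. mollifier r (x - t))" "(\<integral>x. mollifier r (x - t) \<partial>lborel) = 1"
proof -
  have [measurable]: "mollifier r \<in> borel_measurable borel" using assms by simp
  show "integrable lborel (\<lambda>x. mollifier r (x - t))"
    by (rule integrableI_bounded) (use nn_integral_mollifier(1)[OF assms, of t] in \<open>simp_all add: mollifier_nonneg\<close>)
  show "(\<integral>x. mollifier r (x - t) \<partial>lborel) = 1"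
    using nn_integral_mollifier(1)[OF assms, of t]
    by (subst integral_eq_nn_integral) (simp_all add: mollifier_nonneg)
qed

lemma mollifier_bounded:
  assumes "r > 0" obtains C where "C > 0" "\<And>x :: real ^ 'd::finite. mollifier r x \<le> C"
proof -
  have "mollifier r x \<le> 1 / (\<integral>x. bump r x \<partial>(lborel :: (real ^ 'd) measure))" for x :: "real ^ 'd"
    unfolding mollifier_def using integral_bump_pos[OF assms, where 'd = 'd]
    by (intro divide_right_mono) (auto simp: bump_le_1)
  then show thesis using integral_bump_pos[OF assms, where 'd = 'd] that by (metis zero_less_divide_1_iff)
qed

section \<open>Mollification as an approximate identity in L1\<close>

definition mollify :: "real \<Rightarrow> (real ^ 'd::finite \<Rightarrow> real) \<Rightarrow> real ^ 'd \<Rightarrow> real" where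
  "mollify r g t = (\<integral>x. g x * mollifier r (x - t) \<partial>lborel)"

lemma integrable_mult_mollifier:
  assumes "integrable lborel g" "r > 0"
  shows "integrable lborel (\<lambda>x. g x * mollifier r (x - t))"
proof -
  obtain C where C: "C > 0" "\<And>x. mollifier r (x :: real ^ 'a) \<le> C" using mollifier_bounded[OF assms(2)] by blast
  have [measurable]: "mollifier r \<in> borel_measurable borel" "g \<in> borel_measurable borel" using assms by auto
  show ?thesis
  proof (rule Bochner_Integration.integrable_bound[of lborel "\<lambda>x. C * g x"])
    show "AE x in lborel. norm (g x * mollifier r (x - t)) \<le> norm (C * g x)"
      using C by (auto simp: abs_mult mult.commute[of C] abs_of_nonneg mollifier_nonneg intro!: mult_left_mono)
  qed (use assms in auto)
qed

lemma mollify_measurable [measurable]: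
  assumes [measurable]: "g \<in> borel_measurable borel" and "r > 0"
  shows "mollify r g \<in> borel_measurable borel"
proof -
  have [measurable]: "mollifier r \<in> borel_measurable borel" using assms by simp
  show ?thesis unfolding mollify_def by measurable
qed

text \<open>Young's inequality for a kernel of unit mass: by Tonelli, mollification is a contraction
  of L1.\<close>

lemma nn_integral_mollify_le:
  assumes g[measurable]: "g \<in> borel_measurable borel" and "r > 0"
  shows "(\<integral>\<^sup>+t. ennreal \<bar>mollify r g t\<bar> \<partial>lborel) \<le> (\<integral>\<^sup>+x. ennreal \<bar>g x\<bar> \<partial>lborel)"
proof -
  have [measurable]: "mollifier r \<in> borel_measurable borel" using assms by simp
  have "ennreal \<bar>mollify r g t\<bar> \<le> (\<integral>\<^sup>+x. ennreal \<bar>g x\<bar> * ennreal (mollifier r (x - t)) \<partial>lborel)" for t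
  proof (cases "integrable lborel (\<lambda>x. g x * mollifier r (x - t))")
    case True
    from integral_norm_bound_ennreal[OF this] show ?thesis
      by (simp add: mollify_def abs_mult mollifier_nonneg ennreal_mult)
  next
    \<comment> \<open>A Bochner integral that does not exist has the value 0, so the bound is
      trivial here.\<close>
    case False
    then show ?thesis by (simp add: mollify_def not_integrable_integral_eq)
  qed
  then have "(\<integral>\<^sup>+t. ennreal \<bar>mollify r g t\<bar> \<partial>lborel) \<le>
    (\<integral>\<^sup>+t. \<integral>\<^sup>+x. ennreal \<bar>g x\<bar> * ennreal (mollifier r (x - t)) \<partial>lborel \<partial>lborel)"
    by (intro nn_integral_mono)
  also have "\<dots> = (\<integral>\<^sup>+x. \<integral>\<^sup>+t. ennreal \<bar>g x\<bar> * ennreal (mollifier r (x - t)) \<partial>lborel \<partial>lborel)"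
    by (rule lborel_pair.Fubini'[symmetric]) measurable
  also have "\<dots> = (\<integral>\<^sup>+x. ennreal \<bar>g x\<bar> \<partial>lborel)"
    by (subst nn_integral_cmult) (simp_all add: nn_integral_mollifier assms)
  finally show ?thesis .
qed

lemma mollify_add:
  "integrable lborel f \<Longrightarrow> integrable lborel g \<Longrightarrow> r > 0 \<Longrightarrow> mollify r (\<lambda>x. f x + g x) t = mollify r f t + mollify r g t"
  unfolding mollify_def by (simp add: distrib_right integrable_mult_mollifier)

lemma mollify_diff:
  "integrable lborel f \<Longrightarrow> integrable lborel g \<Longrightarrow> r > 0 \<Longrightarrow> mollify r (\<lambda>x. f x - g x) t = mollify r f t - mollify r g t"
  unfolding mollify_def by (simp add: left_diff_distrib integrable_mult_mollifier)

text \<open>\<open>mollify r g t\<close> is an average of g over the ball of radius r about t with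
  total weight 1.\<close>

lemma mollify_close:
  assumes "r > 0" "integrable lborel g" "\<And>y. norm (y - t) \<le> r \<Longrightarrow> \<bar>g y - a\<bar> \<le> e"
  shows "\<bar>mollify r g t - a\<bar> \<le> e"
proof -
  have "mollify r g t - a = (\<integral>x. g x * mollifier r (x - t) - a * mollifier r (x - t) \<partial>lborel)"
    by (subst Bochner_Integration.integral_diff)
      (auto simp: mollify_def integrable_mult_mollifier assms integral_mollifier_translate)
  also have "\<bar>\<dots>\<bar> \<le> (\<integral>x. e * mollifier r (x - t) \<partial>lborel)"
  proof (rule integral_abs_bound_integral)
    fix x
    show "\<bar>g x * mollifier r (x - t) - a * mollifier r (x - t)\<bar> \<le> e * mollifier r (x - t)"
    proof (cases "norm (x - t) \<le> r")
      case True
      then show ?thesis using assms(3)[OF True] mollifier_nonneg[of r "x - t"]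
        by (simp add: left_diff_distrib[symmetric] abs_mult mult_right_mono)
    next
      case False
      then show ?thesis using assms(1) by (simp add: mollifier_eq_0)
    qed
  qed (auto simp: integrable_mult_mollifier assms integral_mollifier_translate)
  also have "\<dots> = e" by (simp add: integral_mollifier_translate assms)
  finally show ?thesis .
qed

text \<open>By Tonelli, mollification preserves the integral of the indicator, so the L1 distance is
  twice the integral of the positive part of \<open>?g - ?T n\<close>. That part is dominated by
  \<open>?g\<close>, is eventually 0 at each point of U because U is open, and is 0 off U; thus the
  boundary of U causes no trouble.\<close>

lemma mollify_open_tendsto:
  fixes U :: "(real ^ 'd::finite) set"
  assumes "open U" "emeasure lborel U < \<top>"
  shows "(\<lambda>n. \<integral>\<^sup>+t. ennreal \<bar>mollify (1 / Suc n) (indicator U) t - indicator U t\<bar> \<partial>lborel) \<longlonglongrightarrow> 0"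
proof -
  let ?g = "indicator U :: real ^ 'd \<Rightarrow> real" and ?T = "\<lambda>n. mollify (1 / Suc n) (indicator U)"
  have [measurable]: "U \<in> sets borel" using assms by simp
  have int: "integrable lborel ?g" using assms by simp
  have [measurable]: "?T n \<in> borel_measurable borel" for n by simp
  have T01: "0 \<le> ?T n t" "?T n t \<le> 1" for n t
  proof -
    show "0 \<le> ?T n t" unfolding mollify_def by (intro integral_nonneg_AE) (simp add: mollifier_nonneg)
    have "?T n t \<le> (\<integral>x. mollifier (1 / Suc n) (x - t) \<partial>lborel)" unfolding mollify_def
      by (intro integral_mono integrable_mult_mollifier[OF int] integral_mollifier_translate(1))
        (auto simp: indicator_def mollifier_nonneg)
    then show "?T n t \<le> 1" by (simp add: integral_mollifier_translate)
  qed
  have intT: "integrable lborel (?T n)" and T_le: "(\<integral>t. ?T n t \<partial>lborel) = (\<integral>t. ?g t \<partial>lborel)" for n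
  proof -
    have "(\<integral>\<^sup>+t. ennreal \<bar>?T n t\<bar> \<partial>lborel) \<le> (\<integral>\<^sup>+x. ennreal \<bar>?g x\<bar> \<partial>lborel)"
      by (rule nn_integral_mollify_le) auto
    also have "\<dots> < \<infinity>" using int by (simp add: integrable_iff_bounded)
    finally show intT: "integrable lborel (?T n)" by (intro integrableI_bounded) auto
    have *: "ennreal (?T n t) = (\<integral>\<^sup>+x. ennreal (?g x) * ennreal (mollifier (1 / Suc n) (x - t)) \<partial>lborel)" for t
      unfolding mollify_def
      by (subst nn_integral_eq_integral[OF integrable_mult_mollifier[OF int], symmetric])
        (auto simp: mollifier_nonneg ennreal_mult)
    have [measurable]: "mollifier (1 / Suc n) \<in> borel_measurable (borel :: (real ^ 'd) measure)" by simp
    have "(\<integral>\<^sup>+t. ennreal (?T n t) \<partial>lborel) =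
      (\<integral>\<^sup>+x. \<integral>\<^sup>+t. ennreal (?g x) * ennreal (mollifier (1 / Suc n) (x - t)) \<partial>lborel \<partial>lborel)"
      unfolding * by (rule lborel_pair.Fubini'[symmetric]) measurable
    also have "\<dots> = (\<integral>\<^sup>+x. ennreal (?g x) \<partial>lborel)"
      by (subst nn_integral_cmult) (simp_all add: nn_integral_mollifier)
    finally have eq: "(\<integral>\<^sup>+t. ennreal (?T n t) \<partial>lborel) = (\<integral>\<^sup>+x. ennreal (?g x) \<partial>lborel)" .
    have "(\<integral>t. ?T n t \<partial>lborel) = enn2real (\<integral>\<^sup>+t. ennreal (?T n t) \<partial>lborel)"
      by (rule integral_eq_nn_integral) (simp, intro AE_I2 T01)
    also have "\<dots> = (\<integral>t. ?g t \<partial>lborel)"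
      unfolding eq by (rule integral_eq_nn_integral[symmetric]) auto
    finally show "(\<integral>t. ?T n t \<partial>lborel) = (\<integral>t. ?g t \<partial>lborel)" .
  qed
  have "(\<lambda>n. \<integral>t. max 0 (?g t - ?T n t) \<partial>lborel) \<longlonglongrightarrow> (\<integral>t. 0 \<partial>(lborel :: (real ^ 'd) measure))"
  proof (rule integral_dominated_convergence[where w = ?g])
    show "AE t in lborel. (\<lambda>n. max 0 (?g t - ?T n t)) \<longlonglongrightarrow> 0"
    proof (rule AE_I2)
      fix t
      show "(\<lambda>n. max 0 (?g t - ?T n t)) \<longlonglongrightarrow> 0"
      proof (cases "t \<in> U")
        case True
        then obtain d where d: "d > 0" "cball t d \<subseteq> U" using assms(1) open_contains_cball by blast
        have "\<forall>\<^sub>F n in sequentially. 1 / Suc n < d"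
          using order_tendstoD(2)[OF LIMSEQ_inverse_real_of_nat d(1)] by (simp add: inverse_eq_divide)
        then have "\<forall>\<^sub>F n in sequentially. max 0 (?g t - ?T n t) = 0"
        proof eventually_elim
          case (elim n)
          have "\<bar>?T n t - 1\<bar> \<le> 0"
          proof (rule mollify_close)
            fix y assume "norm (y - t) \<le> 1 / Suc n"
            then have "y \<in> cball t d" using elim by (simp add: dist_norm norm_minus_commute)
            then show "\<bar>?g y - 1\<bar> \<le> 0" using d by auto
          qed (auto simp: int)
          then show ?case by simp
        qed
        then show ?thesis by (rule tendsto_eventually)
      qed (use T01 in \<open>simp add: max_absorb1\<close>)
    qed
    show "AE t in lborel. norm (max 0 (?g t - ?T n t)) \<le> ?g t" for n
      using T01 by (auto simp: indicator_def)
  qed (auto simp: int)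
  then have "(\<lambda>n. 2 * (\<integral>t. max 0 (?g t - ?T n t) \<partial>lborel)) \<longlonglongrightarrow> 0"
    by (auto intro: tendsto_mult_right_zero)
  moreover have "(\<integral>\<^sup>+t. ennreal \<bar>?T n t - ?g t\<bar> \<partial>lborel) = ennreal (2 * (\<integral>t. max 0 (?g t - ?T n t) \<partial>lborel))" for n
  proof -
    have i: "integrable lborel (\<lambda>t. max 0 (?g t - ?T n t))"
      by (intro Bochner_Integration.integrable_max Bochner_Integration.integrable_diff int intT) auto
    have "(\<integral>\<^sup>+t. ennreal \<bar>?T n t - ?g t\<bar> \<partial>lborel) = ennreal (\<integral>t. \<bar>?T n t - ?g t\<bar> \<partial>lborel)"
      by (intro nn_integral_eq_integral Bochner_Integration.integrable_abs Bochner_Integration.integrable_diff int intT) auto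
    also have "(\<integral>t. \<bar>?T n t - ?g t\<bar> \<partial>lborel) = (\<integral>t. 2 * max 0 (?g t - ?T n t) - (?g t - ?T n t) \<partial>lborel)"
    proof (intro Bochner_Integration.integral_cong refl)
      have "\<bar>a - b\<bar> = 2 * max 0 (b - a) - (b - a)" for a b :: real by (cases "a \<le> b") (simp_all add: max_def)
      then show "\<bar>?T n t - ?g t\<bar> = 2 * max 0 (?g t - ?T n t) - (?g t - ?T n t)" for t .
    qed
    also have "\<dots> = 2 * (\<integral>t. max 0 (?g t - ?T n t) \<partial>lborel)"
      using i int intT[of n] T_le[of n] by simp
    finally show ?thesis .
  qed
  ultimately show ?thesis by (simp add: ennreal_tendsto_0_iff) 
qed


lemma nn_integral_abs_diff_triangle:
  fixes f g h :: "'a \<Rightarrow> real"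
  assumes [measurable]: "f \<in> borel_measurable M" "g \<in> borel_measurable M" "h \<in> borel_measurable M"
  shows "(\<integral>\<^sup>+x. ennreal \<bar>f x - h x\<bar> \<partial>M) \<le> (\<integral>\<^sup>+x. ennreal \<bar>f x - g x\<bar> \<partial>M) + (\<integral>\<^sup>+x. ennreal \<bar>g x - h x\<bar> \<partial>M)"
  by (subst nn_integral_add[symmetric]) (auto intro!: nn_integral_mono simp: ennreal_plus[symmetric] ennreal_leI simp del: ennreal_plus)


lemma ennreal_tendsto_0I:
  fixes f :: "nat \<Rightarrow> ennreal"
  assumes "\<And>e::real. e > 0 \<Longrightarrow> \<forall>\<^sub>F n in sequentially. f n \<le> ennreal e"
  shows "f \<longlonglongrightarrow> 0"
proof (rule order_tendstoI)
  fix a :: ennreal assume "0 < a"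
  then obtain e :: real where e: "e > 0" "ennreal e < a"
    by (metis dense ennreal_cases ennreal_less_zero_iff less_top_ennreal not_less_iff_gr_or_eq top.not_eq_extremum)
  from assms[OF e(1)] show "\<forall>\<^sub>F n in sequentially. f n < a"
    by eventually_elim (use e in auto)
qed auto

text \<open>Since mollification contracts L1, the set of functions for which it converges is closed
  in L1: three errors of size e / 3.\<close>

lemma mollify_tendsto_approx:
  fixes g :: "real ^ 'd::finite \<Rightarrow> real"
  assumes g: "integrable lborel g"
    and approx: "\<And>e::real. e > 0 \<Longrightarrow> \<exists>f. integrable lborel f \<and> (\<integral>\<^sup>+t. ennreal \<bar>g t - f t\<bar> \<partial>lborel) \<le> ennreal e \<and>
      (\<lambda>n. \<integral>\<^sup>+t. ennreal \<bar>mollify (1 / Suc n) f t - f t\<bar> \<partial>lborel) \<longlonglongrightarrow> 0"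
  shows "(\<lambda>n. \<integral>\<^sup>+t. ennreal \<bar>mollify (1 / Suc n) g t - g t\<bar> \<partial>lborel) \<longlonglongrightarrow> 0"
proof (rule ennreal_tendsto_0I)
  fix e :: real assume e: "e > 0"
  then obtain f where f: "integrable lborel f" "(\<integral>\<^sup>+t. ennreal \<bar>g t - f t\<bar> \<partial>lborel) \<le> ennreal (e / 3)"
    and lim: "(\<lambda>n. \<integral>\<^sup>+t. ennreal \<bar>mollify (1 / Suc n) f t - f t\<bar> \<partial>lborel) \<longlonglongrightarrow> 0"
    using approx[of "e / 3"] by auto
  have [measurable]: "f \<in> borel_measurable borel" "g \<in> borel_measurable borel" using f g by auto
  have "\<forall>\<^sub>F n in sequentially. (\<integral>\<^sup>+t. ennreal \<bar>mollify (1 / Suc n) f t - f t\<bar> \<partial>lborel) < ennreal (e / 3)"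
    using order_tendstoD(2)[OF lim, of "ennreal (e / 3)"] e by simp
  then show "\<forall>\<^sub>F n in sequentially. (\<integral>\<^sup>+t. ennreal \<bar>mollify (1 / Suc n) g t - g t\<bar> \<partial>lborel) \<le> ennreal e"
  proof eventually_elim
    case (elim n)
    have [measurable]: "mollify (1 / Suc n) f \<in> borel_measurable borel" "mollify (1 / Suc n) g \<in> borel_measurable borel" by simp_all
    have "(\<integral>\<^sup>+t. ennreal \<bar>mollify (1 / Suc n) g t - mollify (1 / Suc n) f t\<bar> \<partial>lborel) =
       (\<integral>\<^sup>+t. ennreal \<bar>mollify (1 / Suc n) (\<lambda>x. g x - f x) t\<bar> \<partial>lborel)"
      by (simp add: mollify_diff f g)
    also have "\<dots> \<le> (\<integral>\<^sup>+t. ennreal \<bar>g t - f t\<bar> \<partial>lborel)" by (rule nn_integral_mollify_le) auto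
    finally have 1: "(\<integral>\<^sup>+t. ennreal \<bar>mollify (1 / Suc n) g t - mollify (1 / Suc n) f t\<bar> \<partial>lborel) \<le> ennreal (e / 3)"
      using f(2) by simp
    have 2: "(\<integral>\<^sup>+t. ennreal \<bar>f t - g t\<bar> \<partial>lborel) \<le> ennreal (e / 3)" using f(2) by (simp add: abs_minus_commute)
    have "(\<integral>\<^sup>+t. ennreal \<bar>mollify (1 / Suc n) g t - g t\<bar> \<partial>lborel) \<le>
      (\<integral>\<^sup>+t. ennreal \<bar>mollify (1 / Suc n) g t - mollify (1 / Suc n) f t\<bar> \<partial>lborel) +
      ((\<integral>\<^sup>+t. ennreal \<bar>mollify (1 / Suc n) f t - f t\<bar> \<partial>lborel) + (\<integral>\<^sup>+t. ennreal \<bar>f t - g t\<bar> \<partial>lborel))"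
      by (rule order_trans[OF nn_integral_abs_diff_triangle add_left_mono[OF nn_integral_abs_diff_triangle]]) simp_all
    also have "\<dots> \<le> ennreal (e / 3) + (ennreal (e / 3) + ennreal (e / 3))"
      by (intro add_mono 1 2 less_imp_le[OF elim])
    also have "\<dots> = ennreal e" using e by (simp add: ennreal_plus[symmetric] del: ennreal_plus)
    finally show ?case .
  qed
qed

text \<open>Induction over integrable functions. Closedness in L1 reduces indicators of measurable
  sets to those of open sets and also handles the limit case.\<close>

lemma mollify_tendsto:
  fixes g :: "real ^ 'd::finite \<Rightarrow> real"
  assumes "integrable lborel g"
  shows "(\<lambda>n. \<integral>\<^sup>+t. ennreal \<bar>mollify (1 / Suc n) g t - g t\<bar> \<partial>lborel) \<longlonglongrightarrow> 0"
  using assms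
proof (induction rule: integrable_induct)
  case (base A c)
  have [measurable]: "A \<in> sets borel" using base by simp
  have ind: "(\<lambda>n. \<integral>\<^sup>+t. ennreal \<bar>mollify (1 / Suc n) (indicator A) t - indicator A t\<bar> \<partial>lborel) \<longlonglongrightarrow> 0"
  proof (rule mollify_tendsto_approx)
    show "integrable lborel (indicat_real A)" using base by simp
    fix e :: real assume "e > 0"
    \<comment> \<open>Outer regularity replaces the measurable set by an open one at an L1 cost
      below e.\<close>
    then obtain U where U: "open U" "A \<subseteq> U" "emeasure lborel (U - A) < ennreal e"
      using outer_regular_lborel[of A e] by auto
    have [measurable]: "U \<in> sets borel" using U by simp
    have "emeasure lborel U = emeasure lborel (U - A) + emeasure lborel A"
      using U by (subst plus_emeasure) (auto intro!: arg_cong[where f = "emeasure lborel"])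
    also have "\<dots> < \<top>" using less_trans[OF U(3) ennreal_less_top] base(2) by simp
    finally have fin: "emeasure lborel U < \<top>" .
    have "(\<integral>\<^sup>+t. ennreal \<bar>indicat_real A t - indicat_real U t\<bar> \<partial>lborel) = (\<integral>\<^sup>+t. indicator (U - A) t \<partial>lborel)"
      using U(2) by (intro nn_integral_cong) (auto simp: indicator_def)
    also have "\<dots> \<le> ennreal e" using U(3) by simp
    finally show "\<exists>f. integrable lborel f \<and> (\<integral>\<^sup>+t. ennreal \<bar>indicat_real A t - f t\<bar> \<partial>lborel) \<le> ennreal e \<and>
      (\<lambda>n. \<integral>\<^sup>+t. ennreal \<bar>mollify (1 / Suc n) f t - f t\<bar> \<partial>lborel) \<longlonglongrightarrow> 0"
      using fin mollify_open_tendsto[OF U(1) fin] by (intro exI[of _ "indicator U"]) auto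
  qed
  have "mollify (1 / Suc n) (\<lambda>x. indicator A x *\<^sub>R c) t = mollify (1 / Suc n) (indicator A) t * c" for n t
    unfolding mollify_def by (subst Bochner_Integration.integral_mult_left_zero[symmetric]) (simp add: ac_simps)
  then have "(\<integral>\<^sup>+t. ennreal \<bar>mollify (1 / Suc n) (\<lambda>x. indicator A x *\<^sub>R c) t - indicator A t *\<^sub>R c\<bar> \<partial>lborel) =
     (\<integral>\<^sup>+t. ennreal \<bar>c\<bar> * ennreal \<bar>mollify (1 / Suc n) (indicator A) t - indicator A t\<bar> \<partial>lborel)" for n
    by (intro nn_integral_cong) (simp add: ennreal_mult[symmetric] abs_mult[symmetric] algebra_simps)
  also have "(\<integral>\<^sup>+t. ennreal \<bar>c\<bar> * ennreal \<bar>mollify (1 / Suc n) (indicator A) t - indicator A t\<bar> \<partial>lborel) =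
    ennreal \<bar>c\<bar> * (\<integral>\<^sup>+t. ennreal \<bar>mollify (1 / Suc n) (indicator A) t - indicator A t\<bar> \<partial>lborel)" for n
    by (rule nn_integral_cmult) simp
  finally show ?case using ennreal_tendsto_cmult[OF _ ind, of "ennreal \<bar>c\<bar>"] by simp
next
  case (add f g)
  have [measurable]: "f \<in> borel_measurable borel" "g \<in> borel_measurable borel" using add by auto
  have "(\<lambda>n. (\<integral>\<^sup>+t. ennreal \<bar>mollify (1 / Suc n) f t - f t\<bar> \<partial>lborel) +
    (\<integral>\<^sup>+t. ennreal \<bar>mollify (1 / Suc n) g t - g t\<bar> \<partial>lborel)) \<longlonglongrightarrow> 0"
    using tendsto_add[OF add.IH] by simp
  then show ?case
  proof (rule tendsto_sandwich[OF _ _ tendsto_const, rotated 2])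
    show "\<forall>\<^sub>F n in sequentially. (\<integral>\<^sup>+t. ennreal \<bar>mollify (1 / Suc n) (\<lambda>x. f x + g x) t - (f t + g t)\<bar> \<partial>lborel)
       \<le> (\<integral>\<^sup>+t. ennreal \<bar>mollify (1 / Suc n) f t - f t\<bar> \<partial>lborel) +
    (\<integral>\<^sup>+t. ennreal \<bar>mollify (1 / Suc n) g t - g t\<bar> \<partial>lborel)"
    proof (intro always_eventually allI)
      fix n
      have [measurable]: "mollify (1 / Suc n) f \<in> borel_measurable borel" "mollify (1 / Suc n) g \<in> borel_measurable borel" by simp_all
      show "(\<integral>\<^sup>+t. ennreal \<bar>mollify (1 / Suc n) (\<lambda>x. f x + g x) t - (f t + g t)\<bar> \<partial>lborel)
       \<le> (\<integral>\<^sup>+t. ennreal \<bar>mollify (1 / Suc n) f t - f t\<bar> \<partial>lborel) +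
    (\<integral>\<^sup>+t. ennreal \<bar>mollify (1 / Suc n) g t - g t\<bar> \<partial>lborel)"
        by (subst nn_integral_add[symmetric])
          (auto intro!: nn_integral_mono simp: mollify_add add ennreal_plus[symmetric] ennreal_leI simp del: ennreal_plus)
    qed
  qed auto
next
  case (lim f s)
  have [measurable]: "f \<in> borel_measurable borel" "s i \<in> borel_measurable borel" for i using lim by auto
  show ?case
  proof (rule mollify_tendsto_approx[OF lim.hyps(4)])
    fix e :: real assume e: "e > 0"
    have "integrable lborel (\<lambda>t. 2 * f t)" using lim.hyps(4) by simp
    from this[unfolded integrable_iff_bounded]
    have fin: "(\<integral>\<^sup>+t. ennreal (2 * norm (f t)) \<partial>lborel) < \<infinity>"
      unfolding norm_mult by simp
    have "(\<lambda>i. \<integral>\<^sup>+t. ennreal (norm (f t - s i t)) \<partial>lborel) \<longlonglongrightarrow> 0"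
      by (rule nn_integral_dominated_convergence_norm[where w = "\<lambda>t. 2 * norm (f t)"])
        (use lim fin in auto)
    from order_tendstoD(2)[OF this, of "ennreal e"] e
    have "\<forall>\<^sub>F i in sequentially. (\<integral>\<^sup>+t. ennreal (norm (f t - s i t)) \<partial>lborel) < ennreal e" by simp
    then obtain i where i: "(\<integral>\<^sup>+t. ennreal (norm (f t - s i t)) \<partial>lborel) < ennreal e"
      using eventually_happens by force
    show "\<exists>h. integrable lborel h \<and> (\<integral>\<^sup>+t. ennreal \<bar>f t - h t\<bar> \<partial>lborel) \<le> ennreal e \<and>
      (\<lambda>n. \<integral>\<^sup>+t. ennreal \<bar>mollify (1 / Suc n) h t - h t\<bar> \<partial>lborel) \<longlonglongrightarrow> 0"
      using lim.IH[of i] lim.hyps(1)[of i] less_imp_le[OF i] unfolding real_norm_def by blast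
  qed
qed


section \<open>Locally integrable functions\<close>

lemma locally_integrable_measurable [measurable_dest]:
  fixes g :: "real ^ 'd::finite \<Rightarrow> real"
  assumes "locally_integrable g" shows "g \<in> borel_measurable borel"
proof (rule borel_measurable_LIMSEQ_real)
  show "(\<lambda>x. indicator (cball 0 (real n)) x *\<^sub>R g x) \<in> borel_measurable borel" for n
  proof -
    have "integrable lborel (\<lambda>x. indicator (cball 0 (real n)) x *\<^sub>R g x)"
      using assms unfolding locally_integrable_def set_integrable_def by (metis compact_cball)
    from borel_measurable_integrable[OF this] show ?thesis by simp
  qed
  fix x :: "real ^ 'd"
  have "\<forall>\<^sub>F n in sequentially. norm x \<le> real n" using filterlim_real_sequentially unfolding filterlim_at_top by blast
  then have "\<forall>\<^sub>F n in sequentially. indicator (cball 0 (real n)) x *\<^sub>R g x = g x"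
    by eventually_elim simp
  then show "(\<lambda>n. indicator (cball 0 (real n)) x *\<^sub>R g x) \<longlonglongrightarrow> g x" by (rule tendsto_eventually)
qed

lemma locally_integrable_cball:
  "locally_integrable g \<Longrightarrow> integrable lborel (\<lambda>x. indicator (cball 0 R) x * g x)"
  by (simp add: locally_integrable_def set_integrable_def)

lemma locally_integrable_mult_test:
  assumes "locally_integrable g" "test_function \<phi>"
  shows "integrable lborel (\<lambda>x. g x * \<phi> x)"
proof -
  obtain R where R: "\<And>x. \<phi> x \<noteq> 0 \<Longrightarrow> norm x \<le> R" using test_function_support[OF assms(2)] by blast
  have cont: "continuous_on UNIV \<phi>" using assms(2) by (simp add: smooth_continuous test_function_smooth)
  then have "bounded (\<phi> ` cball 0 R)"
    by (intro compact_imp_bounded compact_continuous_image continuous_on_subset[OF cont]) auto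
  then obtain B where B: "\<And>x. norm x \<le> R \<Longrightarrow> \<bar>\<phi> x\<bar> \<le> B"
    unfolding bounded_iff by (metis image_eqI mem_cball_0 real_norm_def)
  have [measurable]: "\<phi> \<in> borel_measurable borel" "g \<in> borel_measurable borel"
    using borel_measurable_continuous_onI[OF cont] locally_integrable_measurable[OF assms(1)] by auto
  show ?thesis
  proof (rule Bochner_Integration.integrable_bound)
    show "integrable lborel (\<lambda>x. B * (indicator (cball 0 R) x * g x))"
      using locally_integrable_cball[OF assms(1)] by simp
    show "AE x in lborel. norm (g x * \<phi> x) \<le> norm (B * (indicator (cball 0 R) x * g x))"
    proof (rule AE_I2)
      fix x
      show "norm (g x * \<phi> x) \<le> norm (B * (indicator (cball 0 R) x * g x))"
      proof (cases "norm x \<le> R")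
        case True
        then show ?thesis using B[OF True] by (auto simp: abs_mult mult.commute[of "\<bar>g x\<bar>"] intro!: mult_right_mono)
      next
        case False
        then have "\<phi> x = 0" using R by blast
        then show ?thesis by simp
      qed
    qed
  qed simp
qed

text \<open>A mollifier of radius at most 1 sees only points within distance 1 of t. This reduces
  statements about locally integrable functions on a ball to integrable ones.\<close>

lemma mollify_cutoff:
  assumes "0 < r" "r \<le> 1" "norm t \<le> R"
  shows "mollify r (\<lambda>x. indicator (cball 0 (R + 1)) x * g x) t = mollify r g t"
  unfolding mollify_def
proof (intro Bochner_Integration.integral_cong refl)
  fix x
  show "indicator (cball 0 (R + 1)) x * g x * mollifier r (x - t) = g x * mollifier r (x - t)"
  proof (cases "norm (x - t) < r")
    case True
    then have "norm x \<le> R + 1" using assms norm_triangle_sub[of x t] by linarith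
    then show ?thesis by simp
  qed (use assms in \<open>simp add: mollifier_eq_0\<close>)
qed

lemma mollify_tendsto_local:
  fixes g :: "real ^ 'd::finite \<Rightarrow> real"
  assumes "locally_integrable g"
  shows "(\<lambda>n. \<integral>\<^sup>+t. ennreal \<bar>mollify (1 / Suc n) g t - g t\<bar> * indicator (cball 0 R) t \<partial>lborel) \<longlonglongrightarrow> 0"
proof (rule tendsto_sandwich[OF _ _ tendsto_const mollify_tendsto[OF locally_integrable_cball[OF assms, of "R + 1"]]])
  show "\<forall>\<^sub>F n in sequentially. (\<integral>\<^sup>+t. ennreal \<bar>mollify (1 / Suc n) g t - g t\<bar> * indicator (cball 0 R) t \<partial>lborel)
    \<le> (\<integral>\<^sup>+t. ennreal \<bar>mollify (1 / Suc n) (\<lambda>x. indicator (cball 0 (R + 1)) x * g x) t - indicator (cball 0 (R + 1)) t * g t\<bar> \<partial>lborel)"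
  proof (intro always_eventually allI nn_integral_mono)
    fix n t
    show "ennreal \<bar>mollify (1 / Suc n) g t - g t\<bar> * indicator (cball 0 R) t
      \<le> ennreal \<bar>mollify (1 / Suc n) (\<lambda>x. indicator (cball 0 (R + 1)) x * g x) t - indicator (cball 0 (R + 1)) t * g t\<bar>"
    proof (cases "norm t \<le> R")
      case True
      then have "mollify (1 / Suc n) (\<lambda>x. indicator (cball 0 (R + 1)) x * g x) t = mollify (1 / Suc n) g t"
        by (intro mollify_cutoff) auto
      then show ?thesis using True by simp
    qed simp
  qed
qed simp

section \<open>Riemann sums over fine partitions of a ball\<close>

lemma cball_fine_partition:
  fixes R :: real
  assumes "\<delta> > 0"
  obtains n :: nat and P :: "nat \<Rightarrow> 'a::euclidean_space set" and c :: "nat \<Rightarrow> 'a"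
  where "\<And>j. P j \<in> sets borel" "disjoint_family_on P {..<n}" "(\<Union>j<n. P j) = cball 0 R"
    "\<And>j. P j \<subseteq> ball (c j) \<delta>" "\<And>j. j < n \<Longrightarrow> c j \<in> cball 0 R"
proof -
  have "cball (0::'a) R \<subseteq> (\<Union>x\<in>cball 0 R. ball x \<delta>)" using assms by auto
  then obtain C where C: "C \<subseteq> cball (0::'a) R" "finite C" "cball 0 R \<subseteq> (\<Union>x\<in>C. ball x \<delta>)"
    using compactE_image[OF compact_cball, of "cball 0 R" "\<lambda>x. ball x \<delta>"] by (metis open_ball)
  obtain c :: "nat \<Rightarrow> 'a" and n where c: "C = c ` {i. i < n}"
    using C(2) finite_imp_nat_seg_image_inj_on by blast
  \<comment> \<open>Removing the earlier balls makes the finite subcover disjoint.\<close>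
  define P where "P = (\<lambda>j. cball 0 R \<inter> ball (c j) \<delta> - (\<Union>i<j. ball (c i) \<delta>))"
  show thesis
  proof (rule that[of P n c])
    show "P j \<in> sets borel" for j unfolding P_def by auto
    show "disjoint_family_on P {..<n}"
      unfolding disjoint_family_on_def P_def
    proof (intro ballI impI)
      fix i j :: nat assume "i \<noteq> j"
      then consider "i < j" | "j < i" by linarith
      then show "(cball 0 R \<inter> ball (c i) \<delta> - (\<Union>i<i. ball (c i) \<delta>)) \<inter> (cball 0 R \<inter> ball (c j) \<delta> - (\<Union>i<j. ball (c i) \<delta>)) = {}"
        by cases auto
    qed
    show "(\<Union>j<n. P j) = cball 0 R"
    proof
      show "cball 0 R \<subseteq> (\<Union>j<n. P j)"
      proof
        fix x :: 'a assume x: "x \<in> cball 0 R"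
        then obtain y where "y \<in> C" "x \<in> ball y \<delta>" using C(3) by blast
        then have ex: "\<exists>j. j < n \<and> x \<in> ball (c j) \<delta>" unfolding c by blast
        define j where "j = (LEAST j. j < n \<and> x \<in> ball (c j) \<delta>)"
        have j: "j < n" "x \<in> ball (c j) \<delta>" using LeastI_ex[OF ex] unfolding j_def by auto
        have "x \<notin> ball (c i) \<delta>" if "i < j" for i
          using not_less_Least[of i "\<lambda>j. j < n \<and> x \<in> ball (c j) \<delta>"] that j(1) unfolding j_def[symmetric] by auto
        then show "x \<in> (\<Union>j<n. P j)" using x j unfolding P_def by blast
      qed
    qed (auto simp: P_def)
    show "P j \<subseteq> ball (c j) \<delta>" for j unfolding P_def by auto
    show "c j \<in> cball 0 R" if "j < n" for j using C(1) that unfolding c by auto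
  qed
qed

lemma riemann_sum_close:
  fixes G :: "'a::euclidean_space \<Rightarrow> real"
  assumes P: "\<And>j. P j \<in> sets borel" "disjoint_family_on P {..<n::nat}" "(\<Union>j<n. P j) = cball 0 R"
    and G: "continuous_on (cball 0 R) G"
    and close: "\<And>j x. j < n \<Longrightarrow> x \<in> P j \<Longrightarrow> \<bar>G x - G (c j)\<bar> \<le> e"
  shows "\<bar>(\<integral>x. indicator (cball 0 R) x * G x \<partial>lborel) - (\<Sum>j<n. measure lborel (P j) * G (c j))\<bar> \<le> measure lborel (cball (0::'a) R) * e"
proof -
  have sub: "P j \<subseteq> cball 0 R" if "j < n" for j using P(3) that by blast
  have fin: "emeasure lborel (P j) < \<top>" if "j < n" for j
    using emeasure_mono[OF sub[OF that], of lborel] emeasure_lborel_cball_finite[of "0::'a" R] by auto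
  have G_int: "integrable lborel (\<lambda>x. indicator (cball 0 R) x *\<^sub>R G x)"
    using borel_integrable_compact[OF compact_cball G] .
  have int: "integrable lborel (\<lambda>x. indicator (P j) x * G x)" if "j < n" for j
  proof (rule Bochner_Integration.integrable_bound[OF G_int])
    have "(\<lambda>x. indicator (P j) x * (indicator (cball 0 R) x *\<^sub>R G x)) \<in> borel_measurable lborel"
      using P(1)[of j] G_int by measurable
    also have "(\<lambda>x. indicator (P j) x * (indicator (cball 0 R) x *\<^sub>R G x)) = (\<lambda>x. indicator (P j) x * G x)"
      using sub[OF that] by (auto simp: indicator_def fun_eq_iff)
    finally show "(\<lambda>x. indicator (P j) x * G x) \<in> borel_measurable lborel" .
  qed (use sub[OF that] in \<open>auto simp: indicator_def subset_iff intro!: AE_I2\<close>)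
  have ind: "indicator (cball 0 R) x = (\<Sum>j<n. indicator (P j) x :: real)" for x
    unfolding P(3)[symmetric] using indicator_UN_disjoint[OF _ P(2), of x] by simp
  have int_ind: "integrable lborel (\<lambda>x. indicator (P j) x * b)" if "j < n" for j and b :: real
    using fin[OF that] P(1)[of j] by (intro integrable_mult_left) auto
  have "(\<integral>x. indicator (cball 0 R) x * G x \<partial>lborel) = (\<Sum>j<n. \<integral>x. indicator (P j) x * G x \<partial>lborel)"
    unfolding ind sum_distrib_right by (rule Bochner_Integration.integral_sum) (use int in auto)
  moreover have "measure lborel (P j) * G (c j) = (\<integral>x. indicator (P j) x * G (c j) \<partial>lborel)" for j
    by simp
  moreover have "(\<integral>x. indicator (P j) x * (G x - G (c j)) \<partial>lborel) =
    (\<integral>x. indicator (P j) x * G x \<partial>lborel) - (\<integral>x. indicator (P j) x * G (c j) \<partial>lborel)" if "j < n" for j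
    unfolding right_diff_distrib by (rule Bochner_Integration.integral_diff[OF int[OF that] int_ind[OF that]])
  ultimately have "(\<integral>x. indicator (cball 0 R) x * G x \<partial>lborel) - (\<Sum>j<n. measure lborel (P j) * G (c j)) =
    (\<Sum>j<n. \<integral>x. indicator (P j) x * (G x - G (c j)) \<partial>lborel)"
    by (simp only: sum_subtractf[symmetric]) (auto intro!: sum.cong)
  also have "\<bar>\<dots>\<bar> \<le> (\<Sum>j<n. \<integral>x. indicator (P j) x * e \<partial>lborel)"
  proof (rule order_trans[OF sum_abs], rule sum_mono)
    fix j assume "j \<in> {..<n}"
    then have j: "j < n" by simp
    show "\<bar>\<integral>x. indicator (P j) x * (G x - G (c j)) \<partial>lborel\<bar> \<le> (\<integral>x. indicator (P j) x * e \<partial>lborel)"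
      by (rule integral_abs_bound_integral)
        (use j int[OF j] int_ind[OF j] close[OF j] in \<open>auto simp: right_diff_distrib indicator_def\<close>)
  qed
  also have "\<dots> = (\<integral>x. indicator (cball 0 R) x * e \<partial>(lborel :: 'a measure))"
    unfolding ind sum_distrib_right by (rule Bochner_Integration.integral_sum[symmetric]) (use int_ind in auto)
  also have "\<dots> = measure lborel (cball (0::'a) R) * e" by simp
  finally show ?thesis .
qed

section \<open>Characteristic functions of Poisson integrals\<close>

definition poisson_weight :: "real \<Rightarrow> nat \<Rightarrow> real" where
  "poisson_weight l k = exp (- l) * l ^ k / fact k"

lemma poisson_weight_nonneg: "l \<ge> 0 \<Longrightarrow> poisson_weight l k \<ge> 0"
  by (simp add: poisson_weight_def)

text \<open>The generating function is stated over a general field because it is used twice: at x =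
  1 for the total mass and at \<open>x = iexp c\<close> for the characteristic function.\<close>

lemma poisson_weight_sums:
  fixes x :: "'a::{real_normed_field, banach}"
  shows "(\<lambda>k. of_real (poisson_weight l k) * x ^ k) sums (exp (of_real l * (x - 1)))"
proof -
  have "(\<lambda>k. (of_real l * x) ^ k /\<^sub>R fact k) sums exp (of_real l * x)" by (rule exp_converges)
  then have "(\<lambda>k. exp (- of_real l) * ((of_real l * x) ^ k /\<^sub>R fact k)) sums (exp (- of_real l) * exp (of_real l * x))"
    by (rule sums_mult)
  also have "exp (- of_real l) * exp (of_real l * x) = exp (of_real l * (x - 1))"
    by (simp add: exp_add[symmetric] algebra_simps)
  also have "(\<lambda>k. exp (- of_real l) * ((of_real l * x) ^ k /\<^sub>R fact k)) = (\<lambda>k. of_real (poisson_weight l k) * x ^ k)"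
    by (simp add: poisson_weight_def fun_eq_iff power_mult_distrib scaleR_conv_of_real exp_of_real[symmetric] field_simps)
  finally show ?thesis .
qed

text \<open>The identity l p(k) = (k + 1) p(k + 1) shifts the series of the mean onto the total
  mass.\<close>

lemma poisson_weight_mean: "(\<lambda>k. poisson_weight l k * real k) sums l"
proof -
  have "(\<lambda>k. poisson_weight l k) sums 1"
    using poisson_weight_sums[of l "1::real"] by simp
  then have "(\<lambda>k. l * poisson_weight l k) sums l" using sums_mult[of _ 1 l] by simp
  also have "(\<lambda>k. l * poisson_weight l k) = (\<lambda>k. poisson_weight l (Suc k) * real (Suc k))"
  proof
    fix k
    have "fact (Suc k) = real (Suc k) * fact k" by simp
    then show "l * poisson_weight l k = poisson_weight l (Suc k) * real (Suc k)"
      unfolding poisson_weight_def by (simp add: field_simps del: fact_Suc of_nat_Suc)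
  qed
  finally show ?thesis using sums_Suc_iff[of "\<lambda>k. poisson_weight l k * real k" l] by simp
qed

text \<open>Applying F to a simple function gives the sum of F over its nonzero levels, provided F 0
  = 0. Dropping the level 0 matters because its set may have infinite intensity. The lemma serves
  for the identity and for \<open>iexp x - 1\<close>.\<close>

lemma sum_scaleR_delta:
  fixes F :: "real \<Rightarrow> 'a::real_vector" and c :: "nat \<Rightarrow> real"
  assumes "x = 0 \<and> (\<forall>i<n. c i = 0) \<or> (\<exists>j<n. x = h j \<and> (\<forall>i<n. c i = (if i = j then 1 else 0)))" "F 0 = 0"
  shows "F x = (\<Sum>i<n. c i *\<^sub>R F (h i))"
  using assms(1)
proof (elim disjE conjE exE)
  fix j assume j: "j < n" "x = h j" and c: "\<forall>i<n. c i = (if i = j then 1 else 0)"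
  have "(\<Sum>i<n. c i *\<^sub>R F (h i)) = (\<Sum>i<n. if i = j then F (h i) else 0)"
    using c by (intro sum.cong) auto
  then show ?thesis using j by simp
qed (simp add: assms(2))

section \<open>Counts, Campbell's formula and the exponential formula\<close>

locale poisson_measure = prob_space M for M :: "'w measure" +
  fixes \<mu> :: "'e measure" and J :: "'w \<Rightarrow> 'e measure"
  assumes prm: "poisson_random_measure M \<mu> J"
begin

lemma sets_J [simp, measurable_cong]: "\<omega> \<in> space M \<Longrightarrow> sets (J \<omega>) = sets \<mu>"
  using prm unfolding poisson_random_measure_def by blast

lemma space_J [simp]: "\<omega> \<in> space M \<Longrightarrow> space (J \<omega>) = space \<mu>"
  by (rule sets_eq_imp_space_eq) simp

lemma measurable_J [simp]: "\<omega> \<in> space M \<Longrightarrow> borel_measurable (J \<omega>) = borel_measurable \<mu>"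
  by (rule measurable_cong_sets) simp_all

lemma emeasure_J_measurable [measurable (raw)]: "B \<in> sets \<mu> \<Longrightarrow> (\<lambda>\<omega>. emeasure (J \<omega>) B) \<in> borel_measurable M"
  using prm unfolding poisson_random_measure_def by blast

lemma J_indep:
  "range B \<subseteq> sets \<mu> \<Longrightarrow> disjoint_family (B :: nat \<Rightarrow> _) \<Longrightarrow> indep_vars (\<lambda>_. borel) (\<lambda>i \<omega>. emeasure (J \<omega>) (B i)) UNIV"
  using prm unfolding poisson_random_measure_def by blast

lemma prob_J:
  assumes "B \<in> sets \<mu>" "emeasure \<mu> B < \<top>"
  shows "prob {\<omega> \<in> space M. emeasure (J \<omega>) B = of_nat k} = poisson_weight (measure \<mu> B) k"
  using prm assms unfolding poisson_random_measure_def poisson_distributed_def poisson_weight_def measure_def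
  by (auto simp: less_top)

text \<open>An everywhere defined integer-valued version of the number of points in B; for finite
  intensity it agrees almost surely with the extended real count.\<close>

definition count :: "'e set \<Rightarrow> 'w \<Rightarrow> nat" where
  "count B \<omega> = nat \<lfloor>enn2real (emeasure (J \<omega>) B)\<rfloor>"

lemma count_measurable [measurable]: "B \<in> sets \<mu> \<Longrightarrow> count B \<in> measurable M (count_space UNIV)"
  unfolding count_def by measurable

text \<open>Only the probabilities of the finite integer values are prescribed; as these sum to 1,
  all other values, infinity included, have probability 0.\<close>

lemma AE_emeasure_J:
  assumes B: "B \<in> sets \<mu>" "emeasure \<mu> B < \<top>"
  shows "AE \<omega> in M. emeasure (J \<omega>) B = of_nat (count B \<omega>)"
proof -
  let ?A = "\<lambda>k::nat. {\<omega> \<in> space M. emeasure (J \<omega>) B = of_nat k}"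
  have [measurable]: "?A k \<in> sets M" for k using B by measurable
  have disj: "disjoint_family ?A" by (auto simp: disjoint_family_on_def)
  have "(\<lambda>k. prob (?A k)) sums prob (\<Union>k. ?A k)"
    by (rule finite_measure_UNION[OF _ disj]) auto
  moreover have "(\<lambda>k. prob (?A k)) sums 1"
    unfolding prob_J[OF B] using poisson_weight_sums[of "measure \<mu> B" "1::real"] by simp
  ultimately have "prob (\<Union>k. ?A k) = 1" using sums_unique2 by blast
  then have "AE \<omega> in M. \<omega> \<in> (\<Union>k. ?A k)" by (subst (asm) prob_eq_1) auto
  then show ?thesis
    by eventually_elim (auto simp: count_def)
qed

lemma distr_count:
  assumes B: "B \<in> sets \<mu>" "emeasure \<mu> B < \<top>"
  shows "distr M (count_space UNIV) (count B) = density (count_space UNIV) (\<lambda>k. ennreal (poisson_weight (measure \<mu> B) k))"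
proof (rule measure_eqI_countable[where A = UNIV])
  have [measurable]: "count B \<in> measurable M (count_space UNIV)" using B by simp
  fix k
  have "emeasure (distr M (count_space UNIV) (count B)) {k} = emeasure M {\<omega>\<in>space M. count B \<omega> = k}"
    by (subst emeasure_distr) (auto intro!: arg_cong[where f = "emeasure M"])
  also have "\<dots> = emeasure M {\<omega> \<in> space M. emeasure (J \<omega>) B = of_nat k}"
  proof (rule emeasure_eq_AE)
    show "AE x in M. (x \<in> {\<omega> \<in> space M. count B \<omega> = k}) = (x \<in> {\<omega> \<in> space M. emeasure (J \<omega>) B = of_nat k})"
      using AE_emeasure_J[OF B] by eventually_elim auto
  qed (use B in measurable)
  also have "\<dots> = ennreal (poisson_weight (measure \<mu> B) k)"
    by (simp add: emeasure_eq_measure prob_J[OF B])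
  also have "\<dots> = emeasure (density (count_space UNIV) (\<lambda>k. ennreal (poisson_weight (measure \<mu> B) k))) {k}"
    by (subst emeasure_density) (auto simp: nn_integral_count_space_indicator[symmetric] nn_integral_count_space_finite)
  finally show "emeasure (distr M (count_space UNIV) (count B)) {k} =
    emeasure (density (count_space UNIV) (\<lambda>k. ennreal (poisson_weight (measure \<mu> B) k))) {k}" .
qed auto

text \<open>For infinite intensity the count is almost surely infinite by definition; for finite
  intensity this is the mean of the Poisson distribution.\<close>

lemma mean_J: 
  assumes B: "B \<in> sets \<mu>"
  shows "(\<integral>\<^sup>+\<omega>. emeasure (J \<omega>) B \<partial>M) = emeasure \<mu> B"
proof (cases "emeasure \<mu> B = \<top>")
  case True
  then have "AE \<omega> in M. emeasure (J \<omega>) B = \<top>"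
    using prm B unfolding poisson_random_measure_def poisson_distributed_def by auto
  then have "(\<integral>\<^sup>+\<omega>. emeasure (J \<omega>) B \<partial>M) = (\<integral>\<^sup>+\<omega>. \<top> \<partial>M)" by (rule nn_integral_cong_AE)
  then show ?thesis using True by (simp add: emeasure_space_1)
next
  case False
  then have B': "emeasure \<mu> B < \<top>" by (simp add: less_top)
  have [measurable]: "count B \<in> measurable M (count_space UNIV)" using B by simp
  let ?w = "poisson_weight (measure \<mu> B)"
  have "(\<integral>\<^sup>+\<omega>. emeasure (J \<omega>) B \<partial>M) = (\<integral>\<^sup>+\<omega>. of_nat (count B \<omega>) \<partial>M)"
    by (rule nn_integral_cong_AE[OF AE_emeasure_J[OF B B']])
  also have "\<dots> = (\<integral>\<^sup>+k. of_nat k \<partial>distr M (count_space UNIV) (count B))"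
    by (subst nn_integral_distr) auto
  also have "\<dots> = (\<Sum>k. ennreal (?w k * real k))"
    unfolding distr_count[OF B B']
    by (subst nn_integral_density) (auto simp: nn_integral_count_space_nat ennreal_mult poisson_weight_nonneg ennreal_of_nat_eq_real_of_nat)
  also have "\<dots> = ennreal (measure \<mu> B)"
    using poisson_weight_mean[of "measure \<mu> B"]
    by (subst suminf_ennreal2) (auto simp: poisson_weight_nonneg sums_iff)
  also have "\<dots> = emeasure \<mu> B" using B' by (simp add: emeasure_eq_ennreal_measure less_top)
  finally show ?thesis .
qed

lemma iexp_J:
  assumes B: "B \<in> sets \<mu>" "emeasure \<mu> B < \<top>"
  shows "(CLINT \<omega>|M. iexp (c * measure (J \<omega>) B)) = exp (measure \<mu> B * (iexp c - 1))"
proof -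
  have [measurable]: "count B \<in> measurable M (count_space UNIV)" using B by simp
  let ?w = "poisson_weight (measure \<mu> B)"
  have "(CLINT \<omega>|M. iexp (c * measure (J \<omega>) B)) = (CLINT \<omega>|M. iexp c ^ count B \<omega>)"
  proof (rule Bochner_Integration.integral_cong_AE)
    show "AE \<omega> in M. iexp (c * measure (J \<omega>) B) = iexp c ^ count B \<omega>"
      using AE_emeasure_J[OF B]
    proof eventually_elim
      case (elim \<omega>)
      then have "measure (J \<omega>) B = real (count B \<omega>)" by (simp add: measure_def)
      then show ?case by (simp add: exp_of_nat_mult[symmetric] algebra_simps)
    qed
  qed (use B in \<open>auto simp: measure_def\<close>)
  also have "\<dots> = (\<integral>k. iexp c ^ k \<partial>distr M (count_space UNIV) (count B))"
    by (subst integral_distr) auto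
  also have "\<dots> = (\<integral>k. ?w k *\<^sub>R iexp c ^ k \<partial>count_space UNIV)"
    unfolding distr_count[OF B] by (rule integral_density) (auto simp: poisson_weight_nonneg)
  also have "\<dots> = exp (measure \<mu> B * (iexp c - 1))"
  proof -
    have "integrable (count_space UNIV) (\<lambda>k. ?w k *\<^sub>R iexp c ^ k)"
      using poisson_weight_sums[of "measure \<mu> B" "1::real"]
      by (subst integrable_count_space_nat_iff)
        (auto simp: norm_mult norm_power poisson_weight_nonneg sums_iff)
    from sums_integral_count_space_nat[OF this]
    show ?thesis using poisson_weight_sums[of "measure \<mu> B" "iexp c"] sums_unique2
      by (fastforce simp: scaleR_conv_of_real)
  qed
  finally show ?thesis .
qed

text \<open>Campbell's formula for the mean. Measurability and value are proved together, because
  each stage of the monotone class induction uses the measurability of the previous ones to compute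
  the mean.\<close>

lemma campbell:
  fixes k :: "'e \<Rightarrow> ennreal"
  assumes "k \<in> borel_measurable \<mu>"
  shows "(\<lambda>\<omega>. \<integral>\<^sup>+e. k e \<partial>J \<omega>) \<in> borel_measurable M \<and> (\<integral>\<^sup>+\<omega>. (\<integral>\<^sup>+e. k e \<partial>J \<omega>) \<partial>M) = (\<integral>\<^sup>+e. k e \<partial>\<mu>)"
  using assms
proof (induction rule: borel_measurable_induct)
  case (cong f g)
  have "(\<integral>\<^sup>+e. f e \<partial>J \<omega>) = (\<integral>\<^sup>+e. g e \<partial>J \<omega>)" if "\<omega> \<in> space M" for \<omega>
    using cong that by (intro nn_integral_cong) auto
  moreover have "(\<integral>\<^sup>+e. f e \<partial>\<mu>) = (\<integral>\<^sup>+e. g e \<partial>\<mu>)" using cong by (intro nn_integral_cong) auto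
  ultimately show ?case using cong by (simp cong: measurable_cong nn_integral_cong)
next
  case (set A)
  have "(\<integral>\<^sup>+e. indicator A e \<partial>J \<omega>) = emeasure (J \<omega>) A" if "\<omega> \<in> space M" for \<omega>
    using set that by simp
  then show ?case using set by (simp cong: measurable_cong nn_integral_cong add: mean_J)
next
  case (mult u c)
  have "(\<integral>\<^sup>+e. c * u e \<partial>J \<omega>) = c * (\<integral>\<^sup>+e. u e \<partial>J \<omega>)" if "\<omega> \<in> space M" for \<omega>
    using mult that by (intro nn_integral_cmult) simp
  moreover have [measurable]: "(\<lambda>\<omega>. \<integral>\<^sup>+e. u e \<partial>J \<omega>) \<in> borel_measurable M" using mult by blast
  moreover have "(\<lambda>\<omega>. c * (\<integral>\<^sup>+e. u e \<partial>J \<omega>)) \<in> borel_measurable M" by measurable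
  ultimately show ?case using mult by (simp cong: measurable_cong nn_integral_cong add: nn_integral_cmult)
next
  case (add u v)
  have "(\<integral>\<^sup>+e. v e + u e \<partial>J \<omega>) = (\<integral>\<^sup>+e. v e \<partial>J \<omega>) + (\<integral>\<^sup>+e. u e \<partial>J \<omega>)" if "\<omega> \<in> space M" for \<omega>
    using add that by (intro nn_integral_add) simp_all
  moreover have [measurable]: "(\<lambda>\<omega>. \<integral>\<^sup>+e. u e \<partial>J \<omega>) \<in> borel_measurable M"
    "(\<lambda>\<omega>. \<integral>\<^sup>+e. v e \<partial>J \<omega>) \<in> borel_measurable M" using add by blast+
  moreover have "(\<lambda>\<omega>. (\<integral>\<^sup>+e. v e \<partial>J \<omega>) + (\<integral>\<^sup>+e. u e \<partial>J \<omega>)) \<in> borel_measurable M" by measurable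
  ultimately show ?case using add by (simp cong: measurable_cong nn_integral_cong add: nn_integral_add)
next
  case (seq U)
  have "(\<integral>\<^sup>+e. (SUP i. U i) e \<partial>J \<omega>) = (SUP i. \<integral>\<^sup>+e. U i e \<partial>J \<omega>)" if "\<omega> \<in> space M" for \<omega>
    unfolding SUP_apply using seq that by (intro nn_integral_monotone_convergence_SUP) simp_all
  moreover have "(\<integral>\<^sup>+\<omega>. (SUP i. \<integral>\<^sup>+e. U i e \<partial>J \<omega>) \<partial>M) = (SUP i. \<integral>\<^sup>+\<omega>. (\<integral>\<^sup>+e. U i e \<partial>J \<omega>) \<partial>M)"
    using seq by (intro nn_integral_monotone_convergence_SUP) (auto simp: incseq_def le_fun_def intro!: nn_integral_mono)
  moreover have "(\<integral>\<^sup>+e. (SUP i. U i) e \<partial>\<mu>) = (SUP i. \<integral>\<^sup>+e. U i e \<partial>\<mu>)"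
    unfolding SUP_apply using seq by (intro nn_integral_monotone_convergence_SUP) simp_all
  moreover have [measurable]: "(\<lambda>\<omega>. \<integral>\<^sup>+e. U i e \<partial>J \<omega>) \<in> borel_measurable M" for i using seq by blast
  moreover have "(\<lambda>\<omega>. SUP i. \<integral>\<^sup>+e. U i e \<partial>J \<omega>) \<in> borel_measurable M" by measurable
  ultimately show ?case using seq by (simp cong: measurable_cong nn_integral_cong)
qed


text \<open>The Bochner integral jumps to its default 0 where k is not integrable, so the integral
  is written by cases on the finiteness of the absolute integral.\<close>

lemma integral_J_measurable [measurable (raw)]:
  fixes k :: "'e \<Rightarrow> real"
  assumes k: "k \<in> borel_measurable \<mu>"
  shows "(\<lambda>\<omega>. \<integral>e. k e \<partial>J \<omega>) \<in> borel_measurable M"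
proof -
  have [measurable]: "(\<lambda>\<omega>. \<integral>\<^sup>+e. ennreal (k e) \<partial>J \<omega>) \<in> borel_measurable M"
    "(\<lambda>\<omega>. \<integral>\<^sup>+e. ennreal (- k e) \<partial>J \<omega>) \<in> borel_measurable M"
    "(\<lambda>\<omega>. \<integral>\<^sup>+e. ennreal (norm (k e)) \<partial>J \<omega>) \<in> borel_measurable M"
    using k by (auto intro!: campbell[THEN conjunct1])
  have "(\<lambda>\<omega>. if (\<integral>\<^sup>+e. ennreal (norm (k e)) \<partial>J \<omega>) < \<infinity> then
      enn2real (\<integral>\<^sup>+e. ennreal (k e) \<partial>J \<omega>) - enn2real (\<integral>\<^sup>+e. ennreal (- k e) \<partial>J \<omega>) else 0) \<in> borel_measurable M"
    by measurable
  also have "?this \<longleftrightarrow> ?thesis"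
  proof (rule measurable_cong)
    fix \<omega> assume \<omega>: "\<omega> \<in> space M"
    show "(if (\<integral>\<^sup>+e. ennreal (norm (k e)) \<partial>J \<omega>) < \<infinity> then
      enn2real (\<integral>\<^sup>+e. ennreal (k e) \<partial>J \<omega>) - enn2real (\<integral>\<^sup>+e. ennreal (- k e) \<partial>J \<omega>) else 0) = (\<integral>e. k e \<partial>J \<omega>)"
      using \<omega> k by (auto simp: real_lebesgue_integral_def integrable_iff_bounded not_integrable_integral_eq)
  qed
  finally show ?thesis .
qed

lemma iexp_sum_J:
  fixes B :: "nat \<Rightarrow> 'e set"
  assumes B: "\<And>i. i < n \<Longrightarrow> B i \<in> sets \<mu>" "\<And>i. i < n \<Longrightarrow> emeasure \<mu> (B i) < \<top>" "disjoint_family_on B {..<n}"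
  shows "(CLINT \<omega>|M. iexp (\<Sum>i<n. c i * measure (J \<omega>) (B i))) = exp (\<Sum>i<n. measure \<mu> (B i) * (iexp (c i) - 1))"
proof -
  \<comment> \<open>Independence is formulated for infinite disjoint sequences, so the finite family
    is padded with empty sets.\<close>
  define B' where "B' = (\<lambda>i. if i < n then B i else {})"
  have B': "range B' \<subseteq> sets \<mu>" "disjoint_family B'"
    using B by (auto simp: B'_def disjoint_family_on_def)
  have "indep_vars (\<lambda>_. borel) (\<lambda>i \<omega>. iexp (c i * enn2real (emeasure (J \<omega>) (B' i)))) UNIV"
    by (rule indep_vars_compose2[OF J_indep[OF B']]) auto
  then have indep: "indep_vars (\<lambda>_. borel) (\<lambda>i \<omega>. iexp (c i * enn2real (emeasure (J \<omega>) (B' i)))) {..<n}"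
    by (rule indep_vars_subset) simp
  have m: "(\<lambda>\<omega>. measure (J \<omega>) (B i)) \<in> borel_measurable M" if "i < n" for i
    unfolding measure_def using B(1)[OF that] by measurable
  have int: "integrable M (\<lambda>\<omega>. iexp (c i * enn2real (emeasure (J \<omega>) (B' i))))" if "i < n" for i
    by (rule integrable_const_bound[where B = 1]) (use m[OF that] that in \<open>auto simp: B'_def measure_def\<close>)
  have "(CLINT \<omega>|M. iexp (\<Sum>i<n. c i * measure (J \<omega>) (B i))) =
      (CLINT \<omega>|M. (\<Prod>i<n. iexp (c i * enn2real (emeasure (J \<omega>) (B' i)))))"
    by (intro Bochner_Integration.integral_cong refl)
      (simp add: exp_sum[symmetric] sum_distrib_left B'_def measure_def)
  also have "\<dots> = (\<Prod>i<n. CLINT \<omega>|M. iexp (c i * enn2real (emeasure (J \<omega>) (B' i))))"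
    by (rule indep_vars_lebesgue_integral[OF _ indep]) (use int in auto)
  also have "\<dots> = (\<Prod>i<n. exp (measure \<mu> (B i) * (iexp (c i) - 1)))"
    by (intro prod.cong refl) (use iexp_J[OF B(1,2)] in \<open>auto simp: B'_def measure_def\<close>)
  also have "\<dots> = exp (\<Sum>i<n. measure \<mu> (B i) * (iexp (c i) - 1))"
    by (simp add: exp_sum)
  finally show ?thesis .
qed

lemma iexp_simple_J:
  fixes k :: "'e \<Rightarrow> real"
  assumes k: "simple_function \<mu> k" and fin: "emeasure \<mu> {e \<in> space \<mu>. k e \<noteq> 0} < \<top>"
  shows "(CLINT \<omega>|M. iexp (\<integral>e. k e \<partial>J \<omega>)) = exp (CLINT e|\<mu>. iexp (k e) - 1)"
proof -
  have "finite (k ` space \<mu> - {0})" using simple_functionD(1)[OF k] by simp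
  from ex_bij_betw_nat_finite[OF this] obtain h :: "nat \<Rightarrow> real" and n where
    h: "bij_betw h {0..<n} (k ` space \<mu> - {0})" by blast
  define B where "B = (\<lambda>i. k -` {h i} \<inter> space \<mu>)"
  have B: "B i \<in> sets \<mu>" for i unfolding B_def using simple_functionD(2)[OF k] .
  have h0: "h i \<noteq> 0" if "i < n" for i using h that unfolding bij_betw_def by auto
  have Bfin: "emeasure \<mu> (B i) < \<top>" if "i < n" for i
  proof -
    have "emeasure \<mu> (B i) \<le> emeasure \<mu> {e \<in> space \<mu>. k e \<noteq> 0}"
      using h0[OF that] borel_measurable_simple_function[OF k] by (intro emeasure_mono) (auto simp: B_def)
    then show ?thesis using fin by simp
  qed
  have inj: "inj_on h {..<n}" using h by (simp add: bij_betw_def lessThan_atLeast0)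
  have disj: "disjoint_family_on B {..<n}"
    using inj by (auto simp: disjoint_family_on_def B_def inj_on_def)
  have cases_k: "k e = 0 \<and> (\<forall>i<n. indicator (B i) e = (0::real)) \<or>
      (\<exists>j<n. k e = h j \<and> (\<forall>i<n. indicator (B i) e = (if i = j then 1 else 0::real)))" if e: "e \<in> space \<mu>" for e
  proof (cases "k e = 0")
    case True
    then have "indicator (B i) e = (0::real)" if "i < n" for i using h0[OF that] by (auto simp: B_def)
    then show ?thesis using True by simp
  next
    case False
    then have "k e \<in> k ` space \<mu> - {0}" using e by simp
    then have "k e \<in> h ` {0..<n}" using h unfolding bij_betw_def by simp
    then obtain j where j: "j < n" "k e = h j" by auto
    have "indicator (B i) e = (if i = j then 1 else 0::real)" if "i < n" for i
      using j that inj e by (auto simp: B_def inj_on_def indicator_def)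
    then show ?thesis using j by blast
  qed
  have sum_real: "k e = (\<Sum>i<n. indicator (B i) e *\<^sub>R h i)" if e: "e \<in> space \<mu>" for e
    using sum_scaleR_delta[OF cases_k[OF e], of "\<lambda>x. x"] by simp
  have sum_cplx: "iexp (k e) - 1 = (\<Sum>i<n. indicator (B i) e *\<^sub>R (iexp (h i) - 1))" if e: "e \<in> space \<mu>" for e
    using sum_scaleR_delta[OF cases_k[OF e], of "\<lambda>x. iexp x - 1"] by simp
  \<comment> \<open>Off a null event the counts on all level sets are finite at once, which permits
    splitting the integral under \<open>J \<omega>\<close> into finitely many terms.\<close>
  have "AE \<omega> in M. \<forall>i\<in>{..<n}. emeasure (J \<omega>) (B i) = of_nat (count (B i) \<omega>)"
    by (rule AE_finite_allI) (use AE_emeasure_J B Bfin in auto)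
  then have "AE \<omega> in M. (\<integral>e. k e \<partial>J \<omega>) = (\<Sum>i<n. h i * measure (J \<omega>) (B i))"
    using AE_space
  proof eventually_elim
    case (elim \<omega>)
    have int: "integrable (J \<omega>) (indicat_real (B i))" if "i < n" for i
      using elim B that by (intro integrable_real_indicator) (auto simp: of_nat_less_top)
    have "(\<integral>e. k e \<partial>J \<omega>) = (\<integral>e. (\<Sum>i<n. indicator (B i) e *\<^sub>R h i) \<partial>J \<omega>)"
      using sum_real elim by (intro Bochner_Integration.integral_cong) auto
    also have "\<dots> = (\<Sum>i<n. \<integral>e. indicator (B i) e *\<^sub>R h i \<partial>J \<omega>)"
      by (rule Bochner_Integration.integral_sum) (use int in auto)
    also have "\<dots> = (\<Sum>i<n. h i * measure (J \<omega>) (B i))"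
      by (intro sum.cong refl) (use elim B in \<open>auto simp: mult.commute\<close>)
    finally show ?case .
  qed
  moreover have [measurable]: "k \<in> borel_measurable \<mu>" using k by (rule borel_measurable_simple_function)
  moreover have "(\<lambda>\<omega>. measure (J \<omega>) (B i)) \<in> borel_measurable M" for i
    unfolding measure_def using B by measurable
  ultimately have "(CLINT \<omega>|M. iexp (\<integral>e. k e \<partial>J \<omega>)) = (CLINT \<omega>|M. iexp (\<Sum>i<n. h i * measure (J \<omega>) (B i)))"
    by (intro Bochner_Integration.integral_cong_AE) auto
  also have "\<dots> = exp (\<Sum>i<n. measure \<mu> (B i) * (iexp (h i) - 1))"
    by (rule iexp_sum_J) (use B Bfin disj in auto)
  also have "(\<Sum>i<n. measure \<mu> (B i) * (iexp (h i) - 1)) = (\<Sum>i<n. CLINT e|\<mu>. indicator (B i) e *\<^sub>R (iexp (h i) - 1))"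
    using B Bfin by (intro sum.cong refl) (simp add: scaleR_conv_of_real)
  also have "\<dots> = (CLINT e|\<mu>. (\<Sum>i<n. indicator (B i) e *\<^sub>R (iexp (h i) - 1)))"
    by (rule Bochner_Integration.integral_sum[symmetric]) (use B Bfin in auto)
  also have "\<dots> = (CLINT e|\<mu>. iexp (k e) - 1)"
    using sum_cplx by (intro Bochner_Integration.integral_cong) auto
  finally show ?thesis .
qed

text \<open>By Campbell's formula the truncation of |k| at 1 has a finite integral along almost
  every path. The sets where |k| exceeds a level have finite intensity and decrease to the empty
  set, so almost surely their integer counts reach 0; then k is bounded
  \<open>J \<omega>\<close>-almost everywhere and hence integrable.\<close>

lemma AE_integrable_J:
  fixes k :: "'e \<Rightarrow> real"
  assumes k[measurable]: "k \<in> borel_measurable \<mu>" and fin: "(\<integral>\<^sup>+e. ennreal (min \<bar>k e\<bar> 1) \<partial>\<mu>) < \<top>"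
  shows "AE \<omega> in M. integrable (J \<omega>) k"
proof -
  define A where "A = (\<lambda>m::nat. {e \<in> space \<mu>. \<bar>k e\<bar> > real (Suc m)})"
  have A[measurable]: "A m \<in> sets \<mu>" for m unfolding A_def by measurable
  have A_le: "indicator (A m) e \<le> ennreal (min \<bar>k e\<bar> 1)" for m e
    by (auto simp: A_def indicator_def min_def not_le)
  have Afin: "emeasure \<mu> (A m) < \<top>" for m
  proof -
    have "emeasure \<mu> (A m) = (\<integral>\<^sup>+e. indicator (A m) e \<partial>\<mu>)" by simp
    also have "\<dots> \<le> (\<integral>\<^sup>+e. ennreal (min \<bar>k e\<bar> 1) \<partial>\<mu>)" by (intro nn_integral_mono A_le)
    finally show ?thesis using fin by simp
  qed
  have meas: "(\<lambda>\<omega>. \<integral>\<^sup>+e. ennreal (min \<bar>k e\<bar> 1) \<partial>J \<omega>) \<in> borel_measurable M"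
    and eq: "(\<integral>\<^sup>+\<omega>. (\<integral>\<^sup>+e. ennreal (min \<bar>k e\<bar> 1) \<partial>J \<omega>) \<partial>M) = (\<integral>\<^sup>+e. ennreal (min \<bar>k e\<bar> 1) \<partial>\<mu>)"
    using campbell[of "\<lambda>e. ennreal (min \<bar>k e\<bar> 1)"] by simp_all
  have "AE \<omega> in M. (\<integral>\<^sup>+e. ennreal (min \<bar>k e\<bar> 1) \<partial>J \<omega>) \<noteq> \<infinity>"
    by (rule nn_integral_PInf_AE[OF meas]) (use eq fin in auto)
  moreover have "AE \<omega> in M. \<forall>m. emeasure (J \<omega>) (A m) = of_nat (count (A m) \<omega>)"
    unfolding AE_all_countable using AE_emeasure_J[OF A Afin] by blast
  ultimately show ?thesis using AE_space
  proof eventually_elim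
    case (elim \<omega>)
    have A'[measurable]: "A m \<in> sets (J \<omega>)" for m using elim A by simp
    have k'[measurable]: "k \<in> borel_measurable (J \<omega>)" using elim k by simp
    have "(\<lambda>m. emeasure (J \<omega>) (A m)) \<longlonglongrightarrow> emeasure (J \<omega>) (\<Inter>m. A m)"
      by (rule Lim_emeasure_decseq) (use elim in \<open>auto simp: A_def decseq_def\<close>)
    also have "(\<Inter>m. A m) = {}"
    proof -
      have "e \<notin> (\<Inter>m. A m)" for e
      proof -
        obtain m where "\<bar>k e\<bar> \<le> real m" using real_arch_simple by blast
        then show ?thesis by (auto simp: A_def intro!: exI[of _ m])
      qed
      then show ?thesis by blast
    qed
    finally have "(\<lambda>m. emeasure (J \<omega>) (A m)) \<longlonglongrightarrow> 0" by simp
    then have "\<forall>\<^sub>F m in sequentially. emeasure (J \<omega>) (A m) < 1"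
      by (rule order_tendstoD) simp
    then obtain m where "emeasure (J \<omega>) (A m) < 1" using eventually_happens by force
    then have m: "emeasure (J \<omega>) (A m) = 0" using elim by simp
    then have "AE e in J \<omega>. e \<notin> A m" by (intro AE_not_in) (simp add: null_sets_def)
    then have "AE e in J \<omega>. ennreal (norm (k e)) \<le> ennreal (Suc m) * ennreal (min \<bar>k e\<bar> 1)"
      using AE_space
    proof eventually_elim
      case (elim e)
      have "\<bar>k e\<bar> \<le> Suc m * min \<bar>k e\<bar> 1"
      proof (cases "\<bar>k e\<bar> \<le> 1")
        case True
        then show ?thesis by (simp add: mult_le_cancel_right1 algebra_simps)
      next
        case False
        then show ?thesis using elim \<open>\<omega> \<in> space M\<close> by (simp add: A_def)
      qed
      then show ?case
        by (subst ennreal_mult[symmetric]) (auto intro!: ennreal_leI simp del: of_nat_Suc)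
    qed
    then have "(\<integral>\<^sup>+e. ennreal (norm (k e)) \<partial>J \<omega>) \<le> (\<integral>\<^sup>+e. ennreal (Suc m) * ennreal (min \<bar>k e\<bar> 1) \<partial>J \<omega>)"
      by (rule nn_integral_mono_AE)
    also have "\<dots> = ennreal (Suc m) * (\<integral>\<^sup>+e. ennreal (min \<bar>k e\<bar> 1) \<partial>J \<omega>)"
      by (rule nn_integral_cmult) simp
    also have "\<dots> < \<infinity>" using elim by (simp add: ennreal_mult_less_top less_top)
    finally show ?case by (intro integrableI_bounded k') simp
  qed
qed

text \<open>Simple approximations bounded by 2 |k| permit dominated convergence at three places:
  under \<open>J \<omega>\<close>, under M, and under \<mu> in the exponent.\<close>

lemma iexp_J_integral:
  fixes k :: "'e \<Rightarrow> real"
  assumes k[measurable]: "k \<in> borel_measurable \<mu>" and fin: "(\<integral>\<^sup>+e. ennreal (min \<bar>k e\<bar> 1) \<partial>\<mu>) < \<top>"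
  shows "(CLINT \<omega>|M. iexp (\<integral>e. k e \<partial>J \<omega>)) = exp (CLINT e|\<mu>. iexp (k e) - 1)"
proof -
  obtain F where F: "\<And>i. simple_function \<mu> (F i)" "\<And>x. x \<in> space \<mu> \<Longrightarrow> (\<lambda>i. F i x) \<longlonglongrightarrow> k x"
    "\<And>i x. x \<in> space \<mu> \<Longrightarrow> \<bar>F i x\<bar> \<le> 2 * \<bar>k x\<bar>"
  proof -
    from borel_measurable_implies_sequence_metric[OF k, of 0] obtain F where
      "\<forall>i. simple_function \<mu> (F i)" "\<forall>x\<in>space \<mu>. (\<lambda>i. F i x) \<longlonglongrightarrow> k x"
      "\<forall>i. \<forall>x\<in>space \<mu>. dist (F i x) 0 \<le> 2 * dist (k x) 0" by blast
    then show thesis by (intro that[of F]) (simp_all add: dist_real_def)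
  qed
  have Fm[measurable]: "F i \<in> borel_measurable \<mu>" for i by (rule borel_measurable_simple_function[OF F(1)])
  have min_int: "integrable \<mu> (\<lambda>e. min \<bar>k e\<bar> 1)"
    using fin by (intro integrableI_bounded) auto
  have Ffin: "emeasure \<mu> {e \<in> space \<mu>. F i e \<noteq> 0} < \<top>" for i
  proof -
    have "finite ((\<lambda>e. \<bar>F i e\<bar>) ` space \<mu> - {0})"
      using finite_imageI[OF simple_functionD(1)[OF F(1), of i], of abs] by (simp add: image_image)
    \<comment> \<open>The extra element 2 keeps V nonempty and forces \<open>d \<le> 2\<close>, so
      that \<open>d / 2\<close> lies below both |k| and 1 wherever the simple function is
      nonzero.\<close>
    define V where "V = insert 2 ((\<lambda>e. \<bar>F i e\<bar>) ` space \<mu> - {0})"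
    have V: "finite V" "V \<noteq> {}" "\<And>v. v \<in> V \<Longrightarrow> v > 0"
      using \<open>finite ((\<lambda>e. \<bar>F i e\<bar>) ` space \<mu> - {0})\<close> by (auto simp: V_def)
    define d where "d = Min V"
    have d: "d > 0" "d \<le> 2" unfolding d_def using Min_in[OF V(1,2)] V(1,3) by (auto simp: V_def)
    have "ennreal (d / 2) * indicator {e \<in> space \<mu>. F i e \<noteq> 0} e \<le> ennreal (min \<bar>k e\<bar> 1)" if e: "e \<in> space \<mu>" for e
    proof (cases "F i e = 0")
      case False
      then have "d \<le> \<bar>F i e\<bar>" unfolding d_def using V(1) e by (intro Min_le) (auto simp: V_def)
      then have "d / 2 \<le> min \<bar>k e\<bar> 1" using F(3)[OF e, of i] d by simp
      then show ?thesis using False e by (simp add: ennreal_leI)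
    qed simp
    then have "(\<integral>\<^sup>+e. ennreal (d / 2) * indicator {e \<in> space \<mu>. F i e \<noteq> 0} e \<partial>\<mu>) \<le> (\<integral>\<^sup>+e. ennreal (min \<bar>k e\<bar> 1) \<partial>\<mu>)"
      by (rule nn_integral_mono)
    also have "\<dots> < \<top>" by (rule fin)
    finally show ?thesis using d by (auto simp: nn_integral_cmult ennreal_mult_less_top)
  qed
  have "AE \<omega> in M. (\<lambda>i. iexp (\<integral>e. F i e \<partial>J \<omega>)) \<longlonglongrightarrow> iexp (\<integral>e. k e \<partial>J \<omega>)"
    using AE_integrable_J[OF k fin] AE_space
  proof eventually_elim
    case (elim \<omega>)
    have "(\<lambda>i. \<integral>e. F i e \<partial>J \<omega>) \<longlonglongrightarrow> (\<integral>e. k e \<partial>J \<omega>)"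
      by (rule integral_dominated_convergence[where w = "\<lambda>e. 2 * \<bar>k e\<bar>"])
        (use elim F Fm k in auto)
    then show ?case by (intro tendsto_intros)
  qed
  then have "(\<lambda>i. CLINT \<omega>|M. iexp (\<integral>e. F i e \<partial>J \<omega>)) \<longlonglongrightarrow> (CLINT \<omega>|M. iexp (\<integral>e. k e \<partial>J \<omega>))"
    by (intro integral_dominated_convergence[where w = "\<lambda>_. 1"]) auto
  moreover have "(\<lambda>i. CLINT e|\<mu>. iexp (F i e) - 1) \<longlonglongrightarrow> (CLINT e|\<mu>. iexp (k e) - 1)"
  proof (rule integral_dominated_convergence[where w = "\<lambda>e. 2 * min \<bar>k e\<bar> 1"])
    show "AE e in \<mu>. (\<lambda>i. iexp (F i e) - 1) \<longlonglongrightarrow> iexp (k e) - 1"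
      using F(2) by (intro AE_I2 tendsto_intros)
    fix i
    show "AE e in \<mu>. cmod (iexp (F i e) - 1) \<le> 2 * min \<bar>k e\<bar> 1"
    proof (rule AE_I2)
      fix e assume "e \<in> space \<mu>"
      then show "cmod (iexp (F i e) - 1) \<le> 2 * min \<bar>k e\<bar> 1"
        using iexp_approx1[of "F i e" 0] iexp_approx2[of "F i e" 0] F(3)[of e i] by (simp add: min_def)
    qed
  qed (use min_int in auto)
  then have "(\<lambda>i. exp (CLINT e|\<mu>. iexp (F i e) - 1)) \<longlonglongrightarrow> exp (CLINT e|\<mu>. iexp (k e) - 1)"
    by (intro tendsto_intros)
  then have "(\<lambda>i. CLINT \<omega>|M. iexp (\<integral>e. F i e \<partial>J \<omega>)) \<longlonglongrightarrow> exp (CLINT e|\<mu>. iexp (k e) - 1)"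
    by (simp add: iexp_simple_J[OF F(1) Ffin])
  ultimately show ?thesis using LIMSEQ_unique by blast
qed

end

text \<open>The shape in which Cauchy-Schwarz delivers convergence: a square bounded by a finite
  constant times a null sequence.\<close>

lemma ennreal_sq_tendsto_0:
  fixes f b :: "nat \<Rightarrow> ennreal"
  assumes le: "\<And>n. (f n)\<^sup>2 \<le> c * b n" and c: "c < \<top>" and b: "b \<longlonglongrightarrow> 0"
  shows "f \<longlonglongrightarrow> 0"
proof (rule ennreal_tendsto_0I)
  fix e :: real assume e: "e > 0"
  have "(\<lambda>n. c * b n) \<longlonglongrightarrow> 0" using ennreal_tendsto_cmult[OF c b] by simp
  then have "\<forall>\<^sub>F n in sequentially. c * b n < ennreal (e\<^sup>2)"
    using e by (intro order_tendstoD(2)) auto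
  then show "\<forall>\<^sub>F n in sequentially. f n \<le> ennreal e"
  proof eventually_elim
    case (elim n)
    show ?case
    proof (rule ccontr)
      assume "\<not> f n \<le> ennreal e"
      then have "(ennreal e)\<^sup>2 \<le> (f n)\<^sup>2" by (intro power_mono) auto
      then have "ennreal (e\<^sup>2) \<le> (f n)\<^sup>2" using e by (simp add: ennreal_power)
      then show False using elim le[of n] by (meson leD le_less_trans)
    qed
  qed
qed

lemma nn_integral_square_sum_le:
  fixes f g :: "'a \<Rightarrow> real"
  assumes [measurable]: "f \<in> borel_measurable M" "g \<in> borel_measurable M"
  shows "(\<integral>\<^sup>+x. ennreal ((f x + g x)\<^sup>2) \<partial>M) \<le> 2 * (\<integral>\<^sup>+x. ennreal ((f x)\<^sup>2) \<partial>M) + 2 * (\<integral>\<^sup>+x. ennreal ((g x)\<^sup>2) \<partial>M)"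
proof -
  have "(a + b)\<^sup>2 \<le> 2 * a\<^sup>2 + 2 * b\<^sup>2" for a b :: real
    using sum_squares_bound[of a b] by (simp add: power2_sum)
  then have "ennreal ((a + b)\<^sup>2) \<le> 2 * ennreal (a\<^sup>2) + 2 * ennreal (b\<^sup>2)" for a b :: real
    using ennreal_leI[of "(a + b)\<^sup>2" "2 * a\<^sup>2 + 2 * b\<^sup>2"] by (simp add: ennreal_mult)
  then have "(\<integral>\<^sup>+x. ennreal ((f x + g x)\<^sup>2) \<partial>M) \<le> (\<integral>\<^sup>+x. 2 * ennreal ((f x)\<^sup>2) + 2 * ennreal ((g x)\<^sup>2) \<partial>M)"
    by (intro nn_integral_mono)
  also have "\<dots> = 2 * (\<integral>\<^sup>+x. ennreal ((f x)\<^sup>2) \<partial>M) + 2 * (\<integral>\<^sup>+x. ennreal ((g x)\<^sup>2) \<partial>M)"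
    by (subst nn_integral_add) (auto simp: nn_integral_cmult)
  finally show ?thesis .
qed

lemma integrable_square_add:
  fixes f g :: "'a \<Rightarrow> real"
  assumes [measurable]: "f \<in> borel_measurable M" "g \<in> borel_measurable M"
    and "integrable M (\<lambda>x. (f x)\<^sup>2)" "integrable M (\<lambda>x. (g x)\<^sup>2)"
  shows "integrable M (\<lambda>x. (f x + g x)\<^sup>2)"
proof (rule integrableI_bounded)
  have "(\<integral>\<^sup>+x. ennreal ((f x)\<^sup>2) \<partial>M) < \<infinity>" "(\<integral>\<^sup>+x. ennreal ((g x)\<^sup>2) \<partial>M) < \<infinity>"
    using assms(3,4) by (simp_all add: integrable_iff_bounded)
  then show "(\<integral>\<^sup>+x. ennreal (norm ((f x + g x)\<^sup>2)) \<partial>M) < \<infinity>"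
    using nn_integral_square_sum_le[of f M g] by (simp add: le_less_trans ennreal_mult_less_top)
qed simp

lemma cmod_iexp_diff_le: "cmod (iexp x - iexp y) \<le> \<bar>x - y\<bar>"
proof -
  have "iexp x - iexp y = iexp y * (iexp (x - y) - 1)"
    by (simp add: exp_diff right_diff_distrib algebra_simps)
  then show ?thesis using iexp_approx1[of "x - y" 0] by (simp add: norm_mult)
qed

lemma cmod_iexp_minus_one: "cmod (iexp x - 1) \<le> \<bar>x\<bar>" "cmod (iexp x - 1) \<le> 2"
  using iexp_approx1[of x 0] iexp_approx2[of x 0] by simp_all

lemma cmod_iexp_second_order: "cmod (iexp x - 1 - \<i> * x) \<le> x\<^sup>2"
proof -
  have "2 * cmod (iexp x - 1 - \<i> * x) \<le> x\<^sup>2"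
    using iexp_approx1[of x 1] by (simp add: power2_eq_square algebra_simps abs_mult[symmetric])
  then show ?thesis using norm_ge_zero[of "iexp x - 1 - \<i> * x"] by linarith
qed

section \<open>Compensated Poisson integrals\<close>

context poisson_measure
begin

lemma AE_integrable_J_L1:
  fixes k :: "'e \<Rightarrow> real"
  assumes "integrable \<mu> k" shows "AE \<omega> in M. integrable (J \<omega>) k"
proof (rule AE_integrable_J)
  show k: "k \<in> borel_measurable \<mu>" using assms by auto
  have "(\<integral>\<^sup>+e. ennreal (min \<bar>k e\<bar> 1) \<partial>\<mu>) \<le> (\<integral>\<^sup>+e. ennreal (norm (k e)) \<partial>\<mu>)"
    by (intro nn_integral_mono ennreal_leI) simp
  also have "\<dots> < \<infinity>" using assms by (simp add: integrable_iff_bounded)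
  finally show "(\<integral>\<^sup>+e. ennreal (min \<bar>k e\<bar> 1) \<partial>\<mu>) < \<top>" by simp
qed

lemma AE_integrable_J_finite:
  fixes g :: "'e \<Rightarrow> real"
  assumes [measurable]: "g \<in> borel_measurable \<mu>" and fin: "emeasure \<mu> {e \<in> space \<mu>. g e \<noteq> 0} < \<top>"
  shows "AE \<omega> in M. integrable (J \<omega>) g"
proof (rule AE_integrable_J)
  have "(\<integral>\<^sup>+e. ennreal (min \<bar>g e\<bar> 1) \<partial>\<mu>) \<le> (\<integral>\<^sup>+e. indicator {e \<in> space \<mu>. g e \<noteq> 0} e \<partial>\<mu>)"
    by (intro nn_integral_mono) (auto simp: indicator_def)
  then show "(\<integral>\<^sup>+e. ennreal (min \<bar>g e\<bar> 1) \<partial>\<mu>) < \<top>" using fin by (simp add: le_less_trans)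
qed simp

lemma has_compensated_integral_zero: "has_compensated_integral M \<mu> J (\<lambda>_. 0) (\<lambda>_. 0)"
  unfolding has_compensated_integral_def by (intro conjI exI[of _ "\<lambda>_ _. 0"]) auto

lemma has_compensated_integral_cmult:
  assumes "has_compensated_integral M \<mu> J h Z"
  shows "has_compensated_integral M \<mu> J (\<lambda>e. c * h e) (\<lambda>\<omega>. c * Z \<omega>)"
proof -
  obtain hs where h[measurable]: "h \<in> borel_measurable \<mu>" "integrable \<mu> (\<lambda>e. (h e)\<^sup>2)" "Z \<in> borel_measurable M"
    and hs: "\<And>n. integrable \<mu> (hs n)" "\<And>n. integrable \<mu> (\<lambda>e. (hs n e)\<^sup>2)"
    "(\<lambda>n. \<integral>\<^sup>+e. ennreal ((hs n e - h e)\<^sup>2) \<partial>\<mu>) \<longlonglongrightarrow> 0"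
    "(\<lambda>n. \<integral>\<^sup>+\<omega>. ennreal ((((\<integral>e. hs n e \<partial>J \<omega>) - (\<integral>e. hs n e \<partial>\<mu>)) - Z \<omega>)\<^sup>2) \<partial>M) \<longlonglongrightarrow> 0"
    using assms unfolding has_compensated_integral_def by blast
  have [measurable]: "hs n \<in> borel_measurable \<mu>" for n using hs(1) by auto
  show ?thesis unfolding has_compensated_integral_def
  proof (intro conjI exI[of _ "\<lambda>n e. c * hs n e"] allI)
    have "(\<integral>\<^sup>+e. ennreal ((c * hs n e - c * h e)\<^sup>2) \<partial>\<mu>) = ennreal (c\<^sup>2) * (\<integral>\<^sup>+e. ennreal ((hs n e - h e)\<^sup>2) \<partial>\<mu>)" for n
      by (subst nn_integral_cmult[symmetric])
        (auto simp: ennreal_mult[symmetric] power_mult_distrib[symmetric] right_diff_distrib)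
    then show "(\<lambda>n. \<integral>\<^sup>+e. ennreal ((c * hs n e - c * h e)\<^sup>2) \<partial>\<mu>) \<longlonglongrightarrow> 0"
      using ennreal_tendsto_cmult[OF _ hs(3), of "ennreal (c\<^sup>2)"] by simp
    have "(\<integral>\<^sup>+\<omega>. ennreal ((((\<integral>e. c * hs n e \<partial>J \<omega>) - (\<integral>e. c * hs n e \<partial>\<mu>)) - c * Z \<omega>)\<^sup>2) \<partial>M) =
       ennreal (c\<^sup>2) * (\<integral>\<^sup>+\<omega>. ennreal ((((\<integral>e. hs n e \<partial>J \<omega>) - (\<integral>e. hs n e \<partial>\<mu>)) - Z \<omega>)\<^sup>2) \<partial>M)" for n
      by (subst nn_integral_cmult[symmetric])
        (auto simp: ennreal_mult[symmetric] power_mult_distrib[symmetric] right_diff_distrib)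
    then show "(\<lambda>n. \<integral>\<^sup>+\<omega>. ennreal ((((\<integral>e. c * hs n e \<partial>J \<omega>) - (\<integral>e. c * hs n e \<partial>\<mu>)) - c * Z \<omega>)\<^sup>2) \<partial>M) \<longlonglongrightarrow> 0"
      using ennreal_tendsto_cmult[OF _ hs(4), of "ennreal (c\<^sup>2)"] by simp
  qed (use h hs in \<open>auto simp: power_mult_distrib\<close>)
qed

text \<open>The pathwise integral is additive where both approximants are integrable, which holds
  almost surely; hence the detour through an almost everywhere equality in the second limit.\<close>

lemma has_compensated_integral_add:
  assumes "has_compensated_integral M \<mu> J h Z" "has_compensated_integral M \<mu> J h' Z'"
  shows "has_compensated_integral M \<mu> J (\<lambda>e. h e + h' e) (\<lambda>\<omega>. Z \<omega> + Z' \<omega>)"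
proof -
  obtain hs where h[measurable]: "h \<in> borel_measurable \<mu>" "integrable \<mu> (\<lambda>e. (h e)\<^sup>2)" "Z \<in> borel_measurable M"
    and hs: "\<And>n. integrable \<mu> (hs n)" "\<And>n. integrable \<mu> (\<lambda>e. (hs n e)\<^sup>2)"
    "(\<lambda>n. \<integral>\<^sup>+e. ennreal ((hs n e - h e)\<^sup>2) \<partial>\<mu>) \<longlonglongrightarrow> 0"
    "(\<lambda>n. \<integral>\<^sup>+\<omega>. ennreal ((((\<integral>e. hs n e \<partial>J \<omega>) - (\<integral>e. hs n e \<partial>\<mu>)) - Z \<omega>)\<^sup>2) \<partial>M) \<longlonglongrightarrow> 0"
    using assms(1) unfolding has_compensated_integral_def by blast
  obtain hs' where h'[measurable]: "h' \<in> borel_measurable \<mu>" "integrable \<mu> (\<lambda>e. (h' e)\<^sup>2)" "Z' \<in> borel_measurable M"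
    and hs': "\<And>n. integrable \<mu> (hs' n)" "\<And>n. integrable \<mu> (\<lambda>e. (hs' n e)\<^sup>2)"
    "(\<lambda>n. \<integral>\<^sup>+e. ennreal ((hs' n e - h' e)\<^sup>2) \<partial>\<mu>) \<longlonglongrightarrow> 0"
    "(\<lambda>n. \<integral>\<^sup>+\<omega>. ennreal ((((\<integral>e. hs' n e \<partial>J \<omega>) - (\<integral>e. hs' n e \<partial>\<mu>)) - Z' \<omega>)\<^sup>2) \<partial>M) \<longlonglongrightarrow> 0"
    using assms(2) unfolding has_compensated_integral_def by blast
  have [measurable]: "hs n \<in> borel_measurable \<mu>" "hs' n \<in> borel_measurable \<mu>" for n using hs(1) hs'(1) by auto
  have lim: "(\<lambda>n. 2 * a n + 2 * b n) \<longlonglongrightarrow> 0" if "a \<longlonglongrightarrow> 0" "b \<longlonglongrightarrow> 0" for a b :: "nat \<Rightarrow> ennreal"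
    using tendsto_add[OF ennreal_tendsto_cmult[OF _ that(1), of 2] ennreal_tendsto_cmult[OF _ that(2), of 2]] by simp
  show ?thesis unfolding has_compensated_integral_def
  proof (intro conjI exI[of _ "\<lambda>n e. hs n e + hs' n e"] allI)
    show "(\<lambda>n. \<integral>\<^sup>+e. ennreal ((hs n e + hs' n e - (h e + h' e))\<^sup>2) \<partial>\<mu>) \<longlonglongrightarrow> 0"
    proof (rule tendsto_sandwich[OF _ _ tendsto_const lim[OF hs(3) hs'(3)]])
      show "\<forall>\<^sub>F n in sequentially. (\<integral>\<^sup>+e. ennreal ((hs n e + hs' n e - (h e + h' e))\<^sup>2) \<partial>\<mu>) \<le>
        2 * (\<integral>\<^sup>+e. ennreal ((hs n e - h e)\<^sup>2) \<partial>\<mu>) + 2 * (\<integral>\<^sup>+e. ennreal ((hs' n e - h' e)\<^sup>2) \<partial>\<mu>)"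
        using nn_integral_square_sum_le[of "\<lambda>e. hs n e - h e" \<mu> "\<lambda>e. hs' n e - h' e" for n]
        by (auto simp: algebra_simps intro!: always_eventually)
    qed simp
    let ?V = "\<lambda>n \<omega>. (\<integral>e. hs n e \<partial>J \<omega>) - (\<integral>e. hs n e \<partial>\<mu>) - Z \<omega>"
    let ?V' = "\<lambda>n \<omega>. (\<integral>e. hs' n e \<partial>J \<omega>) - (\<integral>e. hs' n e \<partial>\<mu>) - Z' \<omega>"
    have eq: "(\<integral>\<^sup>+\<omega>. ennreal (((\<integral>e. hs n e + hs' n e \<partial>J \<omega>) - (\<integral>e. hs n e + hs' n e \<partial>\<mu>) - (Z \<omega> + Z' \<omega>))\<^sup>2) \<partial>M) =
       (\<integral>\<^sup>+\<omega>. ennreal ((?V n \<omega> + ?V' n \<omega>)\<^sup>2) \<partial>M)" for n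
    proof (rule nn_integral_cong_AE)
      show "AE \<omega> in M. ennreal (((\<integral>e. hs n e + hs' n e \<partial>J \<omega>) - (\<integral>e. hs n e + hs' n e \<partial>\<mu>) - (Z \<omega> + Z' \<omega>))\<^sup>2)
         = ennreal ((?V n \<omega> + ?V' n \<omega>)\<^sup>2)"
        using AE_integrable_J_L1[OF hs(1)[of n]] AE_integrable_J_L1[OF hs'(1)[of n]]
        by eventually_elim (simp add: hs hs' algebra_simps)
    qed
    show "(\<lambda>n. \<integral>\<^sup>+\<omega>. ennreal (((\<integral>e. hs n e + hs' n e \<partial>J \<omega>) - (\<integral>e. hs n e + hs' n e \<partial>\<mu>) - (Z \<omega> + Z' \<omega>))\<^sup>2) \<partial>M) \<longlonglongrightarrow> 0"
      unfolding eq
    proof (rule tendsto_sandwich[OF _ _ tendsto_const lim[OF hs(4) hs'(4)]])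
      show "\<forall>\<^sub>F n in sequentially. (\<integral>\<^sup>+\<omega>. ennreal ((?V n \<omega> + ?V' n \<omega>)\<^sup>2) \<partial>M)
        \<le> 2 * (\<integral>\<^sup>+\<omega>. ennreal ((?V n \<omega>)\<^sup>2) \<partial>M) + 2 * (\<integral>\<^sup>+\<omega>. ennreal ((?V' n \<omega>)\<^sup>2) \<partial>M)"
        by (intro always_eventually allI nn_integral_square_sum_le) measurable
    qed simp
  qed (use h h' hs hs' in \<open>auto intro!: integrable_square_add\<close>)
qed

text \<open>Expansion around the part h: its second-order remainder is bounded by
  \<open>h\<^sup>2\<close>, and every other term carries \<open>iexp g - 1\<close>, which is at most
  2 and supported on a set of finite intensity. The product with h is split by
  \<open>2 * \<bar>h\<bar> \<le> h\<^sup>2 + 1\<close>, whence the constants 2 and 3.\<close>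

lemma compensated_integrable:
  assumes h: "h \<in> borel_measurable \<mu>" "integrable \<mu> (\<lambda>e. (h e)\<^sup>2)"
    and g: "g \<in> borel_measurable \<mu>" "emeasure \<mu> {e \<in> space \<mu>. g e \<noteq> 0} < \<top>"
  shows "complex_integrable \<mu> (\<lambda>e. iexp (h e + g e) - 1 - \<i> * h e)"
proof (rule Bochner_Integration.integrable_bound)
  let ?A = "{e \<in> space \<mu>. g e \<noteq> 0}"
  have [measurable]: "h \<in> borel_measurable \<mu>" "g \<in> borel_measurable \<mu>" by fact+
  show "integrable \<mu> (\<lambda>e. 2 * (h e)\<^sup>2 + 3 * indicator ?A e)"
    using h g by (intro Bochner_Integration.integrable_add integrable_mult_right) auto
  show "AE e in \<mu>. cmod (iexp (h e + g e) - 1 - \<i> * h e) \<le> norm (2 * (h e)\<^sup>2 + 3 * indicator ?A e :: real)"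
  proof (rule AE_I2)
    fix e assume e: "e \<in> space \<mu>"
    have "iexp (h e + g e) - 1 - \<i> * h e = iexp (g e) * (iexp (h e) - 1 - \<i> * h e) + (\<i> * h e * (iexp (g e) - 1) + (iexp (g e) - 1))"
      by (simp add: exp_add algebra_simps)
    also have "cmod \<dots> \<le> cmod (iexp (g e) * (iexp (h e) - 1 - \<i> * h e)) + (cmod (\<i> * h e * (iexp (g e) - 1)) + cmod (iexp (g e) - 1))"
      by (intro order_trans[OF norm_triangle_ineq] add_left_mono norm_triangle_ineq)
    also have "\<dots> = cmod (iexp (h e) - 1 - \<i> * h e) + (\<bar>h e\<bar> * cmod (iexp (g e) - 1) + cmod (iexp (g e) - 1))"
      by (simp add: norm_mult)
    also have "\<dots> \<le> (h e)\<^sup>2 + (\<bar>h e\<bar> * (2 * indicator ?A e) + 2 * indicator ?A e)"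
    proof -
      have "cmod (iexp (g e) - 1) \<le> 2 * indicator ?A e"
        using cmod_iexp_minus_one(2)[of "g e"] e by (auto simp: indicator_def)
      then show ?thesis
        by (intro add_mono mult_left_mono cmod_iexp_second_order) auto
    qed
    also have "\<bar>h e\<bar> * (2 * indicator ?A e) \<le> (h e)\<^sup>2 + indicator ?A e"
      using sum_squares_bound[of "\<bar>h e\<bar>" 1] by (auto simp: indicator_def)
    finally show "cmod (iexp (h e + g e) - 1 - \<i> * h e) \<le> norm (2 * (h e)\<^sup>2 + 3 * indicator ?A e :: real)"
      by (simp add: algebra_simps)
  qed
qed (use h g in measurable)

text \<open>The Levy-Khintchine formula for a compensated integral and an integral of finite
  activity taken jointly: both come from one use of the exponential formula for
  \<open>hs n + g\<close>, followed by an L2 limit on the two sides.\<close>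

lemma iexp_compensated:
  assumes CI: "has_compensated_integral M \<mu> J h Z"
    and g[measurable]: "g \<in> borel_measurable \<mu>" and gfin: "emeasure \<mu> {e \<in> space \<mu>. g e \<noteq> 0} < \<top>"
  shows "(CLINT \<omega>|M. iexp (Z \<omega> + (\<integral>e. g e \<partial>J \<omega>))) = exp (CLINT e|\<mu>. iexp (h e + g e) - 1 - \<i> * h e)"
proof -
  obtain hs where h[measurable]: "h \<in> borel_measurable \<mu>" and h2: "integrable \<mu> (\<lambda>e. (h e)\<^sup>2)" and Z[measurable]: "Z \<in> borel_measurable M"
    and hs: "\<And>n. integrable \<mu> (hs n)" "\<And>n. integrable \<mu> (\<lambda>e. (hs n e)\<^sup>2)"
    "(\<lambda>n. \<integral>\<^sup>+e. ennreal ((hs n e - h e)\<^sup>2) \<partial>\<mu>) \<longlonglongrightarrow> 0"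
    "(\<lambda>n. \<integral>\<^sup>+\<omega>. ennreal ((((\<integral>e. hs n e \<partial>J \<omega>) - (\<integral>e. hs n e \<partial>\<mu>)) - Z \<omega>)\<^sup>2) \<partial>M) \<longlonglongrightarrow> 0"
    using CI unfolding has_compensated_integral_def by blast
  have [measurable]: "hs n \<in> borel_measurable \<mu>" for n using hs(1) by auto
  define G where "G = (\<lambda>\<omega>. \<integral>e. g e \<partial>J \<omega>)"
  have [measurable]: "G \<in> borel_measurable M" unfolding G_def by measurable
  define V where "V = (\<lambda>n \<omega>. (\<integral>e. hs n e \<partial>J \<omega>) - (\<integral>e. hs n e \<partial>\<mu>))"
  have [measurable]: "V n \<in> borel_measurable M" for n unfolding V_def by measurable
  have V: "(\<lambda>n. \<integral>\<^sup>+\<omega>. ennreal ((V n \<omega> - Z \<omega>)\<^sup>2) \<partial>M) \<longlonglongrightarrow> 0" using hs(4) by (simp add: V_def)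
  define \<Psi> where "\<Psi> = (\<lambda>u e. iexp (u e + g e) - 1 - \<i> * (u e :: real))"
  have int: "complex_integrable \<mu> (\<Psi> h)" "complex_integrable \<mu> (\<Psi> (hs n))" for n
    unfolding \<Psi>_def using compensated_integrable[OF h h2 g gfin] compensated_integrable[OF _ hs(2) g gfin] by auto
  have cf: "(CLINT \<omega>|M. iexp (V n \<omega> + G \<omega>)) = exp (CLINT e|\<mu>. \<Psi> (hs n) e)" for n
  proof -
    let ?k = "\<lambda>e. hs n e + g e"
    have "(\<integral>\<^sup>+e. ennreal (min \<bar>?k e\<bar> 1) \<partial>\<mu>) \<le> (\<integral>\<^sup>+e. ennreal (norm (hs n e)) + indicator {e \<in> space \<mu>. g e \<noteq> 0} e \<partial>\<mu>)"
    proof (rule nn_integral_mono)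
      fix e assume "e \<in> space \<mu>"
      then show "ennreal (min \<bar>?k e\<bar> 1) \<le> ennreal (norm (hs n e)) + indicator {e \<in> space \<mu>. g e \<noteq> 0} e"
      proof (cases "g e = 0")
        case False
        have "ennreal (min \<bar>?k e\<bar> 1) \<le> ennreal (norm (hs n e) + 1)" by (intro ennreal_leI) auto
        then show ?thesis using False \<open>e \<in> space \<mu>\<close> by (simp add: ennreal_plus)
      qed (auto intro!: ennreal_leI)
    qed
    also have "\<dots> = (\<integral>\<^sup>+e. ennreal (norm (hs n e)) \<partial>\<mu>) + emeasure \<mu> {e \<in> space \<mu>. g e \<noteq> 0}"
      by (subst nn_integral_add) auto
    also have "\<dots> < \<top>" using hs(1)[of n] gfin by (simp add: integrable_iff_bounded)
    finally have kfin: "(\<integral>\<^sup>+e. ennreal (min \<bar>?k e\<bar> 1) \<partial>\<mu>) < \<top>" .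
    have kint: "complex_integrable \<mu> (\<lambda>e. iexp (?k e) - 1)"
    proof -
      have "complex_integrable \<mu> (\<lambda>e. \<Psi> (hs n) e + \<i> * complex_of_real (hs n e))"
        by (intro Bochner_Integration.integrable_add int integrable_mult_right integrable_of_real hs)
      then show ?thesis by (simp add: \<Psi>_def)
    qed
    have "(CLINT \<omega>|M. iexp (V n \<omega> + G \<omega>)) = (CLINT \<omega>|M. iexp (- (\<integral>e. hs n e \<partial>\<mu>)) * iexp (\<integral>e. ?k e \<partial>J \<omega>))"
    proof (rule Bochner_Integration.integral_cong_AE)
      show "AE \<omega> in M. iexp (V n \<omega> + G \<omega>) = iexp (- (\<integral>e. hs n e \<partial>\<mu>)) * iexp (\<integral>e. ?k e \<partial>J \<omega>)"
        using AE_integrable_J_L1[OF hs(1)[of n]] AE_integrable_J_finite[OF g gfin]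
        by eventually_elim (simp add: V_def G_def exp_add[symmetric] algebra_simps)
    qed measurable
    also have "\<dots> = iexp (- (\<integral>e. hs n e \<partial>\<mu>)) * exp (CLINT e|\<mu>. iexp (?k e) - 1)"
      using iexp_J_integral[of ?k] kfin by simp
    \<comment> \<open>The deterministic compensator of the integrable function \<open>hs n\<close>
      moves into the exponent and removes the linear term there.\<close>
    also have "\<dots> = exp ((CLINT e|\<mu>. iexp (?k e) - 1) - (CLINT e|\<mu>. \<i> * complex_of_real (hs n e)))"
      by (simp add: exp_diff exp_minus divide_inverse mult.commute)
    also have "(CLINT e|\<mu>. iexp (?k e) - 1) - (CLINT e|\<mu>. \<i> * complex_of_real (hs n e)) = (CLINT e|\<mu>. \<Psi> (hs n) e)"
      unfolding \<Psi>_def by (rule Bochner_Integration.integral_diff[symmetric, OF kint])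
        (intro integrable_mult_right integrable_of_real hs)
    finally show ?thesis .
  qed
  have "(\<lambda>n. CLINT \<omega>|M. iexp (V n \<omega> + G \<omega>)) \<longlonglongrightarrow> (CLINT \<omega>|M. iexp (Z \<omega> + G \<omega>))"
  proof (rule tendsto_L1_int)
    \<comment> \<open>On a probability space the L2 convergence of the compensated integrals gives
      L1 convergence, and \<open>iexp\<close> is Lipschitz with constant 1.\<close>
    have L1: "(\<lambda>n. \<integral>\<^sup>+\<omega>. ennreal \<bar>V n \<omega> - Z \<omega>\<bar> \<partial>M) \<longlonglongrightarrow> 0"
    proof (rule ennreal_sq_tendsto_0[OF _ _ V])
      show "(\<integral>\<^sup>+\<omega>. ennreal \<bar>V n \<omega> - Z \<omega>\<bar> \<partial>M)\<^sup>2 \<le> 1 * (\<integral>\<^sup>+\<omega>. ennreal ((V n \<omega> - Z \<omega>)\<^sup>2) \<partial>M)" for n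
        using Cauchy_Schwarz_nn_integral[of "\<lambda>\<omega>. ennreal \<bar>V n \<omega> - Z \<omega>\<bar>" M "\<lambda>_. 1"]
        by (simp add: emeasure_space_1 ennreal_power)
    qed simp
    show "(\<lambda>n. \<integral>\<^sup>+\<omega>. ennreal (cmod (iexp (V n \<omega> + G \<omega>) - iexp (Z \<omega> + G \<omega>))) \<partial>M) \<longlonglongrightarrow> 0"
    proof (rule tendsto_sandwich[OF _ _ tendsto_const L1])
      show "\<forall>\<^sub>F n in sequentially. (\<integral>\<^sup>+\<omega>. ennreal (cmod (iexp (V n \<omega> + G \<omega>) - iexp (Z \<omega> + G \<omega>))) \<partial>M) \<le> (\<integral>\<^sup>+\<omega>. ennreal \<bar>V n \<omega> - Z \<omega>\<bar> \<partial>M)"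
        using cmod_iexp_diff_le[of "V n \<omega> + G \<omega>" "Z \<omega> + G \<omega>" for n \<omega>]
        by (intro always_eventually allI nn_integral_mono ennreal_leI) simp
    qed simp
  qed (auto intro!: integrable_const_bound[where B = 1])
  moreover have "(\<lambda>n. CLINT e|\<mu>. \<Psi> (hs n) e) \<longlonglongrightarrow> (CLINT e|\<mu>. \<Psi> h e)"
  proof (rule tendsto_L1_int)
    \<comment> \<open>A square integrable majorant of \<open>iexp (h + g) - 1\<close>, so that
      Cauchy-Schwarz controls the term linear in \<open>hs n - h\<close>.\<close>
    define w where "w = (\<lambda>e. \<bar>h e\<bar> + cmod (iexp (g e) - 1))"
    have [measurable]: "w \<in> borel_measurable \<mu>" unfolding w_def by measurable
    have w0: "w e \<ge> 0" for e by (simp add: w_def)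
    have "integrable \<mu> (\<lambda>e. (w e)\<^sup>2)" unfolding w_def
    proof (rule integrable_square_add)
      show "integrable \<mu> (\<lambda>e. (cmod (iexp (g e) - 1))\<^sup>2)"
      proof (rule Bochner_Integration.integrable_bound[where f = "\<lambda>e. 4 * indicator {e \<in> space \<mu>. g e \<noteq> 0} e :: real"])
        show "AE e in \<mu>. norm ((cmod (iexp (g e) - 1))\<^sup>2) \<le> norm (4 * indicator {e \<in> space \<mu>. g e \<noteq> 0} e :: real)"
        proof (rule AE_I2)
          fix e assume "e \<in> space \<mu>"
          then show "norm ((cmod (iexp (g e) - 1))\<^sup>2) \<le> norm (4 * indicator {e \<in> space \<mu>. g e \<noteq> 0} e :: real)"
            using power_mono[OF cmod_iexp_minus_one(2)[of "g e"], of 2] by (auto simp: indicator_def)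
        qed
      qed (use gfin in auto)
    qed (use h2 in auto)
    then have wfin: "(\<integral>\<^sup>+e. ennreal ((w e)\<^sup>2) \<partial>\<mu>) < \<top>" by (simp add: integrable_iff_bounded)
    have cs: "(\<lambda>n. \<integral>\<^sup>+e. ennreal \<bar>hs n e - h e\<bar> * ennreal (w e) \<partial>\<mu>) \<longlonglongrightarrow> 0"
    proof (rule ennreal_sq_tendsto_0[OF _ wfin hs(3)])
      show "(\<integral>\<^sup>+e. ennreal \<bar>hs n e - h e\<bar> * ennreal (w e) \<partial>\<mu>)\<^sup>2 \<le> (\<integral>\<^sup>+e. ennreal ((w e)\<^sup>2) \<partial>\<mu>) * (\<integral>\<^sup>+e. ennreal ((hs n e - h e)\<^sup>2) \<partial>\<mu>)" for n
        using Cauchy_Schwarz_nn_integral[of "\<lambda>e. ennreal \<bar>hs n e - h e\<bar>" \<mu> "\<lambda>e. ennreal (w e)"]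
        by (simp add: ennreal_power mult.commute w0)
    qed
    have lim: "(\<lambda>n. (\<integral>\<^sup>+e. ennreal ((hs n e - h e)\<^sup>2) \<partial>\<mu>) + (\<integral>\<^sup>+e. ennreal \<bar>hs n e - h e\<bar> * ennreal (w e) \<partial>\<mu>)) \<longlonglongrightarrow> 0"
      using tendsto_add[OF hs(3) cs] by simp
    show "(\<lambda>n. \<integral>\<^sup>+e. ennreal (cmod (\<Psi> (hs n) e - \<Psi> h e)) \<partial>\<mu>) \<longlonglongrightarrow> 0"
    proof (rule tendsto_sandwich[OF _ _ tendsto_const lim])
      have pw: "cmod (\<Psi> (hs n) e - \<Psi> h e) \<le> (hs n e - h e)\<^sup>2 + \<bar>hs n e - h e\<bar> * w e" for n e
      proof -
        define d where "d = hs n e - h e"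
        have hs_eq: "hs n e = h e + d" by (simp add: d_def)
        \<comment> \<open>Taylor expansion in the increment d: a second-order remainder and a linear
          term whose coefficient is the increment of \<open>iexp\<close> at
          \<open>h + g\<close>.\<close>
        have "\<Psi> (hs n) e - \<Psi> h e = iexp (h e + g e) * (iexp d - 1 - \<i> * d) + \<i> * d * (iexp (h e + g e) - 1)"
          unfolding \<Psi>_def hs_eq by (simp add: exp_add algebra_simps)
        also have "cmod \<dots> \<le> cmod (iexp d - 1 - \<i> * d) + \<bar>d\<bar> * cmod (iexp (h e + g e) - 1)"
          by (rule order_trans[OF norm_triangle_ineq]) (simp add: norm_mult)
        also have "cmod (iexp d - 1 - \<i> * d) \<le> d\<^sup>2" by (rule cmod_iexp_second_order)
        also have "cmod (iexp (h e + g e) - 1) \<le> w e"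
        proof -
          have "iexp (h e + g e) - 1 = (iexp (h e + g e) - iexp (g e)) + (iexp (g e) - 1)" by simp
          also have "cmod \<dots> \<le> \<bar>h e\<bar> + cmod (iexp (g e) - 1)"
            by (rule order_trans[OF norm_triangle_ineq])
              (use cmod_iexp_diff_le[of "h e + g e" "g e"] in simp)
          finally show ?thesis by (simp add: w_def)
        qed
        finally show ?thesis by (simp add: d_def mult_left_mono)
      qed
      show "\<forall>\<^sub>F n in sequentially. (\<integral>\<^sup>+e. ennreal (cmod (\<Psi> (hs n) e - \<Psi> h e)) \<partial>\<mu>) \<le>
        (\<integral>\<^sup>+e. ennreal ((hs n e - h e)\<^sup>2) \<partial>\<mu>) + (\<integral>\<^sup>+e. ennreal \<bar>hs n e - h e\<bar> * ennreal (w e) \<partial>\<mu>)"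
      proof (intro always_eventually allI)
        fix n
        have "(\<integral>\<^sup>+e. ennreal (cmod (\<Psi> (hs n) e - \<Psi> h e)) \<partial>\<mu>) \<le> (\<integral>\<^sup>+e. ennreal ((hs n e - h e)\<^sup>2) + ennreal \<bar>hs n e - h e\<bar> * ennreal (w e) \<partial>\<mu>)"
          using ennreal_leI[OF pw] by (intro nn_integral_mono) (simp add: w_def ennreal_mult)
        then show "(\<integral>\<^sup>+e. ennreal (cmod (\<Psi> (hs n) e - \<Psi> h e)) \<partial>\<mu>) \<le>
        (\<integral>\<^sup>+e. ennreal ((hs n e - h e)\<^sup>2) \<partial>\<mu>) + (\<integral>\<^sup>+e. ennreal \<bar>hs n e - h e\<bar> * ennreal (w e) \<partial>\<mu>)"
          by (subst (asm) nn_integral_add) auto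
      qed
    qed simp
  qed (use int in auto)
  then have "(\<lambda>n. exp (CLINT e|\<mu>. \<Psi> (hs n) e)) \<longlonglongrightarrow> exp (CLINT e|\<mu>. \<Psi> h e)" by (intro tendsto_intros)
  ultimately show ?thesis unfolding cf using LIMSEQ_unique by (simp add: \<Psi>_def G_def) blast
qed

end

section \<open>Characteristic functions of noise integrals\<close>

lemma one_minus_cos_eq: "1 - cos (x :: real) = 2 * (sin (x / 2))\<^sup>2"
  using cos_double_sin[of "x / 2"] by simp

lemma one_minus_cos_le: "1 - cos (x :: real) \<le> 2 * min (x\<^sup>2) 1"
proof -
  have "(sin (x / 2))\<^sup>2 \<le> (x / 2)\<^sup>2"
    using abs_sin_x_le_abs_x[of "x / 2"] by (metis abs_le_square_iff)
  also have "(x / 2)\<^sup>2 \<le> x\<^sup>2" by (simp add: power_divide)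
  finally have "(sin (x / 2))\<^sup>2 \<le> x\<^sup>2" .
  moreover have "(sin (x / 2))\<^sup>2 \<le> 1" by (simp add: abs_square_le_1)
  ultimately show ?thesis unfolding one_minus_cos_eq by simp
qed

text \<open>For y \<ge> 2 the quotient is at most 1/2. Below 2 the Taylor bound leaves
  \<open>y\<^sup>2 / 6 - y ^ 4 / 120\<close>, which is at least \<open>2 * y\<^sup>2 / 15\<close>
  because \<open>y\<^sup>2 \<le> 4\<close>. The constant 1/10 covers both cases.\<close>

lemma one_minus_sinc_ge:
  fixes y :: real assumes "y > 0"
  shows "min (y\<^sup>2) 1 / 10 \<le> 1 - sin y / y"
proof (cases "y \<ge> 2")
  case True
  have "2 * sin y \<le> y" using True sin_le_one[of y] by linarith
  then have q: "sin y / y \<le> 1 / 2" using True by (simp add: field_simps)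
  have "m / 10 \<le> 1 - q" if "q \<le> 1 / 2" "m \<le> 1" for m q :: real using that by linarith
  from this[OF q min.cobounded2] show ?thesis .
next
  case False
  have "{..<5} = {0, 1, 2, 3, 4 :: nat}" by auto
  moreover have "sin_coeff 0 = 0" "sin_coeff 1 = 1" "sin_coeff 2 = 0" "sin_coeff 3 = - (1 / 6)" "sin_coeff 4 = 0"
    by (simp_all add: sin_coeff_def fact_numeral)
  ultimately have "(\<Sum>m<5. sin_coeff m * y ^ m) = y - y ^ 3 / 6" by simp
  moreover have "inverse (fact 5) * \<bar>y\<bar> ^ 5 = y ^ 5 / (120 :: real)"
    using assms by (simp add: eval_nat_numeral)
  ultimately have "sin y \<le> y - y ^ 3 / 6 + y ^ 5 / 120"
    using Maclaurin_sin_bound[of y 5] by linarith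
  then have "sin y / y \<le> (y - y ^ 3 / 6 + y ^ 5 / 120) / y" using assms by (intro divide_right_mono) auto
  also have "\<dots> = 1 - y\<^sup>2 / 6 + y\<^sup>2 * y\<^sup>2 / 120"
    using assms by (simp add: field_simps eval_nat_numeral)
  finally have s: "sin y / y \<le> 1 - y\<^sup>2 / 6 + y\<^sup>2 * y\<^sup>2 / 120" .
  have "y\<^sup>2 \<le> 2\<^sup>2" using False assms by (intro power_mono) auto
  then have y4: "y\<^sup>2 * y\<^sup>2 \<le> y\<^sup>2 * 4" by (intro mult_left_mono) auto
  have "m / 10 \<le> 1 - q" if "q \<le> 1 - a / 6 + b / 120" "b \<le> a * 4" "m \<le> a" "0 \<le> a" for a b m q :: real
    using that by linarith
  from this[OF s y4 min.cobounded1] show ?thesis by simp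
qed

text \<open>The average of 1 - cos (u y) over u in [0, 1] is 1 - sin y / y. Averaging over
  frequencies recovers the truncated square, whereas a single frequency would miss the multiples of
  the period.\<close>

lemma averaged_one_minus_cos_ge:
  fixes y :: real
  shows "ennreal (min (y\<^sup>2) 1) \<le> 10 * (\<integral>\<^sup>+u. ennreal (1 - cos (u * y)) * indicator {0..1} u \<partial>lborel)"
proof -
  have pos: "ennreal (min (y\<^sup>2) 1) \<le> 10 * (\<integral>\<^sup>+u. ennreal (1 - cos (u * y)) * indicator {0..1} u \<partial>lborel)"
    if "y > 0" for y :: real
  proof -
    have "(\<integral>\<^sup>+u. ennreal (1 - cos (u * y)) * indicator {0..1} u \<partial>lborel) = ennreal ((1 - sin (1 * y) / y) - (0 - sin (0 * y) / y))"
      by (rule nn_integral_FTC_Icc) (use that in \<open>auto intro!: derivative_eq_intros\<close>)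
    also have "10 * \<dots> = ennreal (10 * (1 - sin y / y))"
      by (subst ennreal_mult') auto
    finally have eq: "10 * (\<integral>\<^sup>+u. ennreal (1 - cos (u * y)) * indicator {0..1} u \<partial>lborel) = ennreal (10 * (1 - sin y / y))" .
    have "m \<le> 10 * s" if "m / 10 \<le> s" for m s :: real using that by simp
    from this[OF one_minus_sinc_ge[OF that]] show ?thesis unfolding eq by (rule ennreal_leI)
  qed
  show ?thesis
  proof (cases y "0::real" rule: linorder_cases)
    case less
    then show ?thesis using pos[of "- y"] by simp
  qed (use pos in auto)
qed

section \<open>A complete metric for convergence in probability\<close>

definition pdist :: "'w measure \<Rightarrow> ('w \<Rightarrow> real) \<Rightarrow> ('w \<Rightarrow> real) \<Rightarrow> ennreal" where
  "pdist M Z W = (\<integral>\<^sup>+\<omega>. ennreal (min 1 \<bar>Z \<omega> - W \<omega>\<bar>) \<partial>M)"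

lemma pdist_commute: "pdist M Z W = pdist M W Z"
  by (simp add: pdist_def abs_minus_commute)

lemma pdist_triangle:
  assumes [measurable]: "X \<in> borel_measurable M" "Y \<in> borel_measurable M" "Z \<in> borel_measurable M"
  shows "pdist M X Z \<le> pdist M X Y + pdist M Y Z"
  unfolding pdist_def
  by (subst nn_integral_add[symmetric]) (auto intro!: nn_integral_mono simp: ennreal_plus[symmetric] ennreal_leI simp del: ennreal_plus)

lemma pdist_cong_AE: "AE \<omega> in M. X \<omega> - Y \<omega> = X' \<omega> - Y' \<omega> \<Longrightarrow> pdist M X Y = pdist M X' Y'"
  unfolding pdist_def by (rule nn_integral_cong_AE) auto

context prob_space
begin

lemma pdist_finite: "pdist M X Y < \<top>"
proof -
  have "pdist M X Y \<le> (\<integral>\<^sup>+\<omega>. 1 \<partial>M)" unfolding pdist_def by (intro nn_integral_mono) (auto simp: min_def ennreal_leI)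
  then show ?thesis by (simp add: emeasure_space_1 le_less_trans)
qed

lemma pdist_zero_AE:
  assumes [measurable]: "X \<in> borel_measurable M" "Y \<in> borel_measurable M" and "pdist M X Y = 0"
  shows "AE \<omega> in M. X \<omega> = Y \<omega>"
proof -
  have "AE \<omega> in M. ennreal (min 1 \<bar>X \<omega> - Y \<omega>\<bar>) = 0"
    using assms(3) unfolding pdist_def by (subst (asm) nn_integral_0_iff_AE) auto
  then show ?thesis by eventually_elim (auto simp: min_def ennreal_eq_0_iff split: if_splits)
qed

text \<open>Splitting at level e / 2 gives one direction, Markov's inequality the other.\<close>

lemma converges_in_prob_iff_pdist:
  assumes [measurable]: "\<And>n. Zs n \<in> borel_measurable M" "Z \<in> borel_measurable M"
  shows "converges_in_prob M Zs Z \<longleftrightarrow> (\<lambda>n. pdist M (Zs n) Z) \<longlonglongrightarrow> 0"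
proof
  assume conv: "converges_in_prob M Zs Z"
  show "(\<lambda>n. pdist M (Zs n) Z) \<longlonglongrightarrow> 0"
  proof (rule ennreal_tendsto_0I)
    fix e :: real assume e: "e > 0"
    have "(\<lambda>n. prob {\<omega> \<in> space M. \<bar>Zs n \<omega> - Z \<omega>\<bar> > e / 2}) \<longlonglongrightarrow> 0"
      using conv[unfolded converges_in_prob_def, rule_format, of "e / 2"] e by simp
    then have "\<forall>\<^sub>F n in sequentially. prob {\<omega> \<in> space M. \<bar>Zs n \<omega> - Z \<omega>\<bar> > e / 2} < e / 2"
      using e by (intro order_tendstoD) auto
    then show "\<forall>\<^sub>F n in sequentially. pdist M (Zs n) Z \<le> ennreal e"
    proof eventually_elim
      case (elim n)
      let ?A = "{\<omega> \<in> space M. \<bar>Zs n \<omega> - Z \<omega>\<bar> > e / 2}"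
      have "pdist M (Zs n) Z \<le> (\<integral>\<^sup>+\<omega>. ennreal (e / 2) + indicator ?A \<omega> \<partial>M)"
        unfolding pdist_def
      proof (rule nn_integral_mono)
        fix \<omega> assume w: "\<omega> \<in> space M"
        show "ennreal (min 1 \<bar>Zs n \<omega> - Z \<omega>\<bar>) \<le> ennreal (e / 2) + indicator ?A \<omega>"
        proof (cases "\<omega> \<in> ?A")
          case True
          have "ennreal (min 1 \<bar>Zs n \<omega> - Z \<omega>\<bar>) \<le> ennreal (e / 2 + 1)" using e by (intro ennreal_leI) auto
          then show ?thesis using True e by (simp add: ennreal_plus)
        next
          case False
          then have "\<bar>Zs n \<omega> - Z \<omega>\<bar> \<le> e / 2" using w by simp
          then have "min 1 \<bar>Zs n \<omega> - Z \<omega>\<bar> \<le> e / 2" by (rule min.coboundedI2)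
          then show ?thesis using False by (auto intro!: ennreal_leI)
        qed
      qed
      also have "\<dots> = ennreal (e / 2) + ennreal (prob ?A)"
        by (subst nn_integral_add) (auto simp: emeasure_eq_measure prob_space)
      also have "\<dots> \<le> ennreal (e / 2) + ennreal (e / 2)" using elim by (intro add_left_mono ennreal_leI) simp
      also have "\<dots> = ennreal e" using e by (simp add: ennreal_plus[symmetric] del: ennreal_plus)
      finally show ?case .
    qed
  qed
next
  assume lim: "(\<lambda>n. pdist M (Zs n) Z) \<longlonglongrightarrow> 0"
  show "converges_in_prob M Zs Z" unfolding converges_in_prob_def
  proof (intro allI impI)
    fix e :: real assume e: "e > 0"
    \<comment> \<open>The integrand of \<open>pdist\<close> is capped at 1, so Markov's inequality
      is applied at a level of at most 1.\<close>
    define d where "d = min 1 e"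
    have d: "d > 0" using e by (simp add: d_def)
    have le: "ennreal (prob {\<omega> \<in> space M. \<bar>Zs n \<omega> - Z \<omega>\<bar> > e}) \<le> ennreal (1 / d) * pdist M (Zs n) Z" for n
    proof -
      let ?A = "{\<omega> \<in> space M. \<bar>Zs n \<omega> - Z \<omega>\<bar> > e}"
      have "ennreal (prob ?A) = (\<integral>\<^sup>+\<omega>. indicator ?A \<omega> \<partial>M)" by (simp add: emeasure_eq_measure)
      also have "\<dots> \<le> (\<integral>\<^sup>+\<omega>. ennreal (1 / d) * ennreal (min 1 \<bar>Zs n \<omega> - Z \<omega>\<bar>) \<partial>M)"
      proof (rule nn_integral_mono)
        fix \<omega>
        show "indicator ?A \<omega> \<le> ennreal (1 / d) * ennreal (min 1 \<bar>Zs n \<omega> - Z \<omega>\<bar>)"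
        proof (cases "\<omega> \<in> ?A")
          case True
          then have "d \<le> min 1 \<bar>Zs n \<omega> - Z \<omega>\<bar>" by (auto simp: d_def)
          then have "1 \<le> 1 / d * min 1 \<bar>Zs n \<omega> - Z \<omega>\<bar>" using d by (simp add: field_simps)
          then show ?thesis using True d by (simp add: ennreal_mult[symmetric])
        qed simp
      qed
      also have "\<dots> = ennreal (1 / d) * pdist M (Zs n) Z"
        unfolding pdist_def by (rule nn_integral_cmult) measurable
      finally show ?thesis .
    qed
    have "(\<lambda>n. ennreal (1 / d) * pdist M (Zs n) Z) \<longlonglongrightarrow> 0"
      using ennreal_tendsto_cmult[OF _ lim, of "ennreal (1 / d)"] by simp
    then have "(\<lambda>n. ennreal (prob {\<omega> \<in> space M. \<bar>Zs n \<omega> - Z \<omega>\<bar> > e})) \<longlonglongrightarrow> 0"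
      by (rule tendsto_sandwich[OF _ _ tendsto_const, rotated 2]) (use le in \<open>auto intro!: always_eventually\<close>)
    then show "(\<lambda>n. prob {\<omega> \<in> space M. \<bar>Zs n \<omega> - Z \<omega>\<bar> > e}) \<longlonglongrightarrow> 0"
      by (simp add: ennreal_tendsto_0_iff)
  qed
qed

lemma AE_tendsto_pdist:
  assumes [measurable]: "\<And>n. Zs n \<in> borel_measurable M" "Z \<in> borel_measurable M"
    and lim: "AE \<omega> in M. (\<lambda>n. Zs n \<omega>) \<longlonglongrightarrow> Z \<omega>"
  shows "(\<lambda>n. pdist M (Zs n) Z) \<longlonglongrightarrow> 0"
proof -
  have "(\<lambda>n. \<integral>\<^sup>+\<omega>. ennreal (min 1 \<bar>Zs n \<omega> - Z \<omega>\<bar>) \<partial>M) \<longlonglongrightarrow> (\<integral>\<^sup>+\<omega>. 0 \<partial>M)"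
  proof (rule nn_integral_dominated_convergence[where w = "\<lambda>_. 1"])
    show "AE \<omega> in M. (\<lambda>n. ennreal (min 1 \<bar>Zs n \<omega> - Z \<omega>\<bar>)) \<longlonglongrightarrow> 0"
      using lim
    proof eventually_elim
      case (elim \<omega>)
      have "(\<lambda>n. min 1 \<bar>Zs n \<omega> - Z \<omega>\<bar>) \<longlonglongrightarrow> min 1 \<bar>Z \<omega> - Z \<omega>\<bar>" by (intro tendsto_intros elim)
      then show ?case by (simp add: ennreal_tendsto_0_iff)
    qed
  qed (auto simp: emeasure_space_1 min_def ennreal_leI)
  then show ?thesis by (simp add: pdist_def)
qed

text \<open>A subsequence with geometric errors has truncated increments of finite expected sum, so
  it converges almost surely; the Cauchy property then carries the limit over to the full
  sequence.\<close>

lemma pdist_complete: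
  fixes T :: "nat \<Rightarrow> 'a \<Rightarrow> real"
  assumes [measurable]: "\<And>n. T n \<in> borel_measurable M"
    and cauchy: "\<And>e::real. e > 0 \<Longrightarrow> \<exists>n0. \<forall>n\<ge>n0. \<forall>m\<ge>n0. pdist M (T n) (T m) \<le> ennreal e"
  obtains W where "W \<in> borel_measurable M" "(\<lambda>n. pdist M (T n) W) \<longlonglongrightarrow> 0"
proof -
  have "\<exists>n0. \<forall>n\<ge>n0. \<forall>m\<ge>n0. pdist M (T n) (T m) \<le> ennreal ((1/2) ^ k)" for k :: nat
    by (rule cauchy) simp
  then obtain n0 where n0: "\<And>k n m. n \<ge> n0 k \<Longrightarrow> m \<ge> n0 k \<Longrightarrow> pdist M (T n) (T m) \<le> ennreal ((1/2) ^ k)"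
    by metis
  \<comment> \<open>The maximum over all earlier thresholds places both r k and r (k + 1) beyond
    \<open>n0 k\<close>; the summand k makes the indices tend to infinity.\<close>
  define r where "r = (\<lambda>k. Max (n0 ` {..k}) + k)"
  have r0: "r k \<ge> n0 j" if "j \<le> k" for j k
    using Max_ge[of "n0 ` {..k}" "n0 j"] that by (simp add: r_def trans_le_add1)
  have rk: "r k \<ge> k" for k by (simp add: r_def)
  define D where "D = (\<lambda>k \<omega>. T (r (Suc k)) \<omega> - T (r k) \<omega>)"
  have [measurable]: "D k \<in> borel_measurable M" for k unfolding D_def by measurable
  have "(\<integral>\<^sup>+\<omega>. (\<Sum>k. ennreal (min 1 \<bar>D k \<omega>\<bar>)) \<partial>M) = (\<Sum>k. \<integral>\<^sup>+\<omega>. ennreal (min 1 \<bar>D k \<omega>\<bar>) \<partial>M)"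
    by (rule nn_integral_suminf) measurable
  also have "\<dots> \<le> (\<Sum>k. ennreal ((1/2) ^ k))"
  proof (rule suminf_le)
    fix k
    show "(\<integral>\<^sup>+\<omega>. ennreal (min 1 \<bar>D k \<omega>\<bar>) \<partial>M) \<le> ennreal ((1/2) ^ k)"
      using n0[of k "r (Suc k)" "r k"] r0[of k "Suc k"] r0[of k k] by (simp add: pdist_def D_def)
  qed auto
  also have "\<dots> < \<top>" by (subst suminf_ennreal2) (auto simp: summable_geometric)
  finally have "(\<integral>\<^sup>+\<omega>. (\<Sum>k. ennreal (min 1 \<bar>D k \<omega>\<bar>)) \<partial>M) \<noteq> \<infinity>" by simp
  then have "AE \<omega> in M. (\<Sum>k. ennreal (min 1 \<bar>D k \<omega>\<bar>)) \<noteq> \<infinity>"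
    by (intro nn_integral_PInf_AE) measurable
  then have conv: "AE \<omega> in M. convergent (\<lambda>k. T (r k) \<omega>)"
  proof eventually_elim
    case (elim \<omega>)
    then have s: "summable (\<lambda>k. min 1 \<bar>D k \<omega>\<bar>)" by (intro summable_suminf_not_top) auto
    from summable_LIMSEQ_zero[OF this] have "\<forall>\<^sub>F k in sequentially. min 1 \<bar>D k \<omega>\<bar> < 1"
      by (rule order_tendstoD) simp
    then have "\<forall>\<^sub>F k in sequentially. norm (D k \<omega>) \<le> min 1 \<bar>D k \<omega>\<bar>"
      by eventually_elim (auto simp: min_def split: if_splits)
    then have "summable (\<lambda>k. D k \<omega>)"
      by (rule summable_comparison_test_ev[OF _ s])
    then have "summable (\<lambda>k. T (r (Suc k)) \<omega> - T (r k) \<omega>)" by (simp add: D_def)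
    then have "convergent (\<lambda>n. \<Sum>k<n. T (r (Suc k)) \<omega> - T (r k) \<omega>)" by (simp add: summable_iff_convergent)
    then have conv': "convergent (\<lambda>n. T (r n) \<omega> - T (r 0) \<omega>)" using sum_lessThan_telescope[of "\<lambda>k. T (r k) \<omega>"] by simp
    then show ?case using convergent_add[OF conv' convergent_const[of "T (r 0) \<omega>"]] by simp
  qed
  define W where "W = (\<lambda>\<omega>. lim (\<lambda>k. T (r k) \<omega>))"
  have W[measurable]: "W \<in> borel_measurable M" unfolding W_def by measurable
  have lim: "(\<lambda>k. pdist M (T (r k)) W) \<longlonglongrightarrow> 0"
    by (rule AE_tendsto_pdist) (use conv in \<open>auto simp: W_def convergent_LIMSEQ_iff\<close>)
  have "(\<lambda>n. pdist M (T n) W) \<longlonglongrightarrow> 0"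
  proof (rule ennreal_tendsto_0I)
    fix e :: real assume e: "e > 0"
    obtain n1 where n1: "\<And>n m. n \<ge> n1 \<Longrightarrow> m \<ge> n1 \<Longrightarrow> pdist M (T n) (T m) \<le> ennreal (e / 2)"
      using cauchy[of "e / 2"] e by auto
    have "\<forall>\<^sub>F n in sequentially. pdist M (T (r n)) W < ennreal (e / 2)"
      using lim e by (intro order_tendstoD) auto
    then show "\<forall>\<^sub>F n in sequentially. pdist M (T n) W \<le> ennreal e"
      using eventually_ge_at_top[of n1]
    proof eventually_elim
      case (elim n)
      have "pdist M (T n) W \<le> pdist M (T n) (T (r n)) + pdist M (T (r n)) W"
        by (rule pdist_triangle) measurable
      also have "\<dots> \<le> ennreal (e / 2) + ennreal (e / 2)"
        using elim rk[of n] by (intro add_mono n1) auto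
      also have "\<dots> = ennreal e" using e by (simp add: ennreal_plus[symmetric] del: ennreal_plus)
      finally show ?case .
    qed
  qed
  then show thesis using that W by blast
qed

end


section \<open>The noise, its modular and its characteristic exponent\<close>

locale levy_noise = prob_space M for M :: "'w measure" +
  fixes S :: "(real ^ 'd::finite) set" and \<nu> :: "real measure"
    and J :: "'w \<Rightarrow> ((real ^ 'd) \<times> real) measure" and X :: "(real ^ 'd) set \<Rightarrow> 'w \<Rightarrow> real"
  assumes S_borel [measurable]: "S \<in> sets borel"
    and noise: "symmetric_pure_jump_levy_noise M S \<nu> J X"
begin

abbreviation leb where "leb \<equiv> restrict_space (lborel :: (real ^ 'd) measure) S"
abbreviation \<mu> where "\<mu> \<equiv> jump_intensity S \<nu>"

lemma levy: "levy_measure \<nu>" and symm: "distr \<nu> borel uminus = \<nu>"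
  using noise unfolding symmetric_pure_jump_levy_noise_def symmetric_measure_def by auto

sublocale poisson_measure M \<mu> J
  using noise by unfold_locales (auto simp: symmetric_pure_jump_levy_noise_def)

lemma sets_nu [simp, measurable_cong]: "sets \<nu> = sets borel"
  using levy by (simp add: levy_measure_def)

lemma space_nu [simp]: "space \<nu> = UNIV"
  using sets_eq_imp_space_eq[OF sets_nu] by simp

text \<open>Markov's inequality applied to the integrand of the Levy condition.\<close>

lemma nu_tail_finite:
  assumes "e > 0" shows "emeasure \<nu> {z. \<bar>z\<bar> > e} < \<top>"
proof -
  have e: "min (e\<^sup>2) 1 > 0" using assms by simp
  have "ennreal (min (e\<^sup>2) 1) * emeasure \<nu> {z. \<bar>z\<bar> > e} = (\<integral>\<^sup>+z. ennreal (min (e\<^sup>2) 1) * indicator {z. \<bar>z\<bar> > e} z \<partial>\<nu>)"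
    by (subst nn_integral_cmult_indicator) auto
  also have "\<dots> \<le> (\<integral>\<^sup>+z. ennreal (min (z\<^sup>2) 1) \<partial>\<nu>)"
  proof (rule nn_integral_mono)
    fix z
    show "ennreal (min (e\<^sup>2) 1) * indicator {z. \<bar>z\<bar> > e} z \<le> ennreal (min (z\<^sup>2) 1)"
    proof (cases "\<bar>z\<bar> > e")
      case True
      then have "e\<^sup>2 \<le> \<bar>z\<bar>\<^sup>2" using assms by (intro power_mono) auto
      then have "min (e\<^sup>2) 1 \<le> min (z\<^sup>2) 1" by (intro min.mono) simp_all
      then show ?thesis using True by (simp add: ennreal_leI)
    qed simp
  qed
  also have "\<dots> < \<top>" using levy by (simp add: levy_measure_def)
  finally show ?thesis using e by (auto simp: ennreal_mult_less_top)
qed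

text \<open>Infinite mass can sit only near 0, and {0} itself is null; the tails therefore exhaust
  the line. Fubini for the jump intensity rests on this.\<close>

sublocale nu: sigma_finite_measure \<nu>
proof
  let ?A = "insert {0} (range (\<lambda>n::nat. {z. \<bar>z\<bar> > 1 / Suc n}))"
  show "\<exists>A. countable A \<and> A \<subseteq> sets \<nu> \<and> \<Union>A = space \<nu> \<and> (\<forall>a\<in>A. emeasure \<nu> a \<noteq> \<infinity>)"
  proof (intro exI[of _ ?A] conjI)
    have "z \<in> \<Union>?A" for z
    proof (cases "z = 0")
      case False
      then obtain n where "inverse (real (Suc n)) < \<bar>z\<bar>" using reals_Archimedean[of "\<bar>z\<bar>"] by auto
      then show ?thesis by (auto simp: inverse_eq_divide)
    qed simp
    then show "\<Union>?A = space \<nu>" by auto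
    show "\<forall>a\<in>?A. emeasure \<nu> a \<noteq> \<infinity>"
      using levy nu_tail_finite by (auto simp: levy_measure_def less_top)
  qed auto
qed

sublocale leb: sigma_finite_measure leb
  by (rule sigma_finite_measure_restrict_space) (auto intro: sigma_finite_lborel)

sublocale pair: pair_sigma_finite leb \<nu> ..

lemma space_leb [simp]: "space leb = S" by (simp add: space_restrict_space)

lemma sets_leb: "A \<in> sets leb \<longleftrightarrow> A \<subseteq> S \<and> A \<in> sets borel"
  by (subst sets_restrict_space_iff) auto

lemma measurable_leb [simp]: "f \<in> borel_measurable borel \<Longrightarrow> f \<in> borel_measurable leb"
  by (simp add: measurable_restrict_space1)

lemma sets_mu [measurable_cong]: "sets \<mu> = sets (leb \<Otimes>\<^sub>M borel)"
  unfolding jump_intensity_def by (intro sets_pair_measure_cong) simp_all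

lemma space_mu [simp]: "space \<mu> = S \<times> UNIV"
  by (simp add: jump_intensity_def space_pair_measure)

text \<open>A null set of sites stays null after multiplication with the whole line of jumps, as 0
  times infinity is 0.\<close>

lemma AE_mu_I:
  assumes "AE s in leb. P s" shows "AE e in \<mu>. P (fst e)"
proof -
  from assms obtain N where N: "{s \<in> space leb. \<not> P s} \<subseteq> N" "emeasure leb N = 0" "N \<in> sets leb" by (rule AE_E)
  show ?thesis
  proof (rule AE_I)
    show "{e \<in> space \<mu>. \<not> P (fst e)} \<subseteq> N \<times> UNIV" using N(1) by auto
    show "emeasure \<mu> (N \<times> UNIV) = 0" unfolding jump_intensity_def
      by (subst nu.emeasure_pair_measure_Times) (use N in auto)
    show "N \<times> UNIV \<in> sets \<mu>" unfolding jump_intensity_def using N(3) by (intro pair_measureI) auto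
  qed
qed

text \<open>The modular of the Musielak-Orlicz space \<open>L_noise\<close>. It is not a norm, but
  it does not increase under factors in [0, 1] and is subadditive up to the factor 2.\<close>

definition N :: "(real ^ 'd \<Rightarrow> real) \<Rightarrow> ennreal" where
  "N f = (\<integral>\<^sup>+(s, z). ennreal (min (\<bar>f s * z\<bar>\<^sup>2) 1) \<partial>\<mu>)"

text \<open>The Levy-Khintchine exponent up to sign; symmetry of \<nu> leaves only its real
  part.\<close>

definition Q :: "(real ^ 'd \<Rightarrow> real) \<Rightarrow> real" where
  "Q f = (\<integral>(s, z). 1 - cos (f s * z) \<partial>\<mu>)"

lemma L_noise_iff: "f \<in> L_noise S \<nu> \<longleftrightarrow> f \<in> borel_measurable leb \<and> N f < \<top>"
  by (simp add: L_noise_def N_def)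

lemma N_mono:
  assumes "\<And>s. s \<in> S \<Longrightarrow> \<bar>f s\<bar> \<le> \<bar>g s\<bar>"
  shows "N f \<le> N g"
  unfolding N_def
proof (intro nn_integral_mono, clarify)
  fix s z assume "(s, z :: real) \<in> space \<mu>"
  then have "\<bar>f s\<bar> \<le> \<bar>g s\<bar>" using assms by simp
  then have "\<bar>f s * z\<bar> \<le> \<bar>g s * z\<bar>" by (simp add: abs_mult mult_right_mono)
  then have "\<bar>f s * z\<bar>\<^sup>2 \<le> \<bar>g s * z\<bar>\<^sup>2" by (intro power_mono) auto
  then show "ennreal (min (\<bar>f s * z\<bar>\<^sup>2) 1) \<le> ennreal (min (\<bar>g s * z\<bar>\<^sup>2) 1)"
    by (intro ennreal_leI min.mono) auto
qed

text \<open>The inequality \<open>(a + b)\<^sup>2 \<le> 2 * a\<^sup>2 + 2 * b\<^sup>2\<close>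
  survives truncation at 1.\<close>

lemma N_add:
  assumes [measurable]: "f \<in> borel_measurable leb" "g \<in> borel_measurable leb"
  shows "N (\<lambda>s. f s + g s) \<le> 2 * N f + 2 * N g"
proof -
  have pw: "min (\<bar>a + b\<bar>\<^sup>2) 1 \<le> 2 * min (\<bar>a\<bar>\<^sup>2) 1 + 2 * min (\<bar>b\<bar>\<^sup>2) 1" for a b :: real
  proof -
    have "min x 1 \<le> 2 * min p 1 + 2 * min q 1" if "x \<le> 2 * p + 2 * q" "0 \<le> p" "0 \<le> q" for x p q :: real
      using that by (auto simp: min_def)
    moreover have "\<bar>a + b\<bar>\<^sup>2 \<le> 2 * \<bar>a\<bar>\<^sup>2 + 2 * \<bar>b\<bar>\<^sup>2"
      using sum_squares_bound[of a b] by (simp add: power2_sum)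
    ultimately show ?thesis by simp
  qed
  have "N (\<lambda>s. f s + g s) \<le> (\<integral>\<^sup>+(s, z). 2 * ennreal (min (\<bar>f s * z\<bar>\<^sup>2) 1) + 2 * ennreal (min (\<bar>g s * z\<bar>\<^sup>2) 1) \<partial>\<mu>)"
    unfolding N_def
  proof (intro nn_integral_mono, clarify)
    fix s z
    show "ennreal (min (\<bar>(f s + g s) * z\<bar>\<^sup>2) 1) \<le> 2 * ennreal (min (\<bar>f s * z\<bar>\<^sup>2) 1) + 2 * ennreal (min (\<bar>g s * z\<bar>\<^sup>2) 1)"
      using ennreal_leI[OF pw[of "f s * z" "g s * z"]] by (simp add: distrib_right ennreal_mult)
  qed
  also have "\<dots> = 2 * N f + 2 * N g"
    unfolding N_def case_prod_beta
    by (subst nn_integral_add) (auto simp: nn_integral_cmult)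
  finally show ?thesis .
qed

lemma N_uminus: "N (\<lambda>s. - f s) = N f"
  by (intro antisym N_mono) auto

lemma N_diff:
  assumes "f \<in> borel_measurable leb" "g \<in> borel_measurable leb"
  shows "N (\<lambda>s. f s - g s) \<le> 2 * N f + 2 * N g"
  using N_add[of f "\<lambda>s. - g s"] assms by (simp add: N_uminus)

lemma N_cmult_le: "0 \<le> u \<Longrightarrow> u \<le> 1 \<Longrightarrow> N (\<lambda>s. u * f s) \<le> N f"
  by (rule N_mono) (simp add: abs_mult mult_left_le_one_le)

lemma Q_integrable:
  assumes [measurable]: "f \<in> borel_measurable leb" and "N f < \<top>"
  shows "integrable \<mu> (\<lambda>(s, z). 1 - cos (f s * z))"
    and "ennreal (Q f) = (\<integral>\<^sup>+(s, z). ennreal (1 - cos (f s * z)) \<partial>\<mu>)"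
    and "ennreal (Q f) \<le> 2 * N f"
    and "Q f \<ge> 0"
proof -
  have le: "(\<integral>\<^sup>+(s, z). ennreal (1 - cos (f s * z)) \<partial>\<mu>) \<le> 2 * N f"
  proof -
    have "(\<integral>\<^sup>+(s, z). ennreal (1 - cos (f s * z)) \<partial>\<mu>) \<le> (\<integral>\<^sup>+(s, z). 2 * ennreal (min (\<bar>f s * z\<bar>\<^sup>2) 1) \<partial>\<mu>)"
    proof (intro nn_integral_mono, clarify)
      fix s z
      show "ennreal (1 - cos (f s * z)) \<le> 2 * ennreal (min (\<bar>f s * z\<bar>\<^sup>2) 1)"
        using ennreal_leI[OF one_minus_cos_le[of "f s * z"]] by (simp add: ennreal_mult)
    qed
    also have "\<dots> = 2 * N f" unfolding N_def case_prod_beta by (rule nn_integral_cmult) measurable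
    finally show ?thesis .
  qed
  show int: "integrable \<mu> (\<lambda>(s, z). 1 - cos (f s * z))"
  proof (rule integrableI_bounded)
    have "(\<integral>\<^sup>+x. ennreal (norm (case x of (s, z) \<Rightarrow> 1 - cos (f s * z))) \<partial>\<mu>) = (\<integral>\<^sup>+(s, z). ennreal (1 - cos (f s * z)) \<partial>\<mu>)"
      by (intro nn_integral_cong) auto
    then show "(\<integral>\<^sup>+x. ennreal (norm (case x of (s, z) \<Rightarrow> 1 - cos (f s * z))) \<partial>\<mu>) < \<infinity>"
      using le assms(2) by (simp add: le_less_trans ennreal_mult_less_top)
  qed measurable
  show eq: "ennreal (Q f) = (\<integral>\<^sup>+(s, z). ennreal (1 - cos (f s * z)) \<partial>\<mu>)"
    unfolding Q_def by (subst nn_integral_eq_integral[OF int, symmetric]) (auto simp: case_prod_beta')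
  show "ennreal (Q f) \<le> 2 * N f" using le eq by simp
  show "Q f \<ge> 0" unfolding Q_def by (rule integral_nonneg_AE) (auto simp: case_prod_beta)
qed

text \<open>After Fubini the inner integral equals its own negative, since reflection preserves
  \<nu>.\<close>

lemma integral_mu_odd:
  fixes G :: "(real ^ 'd) \<times> real \<Rightarrow> real"
  assumes int: "integrable \<mu> G" and odd: "\<And>s z. G (s, - z) = - G (s, z)"
  shows "(\<integral>e. G e \<partial>\<mu>) = 0"
proof -
  have [measurable]: "G \<in> borel_measurable (leb \<Otimes>\<^sub>M borel)"
    using int measurable_cong_sets[OF sets_mu refl] by blast
  have inner: "(\<integral>z. G (s, z) \<partial>\<nu>) = 0" if "s \<in> S" for s
  proof -
    have [measurable]: "(\<lambda>z. G (s, z)) \<in> borel_measurable borel"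
      using measurable_Pair2[of G leb borel borel s] that by simp
    have "(\<integral>z. G (s, z) \<partial>\<nu>) = (\<integral>z. G (s, z) \<partial>distr \<nu> borel uminus)" by (simp add: symm)
    also have "\<dots> = (\<integral>z. G (s, - z) \<partial>\<nu>)" by (rule integral_distr) auto
    also have "\<dots> = - (\<integral>z. G (s, z) \<partial>\<nu>)" by (simp add: odd)
    finally show ?thesis by simp
  qed
  have "(\<integral>e. G e \<partial>\<mu>) = (\<integral>s. \<integral>z. G (s, z) \<partial>\<nu> \<partial>leb)"
    using pair.integral_fst'[of G] int by (simp add: jump_intensity_def)
  also have "\<dots> = (\<integral>s. 0 \<partial>leb)" by (intro Bochner_Integration.integral_cong) (auto simp: inner)
  finally show ?thesis by simp
qed


section \<open>Integrals of simple functions\<close>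

lemma noise_sets_Int: "A \<in> noise_sets S \<Longrightarrow> B \<in> sets borel \<Longrightarrow> A \<inter> B \<in> noise_sets S"
  unfolding noise_sets_def using emeasure_mono[of "A \<inter> B" A lborel] by (auto intro: le_less_trans)

lemma noise_sets_Un: "A \<in> noise_sets S \<Longrightarrow> B \<in> noise_sets S \<Longrightarrow> A \<union> B \<in> noise_sets S"
  unfolding noise_sets_def using emeasure_subadditive[of A lborel B] by (auto simp: le_less_trans)

lemma noise_sets_empty: "{} \<in> noise_sets S"
  by (simp add: noise_sets_def)

lemma noise_sets_D: "A \<in> noise_sets S \<Longrightarrow> A \<in> sets borel" "A \<in> noise_sets S \<Longrightarrow> A \<subseteq> S"
  by (auto simp: noise_sets_def)

lemma mu_finite:
  assumes "A \<in> noise_sets S" "B \<in> sets borel" "emeasure \<nu> B < \<top>"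
  shows "emeasure \<mu> (A \<times> B) < \<top>" "A \<times> B \<in> sets \<mu>"
proof -
  have A: "A \<in> sets leb" "emeasure leb A < \<top>"
    using assms(1) by (auto simp: sets_leb noise_sets_def emeasure_restrict_space)
  show "emeasure \<mu> (A \<times> B) < \<top>" unfolding jump_intensity_def
    by (subst nu.emeasure_pair_measure_Times) (use A assms in \<open>auto simp: ennreal_mult_less_top\<close>)
  show "A \<times> B \<in> sets \<mu>" unfolding jump_intensity_def using A assms by (intro pair_measureI) auto
qed

definition simple_list :: "(real \<times> (real ^ 'd) set) list \<Rightarrow> bool" where
  "simple_list F \<longleftrightarrow> (\<forall>(c, A) \<in> set F. A \<in> noise_sets S)"

lemma simple_list_Cons [simp]: "simple_list ((c, A) # F) \<longleftrightarrow> A \<in> noise_sets S \<and> simple_list F"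
  by (auto simp: simple_list_def)

lemma simple_list_Nil [simp]: "simple_list []" by (simp add: simple_list_def)

lemma simple_fun_Cons: "simple_fun ((c, A) # F) s = c * indicator A s + simple_fun F s"
  by (simp add: simple_fun_def)

lemma simple_fun_Nil: "simple_fun [] s = 0" by (simp add: simple_fun_def)

lemma simple_integral_Cons: "simple_integral X ((c, A) # F) B \<omega> = c * X (A \<inter> B) \<omega> + simple_integral X F B \<omega>"
  by (simp add: simple_integral_def)

lemma simple_integral_Nil: "simple_integral X [] B \<omega> = 0" by (simp add: simple_integral_def)

lemma X_measurable: "A \<in> noise_sets S \<Longrightarrow> X A \<in> borel_measurable M"
  using noise by (simp add: symmetric_pure_jump_levy_noise_def)

lemma simple_integral_measurable:
  assumes "simple_list F" "B \<in> sets borel"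
  shows "simple_integral X F B \<in> borel_measurable M"
  using assms(1)
proof (induction F)
  case (Cons a F)
  obtain c A where a: "a = (c, A)" by (cases a)
  have [measurable]: "simple_integral X F B \<in> borel_measurable M" "X (A \<inter> B) \<in> borel_measurable M"
    using Cons a by (auto intro!: X_measurable noise_sets_Int assms(2))
  show ?case unfolding a simple_integral_Cons[abs_def] by measurable
qed (simp add: simple_integral_Nil[abs_def])

lemma simple_fun_measurable [measurable]:
  assumes "simple_list F"
  shows "simple_fun F \<in> borel_measurable borel"
  using assms
proof (induction F)
  case (Cons a F)
  obtain c A where a: "a = (c, A)" by (cases a)
  have [measurable]: "simple_fun F \<in> borel_measurable borel" "A \<in> sets borel"
    using Cons a by (auto simp: noise_sets_D)
  show ?case unfolding a simple_fun_Cons[abs_def] by measurable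
qed (simp add: simple_fun_Nil[abs_def])

lemma simple_fun_support:
  assumes "simple_list F"
  shows "\<exists>A\<in>noise_sets S. \<forall>s. simple_fun F s \<noteq> 0 \<longrightarrow> s \<in> A"
  using assms
proof (induction F)
  case (Cons a F)
  obtain c A where a: "a = (c, A)" by (cases a)
  obtain A' where "A' \<in> noise_sets S" "\<forall>s. simple_fun F s \<noteq> 0 \<longrightarrow> s \<in> A'" using Cons a by auto
  then show ?case using Cons.prems a
    by (intro bexI[of _ "A \<union> A'"]) (auto simp: simple_fun_Cons noise_sets_Un split: if_splits)
qed (rule bexI[OF _ noise_sets_empty], simp add: simple_fun_Nil)

lemma simple_fun_bounded: "\<exists>C\<ge>0. \<forall>s. \<bar>simple_fun F s\<bar> \<le> C"
proof (induction F)
  case (Cons a F)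
  obtain c A where a: "a = (c, A)" by (cases a)
  obtain C where "C \<ge> 0" "\<And>s. \<bar>simple_fun F s\<bar> \<le> C" using Cons by blast
  moreover have "\<bar>c * indicator A s\<bar> \<le> \<bar>c\<bar>" for s by (simp add: indicator_def)
  ultimately show ?case unfolding a simple_fun_Cons
    by (intro exI[of _ "\<bar>c\<bar> + C"]) (auto intro!: order_trans[OF abs_triangle_ineq] add_mono)
qed (auto simp: simple_fun_Nil)

lemma large_jumps_finite:
  assumes "A \<in> noise_sets S"
    and "\<And>s z. k (s, z) \<noteq> 0 \<Longrightarrow> s \<in> A \<and> \<bar>z\<bar> > 1"
  shows "emeasure \<mu> {e \<in> space \<mu>. k e \<noteq> 0} < \<top>"
proof -
  have "emeasure \<mu> {e \<in> space \<mu>. k e \<noteq> 0} \<le> emeasure \<mu> (A \<times> {z. \<bar>z\<bar> > 1})"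
    by (rule emeasure_mono) (use assms mu_finite(2)[OF assms(1) _ nu_tail_finite[of 1]] in auto)
  also have "\<dots> < \<top>" by (rule mu_finite) (use assms nu_tail_finite[of 1] in auto)
  finally show ?thesis .
qed

text \<open>Induction on the list keeps one compensated part and one large-jump part for the whole
  simple function, so that the joint exponential formula applies to their sum. The factor
  \<open>indicator B s\<close> serves the integrals over all Borel subsets that occur in the
  definition of the stochastic integral.\<close>

lemma simple_integral_decomp:
  assumes F: "simple_list F" and B: "B \<in> sets borel"
  shows "\<exists>Z. has_compensated_integral M \<mu> J
           (\<lambda>(s, z). simple_fun F s * indicator B s * z * indicator {z. \<bar>z\<bar> \<le> 1} z) Z \<and>
         (AE \<omega> in M. simple_integral X F B \<omega> = Z \<omega> +
           (\<integral>(s, z). simple_fun F s * indicator B s * z * indicator {z. \<bar>z\<bar> > 1} z \<partial>J \<omega>))"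
  using F
proof (induction F)
  case Nil
  show ?case
    using has_compensated_integral_zero by (intro exI[of _ "\<lambda>_. 0"]) (simp add: simple_fun_Nil simple_integral_Nil case_prod_beta)
next
  case (Cons a F)
  obtain c A where a: "a = (c, A)" by (cases a)
  have A: "A \<in> noise_sets S" and F: "simple_list F" using Cons.prems a by auto
  obtain Z where Z: "has_compensated_integral M \<mu> J
           (\<lambda>(s, z). simple_fun F s * indicator B s * z * indicator {z. \<bar>z\<bar> \<le> 1} z) Z"
     "AE \<omega> in M. simple_integral X F B \<omega> = Z \<omega> +
           (\<integral>(s, z). simple_fun F s * indicator B s * z * indicator {z. \<bar>z\<bar> > 1} z \<partial>J \<omega>)"
    using Cons.IH F by blast
  have AB: "A \<inter> B \<in> noise_sets S" using noise_sets_Int[OF A B] .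
  then obtain Z1 where Z1: "has_compensated_integral M \<mu> J (\<lambda>(s, z). z * indicator (A \<inter> B) s * indicator {z. \<bar>z\<bar> \<le> 1} z) Z1"
    "AE \<omega> in M. X (A \<inter> B) \<omega> = Z1 \<omega> + (\<integral>(s, z). z * indicator (A \<inter> B) s * indicator {z. \<bar>z\<bar> > 1} z \<partial>J \<omega>)"
    using noise unfolding symmetric_pure_jump_levy_noise_def by blast
  have [measurable]: "A \<in> sets borel" "B \<in> sets borel" "simple_fun F \<in> borel_measurable borel"
    using A B F by (auto simp: noise_sets_D)
  define k1 :: "(real ^ 'd) \<times> real \<Rightarrow> real" where "k1 = (\<lambda>(s, z). z * indicator (A \<inter> B) s * indicator {z. \<bar>z\<bar> > 1} z)"
  define k where "k = (\<lambda>(s, z). simple_fun F s * indicator B s * z * indicator {z. \<bar>z\<bar> > 1} z)"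
  have [measurable]: "fst \<in> borel_measurable (leb \<Otimes>\<^sub>M borel)"
    by (rule measurable_compose[OF measurable_fst]) simp
  have "AE \<omega> in M. integrable (J \<omega>) k1"
    by (rule AE_integrable_J_finite, simp add: k1_def, measurable)
      (rule large_jumps_finite[OF AB], auto simp: k1_def indicator_def split: if_splits)
  moreover have "AE \<omega> in M. integrable (J \<omega>) k"
  proof (rule AE_integrable_J_finite)
    show "k \<in> borel_measurable \<mu>" unfolding k_def by measurable
    obtain A' where A': "A' \<in> noise_sets S" "\<And>s. simple_fun F s \<noteq> 0 \<Longrightarrow> s \<in> A'" using simple_fun_support[OF F] by blast
    show "emeasure \<mu> {e \<in> space \<mu>. k e \<noteq> 0} < \<top>"
      by (rule large_jumps_finite[OF A'(1)]) (use A'(2) in \<open>auto simp: k_def indicator_def split: if_splits\<close>)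
  qed
  ultimately have int: "AE \<omega> in M. integrable (J \<omega>) k1 \<and> integrable (J \<omega>) k" by auto
  show ?case
  proof (intro exI conjI)
    have eq: "(\<lambda>e. c * (case e of (s, z) \<Rightarrow> z * indicator (A \<inter> B) s * indicator {z. \<bar>z\<bar> \<le> 1} z) +
        (case e of (s, z) \<Rightarrow> simple_fun F s * indicator B s * z * indicator {z. \<bar>z\<bar> \<le> 1} z)) =
      (\<lambda>(s, z). simple_fun (a # F) s * indicator B s * z * indicator {z. \<bar>z\<bar> \<le> 1} z)"
      by (auto simp: fun_eq_iff a simple_fun_Cons indicator_inter_arith algebra_simps)
    show "has_compensated_integral M \<mu> J (\<lambda>(s, z). simple_fun (a # F) s * indicator B s * z * indicator {z. \<bar>z\<bar> \<le> 1} z) (\<lambda>\<omega>. c * Z1 \<omega> + Z \<omega>)"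
      using has_compensated_integral_add[OF has_compensated_integral_cmult[OF Z1(1), of c] Z(1)] unfolding eq .
    have eq': "(\<lambda>(s, z). simple_fun (a # F) s * indicator B s * z * indicator {z. \<bar>z\<bar> > 1} z) = (\<lambda>e. c * k1 e + k e)"
      by (auto simp: fun_eq_iff a simple_fun_Cons indicator_inter_arith k_def k1_def algebra_simps)
    show "AE \<omega> in M. simple_integral X (a # F) B \<omega> = c * Z1 \<omega> + Z \<omega> +
       (\<integral>(s, z). simple_fun (a # F) s * indicator B s * z * indicator {z. \<bar>z\<bar> > 1} z \<partial>J \<omega>)"
      unfolding eq' using int Z(2)[folded k_def] Z1(2)[folded k1_def]
      by eventually_elim (simp add: a simple_integral_Cons algebra_simps)
  qed
qed

text \<open>The function is bounded by some C and supported on a set of finite Lebesgue measure; the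
  factor \<open>1 + C\<^sup>2\<close> dominates both the quadratic regime and the truncation at
  1.\<close>

lemma simple_fun_L_noise:
  assumes F: "simple_list F" and [measurable]: "B \<in> sets borel"
  shows "(\<lambda>s. simple_fun F s * indicator B s) \<in> L_noise S \<nu>"
proof -
  obtain A where A: "A \<in> noise_sets S" "\<And>s. simple_fun F s \<noteq> 0 \<Longrightarrow> s \<in> A" using simple_fun_support[OF F] by blast
  obtain C where C: "C \<ge> 0" "\<And>s. \<bar>simple_fun F s\<bar> \<le> C" using simple_fun_bounded by blast
  have [measurable]: "simple_fun F \<in> borel_measurable borel" using F by simp
  have A': "A \<in> sets leb" "emeasure leb A < \<top>"
    using A(1) by (auto simp: sets_leb noise_sets_def emeasure_restrict_space)
  have pw: "min (\<bar>simple_fun F s * indicator B s * z\<bar>\<^sup>2) 1 \<le> (1 + C\<^sup>2) * (indicator A s * min (z\<^sup>2) 1)" for s z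
  proof (cases "s \<in> A")
    case True
    have "\<bar>simple_fun F s * indicator B s * z\<bar> \<le> C * \<bar>z\<bar>"
      using C by (auto simp: abs_mult indicator_def intro!: mult_right_mono)
    then have "\<bar>simple_fun F s * indicator B s * z\<bar>\<^sup>2 \<le> (C * \<bar>z\<bar>)\<^sup>2" by (intro power_mono) auto
    then have *: "\<bar>simple_fun F s * indicator B s * z\<bar>\<^sup>2 \<le> C\<^sup>2 * z\<^sup>2" by (simp add: power_mult_distrib)
    have "min (\<bar>simple_fun F s * indicator B s * z\<bar>\<^sup>2) 1 \<le> (1 + C\<^sup>2) * min (z\<^sup>2) 1"
    proof (cases "z\<^sup>2 \<le> 1")
      case True
      have "C\<^sup>2 * z\<^sup>2 \<le> (1 + C\<^sup>2) * z\<^sup>2" by (intro mult_right_mono) auto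
      then show ?thesis using True * by (simp add: min_def)
    next
      case False
      then have "(1 + C\<^sup>2) * min (z\<^sup>2) 1 = 1 + C\<^sup>2" by (simp add: min_def)
      then show ?thesis by (simp only:) (rule min.coboundedI2, simp)
    qed
    then show ?thesis using True by simp
  next
    case False
    then have "simple_fun F s = 0" using A(2)[of s] by blast
    then show ?thesis using False by simp
  qed
  have "N (\<lambda>s. simple_fun F s * indicator B s) \<le> (\<integral>\<^sup>+(s, z). ennreal (1 + C\<^sup>2) * (indicator A s * ennreal (min (z\<^sup>2) 1)) \<partial>\<mu>)"
    unfolding N_def
  proof (intro nn_integral_mono, clarify)
    fix s z
    show "ennreal (min (\<bar>simple_fun F s * indicator B s * z\<bar>\<^sup>2) 1) \<le> ennreal (1 + C\<^sup>2) * (indicator A s * ennreal (min (z\<^sup>2) 1))"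
      using ennreal_leI[OF pw[of s z]] by (simp add: ennreal_mult ennreal_indicator)
  qed
  also have "\<dots> = (\<integral>\<^sup>+s. \<integral>\<^sup>+z. ennreal (1 + C\<^sup>2) * (indicator A s * ennreal (min (z\<^sup>2) 1)) \<partial>\<nu> \<partial>leb)"
    unfolding jump_intensity_def using A'(1)
    by (subst nu.nn_integral_fst[symmetric]) auto
  also have "\<dots> = ennreal (1 + C\<^sup>2) * (emeasure leb A * (\<integral>\<^sup>+z. ennreal (min (z\<^sup>2) 1) \<partial>\<nu>))"
    using A'(1) by (simp add: nn_integral_cmult nn_integral_multc)
  also have "\<dots> < \<top>" using A' levy by (simp add: ennreal_mult_less_top levy_measure_def)
  finally show ?thesis by (simp add: L_noise_iff)
qed

text \<open>In the exponent the compensator is purely imaginary, so the real part is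
  \<open>- Q\<close>. The imaginary part is odd in z and integrates to 0.\<close>

lemma simple_integral_char:
  assumes F: "simple_list F" and B[measurable]: "B \<in> sets borel"
  shows "expectation (\<lambda>\<omega>. cos (simple_integral X F B \<omega>)) = exp (- Q (\<lambda>s. simple_fun F s * indicator B s))"
proof -
  let ?f = "\<lambda>s. simple_fun F s * indicator B s"
  define h where "h = (\<lambda>(s, z). ?f s * z * indicator {z. \<bar>z\<bar> \<le> 1} z)"
  define g where "g = (\<lambda>(s, z). ?f s * z * indicator {z. \<bar>z\<bar> > 1} z)"
  obtain Z where Z: "has_compensated_integral M \<mu> J h Z" "AE \<omega> in M. simple_integral X F B \<omega> = Z \<omega> + (\<integral>e. g e \<partial>J \<omega>)"
    using simple_integral_decomp[OF F B] unfolding h_def g_def by blast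
  have [measurable]: "simple_fun F \<in> borel_measurable borel" using F by simp
  have [measurable]: "fst \<in> borel_measurable (leb \<Otimes>\<^sub>M borel)"
    by (rule measurable_compose[OF measurable_fst]) simp
  have g[measurable]: "g \<in> borel_measurable \<mu>" unfolding g_def by measurable
  obtain A where A: "A \<in> noise_sets S" "\<And>s. simple_fun F s \<noteq> 0 \<Longrightarrow> s \<in> A" using simple_fun_support[OF F] by blast
  have gfin: "emeasure \<mu> {e \<in> space \<mu>. g e \<noteq> 0} < \<top>"
    by (rule large_jumps_finite[OF A(1)]) (use A(2) in \<open>auto simp: g_def indicator_def split: if_splits\<close>)
  have h: "h \<in> borel_measurable \<mu>" "integrable \<mu> (\<lambda>e. (h e)\<^sup>2)" and [measurable]: "Z \<in> borel_measurable M"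
    using Z(1) unfolding has_compensated_integral_def by auto
  let ?\<Psi> = "\<lambda>e. iexp (h e + g e) - 1 - \<i> * h e"
  have int: "complex_integrable \<mu> ?\<Psi>" by (rule compensated_integrable[OF h g gfin])
  have hg: "h (s, z) + g (s, z) = ?f s * z" for s z by (auto simp: h_def g_def indicator_def)
  have "Im (CLINT e|\<mu>. ?\<Psi> e) = (\<integral>e. Im (?\<Psi> e) \<partial>\<mu>)" by (rule integral_Im[OF int, symmetric])
  also have "\<dots> = 0"
  proof (rule integral_mu_odd)
    show "integrable \<mu> (\<lambda>e. Im (?\<Psi> e))" using int by (rule integrable_Im)
    fix s z
    have "h (s, - z) = - h (s, z)" by (simp add: h_def indicator_def)
    then show "Im (?\<Psi> (s, - z)) = - Im (?\<Psi> (s, z))" unfolding hg by (simp add: Im_exp)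
  qed
  finally have Im: "Im (CLINT e|\<mu>. ?\<Psi> e) = 0" .
  have "Re (CLINT e|\<mu>. ?\<Psi> e) = (\<integral>e. Re (?\<Psi> e) \<partial>\<mu>)" by (rule integral_Re[OF int, symmetric])
  also have "\<dots> = (\<integral>e. - (case e of (s, z) \<Rightarrow> 1 - cos (?f s * z)) \<partial>\<mu>)"
  proof (rule Bochner_Integration.integral_cong[OF refl])
    fix e :: "(real ^ 'd) \<times> real"
    obtain s z where e: "e = (s, z)" by (cases e)
    show "Re (?\<Psi> e) = - (case e of (s, z) \<Rightarrow> 1 - cos (?f s * z))" unfolding e hg by (simp add: Re_exp)
  qed
  also have "\<dots> = - Q ?f" unfolding Q_def by (rule Bochner_Integration.integral_minus)
  finally have Re: "Re (CLINT e|\<mu>. ?\<Psi> e) = - Q ?f" .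
  have eq: "(CLINT e|\<mu>. ?\<Psi> e) = complex_of_real (- Q ?f)"
    using Re Im by (simp add: complex_eq_iff)
  have sm: "simple_integral X F B \<in> borel_measurable M" by (rule simple_integral_measurable[OF F B])
  have "(CLINT \<omega>|M. iexp (simple_integral X F B \<omega>)) = (CLINT \<omega>|M. iexp (Z \<omega> + (\<integral>e. g e \<partial>J \<omega>)))"
    by (rule Bochner_Integration.integral_cong_AE) (use Z(2) sm in auto)
  also have "\<dots> = exp (CLINT e|\<mu>. ?\<Psi> e)" by (rule iexp_compensated[OF Z(1) g gfin])
  also have "\<dots> = complex_of_real (exp (- Q ?f))" unfolding eq by (simp only: exp_of_real)
  finally have "Re (CLINT \<omega>|M. iexp (simple_integral X F B \<omega>)) = exp (- Q ?f)" by simp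
  moreover have int': "complex_integrable M (\<lambda>\<omega>. iexp (simple_integral X F B \<omega>))"
    by (rule integrable_const_bound[where B = 1]) (use sm in auto)
  moreover have "Re (CLINT \<omega>|M. iexp (simple_integral X F B \<omega>)) = expectation (\<lambda>\<omega>. Re (iexp (simple_integral X F B \<omega>)))"
    by (rule integral_Re[OF int', symmetric])
  ultimately show ?thesis by (simp add: Re_exp)
qed

end

section \<open>Two-sided control between random variables and integrands\<close>

lemma pdist_diff_le:
  assumes [measurable]: "A \<in> borel_measurable M" "B \<in> borel_measurable M" "C \<in> borel_measurable M" "D \<in> borel_measurable M"
  shows "pdist M (\<lambda>\<omega>. A \<omega> - B \<omega>) (\<lambda>\<omega>. C \<omega> - D \<omega>) \<le> pdist M A C + pdist M B D"
  unfolding pdist_def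
  by (subst nn_integral_add[symmetric])
    (auto intro!: nn_integral_mono simp: ennreal_plus[symmetric] ennreal_leI simp del: ennreal_plus)

lemma abs_cos_diff_le: "\<bar>cos a - cos b\<bar> \<le> \<bar>a - b :: real\<bar>"
proof -
  have "cmod (iexp a - iexp b) \<le> \<bar>a - b\<bar>" by (rule cmod_iexp_diff_le)
  moreover have "\<bar>Re (iexp a - iexp b)\<bar> \<le> cmod (iexp a - iexp b)" by (rule abs_Re_le_cmod)
  ultimately show ?thesis by (simp add: Re_exp)
qed

text \<open>Addition formula for cos ((a - b) + b). Each term keeps a truncated factor in a - b, and
  the cross term is a product of truncated absolute values, so Cauchy-Schwarz bounds its integral by
  the square root of two modulars.\<close>

lemma abs_cos_diff_le_min:
  "\<bar>cos a - cos b\<bar> \<le> 2 * min ((a - b)\<^sup>2) 1 + min \<bar>a - b\<bar> 1 * min \<bar>b :: real\<bar> 1"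
proof -
  have sin_le: "\<bar>sin x\<bar> \<le> min \<bar>x\<bar> 1" for x :: real
    using abs_sin_x_le_abs_x[of x] abs_sin_le_one[of x] by simp
  have "cos a = cos (a - b + b)" by simp
  also have "\<dots> = cos (a - b) * cos b - sin (a - b) * sin b" by (rule cos_add)
  finally have "\<bar>cos a - cos b\<bar> = \<bar>- ((1 - cos (a - b)) * cos b) - sin (a - b) * sin b\<bar>"
    by (simp add: algebra_simps)
  also have "\<dots> \<le> \<bar>(1 - cos (a - b)) * cos b\<bar> + \<bar>sin (a - b) * sin b\<bar>" by linarith
  also have "\<dots> \<le> (2 * min ((a - b)\<^sup>2) 1) * 1 + min \<bar>a - b\<bar> 1 * min \<bar>b\<bar> 1"
    unfolding abs_mult
    by (intro add_mono mult_mono sin_le) (auto simp: one_minus_cos_le)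
  finally show ?thesis by simp
qed

lemma min_square_le_abs: "min (x\<^sup>2) 1 \<le> min 1 \<bar>x :: real\<bar>"
proof (cases "\<bar>x\<bar> \<le> 1")
  case True
  then have "\<bar>x\<bar> * \<bar>x\<bar> \<le> \<bar>x\<bar> * 1" by (intro mult_left_mono) auto
  then have "x\<^sup>2 \<le> \<bar>x\<bar>" by (simp add: power2_eq_square)
  then show ?thesis using True by (simp add: min_def)
qed (simp add: min_def)

lemma simple_fun_append: "simple_fun (F @ G) s = simple_fun F s + simple_fun G s"
  by (simp add: simple_fun_def)

lemma simple_integral_append: "simple_integral X (F @ G) B \<omega> = simple_integral X F B \<omega> + simple_integral X G B \<omega>"
  by (simp add: simple_integral_def)

definition scale_list :: "real \<Rightarrow> (real \<times> 'e set) list \<Rightarrow> (real \<times> 'e set) list" where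
  "scale_list u F = map (\<lambda>(c, A). (u * c, A)) F"

lemma simple_fun_scale: "simple_fun (scale_list u F) s = u * simple_fun F s"
  by (induction F) (auto simp: simple_fun_def scale_list_def algebra_simps)

lemma simple_integral_scale: "simple_integral X (scale_list u F) B \<omega> = u * simple_integral X F B \<omega>"
  by (induction F) (auto simp: simple_integral_def scale_list_def algebra_simps)

context levy_noise
begin

lemma simple_list_scale [simp]: "simple_list F \<Longrightarrow> simple_list (scale_list u F)"
  by (auto simp: simple_list_def scale_list_def)

lemma simple_list_append [simp]: "simple_list (F @ G) \<longleftrightarrow> simple_list F \<and> simple_list G"
  by (auto simp: simple_list_def)

text \<open>The imaginary part vanishes by symmetry, and \<open>u \<in> [0, 1]\<close> suffices for the estimates that
  relate \<open>Z\<close> and \<open>N f\<close>.\<close>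

definition charac :: "('w \<Rightarrow> real) \<Rightarrow> (real ^ 'd \<Rightarrow> real) \<Rightarrow> bool" where
  "charac Z f \<longleftrightarrow> Z \<in> borel_measurable M \<and> f \<in> L_noise S \<nu> \<and>
    (\<forall>u\<in>{0..1}. expectation (\<lambda>\<omega>. cos (u * Z \<omega>)) = exp (- Q (\<lambda>s. u * f s)))"

lemma characD:
  assumes "charac Z f"
  shows "Z \<in> borel_measurable M" "f \<in> borel_measurable leb" "N f < \<top>"
    "\<And>u. 0 \<le> u \<Longrightarrow> u \<le> 1 \<Longrightarrow> expectation (\<lambda>\<omega>. cos (u * Z \<omega>)) = exp (- Q (\<lambda>s. u * f s))"
  using assms by (auto simp: charac_def L_noise_iff)

lemma N_cong: "(\<And>s. s \<in> S \<Longrightarrow> f s = g s) \<Longrightarrow> N f = N g"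
  by (intro antisym N_mono) auto

lemma Q_cong: "(\<And>s. s \<in> S \<Longrightarrow> f s = g s) \<Longrightarrow> Q f = Q g"
  unfolding Q_def by (intro Bochner_Integration.integral_cong) auto

lemma charac_cong:
  assumes "\<And>s. s \<in> S \<Longrightarrow> f s = g s"
  shows "charac Z f \<longleftrightarrow> charac Z g"
proof -
  have "Q (\<lambda>s. u * f s) = Q (\<lambda>s. u * g s)" for u by (rule Q_cong) (simp add: assms)
  moreover have "f \<in> borel_measurable leb \<longleftrightarrow> g \<in> borel_measurable leb"
    by (rule measurable_cong) (simp add: assms)
  ultimately show ?thesis unfolding charac_def L_noise_iff using N_cong[OF assms] by simp
qed

lemma charac_simple:
  assumes F: "simple_list F" and B: "B \<in> sets borel"
  shows "charac (simple_integral X F B) (\<lambda>s. simple_fun F s * indicator B s)"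
  unfolding charac_def
proof (intro conjI ballI)
  show "simple_integral X F B \<in> borel_measurable M" by (rule simple_integral_measurable[OF F B])
  show "(\<lambda>s. simple_fun F s * indicator B s) \<in> L_noise S \<nu>" by (rule simple_fun_L_noise[OF F B])
  fix u :: real
  show "expectation (\<lambda>\<omega>. cos (u * simple_integral X F B \<omega>)) = exp (- Q (\<lambda>s. u * (simple_fun F s * indicator B s)))"
    using simple_integral_char[OF simple_list_scale[OF F, of u] B]
    by (simp add: simple_integral_scale simple_fun_scale mult.assoc)
qed

lemma charac_simple_diff:
  assumes "simple_list F" "simple_list G" "B \<in> sets borel"
  shows "charac (\<lambda>\<omega>. simple_integral X F B \<omega> - simple_integral X G B \<omega>)
    (\<lambda>s. (simple_fun F s - simple_fun G s) * indicator B s)"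
proof -
  have "simple_integral X (F @ scale_list (-1) G) B = (\<lambda>\<omega>. simple_integral X F B \<omega> - simple_integral X G B \<omega>)"
    by (simp add: fun_eq_iff simple_integral_append simple_integral_scale)
  then show ?thesis
    using charac_simple[of "F @ scale_list (-1) G" B] assms by (simp add: simple_fun_append simple_fun_scale)
qed

text \<open>Averaging over frequencies in [0, 1] costs the factor 10, and 1 - exp (- Q) \<le> Q
  \<le> 2 N gives the factor 2. The square on the left comes from Cauchy-Schwarz on the probability
  space.\<close>

lemma charac_pdist_le:
  assumes "charac Z f"
  shows "(pdist M Z (\<lambda>_. 0))\<^sup>2 \<le> 20 * N f"
proof -
  note c = characD[OF assms]
  have [measurable]: "Z \<in> borel_measurable M" "f \<in> borel_measurable leb" using c by auto
  interpret prod_u: pair_sigma_finite M "lborel :: real measure" ..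
  have "(pdist M Z (\<lambda>_. 0))\<^sup>2 \<le> (\<integral>\<^sup>+\<omega>. (ennreal (min 1 \<bar>Z \<omega>\<bar>))\<^sup>2 \<partial>M)"
    using Cauchy_Schwarz_nn_integral[of "\<lambda>\<omega>. ennreal (min 1 \<bar>Z \<omega>\<bar>)" M "\<lambda>_. 1"]
    by (simp add: pdist_def emeasure_space_1)
  also have "\<dots> = (\<integral>\<^sup>+\<omega>. ennreal (min ((Z \<omega>)\<^sup>2) 1) \<partial>M)"
  proof (rule nn_integral_cong)
    fix \<omega>
    have "(min 1 \<bar>Z \<omega>\<bar>)\<^sup>2 = min ((Z \<omega>)\<^sup>2) 1"
      by (auto simp: min_def abs_square_le_1 power2_le_iff_abs_le)
    then show "(ennreal (min 1 \<bar>Z \<omega>\<bar>))\<^sup>2 = ennreal (min ((Z \<omega>)\<^sup>2) 1)" by (simp add: ennreal_power)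
  qed
  also have "\<dots> \<le> (\<integral>\<^sup>+\<omega>. 10 * (\<integral>\<^sup>+u. ennreal (1 - cos (u * Z \<omega>)) * indicator {0..1} u \<partial>lborel) \<partial>M)"
    by (intro nn_integral_mono averaged_one_minus_cos_ge)
  also have "\<dots> = 10 * (\<integral>\<^sup>+\<omega>. (\<integral>\<^sup>+u. ennreal (1 - cos (u * Z \<omega>)) * indicator {0..1} u \<partial>lborel) \<partial>M)"
    by (rule nn_integral_cmult) measurable
  also have "\<dots> = 10 * (\<integral>\<^sup>+u. (\<integral>\<^sup>+\<omega>. ennreal (1 - cos (u * Z \<omega>)) * indicator {0..1} u \<partial>M) \<partial>lborel)"
    by (subst prod_u.Fubini') auto
  also have "\<dots> \<le> 10 * (\<integral>\<^sup>+u. 2 * N f * indicator {0..1} u \<partial>(lborel :: real measure))"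
  proof (intro mult_left_mono nn_integral_mono)
    fix u :: real
    show "(\<integral>\<^sup>+\<omega>. ennreal (1 - cos (u * Z \<omega>)) * indicator {0..1} u \<partial>M) \<le> 2 * N f * indicator {0..1} u"
    proof (cases "u \<in> {0..1}")
      case True
      then have u: "0 \<le> u" "u \<le> 1" by auto
      have Nu: "N (\<lambda>s. u * f s) \<le> N f" using N_cmult_le[OF u] .
      have int: "integrable M (\<lambda>\<omega>. cos (u * Z \<omega>))" by (rule integrable_const_bound[where B = 1]) auto
      have "(\<integral>\<^sup>+\<omega>. ennreal (1 - cos (u * Z \<omega>)) \<partial>M) = ennreal (expectation (\<lambda>\<omega>. 1 - cos (u * Z \<omega>)))"
        by (rule nn_integral_eq_integral) (use int in auto)
      also have "expectation (\<lambda>\<omega>. 1 - cos (u * Z \<omega>)) = 1 - exp (- Q (\<lambda>s. u * f s))"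
        using int by (simp add: prob_space c(4)[OF u])
      also have "\<dots> \<le> Q (\<lambda>s. u * f s)" using exp_ge_add_one_self[of "- Q (\<lambda>s. u * f s)"] by linarith
      also have "ennreal (Q (\<lambda>s. u * f s)) \<le> 2 * N (\<lambda>s. u * f s)"
        by (rule Q_integrable) (use Nu c(3) in auto)
      also have "\<dots> \<le> 2 * N f" using Nu by (intro mult_left_mono) auto
      finally show ?thesis using True by (simp add: ennreal_leI)
    qed simp
  qed simp
  also have "\<dots> = 20 * N f"
    by (subst nn_integral_cmult_indicator) (auto simp: mult.assoc[symmetric])
  finally show ?thesis .
qed

text \<open>The converse estimate. Smallness of Z gives 1 - exp (- Q) \<le> 2 \<eta> at each
  frequency in [0, 1]; for \<eta> \<le> 1/4 this inverts to Q \<le> 4 \<eta>, and averaging over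
  frequencies costs the factor 10.\<close>

lemma charac_N_le:
  assumes "charac Z f" and \<eta>: "pdist M Z (\<lambda>_. 0) \<le> ennreal \<eta>" "0 \<le> \<eta>" "\<eta> \<le> 1/4"
  shows "N f \<le> ennreal (40 * \<eta>)"
proof -
  note c = characD[OF assms(1)]
  have [measurable]: "Z \<in> borel_measurable M" "f \<in> borel_measurable leb" using c by auto
  have [measurable]: "fst \<in> borel_measurable (leb \<Otimes>\<^sub>M borel)"
    by (rule measurable_compose[OF measurable_fst]) simp
  interpret prod_u: pair_sigma_finite \<mu> "lborel :: real measure"
  proof
    show "\<exists>A. countable A \<and> A \<subseteq> sets \<mu> \<and> \<Union>A = space \<mu> \<and> (\<forall>a\<in>A. emeasure \<mu> a \<noteq> \<infinity>)"
      unfolding jump_intensity_def by (rule pair.sigma_finite_countable)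
  qed
  have q: "Q (\<lambda>s. u * f s) \<le> 4 * \<eta>" if u: "0 \<le> u" "u \<le> 1" for u
  proof -
    have int: "integrable M (\<lambda>\<omega>. cos (u * Z \<omega>))" by (rule integrable_const_bound[where B = 1]) auto
    have "ennreal (expectation (\<lambda>\<omega>. 1 - cos (u * Z \<omega>))) = (\<integral>\<^sup>+\<omega>. ennreal (1 - cos (u * Z \<omega>)) \<partial>M)"
      by (rule nn_integral_eq_integral[symmetric]) (use int in auto)
    also have "\<dots> \<le> (\<integral>\<^sup>+\<omega>. 2 * ennreal (min 1 \<bar>Z \<omega> - 0\<bar>) \<partial>M)"
    proof (rule nn_integral_mono)
      fix \<omega>
      have "1 - cos (u * Z \<omega>) \<le> 2 * min ((u * Z \<omega>)\<^sup>2) 1" by (rule one_minus_cos_le)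
      also have "min ((u * Z \<omega>)\<^sup>2) 1 \<le> min 1 \<bar>u * Z \<omega>\<bar>"
        by (rule min_square_le_abs)
      also have "\<dots> \<le> min 1 \<bar>Z \<omega>\<bar>" using u by (intro min.mono) (auto simp: abs_mult mult_left_le_one_le)
      finally have "ennreal (1 - cos (u * Z \<omega>)) \<le> ennreal (2 * min 1 \<bar>Z \<omega>\<bar>)" by (simp add: ennreal_leI)
      then show "ennreal (1 - cos (u * Z \<omega>)) \<le> 2 * ennreal (min 1 \<bar>Z \<omega> - 0\<bar>)" by (simp add: ennreal_mult)
    qed
    also have "\<dots> = 2 * pdist M Z (\<lambda>_. 0)" unfolding pdist_def by (rule nn_integral_cmult) simp
    also have "\<dots> \<le> 2 * ennreal \<eta>" using \<eta> by (intro mult_left_mono) auto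
    also have "\<dots> = ennreal (2 * \<eta>)" using \<eta> by (simp add: ennreal_mult)
    finally have "expectation (\<lambda>\<omega>. 1 - cos (u * Z \<omega>)) \<le> 2 * \<eta>" using \<eta>(2) by (simp add: ennreal_le_iff)
    then have e: "1 - 2 * \<eta> \<le> exp (- Q (\<lambda>s. u * f s))" using int by (simp add: prob_space c(4)[OF u])
    have Q0: "Q (\<lambda>s. u * f s) \<ge> 0"
      by (rule Q_integrable) (use le_less_trans[OF N_cmult_le[OF u, of f] c(3)] in auto)
    \<comment> \<open>Inversion without logarithms: 1 + Q \<le> exp Q and 1 - 2 \<eta> \<le> exp (-
      Q) have a product of at most 1.\<close>
    have "(1 + Q (\<lambda>s. u * f s)) * (1 - 2 * \<eta>) \<le> exp (Q (\<lambda>s. u * f s)) * exp (- Q (\<lambda>s. u * f s))"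
      by (intro mult_mono e) (use \<eta> Q0 in auto)
    also have "\<dots> = 1" by (simp add: exp_minus)
    finally have "Q (\<lambda>s. u * f s) * (1 - 2 * \<eta>) \<le> 2 * \<eta>" by (simp add: algebra_simps)
    moreover have "Q (\<lambda>s. u * f s) * (1 / 2) \<le> Q (\<lambda>s. u * f s) * (1 - 2 * \<eta>)"
      by (rule mult_left_mono) (use \<eta> Q0 in auto)
    ultimately show ?thesis by simp
  qed
  have "N f \<le> (\<integral>\<^sup>+e. 10 * (\<integral>\<^sup>+u. ennreal (1 - cos (u * (f (fst e) * snd e))) * indicator {0..1} u \<partial>lborel) \<partial>\<mu>)"
    unfolding N_def case_prod_beta power2_abs by (intro nn_integral_mono averaged_one_minus_cos_ge)
  also have "\<dots> = 10 * (\<integral>\<^sup>+e. (\<integral>\<^sup>+u. ennreal (1 - cos (u * (f (fst e) * snd e))) * indicator {0..1} u \<partial>lborel) \<partial>\<mu>)"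
    by (rule nn_integral_cmult) measurable
  also have "\<dots> = 10 * (\<integral>\<^sup>+u. (\<integral>\<^sup>+e. ennreal (1 - cos (u * (f (fst e) * snd e))) * indicator {0..1} u \<partial>\<mu>) \<partial>lborel)"
    by (subst prod_u.Fubini') auto
  also have "\<dots> \<le> 10 * (\<integral>\<^sup>+u. ennreal (4 * \<eta>) * indicator {0..1} u \<partial>(lborel :: real measure))"
  proof (intro mult_left_mono nn_integral_mono)
    fix u :: real
    show "(\<integral>\<^sup>+e. ennreal (1 - cos (u * (f (fst e) * snd e))) * indicator {0..1} u \<partial>\<mu>) \<le> ennreal (4 * \<eta>) * indicator {0..1} u"
    proof (cases "u \<in> {0..1}")
      case True
      then have u: "0 \<le> u" "u \<le> 1" by auto
      have "(\<integral>\<^sup>+e. ennreal (1 - cos (u * (f (fst e) * snd e))) \<partial>\<mu>) = ennreal (Q (\<lambda>s. u * f s))"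
        by (subst Q_integrable(2)) (use le_less_trans[OF N_cmult_le[OF u, of f] c(3)] in \<open>auto simp: case_prod_beta' mult.assoc\<close>)
      also have "\<dots> \<le> ennreal (4 * \<eta>)" using q[OF u] by (rule ennreal_leI)
      finally show ?thesis using True by simp
    qed simp
  qed simp
  also have "\<dots> = ennreal (40 * \<eta>)"
    using \<eta>(2) by (subst nn_integral_cmult_indicator) (auto simp: ennreal_mult mult.assoc[symmetric])
  finally show ?thesis .
qed

text \<open>The second-order part of the cosine difference is the modular of the difference; the
  cross term is handled by Cauchy-Schwarz against the fixed finite modular of f.\<close>

lemma Q_tendsto:
  assumes [measurable]: "\<And>n. fs n \<in> borel_measurable leb" "f \<in> borel_measurable leb"
    and fin: "\<And>n. N (fs n) < \<top>" "N f < \<top>" and lim: "(\<lambda>n. N (\<lambda>s. fs n s - f s)) \<longlonglongrightarrow> 0"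
  shows "(\<lambda>n. Q (fs n)) \<longlonglongrightarrow> Q f"
  unfolding Q_def
proof (rule tendsto_L1_int)
  have [measurable]: "fst \<in> borel_measurable (leb \<Otimes>\<^sub>M borel)"
    by (rule measurable_compose[OF measurable_fst]) simp
  let ?C = "\<lambda>n. \<integral>\<^sup>+e. ennreal (min \<bar>fs n (fst e) * snd e - f (fst e) * snd e\<bar> 1) * ennreal (min \<bar>f (fst e) * snd e\<bar> 1) \<partial>\<mu>"
  have sq: "(ennreal (min \<bar>x\<bar> 1))\<^sup>2 = ennreal (min (\<bar>x\<bar>\<^sup>2) 1)" for x :: real
  proof -
    have "(min \<bar>x\<bar> 1)\<^sup>2 = min (\<bar>x\<bar>\<^sup>2) 1" by (auto simp: min_def abs_square_le_1 power2_le_iff_abs_le)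
    then show ?thesis by (simp add: ennreal_power)
  qed
  have C: "?C \<longlonglongrightarrow> 0"
  proof (rule ennreal_sq_tendsto_0[OF _ fin(2) lim])
    fix n
    have "(?C n)\<^sup>2 \<le> (\<integral>\<^sup>+e. (ennreal (min \<bar>fs n (fst e) * snd e - f (fst e) * snd e\<bar> 1))\<^sup>2 \<partial>\<mu>) * (\<integral>\<^sup>+e. (ennreal (min \<bar>f (fst e) * snd e\<bar> 1))\<^sup>2 \<partial>\<mu>)"
      by (rule Cauchy_Schwarz_nn_integral) measurable
    also have "\<dots> = N (\<lambda>s. fs n s - f s) * N f"
      unfolding sq N_def case_prod_beta left_diff_distrib ..
    finally show "(?C n)\<^sup>2 \<le> N f * N (\<lambda>s. fs n s - f s)" by (simp add: mult.commute)
  qed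
  have L: "(\<lambda>n. 2 * N (\<lambda>s. fs n s - f s) + ?C n) \<longlonglongrightarrow> 0"
    using tendsto_add[OF ennreal_tendsto_cmult[OF _ lim, of 2] C] by simp
  show "(\<lambda>n. \<integral>\<^sup>+e. ennreal (norm ((case e of (s, z) \<Rightarrow> 1 - cos (fs n s * z)) - (case e of (s, z) \<Rightarrow> 1 - cos (f s * z)))) \<partial>\<mu>) \<longlonglongrightarrow> 0"
  proof (rule tendsto_sandwich[OF _ _ tendsto_const L])
    show "\<forall>\<^sub>F n in sequentially. (\<integral>\<^sup>+e. ennreal (norm ((case e of (s, z) \<Rightarrow> 1 - cos (fs n s * z)) - (case e of (s, z) \<Rightarrow> 1 - cos (f s * z)))) \<partial>\<mu>)
       \<le> 2 * N (\<lambda>s. fs n s - f s) + ?C n"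
    proof (intro always_eventually allI)
      fix n
      have "(\<integral>\<^sup>+e. ennreal (norm ((case e of (s, z) \<Rightarrow> 1 - cos (fs n s * z)) - (case e of (s, z) \<Rightarrow> 1 - cos (f s * z)))) \<partial>\<mu>)
        \<le> (\<integral>\<^sup>+e. 2 * ennreal (min (\<bar>(fs n (fst e) - f (fst e)) * snd e\<bar>\<^sup>2) 1) +
           ennreal (min \<bar>fs n (fst e) * snd e - f (fst e) * snd e\<bar> 1) * ennreal (min \<bar>f (fst e) * snd e\<bar> 1) \<partial>\<mu>)"
      proof (rule nn_integral_mono)
        fix e :: "(real ^ 'd) \<times> real"
        let ?a = "fs n (fst e) * snd e" and ?b = "f (fst e) * snd e"
        have "ennreal \<bar>cos ?a - cos ?b\<bar> \<le> ennreal (2 * min ((?a - ?b)\<^sup>2) 1 + min \<bar>?a - ?b\<bar> 1 * min \<bar>?b\<bar> 1)"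
          by (rule ennreal_leI[OF abs_cos_diff_le_min])
        also have "\<dots> = 2 * ennreal (min ((?a - ?b)\<^sup>2) 1) + ennreal (min \<bar>?a - ?b\<bar> 1) * ennreal (min \<bar>?b\<bar> 1)"
          by (subst ennreal_plus) (auto simp: ennreal_mult)
        finally show "ennreal (norm ((case e of (s, z) \<Rightarrow> 1 - cos (fs n s * z)) - (case e of (s, z) \<Rightarrow> 1 - cos (f s * z)))) \<le>
          2 * ennreal (min (\<bar>(fs n (fst e) - f (fst e)) * snd e\<bar>\<^sup>2) 1) + ennreal (min \<bar>?a - ?b\<bar> 1) * ennreal (min \<bar>?b\<bar> 1)"
          unfolding left_diff_distrib power2_abs by (simp add: case_prod_beta abs_minus_commute[of "cos ?b"])
      qed
      also have "\<dots> = 2 * N (\<lambda>s. fs n s - f s) + ?C n"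
        unfolding N_def case_prod_beta
        by (subst nn_integral_add) (auto simp: nn_integral_cmult)
      finally show "(\<integral>\<^sup>+e. ennreal (norm ((case e of (s, z) \<Rightarrow> 1 - cos (fs n s * z)) - (case e of (s, z) \<Rightarrow> 1 - cos (f s * z)))) \<partial>\<mu>)
       \<le> 2 * N (\<lambda>s. fs n s - f s) + ?C n" .
    qed
  qed simp
qed (use Q_integrable(1) fin in auto)

text \<open>Convergence in probability passes to expectations of cosines, which are bounded and
  Lipschitz; convergence for \<open>N\<close> passes to the exponents.\<close>

lemma charac_limit:
  assumes c: "\<And>n. charac (Zs n) (fs n)" and Z[measurable]: "Z \<in> borel_measurable M" and f: "f \<in> L_noise S \<nu>"
    and Zlim: "(\<lambda>n. pdist M (Zs n) Z) \<longlonglongrightarrow> 0" and flim: "(\<lambda>n. N (\<lambda>s. fs n s - f s)) \<longlonglongrightarrow> 0"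
  shows "charac Z f"
  unfolding charac_def
proof (intro conjI ballI Z f)
  have [measurable]: "Zs n \<in> borel_measurable M" "fs n \<in> borel_measurable leb" for n using characD(1,2)[OF c[of n]] by auto
  have [measurable]: "f \<in> borel_measurable leb" and ffin: "N f < \<top>" using f by (auto simp: L_noise_iff)
  fix u :: real assume "u \<in> {0..1}"
  then have u: "0 \<le> u" "u \<le> 1" by auto
  have Nu: "N (\<lambda>s. u * g s) < \<top>" if "N g < \<top>" for g using N_cmult_le[OF u, of g] that by simp
  have "(\<lambda>n. Q (\<lambda>s. u * fs n s)) \<longlonglongrightarrow> Q (\<lambda>s. u * f s)"
  proof (rule Q_tendsto)
    show "(\<lambda>n. N (\<lambda>s. u * fs n s - u * f s)) \<longlonglongrightarrow> 0"
      by (rule tendsto_sandwich[OF _ _ tendsto_const flim])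
        (use N_cmult_le[OF u] in \<open>auto simp: right_diff_distrib[symmetric]\<close>)
  qed (use Nu characD(3)[OF c] ffin in auto)
  then have 1: "(\<lambda>n. exp (- Q (\<lambda>s. u * fs n s))) \<longlonglongrightarrow> exp (- Q (\<lambda>s. u * f s))" by (intro tendsto_intros)
  have "(\<lambda>n. expectation (\<lambda>\<omega>. cos (u * Zs n \<omega>))) \<longlonglongrightarrow> expectation (\<lambda>\<omega>. cos (u * Z \<omega>))"
  proof (rule tendsto_L1_int)
    have L: "(\<lambda>n. 2 * pdist M (Zs n) Z) \<longlonglongrightarrow> 0" using ennreal_tendsto_cmult[OF _ Zlim, of 2] by simp
    show "(\<lambda>n. \<integral>\<^sup>+\<omega>. ennreal (norm (cos (u * Zs n \<omega>) - cos (u * Z \<omega>))) \<partial>M) \<longlonglongrightarrow> 0"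
    proof (rule tendsto_sandwich[OF _ _ tendsto_const L])
      show "\<forall>\<^sub>F n in sequentially. (\<integral>\<^sup>+\<omega>. ennreal (norm (cos (u * Zs n \<omega>) - cos (u * Z \<omega>))) \<partial>M) \<le> 2 * pdist M (Zs n) Z"
      proof (intro always_eventually allI)
        fix n
        have "(\<integral>\<^sup>+\<omega>. ennreal (norm (cos (u * Zs n \<omega>) - cos (u * Z \<omega>))) \<partial>M) \<le> (\<integral>\<^sup>+\<omega>. 2 * ennreal (min 1 \<bar>Zs n \<omega> - Z \<omega>\<bar>) \<partial>M)"
        proof (rule nn_integral_mono)
          fix \<omega>
          let ?a = "u * Zs n \<omega>" and ?b = "u * Z \<omega>"
          have "\<bar>cos ?a - cos ?b\<bar> \<le> \<bar>?a - ?b\<bar>" by (rule abs_cos_diff_le)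
          also have "\<dots> = u * \<bar>Zs n \<omega> - Z \<omega>\<bar>" using u by (simp add: right_diff_distrib[symmetric] abs_mult)
          also have "\<dots> \<le> \<bar>Zs n \<omega> - Z \<omega>\<bar>" using u by (simp add: mult_left_le_one_le)
          finally have "\<bar>cos ?a - cos ?b\<bar> \<le> \<bar>Zs n \<omega> - Z \<omega>\<bar>" .
          moreover have "\<bar>cos ?a - cos ?b\<bar> \<le> 2"
            using cos_le_one[of ?a] cos_ge_minus_one[of ?a] cos_le_one[of ?b] cos_ge_minus_one[of ?b] by linarith
          moreover have "x \<le> 2 * min 1 d" if "x \<le> d" "x \<le> 2" "0 \<le> d" for x d :: real
            using that by (auto simp: min_def)
          ultimately have "\<bar>cos ?a - cos ?b\<bar> \<le> 2 * min 1 \<bar>Zs n \<omega> - Z \<omega>\<bar>" by simp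
          then show "ennreal (norm (cos ?a - cos ?b)) \<le> 2 * ennreal (min 1 \<bar>Zs n \<omega> - Z \<omega>\<bar>)"
            using ennreal_leI by (fastforce simp: ennreal_mult)
        qed
        also have "\<dots> = 2 * pdist M (Zs n) Z" unfolding pdist_def by (rule nn_integral_cmult) measurable
        finally show "(\<integral>\<^sup>+\<omega>. ennreal (norm (cos (u * Zs n \<omega>) - cos (u * Z \<omega>))) \<partial>M) \<le> 2 * pdist M (Zs n) Z" .
      qed
    qed simp
  qed (auto intro!: integrable_const_bound[where B = 1])
  then have "(\<lambda>n. exp (- Q (\<lambda>s. u * fs n s))) \<longlonglongrightarrow> expectation (\<lambda>\<omega>. cos (u * Z \<omega>))"
    using characD(4)[OF c u] by simp
  with 1 show "expectation (\<lambda>\<omega>. cos (u * Z \<omega>)) = exp (- Q (\<lambda>s. u * f s))" using LIMSEQ_unique by blast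
qed


section \<open>The stochastic integral: linearity, closedness and existence\<close>

lemma pdist_zero: "pdist M (\<lambda>\<omega>. A \<omega> - B \<omega>) (\<lambda>_. 0) = pdist M A B"
  by (simp add: pdist_def)

text \<open>\<open>stoch_integral\<close> is a version picked by choice, so linearity has to come
  from the defining relation: differences of approximating lists approximate the difference.\<close>

lemma has_stoch_integral_diff:
  assumes "has_stoch_integral M S X f Z" "has_stoch_integral M S X g W"
  shows "has_stoch_integral M S X (\<lambda>s. f s - g s) (\<lambda>\<omega>. Z \<omega> - W \<omega>)"
proof -
  obtain F where Z[measurable]: "Z \<in> borel_measurable M" and F: "\<And>n. simple_list (F n)"
    "AE s in leb. (\<lambda>n. simple_fun (F n) s) \<longlonglongrightarrow> f s"
    "\<And>B. B \<in> sets borel \<Longrightarrow> B \<subseteq> S \<Longrightarrow> \<exists>V \<in> borel_measurable M. converges_in_prob M (\<lambda>n. simple_integral X (F n) B) V"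
    "converges_in_prob M (\<lambda>n. simple_integral X (F n) S) Z"
    using assms(1) unfolding has_stoch_integral_def simple_list_def by blast
  obtain G where W[measurable]: "W \<in> borel_measurable M" and G: "\<And>n. simple_list (G n)"
    "AE s in leb. (\<lambda>n. simple_fun (G n) s) \<longlonglongrightarrow> g s"
    "\<And>B. B \<in> sets borel \<Longrightarrow> B \<subseteq> S \<Longrightarrow> \<exists>V \<in> borel_measurable M. converges_in_prob M (\<lambda>n. simple_integral X (G n) B) V"
    "converges_in_prob M (\<lambda>n. simple_integral X (G n) S) W"
    using assms(2) unfolding has_stoch_integral_def simple_list_def by blast
  define H where "H = (\<lambda>n. F n @ scale_list (-1) (G n))"
  have H: "simple_list (H n)" for n using F(1) G(1) by (simp add: H_def)
  have Hf: "simple_fun (H n) s = simple_fun (F n) s - simple_fun (G n) s" for n s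
    by (simp add: H_def simple_fun_append simple_fun_scale)
  have Hi: "simple_integral X (H n) B = (\<lambda>\<omega>. simple_integral X (F n) B \<omega> - simple_integral X (G n) B \<omega>)" for n B
    by (simp add: fun_eq_iff H_def simple_integral_append simple_integral_scale)
  have lim: "converges_in_prob M (\<lambda>n. simple_integral X (H n) B) (\<lambda>\<omega>. V1 \<omega> - V2 \<omega>)"
    if B: "B \<in> sets borel" and V[measurable]: "V1 \<in> borel_measurable M" "V2 \<in> borel_measurable M"
      and c: "converges_in_prob M (\<lambda>n. simple_integral X (F n) B) V1" "converges_in_prob M (\<lambda>n. simple_integral X (G n) B) V2"
    for B V1 V2
  proof -
    have [measurable]: "simple_integral X (F n) B \<in> borel_measurable M" "simple_integral X (G n) B \<in> borel_measurable M" for n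
      using simple_integral_measurable[OF F(1) B] simple_integral_measurable[OF G(1) B] by auto
    have "(\<lambda>n. pdist M (simple_integral X (F n) B) V1 + pdist M (simple_integral X (G n) B) V2) \<longlonglongrightarrow> 0"
      using c converges_in_prob_iff_pdist[of "\<lambda>n. simple_integral X (F n) B" V1]
        converges_in_prob_iff_pdist[of "\<lambda>n. simple_integral X (G n) B" V2]
        tendsto_add[of "\<lambda>n. pdist M (simple_integral X (F n) B) V1" 0 sequentially "\<lambda>n. pdist M (simple_integral X (G n) B) V2" 0]
      by simp
    then have "(\<lambda>n. pdist M (simple_integral X (H n) B) (\<lambda>\<omega>. V1 \<omega> - V2 \<omega>)) \<longlonglongrightarrow> 0"
      by (rule tendsto_sandwich[OF _ _ tendsto_const, rotated 2])
        (auto simp: Hi intro!: always_eventually pdist_diff_le)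
    then show ?thesis by (subst converges_in_prob_iff_pdist) (auto simp: Hi)
  qed
  show ?thesis unfolding has_stoch_integral_def
  proof (intro conjI exI[of _ H] allI ballI impI)
    show "case ca of (c, A) \<Rightarrow> A \<in> noise_sets S" if "ca \<in> set (H n)" for n ca
      using H[of n] that unfolding simple_list_def by blast
    show "AE s in leb. (\<lambda>n. simple_fun (H n) s) \<longlonglongrightarrow> f s - g s"
      using F(2) G(2) by eventually_elim (auto simp: Hf intro: tendsto_diff)
    fix B assume "B \<in> sets (borel :: (real ^ 'd) measure)" "B \<subseteq> S"
    then obtain V1 V2 where "V1 \<in> borel_measurable M" "V2 \<in> borel_measurable M"
      "converges_in_prob M (\<lambda>n. simple_integral X (F n) B) V1" "converges_in_prob M (\<lambda>n. simple_integral X (G n) B) V2"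
      using F(3)[of B] G(3)[of B] by blast
    from lim[OF \<open>B \<in> sets borel\<close> this] \<open>V1 \<in> _\<close> \<open>V2 \<in> _\<close>
    show "\<exists>W\<in>borel_measurable M. converges_in_prob M (\<lambda>n. simple_integral X (H n) B) W"
      by (intro bexI[of _ "\<lambda>\<omega>. V1 \<omega> - V2 \<omega>"]) auto
  next
    show "converges_in_prob M (\<lambda>n. simple_integral X (H n) S) (\<lambda>\<omega>. Z \<omega> - W \<omega>)"
      by (rule lim[OF S_borel Z W F(4) G(4)])
  qed simp
qed

text \<open>Fatou's lemma on the product space; almost everywhere convergence in s lifts to
  convergence of the truncated squares \<mu>-almost everywhere.\<close>

lemma N_Fatou:
  assumes [measurable]: "\<And>m. gs m \<in> borel_measurable leb" "g \<in> borel_measurable leb"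
    and lim: "AE s in leb. (\<lambda>m. gs m s) \<longlonglongrightarrow> g s"
    and le: "\<forall>\<^sub>F m in sequentially. N (gs m) \<le> c"
  shows "N g \<le> c"
proof -
  have [measurable]: "fst \<in> borel_measurable (leb \<Otimes>\<^sub>M borel)"
    by (rule measurable_compose[OF measurable_fst]) simp
  have "N g = (\<integral>\<^sup>+e. liminf (\<lambda>m. ennreal (min (\<bar>gs m (fst e) * snd e\<bar>\<^sup>2) 1)) \<partial>\<mu>)"
    unfolding N_def case_prod_beta
  proof (rule nn_integral_cong_AE)
    show "AE e in \<mu>. ennreal (min (\<bar>g (fst e) * snd e\<bar>\<^sup>2) 1) = liminf (\<lambda>m. ennreal (min (\<bar>gs m (fst e) * snd e\<bar>\<^sup>2) 1))"
      using AE_mu_I[OF lim]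
    proof eventually_elim
      case (elim e)
      have "(\<lambda>m. ennreal (min (\<bar>gs m (fst e) * snd e\<bar>\<^sup>2) 1)) \<longlonglongrightarrow> ennreal (min (\<bar>g (fst e) * snd e\<bar>\<^sup>2) 1)"
        by (intro tendsto_ennrealI tendsto_intros elim)
      from lim_imp_Liminf[OF _ this] show ?case by simp
    qed
  qed
  also have "\<dots> \<le> liminf (\<lambda>m. N (gs m))"
    unfolding N_def case_prod_beta by (rule nn_integral_liminf) measurable
  also have "\<dots> \<le> c"
  proof -
    have "liminf (\<lambda>m. N (gs m)) \<le> limsup (\<lambda>m. N (gs m))" by (rule Liminf_le_Limsup) simp
    also have "\<dots> \<le> c" by (rule Limsup_bounded[OF le])
    finally show ?thesis .
  qed
  finally show ?thesis .
qed

text \<open>Convergence in probability makes the integrands Cauchy for \<open>N\<close>, and Fatou's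
  lemma passes to their almost everywhere limit. This closedness serves the simple approximants of
  an integrand and, at the end, the mollified kernels \<rho>_q(t - .).\<close>

lemma charac_cauchy_limit:
  assumes c: "\<And>n m. charac (\<lambda>\<omega>. Zs n \<omega> - Zs m \<omega>) (\<lambda>s. fs n s - fs m s)"
    and fin: "\<And>n. fs n \<in> L_noise S \<nu>"
    and [measurable]: "\<And>n. Zs n \<in> borel_measurable M" "Z \<in> borel_measurable M" "f \<in> borel_measurable leb"
    and lim: "AE s in leb. (\<lambda>n. fs n s) \<longlonglongrightarrow> f s" and Zlim: "(\<lambda>n. pdist M (Zs n) Z) \<longlonglongrightarrow> 0"
  shows "f \<in> L_noise S \<nu>" "(\<lambda>n. N (\<lambda>s. fs n s - f s)) \<longlonglongrightarrow> 0"
proof -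
  have fs[measurable]: "fs n \<in> borel_measurable leb" for n using fin[of n] by (simp add: L_noise_iff)
  show conv: "(\<lambda>n. N (\<lambda>s. fs n s - f s)) \<longlonglongrightarrow> 0"
  proof (rule ennreal_tendsto_0I)
    fix e :: real assume e: "e > 0"
    \<comment> \<open>The cap 1/4 is the range of \<open>charac_N_le\<close>, and its factor 40
      turns e / 40 into e.\<close>
    define \<eta> where "\<eta> = min (1 / 4) (e / 40)"
    have \<eta>: "\<eta> > 0" "\<eta> \<le> 1/4" "40 * \<eta> \<le> e" using e by (auto simp: \<eta>_def min_def)
    have ev: "\<forall>\<^sub>F n in sequentially. pdist M (Zs n) Z < ennreal (\<eta> / 2)"
      using Zlim \<eta> by (intro order_tendstoD) auto
    then show "\<forall>\<^sub>F n in sequentially. N (\<lambda>s. fs n s - f s) \<le> ennreal e"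
    proof eventually_elim
      case (elim n)
      show ?case
      proof (rule N_Fatou)
        show "\<forall>\<^sub>F m in sequentially. N (\<lambda>s. fs n s - fs m s) \<le> ennreal e"
          using ev
        proof eventually_elim
          case (elim m)
          have "pdist M (Zs n) (Zs m) \<le> pdist M (Zs n) Z + pdist M Z (Zs m)" by (rule pdist_triangle) measurable
          also have "\<dots> \<le> ennreal (\<eta> / 2) + ennreal (\<eta> / 2)"
            using elim \<open>pdist M (Zs n) Z < ennreal (\<eta> / 2)\<close> by (intro add_mono) (auto simp: pdist_commute)
          also have "\<dots> = ennreal \<eta>" using \<eta> by (simp add: ennreal_plus[symmetric] del: ennreal_plus)
          finally have "N (\<lambda>s. fs n s - fs m s) \<le> ennreal (40 * \<eta>)"
            using \<eta> by (intro charac_N_le[OF c]) (auto simp: pdist_zero)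
          then show ?case using ennreal_leI[OF \<eta>(3)] by (rule order_trans)
        qed
        show "AE s in leb. (\<lambda>m. fs n s - fs m s) \<longlonglongrightarrow> fs n s - f s"
          using lim by eventually_elim (intro tendsto_intros)
      qed measurable
    qed
  qed
  have "\<forall>\<^sub>F n in sequentially. N (\<lambda>s. fs n s - f s) < 1" using conv by (rule order_tendstoD) simp
  then obtain n where n: "N (\<lambda>s. fs n s - f s) < 1" using eventually_happens by force
  \<comment> \<open>One approximant at finite modular distance bounds the limit, by subadditivity up
    to the factor 2.\<close>
  have "N f = N (\<lambda>s. fs n s - (fs n s - f s))" by simp
  also have "\<dots> \<le> 2 * N (fs n) + 2 * N (\<lambda>s. fs n s - f s)" by (rule N_diff) measurable
  also have "\<dots> < \<top>" using n fin[of n] by (auto simp: L_noise_iff ennreal_mult_less_top intro: less_trans)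
  finally show "f \<in> L_noise S \<nu>" by (simp add: L_noise_iff)
qed

text \<open>Every version and every approximating sequence leads to the same exponent, so the
  arbitrary choice in \<open>stoch_integral\<close> is harmless.\<close>

lemma has_stoch_integral_charac:
  assumes "has_stoch_integral M S X f Z" and f[measurable]: "f \<in> borel_measurable leb"
  shows "charac Z f"
proof -
  obtain F where Z[measurable]: "Z \<in> borel_measurable M" and F: "\<And>n. simple_list (F n)"
    "AE s in leb. (\<lambda>n. simple_fun (F n) s) \<longlonglongrightarrow> f s"
    "converges_in_prob M (\<lambda>n. simple_integral X (F n) S) Z"
    using assms(1) unfolding has_stoch_integral_def simple_list_def by blast
  have c: "charac (simple_integral X (F n) S) (simple_fun (F n))" for n
    using charac_simple[OF F(1) S_borel, of n] by (subst charac_cong) auto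
  have cd: "charac (\<lambda>\<omega>. simple_integral X (F n) S \<omega> - simple_integral X (F m) S \<omega>) (\<lambda>s. simple_fun (F n) s - simple_fun (F m) s)" for n m
    using charac_simple_diff[OF F(1) F(1) S_borel, of n m] by (subst charac_cong) auto
  have [measurable]: "simple_integral X (F n) S \<in> borel_measurable M" for n by (rule characD[OF c])
  have lim: "(\<lambda>n. pdist M (simple_integral X (F n) S) Z) \<longlonglongrightarrow> 0"
    using F(3) by (subst (asm) converges_in_prob_iff_pdist) auto
  have fin: "simple_fun (F n) \<in> L_noise S \<nu>" for n using c[of n] by (simp add: charac_def)
  note * = charac_cauchy_limit[of "\<lambda>n. simple_integral X (F n) S" "\<lambda>n. simple_fun (F n)", OF cd fin _ Z f F(2) lim]
  show ?thesis
    by (rule charac_limit[OF c Z _ lim]) (use * in auto)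
qed

lemma simple_approximation:
  assumes "f \<in> L_noise S \<nu>"
  obtains F where "\<And>n. simple_list (F n)" "\<And>s. s \<in> S \<Longrightarrow> (\<lambda>n. simple_fun (F n) s) \<longlonglongrightarrow> f s"
    "(\<lambda>n. N (\<lambda>s. simple_fun (F n) s - f s)) \<longlonglongrightarrow> 0"
proof -
  have f[measurable]: "f \<in> borel_measurable leb" and fin: "N f < \<top>" using assms by (auto simp: L_noise_iff)
  from borel_measurable_implies_sequence_metric[OF f, of 0] obtain \<phi> where
    "\<forall>i. simple_function leb (\<phi> i)" "\<forall>x\<in>space leb. (\<lambda>i. \<phi> i x) \<longlonglongrightarrow> f x"
    "\<forall>i. \<forall>x\<in>space leb. dist (\<phi> i x) 0 \<le> 2 * dist (f x) 0" by blast
  then have \<phi>: "\<And>i. simple_function leb (\<phi> i)" "\<And>s. s \<in> S \<Longrightarrow> (\<lambda>i. \<phi> i s) \<longlonglongrightarrow> f s"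
    "\<And>i s. s \<in> S \<Longrightarrow> \<bar>\<phi> i s\<bar> \<le> 2 * \<bar>f s\<bar>" by (simp_all add: dist_real_def)
  have "\<exists>vs. set vs = \<phi> i ` S \<and> distinct vs" for i
    using simple_functionD(1)[OF \<phi>(1)[of i]] finite_distinct_list by (metis space_leb)
  then obtain vs where vs: "\<And>i. set (vs i) = \<phi> i ` S" "\<And>i. distinct (vs i)" by metis
  \<comment> \<open>Level sets are cut by growing balls to have finite Lebesgue measure, as
    \<open>noise_sets\<close> demands.\<close>
  define A where "A = (\<lambda>i v. \<phi> i -` {v} \<inter> S \<inter> cball 0 (real i))"
  define F where "F = (\<lambda>i. map (\<lambda>v. (v, A i v)) (vs i))"
  have A: "A i v \<in> noise_sets S" for i v
  proof -
    have "\<phi> i -` {v} \<inter> S \<in> sets borel" using simple_functionD(2)[OF \<phi>(1)[of i], of "{v}"] by (simp add: sets_leb)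
    moreover have "emeasure lborel (A i v) \<le> emeasure lborel (cball (0 :: real ^ 'd) (real i))"
      by (rule emeasure_mono) (auto simp: A_def)
    then have "emeasure lborel (A i v) < \<top>"
      by (rule le_less_trans) (use emeasure_lborel_cball_finite[of "0 :: real ^ 'd" "real i"] in simp)
    ultimately show ?thesis by (auto simp: noise_sets_def A_def)
  qed
  then have F: "simple_list (F i)" for i by (auto simp: simple_list_def F_def)
  have Ff: "simple_fun (F i) s = \<phi> i s * indicator (cball 0 (real i)) s" if s: "s \<in> S" for i s
  proof -
    have "simple_fun (F i) s = (\<Sum>v\<in>set (vs i). v * indicator (A i v) s)"
      unfolding simple_fun_def F_def by (simp add: comp_def sum_list_distinct_conv_sum_set vs)
    also have "\<dots> = (\<Sum>v\<in>set (vs i). if v = \<phi> i s then \<phi> i s * indicator (cball 0 (real i)) s else 0)"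
      using s by (intro sum.cong refl) (auto simp: A_def indicator_def)
    also have "\<dots> = \<phi> i s * indicator (cball 0 (real i)) s"
      using s finite_set[of "vs i"] by (subst sum.delta) (auto simp: vs(1))
    finally show ?thesis .
  qed
  have lim: "(\<lambda>i. simple_fun (F i) s) \<longlonglongrightarrow> f s" if s: "s \<in> S" for s
  proof (rule Lim_transform_eventually[OF \<phi>(2)[OF s]])
    have "\<forall>\<^sub>F i in sequentially. norm s \<le> real i"
      using filterlim_real_sequentially unfolding filterlim_at_top by blast
    then show "\<forall>\<^sub>F i in sequentially. \<phi> i s = simple_fun (F i) s"
      by eventually_elim (simp add: Ff[OF s])
  qed
  have [measurable]: "simple_fun (F i) \<in> borel_measurable borel" for i using F by simp
  have [measurable]: "fst \<in> borel_measurable (leb \<Otimes>\<^sub>M borel)"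
    by (rule measurable_compose[OF measurable_fst]) simp
  \<comment> \<open>The approximants are at most 2 |f| in size, so their distance to f is at most 3
    |f|; squaring gives the factor 9 of the dominating function.\<close>
  have "(\<lambda>i. N (\<lambda>s. simple_fun (F i) s - f s)) \<longlonglongrightarrow> (\<integral>\<^sup>+e. 0 \<partial>\<mu>)"
    unfolding N_def case_prod_beta
  proof (rule nn_integral_dominated_convergence[where w = "\<lambda>e. 9 * ennreal (min (\<bar>f (fst e) * snd e\<bar>\<^sup>2) 1)"])
    fix i
    show "AE e in \<mu>. ennreal (min (\<bar>(simple_fun (F i) (fst e) - f (fst e)) * snd e\<bar>\<^sup>2) 1) \<le> 9 * ennreal (min (\<bar>f (fst e) * snd e\<bar>\<^sup>2) 1)"
    proof (rule AE_I2)
      fix e assume "e \<in> space \<mu>"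
      then have s: "fst e \<in> S" by auto
      have "\<bar>simple_fun (F i) (fst e)\<bar> \<le> \<bar>\<phi> i (fst e)\<bar>" unfolding Ff[OF s] by (simp add: indicator_def)
      then have "\<bar>simple_fun (F i) (fst e) - f (fst e)\<bar> \<le> 3 * \<bar>f (fst e)\<bar>" using \<phi>(3)[OF s, of i] by linarith
      then have "\<bar>(simple_fun (F i) (fst e) - f (fst e)) * snd e\<bar> \<le> (3 * \<bar>f (fst e)\<bar>) * \<bar>snd e\<bar>"
        unfolding abs_mult by (rule mult_right_mono) simp
      also have "\<dots> = 3 * \<bar>f (fst e) * snd e\<bar>" by (simp add: abs_mult)
      finally have "\<bar>(simple_fun (F i) (fst e) - f (fst e)) * snd e\<bar>\<^sup>2 \<le> (3 * \<bar>f (fst e) * snd e\<bar>)\<^sup>2"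
        by (rule power_mono) simp
      then have "\<bar>(simple_fun (F i) (fst e) - f (fst e)) * snd e\<bar>\<^sup>2 \<le> 9 * \<bar>f (fst e) * snd e\<bar>\<^sup>2"
        by (simp add: power_mult_distrib)
      moreover have "min x 1 \<le> 9 * min y 1" if "x \<le> 9 * y" for x y :: real using that by (auto simp: min_def)
      ultimately have "min (\<bar>(simple_fun (F i) (fst e) - f (fst e)) * snd e\<bar>\<^sup>2) 1 \<le> 9 * min (\<bar>f (fst e) * snd e\<bar>\<^sup>2) 1" by blast
      from ennreal_leI[OF this]
      show "ennreal (min (\<bar>(simple_fun (F i) (fst e) - f (fst e)) * snd e\<bar>\<^sup>2) 1) \<le> 9 * ennreal (min (\<bar>f (fst e) * snd e\<bar>\<^sup>2) 1)"
        by (simp add: ennreal_mult)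
    qed
  next
    show "(\<integral>\<^sup>+e. 9 * ennreal (min (\<bar>f (fst e) * snd e\<bar>\<^sup>2) 1) \<partial>\<mu>) < \<infinity>"
      using fin by (simp add: nn_integral_cmult N_def case_prod_beta' ennreal_mult_less_top)
    show "AE e in \<mu>. (\<lambda>i. ennreal (min (\<bar>(simple_fun (F i) (fst e) - f (fst e)) * snd e\<bar>\<^sup>2) 1)) \<longlonglongrightarrow> 0"
    proof (rule AE_I2)
      fix e assume "e \<in> space \<mu>"
      then have "fst e \<in> S" by auto
      then have "(\<lambda>i. ennreal (min (\<bar>(simple_fun (F i) (fst e) - f (fst e)) * snd e\<bar>\<^sup>2) 1)) \<longlonglongrightarrow> ennreal (min (\<bar>(f (fst e) - f (fst e)) * snd e\<bar>\<^sup>2) 1)"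
        by (intro tendsto_ennrealI tendsto_intros lim)
      then show "(\<lambda>i. ennreal (min (\<bar>(simple_fun (F i) (fst e) - f (fst e)) * snd e\<bar>\<^sup>2) 1)) \<longlonglongrightarrow> 0" by simp
    qed
  qed measurable
  then show thesis using that[of F] F lim by simp
qed

text \<open>Multiplication by an indicator does not increase \<open>N\<close>, so the integrals of
  the approximants are Cauchy in probability over every Borel set, and completeness gives limits.
  The threshold \<open>e\<^sup>2 / 80\<close> absorbs the factor 20 of
  \<open>charac_pdist_le\<close> and the factor 2 of \<open>N_diff\<close> for each of two
  terms.\<close>

lemma stoch_integral_exists:
  assumes f: "f \<in> L_noise S \<nu>"
  shows "\<exists>Z. has_stoch_integral M S X f Z"
proof -
  obtain F where F: "\<And>n. simple_list (F n)" "\<And>s. s \<in> S \<Longrightarrow> (\<lambda>n. simple_fun (F n) s) \<longlonglongrightarrow> f s"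
    and lim: "(\<lambda>n. N (\<lambda>s. simple_fun (F n) s - f s)) \<longlonglongrightarrow> 0"
    using simple_approximation[OF f] by blast
  have [measurable]: "f \<in> borel_measurable leb" using f by (auto simp: L_noise_iff)
  have [measurable]: "simple_fun (F i) \<in> borel_measurable borel" for i using F by simp
  have lim_ex: "\<exists>W \<in> borel_measurable M. (\<lambda>n. pdist M (simple_integral X (F n) B) W) \<longlonglongrightarrow> 0" if B: "B \<in> sets borel" for B
  proof -
    have [measurable]: "simple_integral X (F n) B \<in> borel_measurable M" for n
      by (rule simple_integral_measurable[OF F(1) B])
    have "\<exists>n0. \<forall>n\<ge>n0. \<forall>m\<ge>n0. pdist M (simple_integral X (F n) B) (simple_integral X (F m) B) \<le> ennreal e" if e: "e > 0" for e
    proof -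
      have "\<forall>\<^sub>F n in sequentially. N (\<lambda>s. simple_fun (F n) s - f s) < ennreal (e\<^sup>2 / 80)"
        using lim e by (intro order_tendstoD) auto
      then obtain n0 where n0: "\<And>n. n \<ge> n0 \<Longrightarrow> N (\<lambda>s. simple_fun (F n) s - f s) < ennreal (e\<^sup>2 / 80)"
        unfolding eventually_sequentially by blast
      have "pdist M (simple_integral X (F n) B) (simple_integral X (F m) B) \<le> ennreal e" if "n \<ge> n0" "m \<ge> n0" for n m
      proof (rule ccontr)
        let ?p = "pdist M (simple_integral X (F n) B) (simple_integral X (F m) B)"
        assume "\<not> ?p \<le> ennreal e"
        then have p: "ennreal e < ?p" by simp
        have "N (\<lambda>s. (simple_fun (F n) s - simple_fun (F m) s) * indicator B s) \<le> N (\<lambda>s. (simple_fun (F n) s - f s) - (simple_fun (F m) s - f s))"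
          by (rule N_mono) (simp add: indicator_def)
        also have "\<dots> \<le> 2 * N (\<lambda>s. simple_fun (F n) s - f s) + 2 * N (\<lambda>s. simple_fun (F m) s - f s)"
          by (intro N_diff borel_measurable_diff) auto
        also have "\<dots> \<le> 2 * ennreal (e\<^sup>2 / 80) + 2 * ennreal (e\<^sup>2 / 80)"
          using n0[OF that(1)] n0[OF that(2)] by (intro add_mono mult_left_mono) auto
        also have "\<dots> = ennreal (4 * (e\<^sup>2 / 80))"
        proof -
          have "2 * y + 2 * y = 4 * y" for y :: ennreal
            using distrib_right[of 2 2 y] by simp
          then show ?thesis by (subst ennreal_mult) auto
        qed
        finally have Nle: "N (\<lambda>s. (simple_fun (F n) s - simple_fun (F m) s) * indicator B s) \<le> ennreal (4 * (e\<^sup>2 / 80))" .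
        have "?p\<^sup>2 \<le> 20 * N (\<lambda>s. (simple_fun (F n) s - simple_fun (F m) s) * indicator B s)"
          using charac_pdist_le[OF charac_simple_diff[OF F(1)[of n] F(1)[of m] B]] by (simp add: pdist_zero)
        also have "\<dots> \<le> 20 * ennreal (4 * (e\<^sup>2 / 80))" using Nle by (intro mult_left_mono) auto
        also have "\<dots> = ennreal (e\<^sup>2)"
        proof -
          have "ennreal (20 * x) = 20 * ennreal x" if "x \<ge> 0" for x using that by (simp add: ennreal_mult)
          from this[of "4 * (e\<^sup>2 / 80)"] show ?thesis by simp
        qed
        also have "\<dots> = (ennreal e)\<^sup>2" using e by (simp add: ennreal_power)
        finally have "?p\<^sup>2 \<le> (ennreal e)\<^sup>2" .
        moreover have "(ennreal e)\<^sup>2 < ?p\<^sup>2"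
        proof -
          obtain q where q: "?p = ennreal q" "q \<ge> 0" using pdist_finite by (metis ennreal_cases less_irrefl)
          then have "e < q" using p e by (simp add: ennreal_less_iff)
          then have "e\<^sup>2 < q\<^sup>2" using e by (intro power_strict_mono) auto
          then show ?thesis using q e by (simp add: ennreal_power ennreal_less_iff)
        qed
        ultimately show False by simp
      qed
      then show ?thesis by blast
    qed
    then obtain W where "W \<in> borel_measurable M" "(\<lambda>n. pdist M (simple_integral X (F n) B) W) \<longlonglongrightarrow> 0"
      using pdist_complete[of "\<lambda>n. simple_integral X (F n) B"] by (metis \<open>\<And>n. simple_integral X (F n) B \<in> borel_measurable M\<close>)
    then show ?thesis by blast
  qed
  have ex: "\<exists>W \<in> borel_measurable M. converges_in_prob M (\<lambda>n. simple_integral X (F n) B) W" if B: "B \<in> sets borel" for B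
  proof -
    from lim_ex[OF B] obtain W where W: "W \<in> borel_measurable M" "(\<lambda>n. pdist M (simple_integral X (F n) B) W) \<longlonglongrightarrow> 0" ..
    with converges_in_prob_iff_pdist[of "\<lambda>n. simple_integral X (F n) B" W] simple_integral_measurable[OF F(1) B]
    show ?thesis by (intro bexI[of _ W]) simp_all
  qed
  from ex[OF S_borel] obtain Z where Z: "Z \<in> borel_measurable M" "converges_in_prob M (\<lambda>n. simple_integral X (F n) S) Z" by blast
  have "has_stoch_integral M S X f Z"
    unfolding has_stoch_integral_def
  proof (intro conjI exI[of _ F] allI ballI impI Z)
    show "case ca of (c, A) \<Rightarrow> A \<in> noise_sets S" if "ca \<in> set (F n)" for n ca
      using F(1)[of n] that unfolding simple_list_def by blast
    show "AE s in leb. (\<lambda>n. simple_fun (F n) s) \<longlonglongrightarrow> f s" by (rule AE_I2) (simp add: F(2))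
  qed (use ex in auto)
  then show ?thesis by blast
qed

lemma stoch_integral_has:
  "f \<in> L_noise S \<nu> \<Longrightarrow> has_stoch_integral M S X f (stoch_integral M S X f)"
  unfolding stoch_integral_def by (rule someI_ex[OF stoch_integral_exists])

lemma charac_stoch_integral: "f \<in> L_noise S \<nu> \<Longrightarrow> charac (stoch_integral M S X f) f"
  by (rule has_stoch_integral_charac[OF stoch_integral_has]) (auto simp: L_noise_iff)

lemma charac_stoch_integral_diff:
  "f \<in> L_noise S \<nu> \<Longrightarrow> g \<in> L_noise S \<nu> \<Longrightarrow>
    charac (\<lambda>\<omega>. stoch_integral M S X f \<omega> - stoch_integral M S X g \<omega>) (\<lambda>s. f s - g s)"
  by (rule has_stoch_integral_charac[OF has_stoch_integral_diff[OF stoch_integral_has stoch_integral_has]])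
    (auto simp: L_noise_iff)

end

section \<open>Randomized test functions\<close>

definition unit_weight :: "real measure" where
  "unit_weight = density lborel (\<lambda>w. ennreal (indicator {-1..1} w / 2))"

text \<open>The characteristic function of 1 / w for w uniform on [-1, 1], written with a cosine
  since the law is symmetric.\<close>

definition chi :: "real \<Rightarrow> real" where
  "chi y = (\<integral>w. cos (y / w) \<partial>unit_weight)"

lemma sets_unit_weight [simp, measurable_cong]: "sets unit_weight = sets borel"
  by (simp add: unit_weight_def)

lemma nn_integral_unit_weight:
  "f \<in> borel_measurable borel \<Longrightarrow>
    (\<integral>\<^sup>+w. f w \<partial>unit_weight) = (\<integral>\<^sup>+w. ennreal (indicator {-1..1} w / 2) * f w \<partial>lborel)"
  unfolding unit_weight_def by (subst nn_integral_density) auto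

lemma prob_space_unit_weight: "prob_space unit_weight"
proof
  have "emeasure unit_weight (space unit_weight) = (\<integral>\<^sup>+w. 1 \<partial>unit_weight)" by simp
  also have "\<dots> = (\<integral>\<^sup>+w. ennreal (1 / 2) * indicator {-1..1} w \<partial>(lborel :: real measure))"
    by (subst nn_integral_unit_weight) (auto intro!: nn_integral_cong simp: indicator_def)
  also have "\<dots> = ennreal (1 / 2) * ennreal 2" by (subst nn_integral_cmult_indicator) auto
  also have "\<dots> = 1" by (subst ennreal_mult[symmetric]) auto
  finally show "emeasure unit_weight (space unit_weight) = 1" .
qed

interpretation unit_weight: prob_space unit_weight by (rule prob_space_unit_weight)

lemma integrable_cos_unit_weight: "integrable unit_weight (\<lambda>w. cos (y / w))"
  by (rule unit_weight.integrable_const_bound[where B = 1]) auto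

lemma chi_measurable [measurable]: "chi \<in> borel_measurable borel"
  unfolding chi_def by measurable

lemma abs_chi_le_1: "\<bar>chi y\<bar> \<le> 1"
proof -
  have "norm (chi y) \<le> (\<integral>w. norm (cos (y / w)) \<partial>unit_weight)"
    unfolding chi_def by (rule integral_norm_bound)
  also have "\<dots> \<le> (\<integral>w. 1 \<partial>unit_weight)"
    by (intro integral_mono Bochner_Integration.integrable_norm integrable_cos_unit_weight) auto
  also have "\<dots> = 1" by (simp add: unit_weight.prob_space)
  finally show ?thesis by simp
qed

lemma one_minus_chi: "ennreal (1 - chi y) = (\<integral>\<^sup>+w. ennreal (indicator {-1..1} w / 2) * ennreal (1 - cos (y / w)) \<partial>lborel)"
proof -
  have "1 - chi y = (\<integral>w. 1 - cos (y / w) \<partial>unit_weight)"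
    unfolding chi_def by (subst Bochner_Integration.integral_diff) (auto simp: integrable_cos_unit_weight unit_weight.prob_space)
  then have "ennreal (1 - chi y) = (\<integral>\<^sup>+w. ennreal (1 - cos (y / w)) \<partial>unit_weight)"
    by (subst nn_integral_eq_integral) (auto simp: integrable_cos_unit_weight)
  then show ?thesis by (subst (asm) nn_integral_unit_weight) auto
qed

lemma chi_uminus: "chi (- y) = chi y" by (simp add: chi_def)

lemma chi_abs: "chi \<bar>y\<bar> = chi y" by (simp add: abs_if chi_uminus)

text \<open>The window [y / 2, y] has length y / 2, the density is 1/2, and 1 - cos is at least 1 -
  cos 1 there: the product is this constant times y.\<close>

definition chi_const :: real where "chi_const = (1 - cos 1) / 4"

lemma chi_const_pos: "chi_const > 0"
  using cos_monotone_0_pi[of 0 1] pi_gt3 by (simp add: chi_const_def)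

text \<open>Only the weights w in [y / 2, y] are kept: for these y / w lies in [1, 2], where the
  cosine is at most cos 1.\<close>

lemma chi_upper:
  assumes "\<bar>y\<bar> \<le> 1" shows "chi_const * \<bar>y\<bar> \<le> 1 - chi y"
proof -
  have *: "chi_const * y \<le> 1 - chi y" if y: "0 < y" "y \<le> 1" for y
  proof -
    have "ennreal (chi_const * y) = (\<integral>\<^sup>+w. ennreal ((1 - cos 1) / 2) * indicator {y/2..y} w \<partial>lborel)"
      using y by (subst nn_integral_cmult_indicator) (auto simp: chi_const_def ennreal_mult[symmetric])
    also have "\<dots> \<le> (\<integral>\<^sup>+w. ennreal (indicator {-1..1} w / 2) * ennreal (1 - cos (y / w)) \<partial>lborel)"
    proof (rule nn_integral_mono)
      fix w
      show "ennreal ((1 - cos 1) / 2) * indicator {y/2..y} w \<le> ennreal (indicator {-1..1} w / 2) * ennreal (1 - cos (y / w))"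
      proof (cases "w \<in> {y/2..y}")
        case True
        then have w: "0 < w" "1 \<le> y / w" "y / w \<le> 2" using y by (auto simp: field_simps)
        have "cos (y / w) \<le> cos 1" by (rule cos_monotone_0_pi_le) (use w pi_gt3 in auto)
        then have "ennreal ((1 - cos 1) / 2) \<le> ennreal (1 / 2 * (1 - cos (y / w)))" by (intro ennreal_leI) simp
        then show ?thesis using True y by (subst ennreal_mult[symmetric]) auto
      qed simp
    qed
    also have "\<dots> = ennreal (1 - chi y)" by (rule one_minus_chi[symmetric])
    finally show ?thesis using abs_chi_le_1[of y] by (subst (asm) ennreal_le_iff) auto
  qed
  show ?thesis
  proof (cases "y = 0")
    case True
    then show ?thesis using abs_chi_le_1[of 0] by simp
  next
    case False
    then show ?thesis using *[of "\<bar>y\<bar>"] assms by (simp add: chi_abs)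
  qed
qed

text \<open>Weights below y in absolute value contribute at most 2 y; beyond them the bound
  \<open>y\<^sup>2 / w\<^sup>2\<close> integrates to at most y on each side. For |y| \<ge> 1 the
  bound |chi| \<le> 1 is enough.\<close>

lemma chi_lower: "1 - chi y \<le> 4 * \<bar>y\<bar>"
proof -
  have *: "1 - chi y \<le> 4 * y" if y: "0 < y" "y < 1" for y
  proof -
    have F1: "(\<integral>\<^sup>+w. ennreal (y\<^sup>2 / w\<^sup>2) * indicator {y..1} w \<partial>lborel) = ennreal (- (y\<^sup>2 / 1) - (- (y\<^sup>2 / y)))"
      by (rule nn_integral_FTC_Icc) (use y in \<open>auto intro!: derivative_eq_intros simp: power2_eq_square\<close>)
    have F2: "(\<integral>\<^sup>+w. ennreal (y\<^sup>2 / w\<^sup>2) * indicator {-1..-y} w \<partial>lborel) = ennreal (- (y\<^sup>2 / (-y)) - (- (y\<^sup>2 / (-1))))"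
      by (rule nn_integral_FTC_Icc) (use y in \<open>auto intro!: derivative_eq_intros simp: power2_eq_square\<close>)
    have "ennreal (1 - chi y) = (\<integral>\<^sup>+w. ennreal (indicator {-1..1} w / 2) * ennreal (1 - cos (y / w)) \<partial>lborel)"
      by (rule one_minus_chi)
    also have "\<dots> \<le> (\<integral>\<^sup>+w. (ennreal (y\<^sup>2 / w\<^sup>2) * indicator {y..1} w + ennreal (y\<^sup>2 / w\<^sup>2) * indicator {-1..-y} w) + indicator {-y..y} w \<partial>lborel)"
    proof (rule nn_integral_mono)
      fix w :: real
      have b: "1 - cos (y / w) \<le> 2 * min ((y / w)\<^sup>2) 1" by (rule one_minus_cos_le)
      have c1: "1 / 2 * (1 - cos (y / w)) \<le> y\<^sup>2 / w\<^sup>2"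
        using order_trans[OF b mult_left_mono[OF min.cobounded1]] by (simp add: power_divide mult.commute)
      have c2: "1 / 2 * (1 - cos (y / w)) \<le> 1" using order_trans[OF b mult_left_mono[OF min.cobounded2]] by simp
      have le1: "ennreal (1 / 2) * ennreal (1 - cos (y / w)) \<le> ennreal (y\<^sup>2 / w\<^sup>2)"
        using ennreal_leI[OF c1] by (subst ennreal_mult[symmetric]) auto
      have le2: "ennreal (1 / 2) * ennreal (1 - cos (y / w)) \<le> 1"
        using ennreal_leI[OF c2] by (subst ennreal_mult[symmetric]) auto
      consider "w \<in> {-y..y}" | "w \<in> {y..1}" "w \<notin> {-y..y}" | "w \<in> {-1..-y}" "w \<notin> {-y..y}" "w \<notin> {y..1}" | "w \<notin> {-1..1}"
        using y by (cases "w < - y"; cases "y < w"; cases "w < - 1"; cases "1 < w") auto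
      then show "ennreal (indicator {-1..1} w / 2) * ennreal (1 - cos (y / w)) \<le>
         (ennreal (y\<^sup>2 / w\<^sup>2) * indicator {y..1} w + ennreal (y\<^sup>2 / w\<^sup>2) * indicator {-1..-y} w) + indicator {-y..y} w"
      proof cases
        case 1
        then have "ennreal (indicator {-1..1} w / 2) = ennreal (1/2)" using y by simp
        then show ?thesis using 1 le2 by (simp add: add_increasing)
      next
        case 2
        then have "ennreal (indicator {-1..1} w / 2) = ennreal (1/2)" using y by simp
        then show ?thesis using 2 le1 by (simp add: add_increasing2)
      next
        case 3
        then have "ennreal (indicator {-1..1} w / 2) = ennreal (1/2)" using y by simp
        then show ?thesis using 3 le1 by simp
      next
        case 4
        then have "ennreal (indicator {-1..1} w / 2) = 0" by simp
        then show ?thesis by simp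
      qed
    qed
    also have "\<dots> = (ennreal (- (y\<^sup>2 / 1) - (- (y\<^sup>2 / y))) + ennreal (- (y\<^sup>2 / (-y)) - (- (y\<^sup>2 / (-1))))) + ennreal (2 * y)"
      using y by (subst nn_integral_add, simp, simp, subst nn_integral_add, simp, simp, simp add: F1[simplified] F2[simplified])
    also have "\<dots> = ennreal (4 * y - 2 * y\<^sup>2)"
    proof -
      have "y\<^sup>2 \<le> y" using y by (simp add: power2_eq_square)
      then show ?thesis using y by (simp add: ennreal_plus[symmetric] power2_eq_square del: ennreal_plus)
    qed
    finally show ?thesis using y by (subst (asm) ennreal_le_iff) (auto simp: power2_eq_square intro: order_trans)
  qed
  show ?thesis
  proof (cases "y = 0 \<or> \<bar>y\<bar> \<ge> 1")
    case True
    have "chi 0 = 1" by (simp add: chi_def unit_weight.prob_space)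
    then show ?thesis using True abs_chi_le_1[of y] by auto
  next
    case False
    then show ?thesis using *[of "\<bar>y\<bar>"] by (simp add: chi_abs)
  qed
qed

lemma char_unit_weight: "(CLINT w|unit_weight. iexp (y / w)) = complex_of_real (chi y)"
proof -
  have int: "complex_integrable unit_weight (\<lambda>w. iexp (y / w))"
    by (rule unit_weight.integrable_const_bound[where B = 1]) auto
  have "Im (CLINT w|unit_weight. iexp (y / w)) = (\<integral>w. sin (y / w) \<partial>unit_weight)"
    by (subst integral_Im[OF int, symmetric]) (simp add: Im_exp)
  also have "\<dots> = (\<integral>w. indicator {-1..1} w / 2 * sin (y / w) \<partial>lborel)"
    unfolding unit_weight_def by (subst integral_density) auto
  also have "\<dots> = 0"
  proof -
    let ?g = "\<lambda>w::real. indicator {-1..1} w / 2 * sin (y / w)"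
    have "(\<integral>w. ?g w \<partial>lborel) = (\<integral>w. ?g (0 + (-1) * w) \<partial>lborel)"
      using lborel_integral_real_affine[of "-1" ?g 0] by simp
    also have "(\<lambda>w. ?g (0 + (-1) * w)) = (\<lambda>w. - ?g w)" by (auto simp: fun_eq_iff indicator_def)
    finally have "(\<integral>w. ?g w \<partial>lborel) = - (\<integral>w. ?g w \<partial>lborel)" by simp
    then show ?thesis by simp
  qed
  finally have "Im (CLINT w|unit_weight. iexp (y / w)) = 0" .
  moreover have "Re (CLINT w|unit_weight. iexp (y / w)) = chi y"
    unfolding chi_def by (subst integral_Re[OF int, symmetric]) (simp add: Re_exp)
  ultimately show ?thesis by (simp add: complex_eq_iff)
qed

text \<open>Under the product measure the coordinates are independent with a common real
  characteristic value c, so the cosine of the sum has mean \<open>c ^ n\<close>.\<close>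

lemma product_char:
  fixes g :: "'a \<Rightarrow> real"
  assumes "prob_space \<Theta>" and [measurable]: "g \<in> borel_measurable \<Theta>"
    and c: "(CLINT x|\<Theta>. iexp (g x)) = complex_of_real c"
  shows "(\<integral>\<^sup>+\<theta>. ennreal (1 - cos (\<Sum>j<n. g (\<theta> j))) \<partial>Pi\<^sub>M {..<n::nat} (\<lambda>_. \<Theta>)) = ennreal (1 - c ^ n)"
proof -
  interpret \<Theta>: prob_space \<Theta> by fact
  interpret P: product_sigma_finite "\<lambda>_::nat. \<Theta>" by unfold_locales
  interpret pp: prob_space "Pi\<^sub>M {..<n} (\<lambda>_. \<Theta>)" by (rule prob_space_PiM) (rule assms(1))
  have int: "complex_integrable \<Theta> (\<lambda>x. iexp (g x))"
    by (rule \<Theta>.integrable_const_bound[where B = 1]) auto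
  have int': "complex_integrable (Pi\<^sub>M {..<n} (\<lambda>_. \<Theta>)) (\<lambda>\<theta>. iexp (\<Sum>j<n. g (\<theta> j)))"
    by (rule pp.integrable_const_bound[where B = 1]) auto
  have "(CLINT \<theta>|Pi\<^sub>M {..<n} (\<lambda>_. \<Theta>). iexp (\<Sum>j<n. g (\<theta> j))) = (CLINT \<theta>|Pi\<^sub>M {..<n} (\<lambda>_. \<Theta>). (\<Prod>j<n. iexp (g (\<theta> j))))"
    by (simp add: exp_sum sum_distrib_left)
  also have "\<dots> = (\<Prod>j<n. CLINT x|\<Theta>. iexp (g x))"
    by (rule P.product_integral_prod) (use int in auto)
  also have "\<dots> = complex_of_real (c ^ n)" by (simp add: c)
  finally have "Re (CLINT \<theta>|Pi\<^sub>M {..<n} (\<lambda>_. \<Theta>). iexp (\<Sum>j<n. g (\<theta> j))) = c ^ n" by simp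
  then have e: "(\<integral>\<theta>. cos (\<Sum>j<n. g (\<theta> j)) \<partial>Pi\<^sub>M {..<n} (\<lambda>_. \<Theta>)) = c ^ n"
    by (subst (asm) integral_Re[OF int', symmetric]) (simp add: Re_exp)
  have int'': "integrable (Pi\<^sub>M {..<n} (\<lambda>_. \<Theta>)) (\<lambda>\<theta>. cos (\<Sum>j<n. g (\<theta> j)))"
    by (rule pp.integrable_const_bound[where B = 1]) auto
  have "(\<integral>\<^sup>+\<theta>. ennreal (1 - cos (\<Sum>j<n. g (\<theta> j))) \<partial>Pi\<^sub>M {..<n} (\<lambda>_. \<Theta>)) = ennreal (\<integral>\<theta>. 1 - cos (\<Sum>j<n. g (\<theta> j)) \<partial>Pi\<^sub>M {..<n} (\<lambda>_. \<Theta>))"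
    by (rule nn_integral_eq_integral) (use int'' in auto)
  also have "(\<integral>\<theta>. 1 - cos (\<Sum>j<n. g (\<theta> j)) \<partial>Pi\<^sub>M {..<n} (\<lambda>_. \<Theta>)) = 1 - c ^ n"
    using int'' by (simp add: e pp.prob_space)
  finally show ?thesis .
qed

text \<open>Integrating over the weight before the centre replaces the exponential by
  \<open>chi\<close>.\<close>

lemma char_weighted:
  fixes u :: "'a \<Rightarrow> real"
  assumes "prob_space T" and [measurable]: "u \<in> borel_measurable T"
  shows "(CLINT x|T \<Otimes>\<^sub>M unit_weight. iexp (u (fst x) / snd x)) = complex_of_real (\<integral>t. chi (u t) \<partial>T)"
proof -
  interpret T: prob_space T by fact
  interpret P: pair_prob_space T unit_weight ..
  have int: "complex_integrable (T \<Otimes>\<^sub>M unit_weight) (\<lambda>x. iexp (u (fst x) / snd x))"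
    by (rule P.integrable_const_bound[where B = 1]) auto
  have "(CLINT x|T \<Otimes>\<^sub>M unit_weight. iexp (u (fst x) / snd x)) = (CLINT t|T. CLINT w|unit_weight. iexp (u t / w))"
    using P.integral_fst'[OF int] by simp
  also have "\<dots> = complex_of_real (\<integral>t. chi (u t) \<partial>T)" unfolding char_unit_weight by simp
  finally show ?thesis .
qed


text \<open>From 1 - exp (- q) \<ge> q / (1 + q); the a priori bound X on q turns the denominator
  into a constant.\<close>

lemma one_minus_exp_ge:
  fixes q Q X :: real
  assumes "0 \<le> q" "q \<le> Q" "q \<le> X"
  shows "q \<le> (1 + X) * (1 - exp (- Q))"
proof -
  have "exp (- Q) \<le> exp (- q)" using assms by simp
  also have "\<dots> = 1 / exp q" by (simp add: exp_minus inverse_eq_divide)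
  also have "\<dots> \<le> 1 / (1 + q)" using assms by (intro divide_left_mono) auto
  finally have "q / (1 + q) \<le> 1 - exp (- Q)" using assms by (simp add: field_simps)
  have "q = (1 + q) * (q / (1 + q))" using assms by simp
  also have "\<dots> \<le> (1 + X) * (1 - exp (- Q))"
    using assms \<open>q / (1 + q) \<le> 1 - exp (- Q)\<close> by (intro mult_mono) auto
  finally show ?thesis .
qed

section \<open>The random field, its mollifications and randomized pairings\<close>

locale random_field = levy_noise M S \<nu> J X
  for M :: "'w measure" and S :: "(real ^ 'd::finite) set" and \<nu> J X +
  fixes \<rho> :: "(real ^ 'd \<Rightarrow> real) \<Rightarrow> real" and Y :: "real ^ 'd \<Rightarrow> 'w \<Rightarrow> real"
  assumes S_pos: "emeasure lborel S > 0" and nu_pos: "emeasure \<nu> UNIV > 0"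
    and distr_rho: "schwartz_distribution \<rho>"
    and conv_L: "\<And>\<phi>. test_function \<phi> \<Longrightarrow> conv_check \<phi> \<rho> \<in> L_noise S \<nu>"
    and Y_measurable [measurable]: "(\<lambda>(t, \<omega>). Y t \<omega>) \<in> borel_measurable (borel \<Otimes>\<^sub>M M)"
    and Y_loc: "AE \<omega> in M. locally_integrable (\<lambda>t. Y t \<omega>)"
    and Y_rep: "\<And>\<phi>. test_function \<phi> \<Longrightarrow> AE \<omega> in M. u_gen M S X \<rho> \<phi> \<omega> = (\<integral>t. Y t \<omega> * \<phi> t \<partial>lborel)"
begin

definition I :: "(real ^ 'd \<Rightarrow> real) \<Rightarrow> 'w \<Rightarrow> real" where
  "I \<phi> \<omega> = (\<integral>t. Y t \<omega> * \<phi> t \<partial>lborel)"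

lemma test_function_measurable: "test_function \<phi> \<Longrightarrow> \<phi> \<in> borel_measurable borel"
  by (intro borel_measurable_continuous_onI smooth_continuous test_function_smooth)

lemma I_measurable:
  assumes "test_function \<phi>" shows "I \<phi> \<in> borel_measurable M"
proof -
  have [measurable]: "\<phi> \<in> borel_measurable borel" using assms by (rule test_function_measurable)
  show ?thesis unfolding I_def by measurable
qed

lemma charac_AE_cong:
  assumes "charac Z f" "AE \<omega> in M. Z \<omega> = Z' \<omega>" "Z' \<in> borel_measurable M"
  shows "charac Z' f"
proof -
  have "expectation (\<lambda>\<omega>. cos (u * Z' \<omega>)) = expectation (\<lambda>\<omega>. cos (u * Z \<omega>))" for u
  proof (rule Bochner_Integration.integral_cong_AE)
    show "AE \<omega> in M. cos (u * Z' \<omega>) = cos (u * Z \<omega>)" using assms(2) by eventually_elim simp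
  qed (use characD(1)[OF assms(1)] assms(3) in measurable)
  then show ?thesis using assms(1,3) by (simp add: charac_def)
qed

text \<open>By \<open>Y_rep\<close> the pathwise pairing is a version of the stochastic integral,
  and \<open>charac\<close> depends only on the almost sure class. Through this link every property
  of Y becomes one of \<rho>.\<close>

lemma charac_I:
  assumes "test_function \<phi>" shows "charac (I \<phi>) (conv_check \<phi> \<rho>)"
  by (rule charac_AE_cong[OF charac_stoch_integral[OF conv_L[OF assms]]])
    (use Y_rep[OF assms] I_measurable[OF assms] in \<open>auto simp: u_gen_def I_def\<close>)

definition Ym :: "real \<Rightarrow> real ^ 'd \<Rightarrow> 'w \<Rightarrow> real" where
  "Ym r t \<omega> = mollify r (\<lambda>x. Y x \<omega>) t"

text \<open>The mollification of \<rho> at y, that is \<rho> paired with a mollifier centred at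
  y.\<close>

definition rhom :: "real \<Rightarrow> real ^ 'd \<Rightarrow> real" where
  "rhom r y = \<rho> (\<lambda>x. mollifier r (x - y))"

text \<open>Pairing Y with this test function mollifies the path at t, while its convolution with
  the reflected \<rho> is \<open>rhom r (t - s)\<close>; one function thus links the two
  mollifications.\<close>

definition kernel :: "real \<Rightarrow> real ^ 'd \<Rightarrow> real ^ 'd \<Rightarrow> real" where
  "kernel r t x = mollifier r (x - t)"

lemma test_function_kernel: "r > 0 \<Longrightarrow> test_function (kernel r t)"
  using test_function_translate[OF test_function_mollifier, of r "- t"] by (simp add: kernel_def[abs_def])

lemma conv_check_kernel: "conv_check (kernel r t) \<rho> s = rhom r (t - s)"
  by (simp add: conv_check_def kernel_def rhom_def algebra_simps)

lemma I_kernel: "I (kernel r t) \<omega> = Ym r t \<omega>"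
  by (simp add: I_def kernel_def Ym_def mollify_def)

lemma rhom_continuous: assumes "r > 0" shows "continuous_on A (rhom r)"
proof -
  have "continuous_on UNIV (\<lambda>y. conv_check (mollifier r) \<rho> (- y))"
    by (rule continuous_on_compose2[OF conv_check_continuous[OF distr_rho test_function_mollifier[OF assms]]])
      (auto intro: continuous_intros)
  also have "(\<lambda>y. conv_check (mollifier r) \<rho> (- y)) = rhom r"
    by (simp add: fun_eq_iff conv_check_def rhom_def)
  finally show ?thesis using continuous_on_subset by blast
qed

lemma rhom_measurable [measurable]: "r > 0 \<Longrightarrow> rhom r \<in> borel_measurable borel"
  by (intro borel_measurable_continuous_onI rhom_continuous)

lemma Ym_measurable [measurable]:
  assumes "r > 0" shows "(\<lambda>(t, \<omega>). Ym r t \<omega>) \<in> borel_measurable (borel \<Otimes>\<^sub>M M)"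
proof -
  have [measurable]: "mollifier r \<in> borel_measurable (borel :: (real ^ 'd) measure)" using assms by simp
  show ?thesis unfolding Ym_def mollify_def by measurable
qed

text \<open>Linearity of the pairing holds on paths that are locally integrable, hence almost
  surely.\<close>

lemma AE_I_linear:
  assumes "finite I'" "\<And>j. j \<in> I' \<Longrightarrow> test_function (\<phi> j)"
  shows "AE \<omega> in M. I (\<lambda>x. \<Sum>j\<in>I'. c j * \<phi> j x) \<omega> = (\<Sum>j\<in>I'. c j * I (\<phi> j) \<omega>)"
  using Y_loc
proof eventually_elim
  case (elim \<omega>)
  have int: "integrable lborel (\<lambda>t. Y t \<omega> * \<phi> j t)" if "j \<in> I'" for j
    using locally_integrable_mult_test[OF elim assms(2)[OF that]] .
  have "I (\<lambda>x. \<Sum>j\<in>I'. c j * \<phi> j x) \<omega> = (\<integral>t. (\<Sum>j\<in>I'. c j * (Y t \<omega> * \<phi> j t)) \<partial>lborel)"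
    unfolding I_def by (intro Bochner_Integration.integral_cong) (auto simp: sum_distrib_left ac_simps)
  also have "\<dots> = (\<Sum>j\<in>I'. c j * I (\<phi> j) \<omega>)"
    unfolding I_def by (subst Bochner_Integration.integral_sum) (auto simp: int)
  finally show ?case .
qed

lemma conv_check_linear:
  assumes "\<And>j. j \<in> I' \<Longrightarrow> test_function (\<phi> j)"
  shows "conv_check (\<lambda>x. \<Sum>j\<in>I'. c j * \<phi> j x) \<rho> s = (\<Sum>j\<in>I'. c j * conv_check (\<phi> j) \<rho> s)"
proof -
  have t: "test_function (\<lambda>x. \<phi> j (s + x))" if "j \<in> I'" for j by (rule test_function_translate[OF assms[OF that]])
  show ?thesis unfolding conv_check_def
    by (subst distribution_sum[OF distr_rho]) (auto intro!: sum.cong test_function_cmult t simp: distribution_cmult[OF distr_rho t])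
qed

text \<open>The weights \<open>1 / w\<close> with \<open>w\<close> uniform on \<open>[-1, 1]\<close> have Cauchy-like tails, so that
  \<open>1 - chi y\<close> is comparable to \<open>\<bar>y\<bar>\<close>. Averaging the characteristic function of the noise over many
  random linear combinations with such weights therefore produces the exponential of an \<open>L\<^sup>1\<close> norm.\<close>

lemma randomized_inequality:
  fixes T :: "(real ^ 'd) measure" and D :: "((real ^ 'd) \<times> real) set" and N0 :: nat
  assumes T: "prob_space T" "sets T = sets borel"
    and D[measurable]: "D \<in> sets \<mu>" and Dfin: "emeasure \<mu> D < \<top>"
    and r: "r1 > 0" "r2 > 0"
  defines "h \<equiv> \<lambda>y. rhom r1 y - rhom r2 y"
    and "U \<equiv> \<lambda>t \<omega>. Ym r1 t \<omega> - Ym r2 t \<omega>"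
  shows "(\<integral>\<^sup>+e. ennreal (1 - (\<integral>t. chi (snd e * h (t - fst e) / real N0) \<partial>T) ^ N0) * indicator D e \<partial>\<mu>)
    \<le> ennreal (1 + 2 * measure \<mu> D) * (\<integral>\<^sup>+\<omega>. ennreal (1 - (\<integral>t. chi (U t \<omega> / real N0) \<partial>T) ^ N0) \<partial>M)"
proof -
  interpret T: prob_space T by fact
  define \<Theta> where "\<Theta> = T \<Otimes>\<^sub>M unit_weight"
  interpret \<Theta>: prob_space \<Theta> unfolding \<Theta>_def by (intro prob_space_pair T prob_space_unit_weight)
  define PP where "PP = Pi\<^sub>M {..<N0} (\<lambda>_. \<Theta>)"
  interpret pp: prob_space PP unfolding PP_def by (rule prob_space_PiM) unfold_locales
  have sets_T[measurable_cong]: "sets T = sets borel" by fact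
  have sets_\<Theta>[measurable_cong]: "sets \<Theta> = sets (borel \<Otimes>\<^sub>M borel)"
    unfolding \<Theta>_def by (intro sets_pair_measure_cong T) simp
  have sets_PP[measurable_cong]: "sets PP = sets (Pi\<^sub>M {..<N0} (\<lambda>_. \<Theta>))" by (simp add: PP_def)
  have h[measurable]: "h \<in> borel_measurable borel" unfolding h_def using r by simp
  have U[measurable]: "(\<lambda>(t, \<omega>). U t \<omega>) \<in> borel_measurable (borel \<Otimes>\<^sub>M M)"
    unfolding U_def using Ym_measurable[OF r(1)] Ym_measurable[OF r(2)] by measurable
  have [measurable]: "fst \<in> borel_measurable (leb \<Otimes>\<^sub>M borel)"
    by (rule measurable_compose[OF measurable_fst]) simp
  interpret P1: pair_sigma_finite PP \<mu>
  proof
    show "\<exists>A. countable A \<and> A \<subseteq> sets \<mu> \<and> \<Union>A = space \<mu> \<and> (\<forall>a\<in>A. emeasure \<mu> a \<noteq> \<infinity>)"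
      unfolding jump_intensity_def by (rule pair.sigma_finite_countable)
  qed
  interpret P2: pair_sigma_finite M PP ..
  \<comment> \<open>\<open>\<theta> j\<close> holds a centre and a weight; f is the integrand and V
    the field side of the same random test function.\<close>
  define f where "f = (\<lambda>\<theta> s. \<Sum>j<N0. h (fst (\<theta> j) - s) / real N0 / snd (\<theta> j))"
  define V where "V = (\<lambda>\<theta> \<omega>. \<Sum>j<N0. U (fst (\<theta> j)) \<omega> / real N0 / snd (\<theta> j))"
  have V[measurable]: "(\<lambda>(\<omega>, \<theta>). V \<theta> \<omega>) \<in> borel_measurable (M \<Otimes>\<^sub>M PP)" unfolding V_def by measurable
  \<comment> \<open>Here \<open>\<theta>\<close> is fixed. The exceptional event depends on it, but
    only expectations at fixed \<open>\<theta>\<close> are used before Fubini is applied to the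
    jointly measurable V.\<close>
  have ch: "charac (V \<theta>) (f \<theta>)" for \<theta> :: "nat \<Rightarrow> (real ^ 'd) \<times> real"
  proof -
    define \<phi> where "\<phi> = (\<lambda>j x. kernel r1 (fst (\<theta> j)) x - kernel r2 (fst (\<theta> j)) x)"
    have t: "test_function (\<phi> j)" for j unfolding \<phi>_def
      by (intro test_function_diff test_function_kernel r)
    define c where "c = (\<lambda>j. 1 / real N0 / snd (\<theta> j))"
    have tt: "test_function (\<lambda>x. \<Sum>j<N0. c j * \<phi> j x)" by (intro test_function_sum test_function_cmult t)
    have Uphi: "AE \<omega> in M. \<forall>j. I (\<phi> j) \<omega> = U (fst (\<theta> j)) \<omega>"
      using Y_loc
    proof eventually_elim
      case (elim \<omega>)
      have "I (\<phi> j) \<omega> = I (kernel r1 (fst (\<theta> j))) \<omega> - I (kernel r2 (fst (\<theta> j))) \<omega>" for j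
        unfolding I_def \<phi>_def right_diff_distrib
        by (intro Bochner_Integration.integral_diff locally_integrable_mult_test elim test_function_kernel r)
      then show ?case by (simp add: I_kernel U_def)
    qed
    have "charac (I (\<lambda>x. \<Sum>j<N0. c j * \<phi> j x)) (conv_check (\<lambda>x. \<Sum>j<N0. c j * \<phi> j x) \<rho>)"
      by (rule charac_I[OF tt])
    also have "conv_check (\<lambda>x. \<Sum>j<N0. c j * \<phi> j x) \<rho> = f \<theta>"
    proof
      fix s
      have "conv_check (\<phi> j) \<rho> s = h (fst (\<theta> j) - s)" for j
      proof -
        have "conv_check (\<phi> j) \<rho> s = conv_check (kernel r1 (fst (\<theta> j))) \<rho> s - conv_check (kernel r2 (fst (\<theta> j))) \<rho> s"
          unfolding conv_check_def \<phi>_def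
          by (intro distribution_diff[OF distr_rho] test_function_translate test_function_kernel r)
        then show ?thesis by (simp add: conv_check_kernel h_def)
      qed
      then show "conv_check (\<lambda>x. \<Sum>j<N0. c j * \<phi> j x) \<rho> s = f \<theta> s"
        by (subst conv_check_linear[OF t]) (simp add: f_def c_def)
    qed
    finally have "charac (I (\<lambda>x. \<Sum>j<N0. c j * \<phi> j x)) (f \<theta>)" .
    moreover have "AE \<omega> in M. I (\<lambda>x. \<Sum>j<N0. c j * \<phi> j x) \<omega> = V \<theta> \<omega>"
      using AE_I_linear[of "{..<N0}" \<phi> c, OF finite_lessThan t] Uphi
      by eventually_elim (simp add: V_def c_def)
    moreover have "V \<theta> \<in> borel_measurable M"
    proof -
      have "(\<lambda>\<omega>. U t \<omega>) \<in> borel_measurable M" for t using U by measurable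
      then show ?thesis unfolding V_def by measurable
    qed
    ultimately show ?thesis by (rule charac_AE_cong)
  qed
  \<comment> \<open>Restriction to D bounds the exponent by \<open>2 * measure \<mu> D\<close>,
    which makes the restricted exponent comparable to 1 - exp (- Q).\<close>
  have pointwise: "(\<integral>\<^sup>+e. ennreal (1 - cos (f \<theta> (fst e) * snd e)) * indicator D e \<partial>\<mu>)
     \<le> ennreal (1 + 2 * measure \<mu> D) * (\<integral>\<^sup>+\<omega>. ennreal (1 - cos (V \<theta> \<omega>)) \<partial>M)" for \<theta>
  proof -
    note c = characD[OF ch[of \<theta>]]
    have [measurable]: "V \<theta> \<in> borel_measurable M" "f \<theta> \<in> borel_measurable leb" using c by auto
    let ?q = "\<integral>\<^sup>+e. ennreal (1 - cos (f \<theta> (fst e) * snd e)) * indicator D e \<partial>\<mu>"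
    have "?q \<le> (\<integral>\<^sup>+e. ennreal (1 - cos (f \<theta> (fst e) * snd e)) \<partial>\<mu>)"
      by (intro nn_integral_mono) (auto simp: indicator_def)
    also have "\<dots> = ennreal (Q (f \<theta>))" by (subst Q_integrable(2)) (use c in \<open>auto simp: case_prod_beta'\<close>)
    finally have q1: "?q \<le> ennreal (Q (f \<theta>))" .
    have "?q \<le> (\<integral>\<^sup>+e. 2 * indicator D e \<partial>\<mu>)"
    proof (intro nn_integral_mono mult_right_mono)
      fix e
      have "1 - cos (f \<theta> (fst e) * snd e) \<le> 2" using cos_ge_minus_one[of "f \<theta> (fst e) * snd e"] by linarith
      from ennreal_leI[OF this] show "ennreal (1 - cos (f \<theta> (fst e) * snd e)) \<le> 2" by simp
    qed simp
    also have "\<dots> = ennreal (2 * measure \<mu> D)"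
      using Dfin by (simp add: nn_integral_cmult_indicator emeasure_eq_ennreal_measure ennreal_mult less_top)
    finally have q2: "?q \<le> ennreal (2 * measure \<mu> D)" .
    have "?q < \<top>" using q2 ennreal_less_top by (rule le_less_trans)
    then obtain q where q: "?q = ennreal q" "q \<ge> 0" by (cases ?q) auto
    have Q0: "Q (f \<theta>) \<ge> 0" by (rule Q_integrable) (use c in auto)
    have "q \<le> (1 + 2 * measure \<mu> D) * (1 - exp (- Q (f \<theta>)))"
      by (rule one_minus_exp_ge) (use q q1 q2 Q0 in auto)
    then have "?q \<le> ennreal (1 + 2 * measure \<mu> D) * ennreal (1 - exp (- Q (f \<theta>)))"
      unfolding q using Q0 by (subst ennreal_mult[symmetric]) (auto intro: ennreal_leI)
    also have "ennreal (1 - exp (- Q (f \<theta>))) = (\<integral>\<^sup>+\<omega>. ennreal (1 - cos (V \<theta> \<omega>)) \<partial>M)"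
    proof -
      have int: "integrable M (\<lambda>\<omega>. cos (V \<theta> \<omega>))" by (rule integrable_const_bound[where B = 1]) auto
      have "(\<integral>\<^sup>+\<omega>. ennreal (1 - cos (V \<theta> \<omega>)) \<partial>M) = ennreal (expectation (\<lambda>\<omega>. 1 - cos (V \<theta> \<omega>)))"
        by (rule nn_integral_eq_integral) (use int in auto)
      then show ?thesis using int c(4)[of 1] by (simp add: prob_space)
    qed
    finally show ?thesis .
  qed
  have prod: "(\<integral>\<^sup>+\<theta>. ennreal (1 - cos (\<Sum>j<N0. u (fst (\<theta> j)) / snd (\<theta> j))) \<partial>PP) = ennreal (1 - (\<integral>t. chi (u t) \<partial>T) ^ N0)"
    if [measurable]: "u \<in> borel_measurable borel" for u
  proof -
    have uT: "u \<in> borel_measurable T" by measurable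
    have ch: "(CLINT x|\<Theta>. iexp (u (fst x) / snd x)) = complex_of_real (\<integral>t. chi (u t) \<partial>T)"
      unfolding \<Theta>_def by (rule char_weighted[OF T(1) uT])
    have m: "(\<lambda>x. u (fst x) / snd x) \<in> borel_measurable \<Theta>" by measurable
    show ?thesis unfolding PP_def by (rule product_char[OF \<Theta>.prob_space_axioms m ch])
  qed
  have "(\<integral>\<^sup>+e. ennreal (1 - (\<integral>t. chi (snd e * h (t - fst e) / real N0) \<partial>T) ^ N0) * indicator D e \<partial>\<mu>)
    = (\<integral>\<^sup>+e. \<integral>\<^sup>+\<theta>. ennreal (1 - cos (f \<theta> (fst e) * snd e)) * indicator D e \<partial>PP \<partial>\<mu>)"
  proof (rule nn_integral_cong)
    fix e :: "(real ^ 'd) \<times> real"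
    have "f \<theta> (fst e) * snd e = (\<Sum>j<N0. (snd e * h (fst (\<theta> j) - fst e) / real N0) / snd (\<theta> j))" for \<theta>
      unfolding f_def sum_distrib_right by (intro sum.cong) simp_all
    then have "(\<integral>\<^sup>+\<theta>. ennreal (1 - cos (f \<theta> (fst e) * snd e)) \<partial>PP) = ennreal (1 - (\<integral>t. chi (snd e * h (t - fst e) / real N0) \<partial>T) ^ N0)"
      by (simp only:) (rule prod, measurable)
    moreover have "(\<integral>\<^sup>+\<theta>. ennreal (1 - cos (f \<theta> (fst e) * snd e)) * indicator D e \<partial>PP) = (\<integral>\<^sup>+\<theta>. ennreal (1 - cos (f \<theta> (fst e) * snd e)) \<partial>PP) * indicator D e"
      by (cases "e \<in> D") auto
    ultimately show "ennreal (1 - (\<integral>t. chi (snd e * h (t - fst e) / real N0) \<partial>T) ^ N0) * indicator D e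
      = (\<integral>\<^sup>+\<theta>. ennreal (1 - cos (f \<theta> (fst e) * snd e)) * indicator D e \<partial>PP)" by simp
  qed
  also have "\<dots> = (\<integral>\<^sup>+\<theta>. \<integral>\<^sup>+e. ennreal (1 - cos (f \<theta> (fst e) * snd e)) * indicator D e \<partial>\<mu> \<partial>PP)"
    by (rule P1.Fubini') (unfold f_def, measurable)
  also have "\<dots> \<le> (\<integral>\<^sup>+\<theta>. ennreal (1 + 2 * measure \<mu> D) * (\<integral>\<^sup>+\<omega>. ennreal (1 - cos (V \<theta> \<omega>)) \<partial>M) \<partial>PP)"
    by (rule nn_integral_mono) (rule pointwise)
  also have "\<dots> = ennreal (1 + 2 * measure \<mu> D) * (\<integral>\<^sup>+\<theta>. \<integral>\<^sup>+\<omega>. ennreal (1 - cos (V \<theta> \<omega>)) \<partial>M \<partial>PP)"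
    by (rule nn_integral_cmult) measurable
  also have "(\<integral>\<^sup>+\<theta>. \<integral>\<^sup>+\<omega>. ennreal (1 - cos (V \<theta> \<omega>)) \<partial>M \<partial>PP) = (\<integral>\<^sup>+\<omega>. \<integral>\<^sup>+\<theta>. ennreal (1 - cos (V \<theta> \<omega>)) \<partial>PP \<partial>M)"
    by (rule P2.Fubini') measurable
  also have "\<dots> = (\<integral>\<^sup>+\<omega>. ennreal (1 - (\<integral>t. chi (U t \<omega> / real N0) \<partial>T) ^ N0) \<partial>M)"
  proof (rule nn_integral_cong)
    fix \<omega> assume "\<omega> \<in> space M"
    then have "(\<lambda>t. U t \<omega> / real N0) \<in> borel_measurable borel" by measurable
    from prod[OF this] show "(\<integral>\<^sup>+\<theta>. ennreal (1 - cos (V \<theta> \<omega>)) \<partial>PP) = ennreal (1 - (\<integral>t. chi (U t \<omega> / real N0) \<partial>T) ^ N0)"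
      by (simp add: V_def)
  qed
  finally show ?thesis .
qed

end

section \<open>Uniform averages over a ball\<close>

definition unif_cball :: "real \<Rightarrow> 'a::euclidean_space measure" where
  "unif_cball L = density lborel (\<lambda>t. ennreal (indicator (cball 0 L) t / measure lborel (cball (0::'a) L)))"

lemma sets_unif_cball [simp, measurable_cong]: "sets (unif_cball L) = sets borel"
  by (simp add: unif_cball_def)

lemma measure_cball_pos:
  assumes "L > 0" shows "measure lborel (cball (0::'a::euclidean_space) L) > 0"
proof -
  have "0 < measure lborel (ball (0::'a) L)" using content_ball_pos[OF assms] by simp
  also have "\<dots> \<le> measure lborel (cball (0::'a) L)"
    by (rule measure_mono_fmeasurable) (use emeasure_lborel_cball_finite in \<open>auto simp: fmeasurable_def\<close>)
  finally show ?thesis .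
qed

lemma nn_integral_unif_cball:
  fixes f :: "'a::euclidean_space \<Rightarrow> ennreal"
  assumes [measurable]: "f \<in> borel_measurable borel"
  shows "(\<integral>\<^sup>+t. f t \<partial>unif_cball L) = ennreal (1 / measure lborel (cball (0::'a) L)) * (\<integral>\<^sup>+t. f t * indicator (cball 0 L) t \<partial>lborel)"
proof -
  have [measurable]: "cball (0::'a) L \<in> sets borel" by simp
  have "(\<integral>\<^sup>+t. f t \<partial>unif_cball L) = (\<integral>\<^sup>+t. ennreal (indicator (cball 0 L) t / measure lborel (cball (0::'a) L)) * f t \<partial>lborel)"
    unfolding unif_cball_def by (rule nn_integral_density) measurable
  also have "\<dots> = (\<integral>\<^sup>+t. ennreal (1 / measure lborel (cball (0::'a) L)) * (f t * indicator (cball 0 L) t) \<partial>lborel)"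
    by (intro nn_integral_cong) (auto simp: indicator_def)
  also have "\<dots> = ennreal (1 / measure lborel (cball (0::'a) L)) * (\<integral>\<^sup>+t. f t * indicator (cball 0 L) t \<partial>lborel)"
    by (rule nn_integral_cmult) measurable
  finally show ?thesis .
qed

lemma prob_space_unif_cball:
  assumes "L > 0" shows "prob_space (unif_cball L :: 'a::euclidean_space measure)"
proof
  let ?v = "measure lborel (cball (0::'a) L)"
  have v: "?v > 0" by (rule measure_cball_pos[OF assms])
  have "emeasure (unif_cball L :: 'a measure) (space (unif_cball L)) = (\<integral>\<^sup>+t. 1 \<partial>(unif_cball L :: 'a measure))" by simp
  also have "\<dots> = ennreal (1 / ?v) * emeasure lborel (cball (0::'a) L)"
    by (subst nn_integral_unif_cball) auto
  also have "emeasure lborel (cball (0::'a) L) = ennreal ?v"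
    using emeasure_lborel_cball_finite[of "0::'a" L] by (simp add: emeasure_eq_ennreal_measure less_top)
  also have "ennreal (1 / ?v) * ennreal ?v = 1" using v by (subst ennreal_mult[symmetric]) auto
  finally show "emeasure (unif_cball L :: 'a measure) (space (unif_cball L)) = 1" .
qed

lemma AE_unif_cball: "AE t in (unif_cball L :: 'a::euclidean_space measure). t \<in> cball 0 L"
  unfolding unif_cball_def by (subst AE_density) (auto simp: indicator_def)

lemma integral_unif_cball:
  fixes f :: "'a::euclidean_space \<Rightarrow> real"
  assumes [measurable]: "f \<in> borel_measurable borel"
  shows "(\<integral>t. f t \<partial>unif_cball L) = (\<integral>t. indicator (cball 0 L) t * f t \<partial>lborel) / measure lborel (cball (0::'a) L)"
proof -
  have [measurable]: "cball (0::'a) L \<in> sets borel" by simp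
  have "(\<integral>t. f t \<partial>unif_cball L) = (\<integral>t. (indicator (cball 0 L) t / measure lborel (cball (0::'a) L)) *\<^sub>R f t \<partial>lborel)"
    unfolding unif_cball_def
  proof (rule integral_density)
    show "(\<lambda>t. indicator (cball (0::'a) L) t / measure lborel (cball (0::'a) L)) \<in> borel_measurable lborel" by measurable
  qed auto
  then show ?thesis by simp
qed

text \<open>A Bernoulli bound for signed c, as an average of \<open>chi\<close> is only known to lie
  in [-1, 1].\<close>

lemma one_minus_power_le:
  fixes c :: real assumes "\<bar>c\<bar> \<le> 1" shows "1 - c ^ n \<le> real n * (1 - c)"
proof (induction n)
  case (Suc n)
  have "c ^ n * (1 - c) \<le> 1 * (1 - c)"
  proof (rule mult_right_mono)
    have "c ^ n \<le> \<bar>c\<bar> ^ n" by (metis abs_ge_self power_abs)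
    also have "\<dots> \<le> 1" using assms by (intro power_le_one) auto
    finally show "c ^ n \<le> 1" .
  qed (use assms in auto)
  then show ?case using Suc by (simp add: algebra_simps)
qed simp

section \<open>From random pairings to local L1 norms\<close>

context random_field
begin

text \<open>The randomized inequality is evaluated for one finite N0. On the left the mean of
  \<open>chi\<close> is at most 1 - x / N0 \<le> exp (- x / N0), with x a multiple of the L1 norm of
  h; on the right a Bernoulli bound and \<open>chi_lower\<close> apply. In both cases N0 cancels.
  The cap 2 keeps the expectation finite, since Y carries no moment assumption.\<close>

lemma key_inequality:
  fixes A :: "(real ^ 'd) set" and B :: "real set"
  assumes A: "A \<in> noise_sets S" "A \<subseteq> cball 0 a" and a: "0 \<le> a"
    and B: "B \<in> sets borel" "B \<subseteq> {z. \<epsilon> < \<bar>z\<bar> \<and> \<bar>z\<bar> < 1 / \<epsilon>}" and \<epsilon>: "\<epsilon> > 0"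
    and r: "r1 > 0" "r2 > 0" and R: "R > 0"
  defines "h \<equiv> \<lambda>y. rhom r1 y - rhom r2 y"
    and "U \<equiv> \<lambda>t \<omega>. Ym r1 t \<omega> - Ym r2 t \<omega>"
    and "v \<equiv> measure lborel (cball (0 :: real ^ 'd) (R + a))"
  shows "ennreal (measure \<mu> (A \<times> B) * (1 - exp (- (chi_const * \<epsilon> / v * (\<integral>y. indicator (cball 0 R) y * \<bar>h y\<bar> \<partial>lborel)))))
    \<le> ennreal (1 + 2 * measure \<mu> (A \<times> B)) *
      (\<integral>\<^sup>+\<omega>. min 2 (ennreal (4 / v) * (\<integral>\<^sup>+t. ennreal \<bar>U t \<omega>\<bar> * indicator (cball 0 (R + a)) t \<partial>lborel)) \<partial>M)"
proof -
  \<comment> \<open>For |s| \<le> a the ball of radius R about s lies in the ball of radius L, so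
    the average over centres t sees h(t - s) on all of the ball of radius R.\<close>
  define L where "L = R + a"
  have L: "L > 0" using R a by (simp add: L_def)
  have v: "v > 0" unfolding v_def L_def[symmetric] by (rule measure_cball_pos[OF L])
  define T where "T = (unif_cball L :: (real ^ 'd) measure)"
  have T: "prob_space T" "sets T = sets borel" unfolding T_def by (auto intro: prob_space_unif_cball L)
  interpret T: prob_space T by fact
  have [measurable_cong]: "sets T = sets borel" by fact
  have nuB: "emeasure \<nu> B < \<top>"
  proof -
    have "emeasure \<nu> B \<le> emeasure \<nu> {z. \<epsilon> < \<bar>z\<bar>}" by (rule emeasure_mono) (use B in auto)
    then show ?thesis using nu_tail_finite[OF \<epsilon>] by (rule le_less_trans)
  qed
  define D where "D = A \<times> B"
  have D[measurable]: "D \<in> sets \<mu>" and Dfin: "emeasure \<mu> D < \<top>"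
    unfolding D_def using mu_finite[OF A(1) B(1) nuB] by auto
  have hc: "continuous_on UNIV h" unfolding h_def by (intro continuous_intros rhom_continuous r)
  have h[measurable]: "h \<in> borel_measurable borel" by (rule borel_measurable_continuous_onI[OF hc])
  have U[measurable]: "(\<lambda>(t, \<omega>). U t \<omega>) \<in> borel_measurable (borel \<Otimes>\<^sub>M M)"
    unfolding U_def using Ym_measurable[OF r(1)] Ym_measurable[OF r(2)] by measurable
  have [measurable]: "cball (0 :: real ^ 'd) q \<in> sets borel" for q by simp
  have "bounded (h ` cball 0 (L + a))"
    by (intro compact_imp_bounded compact_continuous_image continuous_on_subset[OF hc]) auto
  then obtain H where H: "H > 0" "\<And>y. norm y \<le> L + a \<Longrightarrow> \<bar>h y\<bar> \<le> H"
    unfolding bounded_pos by (metis image_eqI mem_cball_0 real_norm_def)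
  \<comment> \<open>With |z| < 1 / \<epsilon> and |h| \<le> H at all differences t - s, every
    argument of \<open>chi\<close> on the left is at most 1/4 in size. Then \<open>chi_upper\<close>
    applies, and \<open>chi_lower\<close> makes \<open>chi\<close> nonnegative, so that taking
    powers preserves the bound.\<close>
  obtain N0 :: nat where "4 * H / \<epsilon> < real N0" using reals_Archimedean2 by blast
  moreover have "0 < 4 * H / \<epsilon>" using H \<epsilon> by simp
  ultimately have N0: "4 * H / \<epsilon> \<le> real N0" "real N0 > 0" by linarith+
  define x where "x = chi_const * \<epsilon> / v * (\<integral>y. indicator (cball 0 R) y * \<bar>h y\<bar> \<partial>lborel)"
  have lower: "1 - exp (- x) \<le> 1 - (\<integral>t. chi (z * h (t - s) / real N0) \<partial>T) ^ N0" if "s \<in> A" "z \<in> B" for s z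
  proof -
    have s: "norm s \<le> a" using A(2) that by auto
    have z: "\<epsilon> < \<bar>z\<bar>" "\<bar>z\<bar> < 1 / \<epsilon>" using B(2) that by auto
    define y where "y = (\<lambda>t. z * h (t - s) / real N0)"
    have [measurable]: "y \<in> borel_measurable borel" unfolding y_def by measurable
    have yb: "\<bar>y t\<bar> \<le> 1 / 4" if "t \<in> cball 0 L" for t
    proof -
      have "norm (t - s) \<le> L + a" using that s norm_triangle_ineq4[of t s] by simp
      then have "\<bar>h (t - s)\<bar> \<le> H" by (rule H)
      then have "\<bar>z * h (t - s)\<bar> \<le> 1 / \<epsilon> * H" unfolding abs_mult using z H \<epsilon> by (intro mult_mono) auto
      also have "\<dots> \<le> real N0 / 4" using N0 by (simp add: mult.commute)
      finally show ?thesis using N0(2) by (simp add: y_def field_simps)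
    qed
    have yAE: "AE t in T. \<bar>y t\<bar> \<le> 1 / 4" using AE_unif_cball[of L] unfolding T_def by eventually_elim (rule yb)
    have iy: "integrable T (\<lambda>t. \<bar>y t\<bar>)" by (rule T.integrable_const_bound[where B = "1/4"]) (use yAE in auto)
    have ic: "integrable T (\<lambda>t. chi (y t))"
      by (rule T.integrable_const_bound[where B = 1]) (auto simp: abs_chi_le_1)
    define c where "c = (\<integral>t. chi (y t) \<partial>T)"
    have "0 \<le> c" unfolding c_def
    proof (rule integral_nonneg_AE)
      show "AE t in T. 0 \<le> chi (y t)" using yAE
      proof eventually_elim
        case (elim t)
        then show ?case using chi_lower[of "y t"] by linarith
      qed
    qed
    have "c \<le> (\<integral>t. 1 - chi_const * \<bar>y t\<bar> \<partial>T)" unfolding c_def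
    proof (rule integral_mono_AE)
      show "AE t in T. chi (y t) \<le> 1 - chi_const * \<bar>y t\<bar>" using yAE
      proof eventually_elim
        case (elim t)
        then show ?case using chi_upper[of "y t"] by linarith
      qed
    qed (use iy ic in auto)
    also have "\<dots> = 1 - chi_const * (\<integral>t. \<bar>y t\<bar> \<partial>T)" using iy by (simp add: T.prob_space)
    also have "\<dots> \<le> 1 - x / real N0"
    proof -
      have "(\<integral>y. indicator (cball 0 R) y * \<bar>h y\<bar> \<partial>lborel) = (\<integral>t. indicator (cball 0 R) (- s + t) * \<bar>h (- s + t)\<bar> \<partial>lborel)"
        by (rule integral_lborel_translate[symmetric]) measurable
      also have "\<dots> \<le> (\<integral>t. indicator (cball 0 L) t * \<bar>h (t - s)\<bar> \<partial>lborel)"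
      proof (rule integral_mono)
        show "integrable lborel (\<lambda>t. indicator (cball 0 L) t * \<bar>h (t - s)\<bar>)"
          using borel_integrable_compact[of "cball 0 L" "\<lambda>t. \<bar>h (t - s)\<bar>"] 
          by (simp add: continuous_on_compose2[OF hc] continuous_intros)
        have "integrable lborel (\<lambda>t. indicator (cball s R) t * \<bar>h (t - s)\<bar>)"
          using borel_integrable_compact[of "cball s R" "\<lambda>t. \<bar>h (t - s)\<bar>"] 
          by (simp add: continuous_on_compose2[OF hc] continuous_intros)
        also have "(\<lambda>t. indicator (cball s R) t * \<bar>h (t - s)\<bar>) = (\<lambda>t. indicator (cball 0 R) (- s + t) * \<bar>h (- s + t)\<bar>)"
          by (auto simp: fun_eq_iff indicator_def dist_norm norm_minus_commute algebra_simps)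
        finally show "integrable lborel (\<lambda>t. indicator (cball 0 R) (- s + t) * \<bar>h (- s + t)\<bar>)" .
        fix t
        have "norm t \<le> L" if "norm (t - s) \<le> R" using norm_triangle_sub[of t s] s that by (simp add: L_def)
        then show "indicator (cball 0 R) (- s + t) * \<bar>h (- s + t)\<bar> \<le> indicator (cball 0 L) t * \<bar>h (t - s)\<bar>"
          by (auto simp: indicator_def)
      qed
      also have "\<dots> = v * (\<integral>t. \<bar>h (t - s)\<bar> \<partial>T)"
        unfolding T_def using v by (subst integral_unif_cball) (auto simp: v_def L_def)
      finally have *: "(\<integral>y. indicator (cball 0 R) y * \<bar>h y\<bar> \<partial>lborel) \<le> v * (\<integral>t. \<bar>h (t - s)\<bar> \<partial>T)" .
      have ih0: "0 \<le> (\<integral>t. \<bar>h (t - s)\<bar> \<partial>T)" by (rule integral_nonneg_AE) simp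
      have "x \<le> chi_const * \<epsilon> / v * (v * (\<integral>t. \<bar>h (t - s)\<bar> \<partial>T))"
        unfolding x_def using * chi_const_pos \<epsilon> v by (intro mult_left_mono) auto
      also have "\<dots> = chi_const * (\<epsilon> * (\<integral>t. \<bar>h (t - s)\<bar> \<partial>T))" using v by simp
      also have "\<dots> \<le> chi_const * (\<bar>z\<bar> * (\<integral>t. \<bar>h (t - s)\<bar> \<partial>T))"
        using z chi_const_pos ih0 by (intro mult_left_mono mult_right_mono) auto
      also have "\<bar>z\<bar> * (\<integral>t. \<bar>h (t - s)\<bar> \<partial>T) = real N0 * (\<integral>t. \<bar>y t\<bar> \<partial>T)"
        using N0(2) by (simp add: y_def abs_mult)
      finally have "x / real N0 \<le> chi_const * (\<integral>t. \<bar>y t\<bar> \<partial>T)"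
        using N0(2) by (simp add: field_simps)
      then show ?thesis by simp
    qed
    also have "\<dots> \<le> exp (- (x / real N0))" using exp_ge_add_one_self[of "- (x / real N0)"] by simp
    finally have "c ^ N0 \<le> exp (- (x / real N0)) ^ N0" using \<open>0 \<le> c\<close> by (rule power_mono)
    also have "\<dots> = exp (- x)" using N0(2) by (simp add: exp_of_nat_mult[symmetric])
    finally show ?thesis by (simp add: c_def y_def)
  qed
  have upper: "ennreal (1 - (\<integral>t. chi (U t \<omega> / real N0) \<partial>T) ^ N0) \<le>
    min 2 (ennreal (4 / v) * (\<integral>\<^sup>+t. ennreal \<bar>U t \<omega>\<bar> * indicator (cball 0 L) t \<partial>lborel))" if \<omega>: "\<omega> \<in> space M" for \<omega>
  proof -
    have [measurable]: "(\<lambda>t. U t \<omega>) \<in> borel_measurable borel" using \<omega> by measurable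
    have ic: "integrable T (\<lambda>t. chi (U t \<omega> / real N0))"
      by (rule T.integrable_const_bound[where B = 1]) (auto simp: abs_chi_le_1)
    define c where "c = (\<integral>t. chi (U t \<omega> / real N0) \<partial>T)"
    have c1: "\<bar>c\<bar> \<le> 1"
    proof -
      have "norm c \<le> (\<integral>t. norm (chi (U t \<omega> / real N0)) \<partial>T)" unfolding c_def by (rule integral_norm_bound)
      also have "\<dots> \<le> (\<integral>t. 1 \<partial>T)" by (intro integral_mono Bochner_Integration.integrable_norm ic) (auto simp: abs_chi_le_1)
      finally show ?thesis by (simp add: T.prob_space)
    qed
    have "\<bar>c ^ N0\<bar> \<le> 1" using c1 by (simp add: power_abs power_le_one)
    then have "1 - c ^ N0 \<le> 2" by linarith
    from ennreal_leI[OF this] have le2: "ennreal (1 - c ^ N0) \<le> 2" by simp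
    have "ennreal (1 - c ^ N0) \<le> ennreal (real N0 * (1 - c))" by (rule ennreal_leI[OF one_minus_power_le[OF c1]])
    also have "\<dots> = ennreal (real N0) * ennreal (1 - c)" using c1 by (subst ennreal_mult) auto
    also have "ennreal (1 - c) = (\<integral>\<^sup>+t. ennreal (1 - chi (U t \<omega> / real N0)) \<partial>T)"
    proof -
      have "(\<integral>\<^sup>+t. ennreal (1 - chi (U t \<omega> / real N0)) \<partial>T) = ennreal (\<integral>t. 1 - chi (U t \<omega> / real N0) \<partial>T)"
        using abs_chi_le_1 by (intro nn_integral_eq_integral) (auto simp: ic abs_le_iff)
      then show ?thesis using ic by (simp add: c_def T.prob_space)
    qed
    also have "\<dots> \<le> (\<integral>\<^sup>+t. ennreal (4 / real N0) * ennreal \<bar>U t \<omega>\<bar> \<partial>T)"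
    proof (rule nn_integral_mono)
      fix t
      have "1 - chi (U t \<omega> / real N0) \<le> 4 / real N0 * \<bar>U t \<omega>\<bar>"
        using chi_lower[of "U t \<omega> / real N0"] N0(2) by simp
      from ennreal_leI[OF this] show "ennreal (1 - chi (U t \<omega> / real N0)) \<le> ennreal (4 / real N0) * ennreal \<bar>U t \<omega>\<bar>"
        by (subst ennreal_mult[symmetric]) auto
    qed
    also have "\<dots> = ennreal (4 / real N0) * (\<integral>\<^sup>+t. ennreal \<bar>U t \<omega>\<bar> \<partial>T)" by (rule nn_integral_cmult) measurable
    also have "(\<integral>\<^sup>+t. ennreal \<bar>U t \<omega>\<bar> \<partial>T) = ennreal (1 / v) * (\<integral>\<^sup>+t. ennreal \<bar>U t \<omega>\<bar> * indicator (cball 0 L) t \<partial>lborel)"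
      unfolding T_def by (subst nn_integral_unif_cball) (auto simp: v_def L_def)
    also have "ennreal (real N0) * (ennreal (4 / real N0) * (ennreal (1 / v) * (\<integral>\<^sup>+t. ennreal \<bar>U t \<omega>\<bar> * indicator (cball 0 L) t \<partial>lborel)))
      = ennreal (real N0 * (4 / real N0) * (1 / v)) * (\<integral>\<^sup>+t. ennreal \<bar>U t \<omega>\<bar> * indicator (cball 0 L) t \<partial>lborel)"
      using v by (simp add: ennreal_mult mult.assoc del: times_divide_eq_right times_divide_eq_left)
    also have "real N0 * (4 / real N0) * (1 / v) = 4 / v" using N0(2) by simp
    finally have "ennreal (1 - c ^ N0) \<le> ennreal (4 / v) * (\<integral>\<^sup>+t. ennreal \<bar>U t \<omega>\<bar> * indicator (cball 0 L) t \<partial>lborel)"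
      by - (erule meta_mp, rule mult_left_mono, assumption, simp)
    then show ?thesis using le2 by (simp add: c_def)
  qed
  have "ennreal (measure \<mu> D * (1 - exp (- x))) = (\<integral>\<^sup>+e. ennreal (1 - exp (- x)) * indicator D e \<partial>\<mu>)"
  proof -
    have "emeasure \<mu> D = ennreal (measure \<mu> D)" using Dfin by (intro emeasure_eq_ennreal_measure) auto
    then show ?thesis by (subst nn_integral_cmult_indicator[OF D]) (simp add: ennreal_mult'' mult.commute)
  qed
  also have "\<dots> \<le> (\<integral>\<^sup>+e. ennreal (1 - (\<integral>t. chi (snd e * h (t - fst e) / real N0) \<partial>T) ^ N0) * indicator D e \<partial>\<mu>)"
  proof (rule nn_integral_mono)
    fix e :: "(real ^ 'd) \<times> real"
    show "ennreal (1 - exp (- x)) * indicator D e \<le> ennreal (1 - (\<integral>t. chi (snd e * h (t - fst e) / real N0) \<partial>T) ^ N0) * indicator D e"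
      using lower[of "fst e" "snd e"] by (cases "e \<in> D") (auto simp: D_def intro!: ennreal_leI)
  qed
  also have "\<dots> \<le> ennreal (1 + 2 * measure \<mu> D) * (\<integral>\<^sup>+\<omega>. ennreal (1 - (\<integral>t. chi (U t \<omega> / real N0) \<partial>T) ^ N0) \<partial>M)"
    unfolding h_def U_def by (rule randomized_inequality[OF T D Dfin r])
  also have "\<dots> \<le> ennreal (1 + 2 * measure \<mu> D) *
      (\<integral>\<^sup>+\<omega>. min 2 (ennreal (4 / v) * (\<integral>\<^sup>+t. ennreal \<bar>U t \<omega>\<bar> * indicator (cball 0 L) t \<partial>lborel)) \<partial>M)"
    by (intro mult_left_mono nn_integral_mono upper) auto
  finally show ?thesis unfolding x_def D_def L_def .
qed

end

section \<open>The fundamental solution is a function\<close>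

text \<open>Summable L1 increments on balls make the series W of absolute increments finite almost
  everywhere. By telescoping, 2 W dominates the distance to the limit, which gives L1 convergence on
  each ball; one limit r serves all balls.\<close>

lemma L1_loc_limit:
  fixes g :: "nat \<Rightarrow> real ^ 'd::finite \<Rightarrow> real"
  assumes cont: "\<And>j. continuous_on UNIV (g j)"
    and summ: "\<And>R. R > 0 \<Longrightarrow> summable (\<lambda>j. \<integral>y. indicator (cball 0 R) y * \<bar>g j y - g (Suc j) y\<bar> \<partial>lborel)"
  obtains r where "locally_integrable r" "AE y in lborel. (\<lambda>j. g j y) \<longlonglongrightarrow> r y"
    "\<And>R. (\<lambda>j. \<integral>\<^sup>+y. ennreal \<bar>g j y - r y\<bar> * indicator (cball 0 R) y \<partial>lborel) \<longlonglongrightarrow> 0"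
proof -
  have [measurable]: "g j \<in> borel_measurable borel" for j by (rule borel_measurable_continuous_onI[OF cont])
  have cb[measurable]: "cball (0 :: real ^ 'd) q \<in> sets borel" for q by simp
  define W where "W = (\<lambda>y. \<Sum>j. ennreal \<bar>g j y - g (Suc j) y\<bar>)"
  have [measurable]: "W \<in> borel_measurable borel" unfolding W_def by measurable
  have W_fin: "(\<integral>\<^sup>+y. W y * indicator (cball 0 R) y \<partial>lborel) < \<top>" if R: "R > 0" for R
  proof -
    have "(\<integral>\<^sup>+y. W y * indicator (cball 0 R) y \<partial>lborel) = (\<integral>\<^sup>+y. (\<Sum>j. ennreal \<bar>g j y - g (Suc j) y\<bar> * indicator (cball 0 R) y) \<partial>lborel)"
      unfolding W_def by (intro nn_integral_cong ennreal_suminf_multc[symmetric])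
    also have "\<dots> = (\<Sum>j. \<integral>\<^sup>+y. ennreal \<bar>g j y - g (Suc j) y\<bar> * indicator (cball 0 R) y \<partial>lborel)"
      by (rule nn_integral_suminf) measurable
    also have "\<dots> = (\<Sum>j. ennreal (\<integral>y. indicator (cball 0 R) y * \<bar>g j y - g (Suc j) y\<bar> \<partial>lborel))"
    proof (rule suminf_cong)
      fix j
      have "integrable lborel (\<lambda>y. indicator (cball 0 R) y *\<^sub>R \<bar>g j y - g (Suc j) y\<bar>)"
        by (rule borel_integrable_compact) (auto intro!: continuous_intros continuous_on_subset[OF cont])
      then have "(\<integral>\<^sup>+y. ennreal (indicator (cball 0 R) y * \<bar>g j y - g (Suc j) y\<bar>) \<partial>lborel) = ennreal (\<integral>y. indicator (cball 0 R) y * \<bar>g j y - g (Suc j) y\<bar> \<partial>lborel)"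
        by (intro nn_integral_eq_integral) auto
      then show "(\<integral>\<^sup>+y. ennreal \<bar>g j y - g (Suc j) y\<bar> * indicator (cball 0 R) y \<partial>lborel) = ennreal (\<integral>y. indicator (cball 0 R) y * \<bar>g j y - g (Suc j) y\<bar> \<partial>lborel)"
        by (simp add: ennreal_mult' mult.commute ennreal_indicator)
    qed
    also have "\<dots> < \<top>" by (subst suminf_ennreal2[OF integral_nonneg_AE summ[OF R]]) auto
    finally show ?thesis .
  qed
  have AE_W: "AE y in lborel. W y \<noteq> \<top>"
  proof -
    have "AE y in lborel. \<forall>n::nat. W y * indicator (cball 0 (real (Suc n))) y \<noteq> \<infinity>"
      unfolding AE_all_countable
    proof
      fix n :: nat
      show "AE y in lborel. W y * indicator (cball 0 (real (Suc n))) y \<noteq> \<infinity>"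
        by (rule nn_integral_PInf_AE) (use W_fin[of "real (Suc n)"] in auto)
    qed
    then show ?thesis
    proof eventually_elim
      case (elim y)
      obtain n :: nat where "norm y \<le> real n" using real_arch_simple by blast
      then have "y \<in> cball 0 (real (Suc n))" by simp
      then show ?case using elim[rule_format, of n] by simp
    qed
  qed
  define r where "r = (\<lambda>y. lim (\<lambda>j. g j y))"
  have r[measurable]: "r \<in> borel_measurable borel" unfolding r_def by measurable
  have pw: "(\<lambda>j. g j y) \<longlonglongrightarrow> r y \<and> (\<forall>j. ennreal \<bar>g j y - r y\<bar> \<le> 2 * W y)" if "W y \<noteq> \<top>" for y
  proof -
    have s: "summable (\<lambda>j. \<bar>g j y - g (Suc j) y\<bar>)"
      using that unfolding W_def by (intro summable_suminf_not_top) auto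
    define w where "w = (\<Sum>j. \<bar>g j y - g (Suc j) y\<bar>)"
    have W: "W y = ennreal w" unfolding W_def w_def by (rule suminf_ennreal2[OF _ s]) simp
    have w0: "w \<ge> 0" unfolding w_def by (rule suminf_nonneg[OF s]) simp
    have tele: "(\<Sum>i<m. g (Suc i) y - g i y) = g m y - g 0 y" for m
      by (rule sum_lessThan_telescope)
    have "summable (\<lambda>i. g (Suc i) y - g i y)"
      by (rule summable_rabs_cancel) (use s in \<open>simp add: abs_minus_commute\<close>)
    then have "convergent (\<lambda>m. g m y - g 0 y)" unfolding summable_iff_convergent tele .
    then have "convergent (\<lambda>m. g m y)"
      using convergent_add[OF _ convergent_const[of "g 0 y"], of "\<lambda>m. g m y - g 0 y"] by simp
    then have lim: "(\<lambda>j. g j y) \<longlonglongrightarrow> r y" unfolding r_def convergent_LIMSEQ_iff .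
    have b: "\<bar>g m y - g 0 y\<bar> \<le> w" for m
    proof -
      have "\<bar>g m y - g 0 y\<bar> \<le> (\<Sum>i<m. \<bar>g i y - g (Suc i) y\<bar>)"
        unfolding tele[symmetric] by (rule order_trans[OF sum_abs]) (simp add: abs_minus_commute)
      also have "\<dots> \<le> w" unfolding w_def by (rule sum_le_suminf[OF s]) auto
      finally show ?thesis .
    qed
    have "\<bar>r y - g 0 y\<bar> \<le> w"
      by (rule LIMSEQ_le_const2[OF tendsto_rabs[OF tendsto_diff[OF lim tendsto_const]]]) (use b in auto)
    then have "\<bar>g j y - r y\<bar> \<le> 2 * w" for j using b[of j] by linarith
    then have "ennreal \<bar>g j y - r y\<bar> \<le> 2 * W y" for j unfolding W
      using ennreal_leI[of "\<bar>g j y - r y\<bar>" "2 * w"] w0 by (simp add: ennreal_mult)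
    then show ?thesis using lim by blast
  qed
  have lim: "AE y in lborel. (\<lambda>j. g j y) \<longlonglongrightarrow> r y" using AE_W by eventually_elim (use pw in blast)
  have L1: "(\<lambda>j. \<integral>\<^sup>+y. ennreal \<bar>g j y - r y\<bar> * indicator (cball 0 R) y \<partial>lborel) \<longlonglongrightarrow> 0" if R: "R > 0" for R
  proof -
    have "(\<lambda>j. \<integral>\<^sup>+y. ennreal \<bar>g j y - r y\<bar> * indicator (cball 0 R) y \<partial>lborel) \<longlonglongrightarrow> (\<integral>\<^sup>+y. 0 \<partial>(lborel :: (real ^ 'd) measure))"
    proof (rule nn_integral_dominated_convergence[where w = "\<lambda>y. 2 * (W y * indicator (cball 0 R) y)"])
      show "AE y in lborel. ennreal \<bar>g j y - r y\<bar> * indicator (cball 0 R) y \<le> 2 * (W y * indicator (cball 0 R) y)" for j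
        using AE_W by eventually_elim (use pw in \<open>auto simp: indicator_def\<close>)
      show "(\<integral>\<^sup>+y. 2 * (W y * indicator (cball 0 R) y) \<partial>lborel) < \<infinity>"
        using W_fin[OF R] by (subst nn_integral_cmult) (auto simp: ennreal_mult_less_top)
      show "AE y in lborel. (\<lambda>j. ennreal \<bar>g j y - r y\<bar> * indicator (cball 0 R) y) \<longlonglongrightarrow> 0"
        using lim
      proof eventually_elim
        case (elim y)
        have "(\<lambda>j. \<bar>g j y - r y\<bar>) \<longlonglongrightarrow> \<bar>r y - r y\<bar>" by (intro tendsto_intros elim)
        then have "(\<lambda>j. ennreal \<bar>g j y - r y\<bar>) \<longlonglongrightarrow> 0" by (simp add: ennreal_tendsto_0_iff)
        then show ?case by (cases "y \<in> cball 0 R") auto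
      qed
    qed measurable
    then show ?thesis by simp
  qed
  \<comment> \<open>Radii R \<le> 0 are covered by enlarging the ball.\<close>
  have L1': "(\<lambda>j. \<integral>\<^sup>+y. ennreal \<bar>g j y - r y\<bar> * indicator (cball 0 R) y \<partial>lborel) \<longlonglongrightarrow> 0" for R
  proof (rule tendsto_sandwich[OF _ _ tendsto_const L1[of "max R 1"]])
    show "\<forall>\<^sub>F j in sequentially. (\<integral>\<^sup>+y. ennreal \<bar>g j y - r y\<bar> * indicator (cball 0 R) y \<partial>lborel)
      \<le> (\<integral>\<^sup>+y. ennreal \<bar>g j y - r y\<bar> * indicator (cball 0 (max R 1)) y \<partial>lborel)"
      by (intro always_eventually allI nn_integral_mono mult_left_mono) (auto simp: indicator_def)
  qed auto
  have loc: "integrable lborel (\<lambda>y. indicator (cball 0 R) y *\<^sub>R r y)" for R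
  proof (rule integrableI_bounded)
    have "\<forall>\<^sub>F j in sequentially. (\<integral>\<^sup>+y. ennreal \<bar>g j y - r y\<bar> * indicator (cball 0 R) y \<partial>lborel) < 1"
      using L1'[of R] by (rule order_tendstoD) simp
    then obtain j where j: "(\<integral>\<^sup>+y. ennreal \<bar>g j y - r y\<bar> * indicator (cball 0 R) y \<partial>lborel) < 1"
      using eventually_happens by force
    have "integrable lborel (\<lambda>y. indicator (cball 0 R) y *\<^sub>R g j y)"
      by (rule borel_integrable_compact) (auto intro!: continuous_on_subset[OF cont])
    then have gj: "(\<integral>\<^sup>+y. ennreal (norm (indicator (cball 0 R) y *\<^sub>R g j y)) \<partial>lborel) < \<top>"
      unfolding integrable_iff_bounded by simp
    have "(\<integral>\<^sup>+y. ennreal (norm (indicator (cball 0 R) y *\<^sub>R r y)) \<partial>lborel) \<le>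
      (\<integral>\<^sup>+y. ennreal (norm (indicator (cball 0 R) y *\<^sub>R g j y)) + ennreal \<bar>g j y - r y\<bar> * indicator (cball 0 R) y \<partial>lborel)"
      by (intro nn_integral_mono) (auto simp: indicator_def ennreal_plus[symmetric] simp del: ennreal_plus intro!: ennreal_leI)
    also have "\<dots> = (\<integral>\<^sup>+y. ennreal (norm (indicator (cball 0 R) y *\<^sub>R g j y)) \<partial>lborel) + (\<integral>\<^sup>+y. ennreal \<bar>g j y - r y\<bar> * indicator (cball 0 R) y \<partial>lborel)"
      by (rule nn_integral_add) measurable
    also have "\<dots> < \<infinity>" using gj j by (auto intro: less_trans)
    finally show "(\<integral>\<^sup>+y. ennreal (norm (indicator (cball 0 R) y *\<^sub>R r y)) \<partial>lborel) < \<infinity>" .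
  qed measurable
  have "locally_integrable r" unfolding locally_integrable_def
  proof (intro allI impI)
    fix K :: "(real ^ 'd) set" assume K: "compact K"
    obtain R where "\<forall>x\<in>K. norm x \<le> R" using compact_imp_bounded[OF K] unfolding bounded_iff ..
    then have R: "K \<subseteq> cball 0 R" by auto
    have i: "set_integrable lborel (cball 0 R) r" using loc unfolding set_integrable_def .
    have "K \<in> sets lborel" using K by (simp add: compact_imp_closed)
    from set_integrable_subset[OF i this R] show "set_integrable lborel K r" .
  qed
  then show thesis using that lim L1' by blast
qed

text \<open>If x or y reaches 1, the cap 2 decides; otherwise the truncations on the right are
  inactive. The form is dictated by deviations whose expectations are controlled only after
  truncation at 1.\<close>

lemma min_2_cmult_add_le:
  fixes x y c :: ennreal
  shows "min 2 (c * (x + y)) \<le> (2 + c) * (min 1 x + min 1 y)"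
proof (cases "1 \<le> x \<or> 1 \<le> y")
  case True
  then have "1 \<le> min 1 x + min 1 y" by (auto simp: add_increasing add_increasing2)
  then have "(2 + c) * 1 \<le> (2 + c) * (min 1 x + min 1 y)" by (intro mult_left_mono) auto
  moreover have "min 2 (c * (x + y)) \<le> 2 + c" by (rule min.coboundedI1) simp
  ultimately show ?thesis by simp
next
  case False
  then have "min 1 x = x" "min 1 y = y" by auto
  moreover have "c * (x + y) \<le> (2 + c) * (x + y)" by (intro mult_right_mono) auto
  ultimately show ?thesis by (simp add: min.coboundedI2)
qed

text \<open>From \<open>(1 + x) * (1 - d) \<le> exp x * exp (- x)\<close>; the bound d \<le> 1/2
  keeps 1 - d away from 0.\<close>

lemma le_if_one_minus_exp_le:
  fixes x d :: real
  assumes "1 - exp (- x) \<le> d" "d \<le> 1/2" "0 \<le> x"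
  shows "x \<le> 2 * d"
proof -
  have "(1 + x) * (1 - d) \<le> exp x * exp (- x)"
    using assms by (intro mult_mono) auto
  also have "\<dots> = 1" by (simp add: exp_minus)
  finally have "x * (1 - d) \<le> d" by (simp add: algebra_simps)
  moreover have "x * (1 / 2) \<le> x * (1 - d)" using assms by (intro mult_left_mono) auto
  ultimately show ?thesis by simp
qed

section \<open>Radii with geometric errors\<close>

context random_field
begin

text \<open>Balls exhaust S, and bands bounded away from 0 and infinity exhaust the line up to {0},
  which is null for \<nu>. If all pieces were null, so would be S or \<nu>.\<close>

lemma choose_sets:
  obtains a A B \<epsilon> where "0 \<le> a" "A \<in> noise_sets S" "A \<subseteq> cball 0 a" "emeasure lborel A > 0"
    "B \<in> sets borel" "B \<subseteq> {z. \<epsilon> < \<bar>z\<bar> \<and> \<bar>z\<bar> < 1 / \<epsilon>}" "\<epsilon> > 0" "measure \<mu> (A \<times> B) > 0"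
proof -
  have "\<exists>n::nat. emeasure lborel (S \<inter> cball 0 (real n)) \<noteq> 0"
  proof (rule ccontr)
    assume "\<not> ?thesis"
    then have "emeasure lborel (\<Union>n::nat. S \<inter> cball 0 (real n)) = 0" by (intro emeasure_UN_eq_0) auto
    moreover have "(\<Union>n::nat. S \<inter> cball 0 (real n)) = S" using real_arch_simple by auto
    ultimately show False using S_pos by simp
  qed
  then obtain n :: nat where n: "emeasure lborel (S \<inter> cball 0 (real n)) > 0" by (auto simp: zero_less_iff_neq_zero)
  define A where "A = S \<inter> cball 0 (real n)"
  have "emeasure lborel A \<le> emeasure lborel (cball (0 :: real ^ 'd) (real n))" by (rule emeasure_mono) (auto simp: A_def)
  then have Afin: "emeasure lborel A < \<top>"
    by (rule le_less_trans) (use emeasure_lborel_cball_finite[of "0 :: real ^ 'd" "real n"] in simp)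
  then have A: "A \<in> noise_sets S" by (auto simp: noise_sets_def A_def)
  define Bn where "Bn = (\<lambda>m::nat. {z :: real. 1 / Suc m < \<bar>z\<bar> \<and> \<bar>z\<bar> < 1 / (1 / Suc m)})"
  have Bn: "Bn m \<in> sets borel" for m unfolding Bn_def by measurable
  have "\<exists>m. emeasure \<nu> (Bn m) \<noteq> 0"
  proof (rule ccontr)
    assume "\<not> ?thesis"
    then have "emeasure \<nu> (\<Union>m. Bn m) = 0" using Bn by (intro emeasure_UN_eq_0) auto
    moreover have "emeasure \<nu> {0} = 0" using levy by (simp add: levy_measure_def)
    ultimately have "emeasure \<nu> ((\<Union>m. Bn m) \<union> {0}) = 0"
      using Bn by (intro emeasure_Un_null_set[THEN trans]) (auto simp: null_sets_def)
    moreover have "(\<Union>m. Bn m) \<union> {0} = UNIV"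
    proof -
      have "z \<in> (\<Union>m. Bn m)" if z0: "z \<noteq> 0" for z
      proof -
        obtain m1 where m1: "inverse (real (Suc m1)) < \<bar>z\<bar>" using reals_Archimedean[of "\<bar>z\<bar>"] z0 by (auto simp del: of_nat_Suc)
        obtain m2 where m2: "\<bar>z\<bar> < real m2" using reals_Archimedean2 by blast
        have "inverse (real (Suc (max m1 m2))) \<le> inverse (real (Suc m1))" by (intro le_imp_inverse_le) auto
        then have "z \<in> Bn (max m1 m2)" using m1 m2 by (auto simp: Bn_def inverse_eq_divide)
        then show ?thesis by blast
      qed
      then show ?thesis by auto
    qed
    ultimately show False using nu_pos by simp
  qed
  then obtain m where m: "emeasure \<nu> (Bn m) > 0" by (auto simp: zero_less_iff_neq_zero)
  have Bfin: "emeasure \<nu> (Bn m) < \<top>"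
  proof -
    have "emeasure \<nu> (Bn m) \<le> emeasure \<nu> {z. 1 / Suc m < \<bar>z\<bar>}" by (rule emeasure_mono) (auto simp: Bn_def)
    then show ?thesis using nu_tail_finite[of "1 / Suc m"] by (simp add: le_less_trans)
  qed
  have "emeasure \<mu> (A \<times> Bn m) = emeasure leb A * emeasure \<nu> (Bn m)" unfolding jump_intensity_def
    by (rule nu.emeasure_pair_measure_Times) (use A Bn in \<open>auto simp: sets_leb noise_sets_def\<close>)
  also have "emeasure leb A = emeasure lborel A" by (rule emeasure_restrict_space) (auto simp: A_def)
  finally have "emeasure \<mu> (A \<times> Bn m) > 0" using n m by (simp add: A_def ennreal_zero_less_mult_iff)
  moreover have "emeasure \<mu> (A \<times> Bn m) < \<top>" by (rule mu_finite[OF A Bn Bfin])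
  ultimately have "measure \<mu> (A \<times> Bn m) > 0" by (simp add: measure_def enn2real_positive_iff)
  then show thesis
    using that[of "real n" A "Bn m" "1 / Suc m"] A n Bn by (auto simp: A_def Bn_def)
qed

definition dev :: "real \<Rightarrow> real \<Rightarrow> 'w \<Rightarrow> ennreal" where
  "dev r L \<omega> = (\<integral>\<^sup>+t. ennreal \<bar>Ym r t \<omega> - Y t \<omega>\<bar> * indicator (cball 0 L) t \<partial>lborel)"

lemma dev_measurable [measurable]:
  assumes "r > 0" shows "dev r L \<in> borel_measurable M"
proof -
  have [measurable]: "cball (0 :: real ^ 'd) L \<in> sets borel" by simp
  show ?thesis unfolding dev_def using Ym_measurable[OF assms] by measurable
qed

lemma dev_mono: "L \<le> L' \<Longrightarrow> dev r L \<omega> \<le> dev r L' \<omega>"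
  unfolding dev_def by (intro nn_integral_mono mult_left_mono) (auto simp: indicator_def)

text \<open>Almost every path is locally integrable, so the deviation tends to 0 pathwise;
  truncation at 1 supplies the dominating function.\<close>

lemma dev_tendsto: "(\<lambda>k. \<integral>\<^sup>+\<omega>. min 1 (dev (1 / Suc k) L \<omega>) \<partial>M) \<longlonglongrightarrow> 0"
proof -
  have "(\<lambda>k. \<integral>\<^sup>+\<omega>. min 1 (dev (1 / Suc k) L \<omega>) \<partial>M) \<longlonglongrightarrow> (\<integral>\<^sup>+\<omega>. 0 \<partial>M)"
  proof (rule nn_integral_dominated_convergence[where w = "\<lambda>_. 1"])
    show "AE \<omega> in M. (\<lambda>k. min 1 (dev (1 / Suc k) L \<omega>)) \<longlonglongrightarrow> 0"
      using Y_loc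
    proof eventually_elim
      case (elim \<omega>)
      have "(\<lambda>k. dev (1 / Suc k) L \<omega>) \<longlonglongrightarrow> 0"
        unfolding dev_def Ym_def using mollify_tendsto_local[OF elim] .
      then have "(\<lambda>k. min 1 (dev (1 / Suc k) L \<omega>)) \<longlonglongrightarrow> min 1 0" by (intro tendsto_min tendsto_const)
      then show ?case by simp
    qed
  qed (auto simp: emeasure_space_1)
  then show ?thesis by simp
qed

text \<open>The ball of radius j grows with the index, so one sequence of radii serves every fixed
  ball from some index on; the rate 4^-j is chosen for summability.\<close>

lemma choose_radii:
  obtains rr :: "nat \<Rightarrow> real" where "\<And>j. rr j > 0" "\<And>j. rr j \<le> 1 / Suc j"
    "\<And>j. (\<integral>\<^sup>+\<omega>. min 1 (dev (rr j) (real j) \<omega>) \<partial>M) \<le> ennreal ((1/4) ^ j)"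
proof -
  have "\<exists>k\<ge>j. (\<integral>\<^sup>+\<omega>. min 1 (dev (1 / Suc k) (real j) \<omega>) \<partial>M) \<le> ennreal ((1/4) ^ j)" for j :: nat
  proof -
    have "\<forall>\<^sub>F k in sequentially. (\<integral>\<^sup>+\<omega>. min 1 (dev (1 / Suc k) (real j) \<omega>) \<partial>M) < ennreal ((1/4) ^ j)"
      using dev_tendsto by (rule order_tendstoD) simp
    then have "\<forall>\<^sub>F k in sequentially. k \<ge> j \<and> (\<integral>\<^sup>+\<omega>. min 1 (dev (1 / Suc k) (real j) \<omega>) \<partial>M) < ennreal ((1/4) ^ j)"
      using eventually_ge_at_top[of j] by eventually_elim simp
    then show ?thesis using eventually_happens by (force intro: less_imp_le)
  qed
  then obtain k where k: "\<And>j. k j \<ge> j" "\<And>j. (\<integral>\<^sup>+\<omega>. min 1 (dev (1 / Suc (k j)) (real j) \<omega>) \<partial>M) \<le> ennreal ((1/4) ^ j)"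
    by metis
  show thesis
  proof (rule that[of "\<lambda>j. 1 / Suc (k j)"])
    show "1 / real (Suc (k j)) \<le> 1 / real (Suc j)" for j using k(1)[of j] by (intro divide_left_mono) auto
  qed (use k in auto)
qed

end

locale random_field_radii = random_field M S \<nu> J X \<rho> Y
  for M :: "'w measure" and S :: "(real ^ 'd::finite) set" and \<nu> J X \<rho> Y +
  fixes rr :: "nat \<Rightarrow> real"
  assumes rr_pos: "\<And>j. rr j > 0" and rr_le: "\<And>j. rr j \<le> 1 / Suc j"
    and rr_dev: "\<And>j. (\<integral>\<^sup>+\<omega>. min 1 (dev (rr j) (real j) \<omega>) \<partial>M) \<le> ennreal ((1/4) ^ j)"
begin

text \<open>The path Y is the intermediate point between consecutive mollifications, which leaves
  the two deviations at j and j + 1.\<close>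

lemma increment_bound:
  assumes "L \<le> real j" "c \<ge> 0"
  shows "(\<integral>\<^sup>+\<omega>. min 2 (ennreal c * (\<integral>\<^sup>+t. ennreal \<bar>Ym (rr j) t \<omega> - Ym (rr (Suc j)) t \<omega>\<bar> * indicator (cball 0 L) t \<partial>lborel)) \<partial>M)
    \<le> ennreal ((2 + c) * (2 * (1/4) ^ j))"
proof -
  have [measurable]: "cball (0 :: real ^ 'd) q \<in> sets borel" for q by simp
  have [measurable]: "dev (rr j) q \<in> borel_measurable M" for q j using rr_pos by simp
  have pw: "(\<integral>\<^sup>+t. ennreal \<bar>Ym (rr j) t \<omega> - Ym (rr (Suc j)) t \<omega>\<bar> * indicator (cball 0 L) t \<partial>lborel)
     \<le> dev (rr j) (real j) \<omega> + dev (rr (Suc j)) (real (Suc j)) \<omega>" if \<omega>: "\<omega> \<in> space M" for \<omega>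
  proof -
    have [measurable]: "(\<lambda>t. Ym (rr i) t \<omega>) \<in> borel_measurable borel" for i
      using Ym_measurable[OF rr_pos[of i]] \<omega> by measurable
    have [measurable]: "(\<lambda>t. Y t \<omega>) \<in> borel_measurable borel" using \<omega> by measurable
    have "(\<integral>\<^sup>+t. ennreal \<bar>Ym (rr j) t \<omega> - Ym (rr (Suc j)) t \<omega>\<bar> * indicator (cball 0 L) t \<partial>lborel)
      \<le> (\<integral>\<^sup>+t. ennreal \<bar>Ym (rr j) t \<omega> - Y t \<omega>\<bar> * indicator (cball 0 L) t + ennreal \<bar>Ym (rr (Suc j)) t \<omega> - Y t \<omega>\<bar> * indicator (cball 0 L) t \<partial>lborel)"
      by (intro nn_integral_mono) (auto simp: indicator_def ennreal_plus[symmetric] simp del: ennreal_plus intro!: ennreal_leI)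
    also have "\<dots> = dev (rr j) L \<omega> + dev (rr (Suc j)) L \<omega>" unfolding dev_def
      by (rule nn_integral_add) measurable
    also have "\<dots> \<le> dev (rr j) (real j) \<omega> + dev (rr (Suc j)) (real (Suc j)) \<omega>"
      using assms by (intro add_mono dev_mono) auto
    finally show ?thesis .
  qed
  have "(\<integral>\<^sup>+\<omega>. min 2 (ennreal c * (\<integral>\<^sup>+t. ennreal \<bar>Ym (rr j) t \<omega> - Ym (rr (Suc j)) t \<omega>\<bar> * indicator (cball 0 L) t \<partial>lborel)) \<partial>M)
    \<le> (\<integral>\<^sup>+\<omega>. (2 + ennreal c) * (min 1 (dev (rr j) (real j) \<omega>) + min 1 (dev (rr (Suc j)) (real (Suc j)) \<omega>)) \<partial>M)"
    by (intro nn_integral_mono order_trans[OF min.mono[OF order_refl mult_left_mono[OF pw]] min_2_cmult_add_le]) auto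
  also have "\<dots> = (2 + ennreal c) * ((\<integral>\<^sup>+\<omega>. min 1 (dev (rr j) (real j) \<omega>) \<partial>M) + (\<integral>\<^sup>+\<omega>. min 1 (dev (rr (Suc j)) (real (Suc j)) \<omega>) \<partial>M))"
    by (subst nn_integral_cmult, simp, subst nn_integral_add) auto
  also have "\<dots> \<le> (2 + ennreal c) * (ennreal ((1/4) ^ j) + ennreal ((1/4) ^ Suc j))"
    by (intro mult_left_mono add_mono rr_dev) auto
  also have "\<dots> \<le> (2 + ennreal c) * (ennreal ((1/4) ^ j) + ennreal ((1/4) ^ j))"
    by (intro mult_left_mono add_mono ennreal_leI) auto
  also have "\<dots> = ennreal ((2 + c) * (2 * (1/4) ^ j))"
  proof -
    have "2 + ennreal c = ennreal (2 + c)" using assms by simp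
    moreover have "ennreal q + ennreal q = ennreal (2 * q)" if "q \<ge> 0" for q
      using that by (simp add: ennreal_plus[symmetric] del: ennreal_plus)
    ultimately show ?thesis using assms by (simp add: ennreal_mult[symmetric] del: ennreal_plus)
  qed
  finally show ?thesis .
qed

text \<open>One set A x B is fixed for all j, so the constants k and C do not depend on j. Once the
  right side is below 1/2, 1 - exp (- k x) can be inverted, and the increments are of order
  4^-j.\<close>

lemma rhom_summable:
  assumes R: "R > 0"
  shows "summable (\<lambda>j. \<integral>y. indicator (cball 0 R) y * \<bar>rhom (rr j) y - rhom (rr (Suc j)) y\<bar> \<partial>lborel)"
proof -
  obtain a A B \<epsilon> where a: "0 \<le> a" and A: "A \<in> noise_sets S" "A \<subseteq> cball 0 a" "emeasure lborel A > 0"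
    and B: "B \<in> sets borel" "B \<subseteq> {z. \<epsilon> < \<bar>z\<bar> \<and> \<bar>z\<bar> < 1 / \<epsilon>}" "\<epsilon> > 0" and pos: "measure \<mu> (A \<times> B) > 0"
    by (rule choose_sets)
  define x where "x = (\<lambda>j. \<integral>y. indicator (cball 0 R) y * \<bar>rhom (rr j) y - rhom (rr (Suc j)) y\<bar> \<partial>lborel)"
  have x0: "x j \<ge> 0" for j unfolding x_def by (rule integral_nonneg_AE) simp
  define v where "v = measure lborel (cball (0 :: real ^ 'd) (R + a))"
  have v: "v > 0" unfolding v_def by (rule measure_cball_pos) (use R a in simp)
  define m where "m = measure \<mu> (A \<times> B)"
  have m: "m > 0" using pos by (simp add: m_def)
  define k where "k = chi_const * \<epsilon> / v"
  have k: "k > 0" using chi_const_pos B v by (simp add: k_def)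
  \<comment> \<open>The prefactor of \<open>key_inequality\<close>, the constant of
    \<open>increment_bound\<close> for c = 4 / v, and division by the intensity of A x B.\<close>
  define C where "C = (1 + 2 * m) * ((2 + 4 / v) * 2) / m"
  have C: "C > 0" using m v by (simp add: C_def add_pos_pos)
  have bound: "1 - exp (- (k * x j)) \<le> C * (1/4) ^ j" if j: "R + a \<le> real j" for j
  proof -
    have "ennreal (m * (1 - exp (- (k * x j)))) \<le> ennreal (1 + 2 * m) * ennreal ((2 + 4 / v) * (2 * (1/4) ^ j))"
      using key_inequality[OF A(1,2) a B rr_pos[of j] rr_pos[of "Suc j"] R] increment_bound[OF j, of "4 / v"] v
      unfolding m_def k_def x_def v_def by (elim order_trans) (intro mult_left_mono, auto)
    also have "\<dots> = ennreal ((1 + 2 * m) * ((2 + 4 / v) * (2 * (1/4) ^ j)))"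
      using m v by (subst ennreal_mult[symmetric]) auto
    finally have "m * (1 - exp (- (k * x j))) \<le> (1 + 2 * m) * ((2 + 4 / v) * (2 * (1/4) ^ j))"
      using m v by (subst (asm) ennreal_le_iff) auto
    then have "1 - exp (- (k * x j)) \<le> (1 + 2 * m) * ((2 + 4 / v) * (2 * (1/4) ^ j)) / m"
      using m by (simp add: field_simps)
    then show ?thesis by (simp only: C_def times_divide_eq_left mult.assoc)
  qed
  have "(\<lambda>j. C * (1/4) ^ j) \<longlonglongrightarrow> C * 0" by (intro tendsto_mult tendsto_const LIMSEQ_power_zero) simp
  then have "\<forall>\<^sub>F j in sequentially. C * (1/4) ^ j < 1/2" by (intro order_tendstoD) auto
  moreover have "\<forall>\<^sub>F j in sequentially. R + a \<le> real j"
    using filterlim_real_sequentially unfolding filterlim_at_top by blast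
  ultimately have "\<forall>\<^sub>F j in sequentially. norm (x j) \<le> 2 * C / k * (1/4) ^ j"
  proof eventually_elim
    case (elim j)
    have "k * x j \<le> 2 * (C * (1/4) ^ j)"
      by (rule le_if_one_minus_exp_le[OF bound]) (use elim k x0 in auto)
    then show ?case using k x0[of j] by (simp add: field_simps)
  qed
  then have "summable x"
    by (rule summable_comparison_test_ev) (intro summable_mult summable_geometric, simp)
  then show ?thesis unfolding x_def .
qed

end

text \<open>Heine-Cantor on a product of two balls gives one \<delta> for all shifts s at
  once.\<close>

lemma shifted_product_uniform:
  fixes \<psi> F :: "'a::euclidean_space \<Rightarrow> real"
  assumes "continuous_on UNIV \<psi>" "continuous_on UNIV F" "e > 0"
  obtains \<delta> where "\<delta> > 0" "\<And>s t c. norm s \<le> a \<Longrightarrow> norm t \<le> R \<Longrightarrow> norm c \<le> R \<Longrightarrow> dist t c < \<delta> \<Longrightarrow>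
    \<bar>\<psi> t * F (t - s) - \<psi> c * F (c - s)\<bar> \<le> e"
proof -
  let ?G = "\<lambda>p. \<psi> (fst p) * F (fst p - snd p)"
  have "continuous_on (cball (0::'a) R \<times> cball (0::'a) a) ?G"
    by (intro continuous_intros continuous_on_compose2[OF assms(1)] continuous_on_compose2[OF assms(2)]) auto
  then have "uniformly_continuous_on (cball (0::'a) R \<times> cball (0::'a) a) ?G"
    by (rule compact_uniformly_continuous) (intro compact_Times compact_cball)
  from uniformly_continuous_onE[OF this assms(3)]
  obtain \<delta> where d: "\<delta> > 0" "\<And>p q. p \<in> cball (0::'a) R \<times> cball (0::'a) a \<Longrightarrow> q \<in> cball (0::'a) R \<times> cball (0::'a) a \<Longrightarrow> dist q p < \<delta> \<Longrightarrow> dist (?G q) (?G p) < e"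
    by metis
  show thesis
  proof (rule that[OF d(1)])
    fix s t c :: 'a assume *: "norm s \<le> a" "norm t \<le> R" "norm c \<le> R" "dist t c < \<delta>"
    then show "\<bar>\<psi> t * F (t - s) - \<psi> c * F (c - s)\<bar> \<le> e"
      using d(2)[of "(c, s)" "(t, s)"] by (simp add: dist_Pair_Pair dist_real_def)
  qed
qed

text \<open>Convergence of the mollifications of \<rho> is known for almost every y, while the mild
  solution asks for it at y = t - s for almost every s.\<close>

lemma AE_lborel_reflect:
  fixes t :: "'a::euclidean_space"
  assumes "AE y in lborel. P y" shows "AE s in lborel. P (t - s)"
proof -
  have lb: "distr lborel borel (\<lambda>s. t - s) = lborel"
    using lborel_affine[of "-1" t] by (simp add: density_1)
  have "AE y in distr lborel borel (\<lambda>s. t - s). P y" unfolding lb by (rule assms)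
  then show ?thesis by (rule AE_distrD[rotated]) simp
qed

text \<open>Otherwise every point of A would have an open neighbourhood meeting A in a null set; by
  Lindelof countably many of these cover A, which would make A null.\<close>

lemma support_point:
  fixes A :: "'a::euclidean_space set"
  assumes A: "A \<in> sets borel" "emeasure lborel A > 0"
  obtains s where "s \<in> A" "\<And>U. open U \<Longrightarrow> s \<in> U \<Longrightarrow> emeasure lborel (A \<inter> U) > 0"
proof (rule ccontr)
  note th = that
  assume nt: "\<not> thesis"
  have *: "\<exists>U. open U \<and> s \<in> U \<and> emeasure lborel (A \<inter> U) = 0" if sA: "s \<in> A" for s
  proof (rule ccontr)
    assume "\<not> ?thesis"
    then have "emeasure lborel (A \<inter> U) > 0" if "open U" "s \<in> U" for U
      using that by (auto simp: zero_less_iff_neq_zero)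
    from th[OF sA this] show False using nt by simp
  qed
  define F where "F = {U. open U \<and> emeasure lborel (A \<inter> U) = 0}"
  obtain F' where F': "F' \<subseteq> F" "countable F'" "\<Union>F' = \<Union>F"
    using Lindelof[of F] by (auto simp: F_def)
  have "emeasure lborel (\<Union>U\<in>F'. A \<inter> U) = 0"
  proof -
    have "(\<Union>U\<in>F'. A \<inter> U) \<in> null_sets lborel"
      using F' A by (intro null_sets_UN') (auto simp: F_def null_sets_def)
    then show ?thesis by (simp add: null_sets_def)
  qed
  moreover have "A \<subseteq> (\<Union>U\<in>F'. A \<inter> U)"
  proof
    fix s assume s: "s \<in> A"
    then have "s \<in> \<Union>F" using *[OF s] by (auto simp: F_def)
    then show "s \<in> (\<Union>U\<in>F'. A \<inter> U)" using s F' by auto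
  qed
  moreover have "(\<Union>U\<in>F'. A \<inter> U) \<subseteq> A" by auto
  ultimately show False using A(2) by (metis less_irrefl subset_antisym)
qed

context levy_noise
begin

text \<open>By Tonelli the inner integral vanishes for almost every s; with g s \<noteq> 0 this
  would confine \<nu> to {0}, where it has no mass.\<close>

lemma N_zero_AE:
  assumes [measurable]: "g \<in> borel_measurable leb" and "N g = 0" and pos: "emeasure \<nu> UNIV > 0"
  shows "AE s in leb. g s = 0"
proof -
  have [measurable]: "fst \<in> borel_measurable (leb \<Otimes>\<^sub>M borel)"
    by (rule measurable_compose[OF measurable_fst]) simp
  have "N g = (\<integral>\<^sup>+s. \<integral>\<^sup>+z. ennreal (min (\<bar>g s * z\<bar>\<^sup>2) 1) \<partial>\<nu> \<partial>leb)"
    unfolding N_def jump_intensity_def by (subst nu.nn_integral_fst[symmetric]) auto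
  then have "(\<integral>\<^sup>+s. \<integral>\<^sup>+z. ennreal (min (\<bar>g s * z\<bar>\<^sup>2) 1) \<partial>\<nu> \<partial>leb) = 0" using assms(2) by simp
  then have "AE s in leb. (\<integral>\<^sup>+z. ennreal (min (\<bar>g s * z\<bar>\<^sup>2) 1) \<partial>\<nu>) = 0"
    by (subst (asm) nn_integral_0_iff_AE) measurable
  then show ?thesis
  proof eventually_elim
    case (elim s)
    show ?case
    proof (rule ccontr)
      assume gs: "g s \<noteq> 0"
      have "AE z in \<nu>. ennreal (min (\<bar>g s * z\<bar>\<^sup>2) 1) = 0"
        using elim by (subst (asm) nn_integral_0_iff_AE) auto
      then have "AE z in \<nu>. z = 0"
        by eventually_elim (use gs in \<open>auto simp: ennreal_eq_0_iff min_def split: if_splits\<close>)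
      moreover have "AE z in \<nu>. z \<noteq> 0"
        using levy by (intro AE_I[of _ _ "{0}"]) (auto simp: levy_measure_def)
      ultimately have "AE z in \<nu>. False" by eventually_elim auto
      then have "emeasure \<nu> UNIV = 0" by (subst (asm) AE_iff_measurable[OF _ refl]) auto
      then show False using pos by simp
    qed
  qed
qed

end

section \<open>Identification of the distribution with the local limit\<close>

locale random_field_limit = random_field_radii M S \<nu> J X \<rho> Y rr
  for M :: "'w measure" and S :: "(real ^ 'd::finite) set" and \<nu> J X \<rho> Y rr +
  fixes r :: "real ^ 'd \<Rightarrow> real"
  assumes r_loc: "locally_integrable r"
    and r_AE: "AE y in lborel. (\<lambda>j. rhom (rr j) y) \<longlonglongrightarrow> r y"
    and r_L1: "\<And>R. (\<lambda>j. \<integral>\<^sup>+y. ennreal \<bar>rhom (rr j) y - r y\<bar> * indicator (cball 0 R) y \<partial>lborel) \<longlonglongrightarrow> 0"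
begin

lemma r_measurable [measurable]: "r \<in> borel_measurable borel"
  by (rule locally_integrable_measurable[OF r_loc])

text \<open>A mollified test function is an integral of kernels, and \<rho> acts linearly on finite
  sums of kernels. One partition, fine enough for products with \<open>mollifier q\<close> and with
  \<open>rhom q\<close>, makes the Riemann sum accurate for the test functions and for the
  convolutions simultaneously.\<close>

lemma mollified_riemann_sum:
  assumes \<psi>: "test_function \<psi>" "\<And>x. \<psi> x \<noteq> 0 \<Longrightarrow> norm x \<le> R" and q: "0 < q" "q \<le> 1" and e: "e > 0"
  obtains \<zeta> where "test_function \<zeta>" "\<And>x. \<bar>\<zeta> x - (\<psi> x - mollify q \<psi> x)\<bar> \<le> e" "\<And>x. norm x > R + 1 \<Longrightarrow> \<zeta> x = 0"
    "\<And>s. norm s \<le> a \<Longrightarrow> \<bar>conv_check \<zeta> \<rho> s - (conv_check \<psi> \<rho> s - (\<integral>t. \<psi> t * rhom q (t - s) \<partial>lborel))\<bar> \<le> e"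
proof -
  have \<psi>c: "continuous_on A \<psi>" for A using \<psi>(1) by (simp add: smooth_continuous test_function_smooth)
  have \<kappa>c: "continuous_on A (mollifier q)" for A :: "(real ^ 'd) set"
    by (intro smooth_continuous test_function_smooth test_function_mollifier q)
  let ?V = "measure lborel (cball (0 :: real ^ 'd) R)"
  \<comment> \<open>The added 1 keeps the denominator positive whatever the measure of the
    ball.\<close>
  define e' where "e' = e / (?V + 1)"
  have V0: "?V \<ge> 0" by simp
  have e': "e' > 0" "?V * e' \<le> e"
  proof -
    have "e / (v + 1) > 0" "v * (e / (v + 1)) \<le> e" if "v \<ge> 0" for v :: real
      using that e by (simp_all add: field_simps)
    then show "e' > 0" "?V * e' \<le> e" unfolding e'_def using V0 by blast+
  qed
  obtain \<delta>1 where d1: "\<delta>1 > 0" "\<And>s t c. norm s \<le> R + 1 \<Longrightarrow> norm t \<le> R \<Longrightarrow> norm c \<le> R \<Longrightarrow> dist t c < \<delta>1 \<Longrightarrow>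
    \<bar>\<psi> t * mollifier q (t - s) - \<psi> c * mollifier q (c - s)\<bar> \<le> e'"
    by (rule shifted_product_uniform[OF \<psi>c \<kappa>c e'(1), where a = "R + 1" and R = R]) blast
  obtain \<delta>2 where d2: "\<delta>2 > 0" "\<And>s t c. norm s \<le> a \<Longrightarrow> norm t \<le> R \<Longrightarrow> norm c \<le> R \<Longrightarrow> dist t c < \<delta>2 \<Longrightarrow>
    \<bar>\<psi> t * rhom q (t - s) - \<psi> c * rhom q (c - s)\<bar> \<le> e'"
    by (rule shifted_product_uniform[OF \<psi>c rhom_continuous[OF q(1)] e'(1), where a = a and R = R]) blast
  have "min \<delta>1 \<delta>2 > 0" using d1(1) d2(1) by simp
  from cball_fine_partition[OF this, where 'a = "real ^ 'd"]
  obtain n and P :: "nat \<Rightarrow> (real ^ 'd) set" and c where P: "\<And>j. P j \<in> sets borel" "disjoint_family_on P {..<n}" "(\<Union>j<n. P j) = cball 0 R"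
    and Pc: "\<And>j. P j \<subseteq> ball (c j) (min \<delta>1 \<delta>2)" "\<And>j. j < n \<Longrightarrow> c j \<in> cball 0 R"
    by (metis (no_types, lifting))
  have near: "norm t \<le> R \<and> norm (c j) \<le> R \<and> dist t (c j) < \<delta>1 \<and> dist t (c j) < \<delta>2" if "j < n" "t \<in> P j" for j t
  proof -
    have "t \<in> cball 0 R" using that P(3) by blast
    moreover have "t \<in> ball (c j) (min \<delta>1 \<delta>2)" using that Pc(1) by blast
    ultimately show ?thesis using Pc(2)[OF that(1)] by (auto simp: dist_commute)
  qed
  have cut: "(\<integral>t. indicator (cball 0 R) t * (\<psi> t * F t) \<partial>lborel) = (\<integral>t. \<psi> t * F t \<partial>lborel)" for F
    by (intro Bochner_Integration.integral_cong) (use \<psi>(2) in \<open>auto simp: indicator_def\<close>)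
  define w where "w = (\<lambda>j. measure lborel (P j) * \<psi> (c j))"
  define \<zeta> where "\<zeta> = (\<lambda>x. \<psi> x - (\<Sum>j<n. w j * kernel q (c j) x))"
  have sum_t: "test_function (\<lambda>x. \<Sum>j<n. w j * kernel q (c j) x)"
    by (intro test_function_sum test_function_cmult test_function_kernel q)
  have t: "test_function \<zeta>" unfolding \<zeta>_def by (intro test_function_diff \<psi> sum_t)
  have far: "mollifier q (t - x) = 0" if "norm x > R + 1" "norm t \<le> R" for x t :: "real ^ 'd"
  proof -
    have "norm x \<le> norm t + norm (t - x)" by (metis norm_minus_commute norm_triangle_sub)
    then show ?thesis using that q by (intro mollifier_eq_0) auto
  qed
  have sum_far: "(\<Sum>j<n. w j * kernel q (c j) x) = 0" if "norm x > R + 1" for x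
    using far[OF that] Pc(2) by (intro sum.neutral) (auto simp: kernel_def mollifier_minus_commute[of q x])
  have moll: "mollify q \<psi> x = (\<integral>t. \<psi> t * mollifier q (t - x) \<partial>lborel)" for x by (simp add: mollify_def)
  have close: "\<bar>\<zeta> x - (\<psi> x - mollify q \<psi> x)\<bar> \<le> e" for x
  proof (cases "norm x > R + 1")
    case True
    have "mollify q \<psi> x = (\<integral>t. 0 \<partial>(lborel :: (real ^ 'd) measure))" unfolding moll
      by (intro Bochner_Integration.integral_cong) (use far[OF True] \<psi>(2) in force)+
    then show ?thesis using sum_far[OF True] e by (simp add: \<zeta>_def)
  next
    case False
    then have x: "norm x \<le> R + 1" by simp
    have "\<bar>(\<integral>t. indicator (cball 0 R) t * (\<psi> t * mollifier q (t - x)) \<partial>lborel) - (\<Sum>j<n. measure lborel (P j) * (\<psi> (c j) * mollifier q (c j - x)))\<bar> \<le> ?V * e'"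
    proof (rule riemann_sum_close[OF P])
      show "continuous_on (cball 0 R) (\<lambda>t. \<psi> t * mollifier q (t - x))"
        by (intro continuous_intros \<psi>c continuous_on_compose2[OF \<kappa>c]) auto
      show "\<bar>\<psi> t * mollifier q (t - x) - \<psi> (c j) * mollifier q (c j - x)\<bar> \<le> e'" if "j < n" "t \<in> P j" for j t
        using d1(2)[OF x] near[OF that] by blast
    qed
    also have "(\<Sum>j<n. measure lborel (P j) * (\<psi> (c j) * mollifier q (c j - x))) = (\<Sum>j<n. w j * kernel q (c j) x)"
      by (simp add: w_def kernel_def mollifier_minus_commute[of q x] mult.assoc)
    finally show ?thesis using e'(2) unfolding cut moll[symmetric] \<zeta>_def by linarith
  qed
  have conv: "\<bar>conv_check \<zeta> \<rho> s - (conv_check \<psi> \<rho> s - (\<integral>t. \<psi> t * rhom q (t - s) \<partial>lborel))\<bar> \<le> e" if s: "norm s \<le> a" for s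
  proof -
    have "conv_check \<zeta> \<rho> s = conv_check \<psi> \<rho> s - conv_check (\<lambda>x. \<Sum>j<n. w j * kernel q (c j) x) \<rho> s"
      unfolding conv_check_def \<zeta>_def
      by (rule distribution_diff[OF distr_rho]) (intro test_function_translate[OF \<psi>(1)] test_function_translate[OF sum_t])+
    also have "conv_check (\<lambda>x. \<Sum>j<n. w j * kernel q (c j) x) \<rho> s = (\<Sum>j<n. w j * rhom q (c j - s))"
      by (subst conv_check_linear) (auto simp: test_function_kernel q conv_check_kernel)
    finally have eq: "conv_check \<zeta> \<rho> s = conv_check \<psi> \<rho> s - (\<Sum>j<n. w j * rhom q (c j - s))" .
    have "\<bar>(\<integral>t. indicator (cball 0 R) t * (\<psi> t * rhom q (t - s)) \<partial>lborel) - (\<Sum>j<n. measure lborel (P j) * (\<psi> (c j) * rhom q (c j - s)))\<bar> \<le> ?V * e'"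
    proof (rule riemann_sum_close[OF P])
      show "continuous_on (cball 0 R) (\<lambda>t. \<psi> t * rhom q (t - s))"
        by (intro continuous_intros \<psi>c continuous_on_compose2[OF rhom_continuous[OF q(1)]]) auto
      show "\<bar>\<psi> t * rhom q (t - s) - \<psi> (c j) * rhom q (c j - s)\<bar> \<le> e'" if "j < n" "t \<in> P j" for j t
        using d2(2)[OF s] near[OF that] by blast
    qed
    also have "(\<Sum>j<n. measure lborel (P j) * (\<psi> (c j) * rhom q (c j - s))) = (\<Sum>j<n. w j * rhom q (c j - s))"
      by (simp add: w_def mult.assoc)
    finally show ?thesis using e'(2) unfolding cut eq by linarith
  qed
  show thesis
    by (rule that[OF t close _ conv]) (use sum_far \<psi>(2) in \<open>force simp: \<zeta>_def\<close>)
qed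

lemma rr_tendsto: "rr \<longlonglongrightarrow> 0"
  by (rule tendsto_sandwich[OF _ _ tendsto_const LIMSEQ_inverse_real_of_nat])
    (use rr_pos rr_le in \<open>auto simp: inverse_eq_divide intro!: always_eventually less_imp_le\<close>)

lemma mollify_uniform:
  assumes \<psi>: "test_function \<psi>" and e: "e > 0"
  shows "\<forall>\<^sub>F j in sequentially. \<forall>x. \<bar>mollify (rr j) \<psi> x - \<psi> x\<bar> \<le> e"
proof -
  obtain R where R: "\<And>x. \<psi> x \<noteq> 0 \<Longrightarrow> norm x \<le> R" using test_function_support[OF \<psi>] by blast
  have "uniformly_continuous_on UNIV \<psi>"
    by (rule compact_support_uniformly_continuous[of _ R])
      (use R \<psi> in \<open>force simp: smooth_continuous test_function_smooth\<close>)+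
  from uniformly_continuous_onE[OF this e] obtain d where d: "d > 0" "\<And>x y. dist y x < d \<Longrightarrow> dist (\<psi> y) (\<psi> x) < e"
    by (metis UNIV_I)
  have "\<forall>\<^sub>F j in sequentially. rr j < d" using rr_tendsto d(1) by (rule order_tendstoD)
  then show ?thesis
  proof eventually_elim
    case (elim j)
    show ?case
    proof
      fix x
      show "\<bar>mollify (rr j) \<psi> x - \<psi> x\<bar> \<le> e"
      proof (rule mollify_close[OF rr_pos integrable_test_function[OF \<psi>]])
        fix y assume "norm (y - x) \<le> rr j"
        then have "dist y x < d" using elim by (simp add: dist_norm)
        then show "\<bar>\<psi> y - \<psi> x\<bar> \<le> e" using d(2)[of y x] by (simp add: dist_real_def)
      qed
    qed
  qed
qed

text \<open>The functions tend to 0 uniformly with a common bounded support, but their derivatives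
  are not controlled, so continuity of \<rho> gives nothing here. Local integrability of the paths
  makes the pairings with Y tend to 0, and \<open>charac_N_le\<close> transfers this to the
  convolutions.\<close>

lemma N_conv_check_tendsto_0:
  assumes t: "\<And>j. test_function (\<zeta> j)" and supp: "\<And>j x. norm x > R \<Longrightarrow> \<zeta> j x = 0"
    and unif: "\<And>e. e > 0 \<Longrightarrow> \<forall>\<^sub>F j in sequentially. \<forall>x. \<bar>\<zeta> j x\<bar> \<le> e"
  shows "(\<lambda>j. N (conv_check (\<zeta> j) \<rho>)) \<longlonglongrightarrow> 0"
proof -
  have "AE \<omega> in M. (\<lambda>j. I (\<zeta> j) \<omega>) \<longlonglongrightarrow> 0"
    using Y_loc
  proof eventually_elim
    case (elim \<omega>)
    have int: "integrable lborel (\<lambda>t. indicator (cball 0 R) t * Y t \<omega>)" by (rule locally_integrable_cball[OF elim])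
    define K where "K = (\<integral>t. \<bar>indicator (cball 0 R) t * Y t \<omega>\<bar> \<partial>lborel)"
    have K: "K \<ge> 0" unfolding K_def by (rule integral_nonneg_AE) simp
    show ?case
    proof (rule tendstoI)
      fix e :: real assume e: "e > 0"
      then have "e / (2 * (K + 1)) > 0" using K by simp
      from unif[OF this] show "\<forall>\<^sub>F j in sequentially. dist (I (\<zeta> j) \<omega>) 0 < e"
      proof eventually_elim
        case (elim j)
        have "\<bar>I (\<zeta> j) \<omega>\<bar> \<le> (\<integral>t. e / (2 * (K + 1)) * \<bar>indicator (cball 0 R) t * Y t \<omega>\<bar> \<partial>lborel)"
          unfolding I_def
        proof (rule integral_abs_bound_integral)
          show "integrable lborel (\<lambda>t. Y t \<omega> * \<zeta> j t)"
            by (rule locally_integrable_mult_test[OF \<open>locally_integrable (\<lambda>t. Y t \<omega>)\<close> t])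
          show "integrable lborel (\<lambda>t. e / (2 * (K + 1)) * \<bar>indicator (cball 0 R) t * Y t \<omega>\<bar>)"
            using int by (intro integrable_mult_right Bochner_Integration.integrable_abs)
          fix t
          show "\<bar>Y t \<omega> * \<zeta> j t\<bar> \<le> e / (2 * (K + 1)) * \<bar>indicator (cball 0 R) t * Y t \<omega>\<bar>"
          proof (cases "norm t > R")
            case True
            then show ?thesis using supp[OF True] by simp
          next
            case False
            then have "\<bar>Y t \<omega> * \<zeta> j t\<bar> \<le> \<bar>Y t \<omega>\<bar> * (e / (2 * (K + 1)))"
              unfolding abs_mult using elim by (intro mult_left_mono) auto
            then show ?thesis using False by (simp add: mult.commute)
          qed
        qed
        also have "\<dots> = e / (2 * (K + 1)) * K" by (simp add: K_def)
        also have "\<dots> < e" using e K by (simp add: field_simps) (smt (verit) mult_nonneg_nonneg)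
        finally show ?case by simp
      qed
    qed
  qed
  then have p: "(\<lambda>j. pdist M (I (\<zeta> j)) (\<lambda>_. 0)) \<longlonglongrightarrow> 0"
    by (intro AE_tendsto_pdist I_measurable t) auto
  show ?thesis
  proof (rule ennreal_tendsto_0I)
    fix e :: real assume e: "e > 0"
    define \<eta> where "\<eta> = min (1 / 4) (e / 40)"
    have \<eta>: "\<eta> > 0" "\<eta> \<le> 1/4" "40 * \<eta> \<le> e" using e by (auto simp: \<eta>_def min_def)
    have "\<forall>\<^sub>F j in sequentially. pdist M (I (\<zeta> j)) (\<lambda>_. 0) < ennreal \<eta>"
      using p \<eta> by (intro order_tendstoD) auto
    then show "\<forall>\<^sub>F j in sequentially. N (conv_check (\<zeta> j) \<rho>) \<le> ennreal e"
    proof eventually_elim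
      case (elim j)
      have "N (conv_check (\<zeta> j) \<rho>) \<le> ennreal (40 * \<eta>)"
        by (rule charac_N_le[OF charac_I[OF t]]) (use elim \<eta> in auto)
      then show ?case using ennreal_leI[OF \<eta>(3)] by (rule order_trans)
    qed
  qed
qed

lemma test_function_bounded:
  assumes "test_function \<psi>" obtains B where "B > 0" "\<And>x. \<bar>\<psi> x :: real\<bar> \<le> B"
proof -
  obtain R where R: "\<And>x. \<psi> x \<noteq> 0 \<Longrightarrow> norm x \<le> R" using test_function_support[OF assms] by blast
  have "continuous_on (cball 0 R) \<psi>" using assms by (simp add: smooth_continuous test_function_smooth)
  then have "bounded (\<psi> ` cball 0 R)" by (intro compact_imp_bounded compact_continuous_image) auto
  then obtain B where B: "B > 0" "\<And>x. norm x \<le> R \<Longrightarrow> \<bar>\<psi> x\<bar> \<le> B"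
    unfolding bounded_pos by (metis image_eqI mem_cball_0 real_norm_def)
  have "\<bar>\<psi> x\<bar> \<le> B" for x using R[of x] B(1) B(2)[of x] by (cases "\<psi> x = 0") auto
  then show thesis using that B(1) by blast
qed

lemma pairing_translate:
  assumes "test_function \<psi>"
  shows "(\<integral>t. \<psi> t * r (t - s) \<partial>lborel) = (\<integral>x. \<psi> (s + x) * r x \<partial>lborel)"
proof -
  have [measurable]: "\<psi> \<in> borel_measurable borel" by (rule test_function_measurable[OF assms])
  have "(\<integral>t. \<psi> t * r (t - s) \<partial>lborel) = (\<integral>x. \<psi> (s + x) * r (s + x - s) \<partial>lborel)"
    by (rule integral_lborel_translate[symmetric]) measurable
  then show ?thesis by simp
qed

text \<open>The supports of the translates along a convergent sequence lie in a common ball, on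
  which local integrability of r provides the dominating function.\<close>

lemma pairing_continuous:
  assumes \<psi>: "test_function \<psi>"
  shows "continuous_on UNIV (\<lambda>s. \<integral>x. \<psi> (s + x) * r x \<partial>lborel)"
  unfolding continuous_on_sequentially
proof (intro allI ballI impI, unfold comp_def)
  fix s :: "nat \<Rightarrow> real ^ 'd" and s0 assume "(\<forall>n. s n \<in> UNIV) \<and> s \<longlonglongrightarrow> s0"
  then have s: "s \<longlonglongrightarrow> s0" by simp
  obtain R where R: "\<And>x. \<psi> x \<noteq> 0 \<Longrightarrow> norm x \<le> R" using test_function_support[OF \<psi>] by blast
  obtain B where B: "B > 0" "\<And>x. \<bar>\<psi> x\<bar> \<le> B" using test_function_bounded[OF \<psi>] by blast
  have [measurable]: "\<psi> \<in> borel_measurable borel" by (rule test_function_measurable[OF \<psi>])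
  have "Bseq s" using s convergentI convergent_imp_Bseq by blast
  then obtain b where b: "\<And>n. norm (s n) \<le> b" unfolding Bseq_def by auto
  show "(\<lambda>n. \<integral>x. \<psi> (s n + x) * r x \<partial>lborel) \<longlonglongrightarrow> (\<integral>x. \<psi> (s0 + x) * r x \<partial>lborel)"
  proof (rule integral_dominated_convergence[where w = "\<lambda>x. B * \<bar>indicator (cball 0 (R + b)) x * r x\<bar>"])
    show "integrable lborel (\<lambda>x. B * \<bar>indicator (cball 0 (R + b)) x * r x\<bar>)"
      by (intro integrable_mult_right Bochner_Integration.integrable_abs locally_integrable_cball r_loc)
    show "AE x in lborel. (\<lambda>n. \<psi> (s n + x) * r x) \<longlonglongrightarrow> \<psi> (s0 + x) * r x"
    proof (rule AE_I2)
      fix x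
      have "isCont \<psi> (s0 + x)" using \<psi> by (metis UNIV_I continuous_on_eq_continuous_at open_UNIV smooth_continuous test_function_smooth)
      then have "(\<lambda>n. \<psi> (s n + x)) \<longlonglongrightarrow> \<psi> (s0 + x)" by (rule isCont_tendsto_compose) (intro tendsto_intros s)
      then show "(\<lambda>n. \<psi> (s n + x) * r x) \<longlonglongrightarrow> \<psi> (s0 + x) * r x" by (intro tendsto_intros)
    qed
    fix n
    show "AE x in lborel. norm (\<psi> (s n + x) * r x) \<le> B * \<bar>indicator (cball 0 (R + b)) x * r x\<bar>"
    proof (rule AE_I2)
      fix x
      show "norm (\<psi> (s n + x) * r x) \<le> B * \<bar>indicator (cball 0 (R + b)) x * r x\<bar>"
      proof (cases "\<psi> (s n + x) = 0")
        case True
        then show ?thesis using B by simp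
      next
        case False
        have "norm x \<le> norm (s n + x) + norm (s n)" using norm_triangle_ineq4[of "s n + x" "s n"] by simp
        then have "norm x \<le> R + b" using R[OF False] b[of n] by linarith
        then show ?thesis using B by (auto simp: abs_mult intro!: mult_right_mono)
      qed
    qed
  qed measurable
qed

text \<open>Take for \<zeta> j a Riemann version of \<open>\<psi> - mollify (rr j) \<psi>\<close>.
  Its convolutions converge to H at each point of the ball of radius a, yet tend to 0 for
  \<open>N\<close>; Fatou's lemma then makes the modular of H on A vanish.\<close>

lemma rho_eq_AE:
  assumes \<psi>: "test_function \<psi>" and A: "A \<in> noise_sets S" "A \<subseteq> cball 0 a"
  shows "AE s in leb. (conv_check \<psi> \<rho> s - (\<integral>t. \<psi> t * r (t - s) \<partial>lborel)) * indicator A s = 0"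
proof -
  define H where "H = (\<lambda>s. conv_check \<psi> \<rho> s - (\<integral>t. \<psi> t * r (t - s) \<partial>lborel))"
  obtain R where R: "\<And>x. \<psi> x \<noteq> 0 \<Longrightarrow> norm x \<le> R" using test_function_support[OF \<psi>] by blast
  obtain B where B: "B > 0" "\<And>x. \<bar>\<psi> x\<bar> \<le> B" using test_function_bounded[OF \<psi>] by blast
  have [measurable]: "\<psi> \<in> borel_measurable borel" by (rule test_function_measurable[OF \<psi>])
  have [measurable]: "cball (0 :: real ^ 'd) q \<in> sets borel" for q by simp
  have [measurable]: "rhom (rr j) \<in> borel_measurable borel" for j using rr_pos by simp
  have [measurable]: "A \<in> sets borel" using A by (simp add: noise_sets_D)
  have "\<exists>\<zeta>. test_function \<zeta> \<and> (\<forall>x. \<bar>\<zeta> x - (\<psi> x - mollify (rr j) \<psi> x)\<bar> \<le> 1 / Suc j) \<and> (\<forall>x. norm x > R + 1 \<longrightarrow> \<zeta> x = 0) \<and>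
    (\<forall>s. norm s \<le> a \<longrightarrow> \<bar>conv_check \<zeta> \<rho> s - (conv_check \<psi> \<rho> s - (\<integral>t. \<psi> t * rhom (rr j) (t - s) \<partial>lborel))\<bar> \<le> 1 / Suc j)" for j
  proof -
    have rj: "rr j \<le> 1" using rr_le[of j] by (rule order_trans) simp
    have pos: "1 / real (Suc j) > 0" by simp
    show ?thesis
    proof (rule mollified_riemann_sum[OF \<psi> R rr_pos rj pos, where a = a])
      fix \<zeta> :: "real ^ 'd \<Rightarrow> real"
      assume "test_function \<zeta>" "\<And>x. \<bar>\<zeta> x - (\<psi> x - mollify (rr j) \<psi> x)\<bar> \<le> 1 / Suc j" "\<And>x. norm x > R + 1 \<Longrightarrow> \<zeta> x = 0"
        "\<And>s. norm s \<le> a \<Longrightarrow> \<bar>conv_check \<zeta> \<rho> s - (conv_check \<psi> \<rho> s - (\<integral>t. \<psi> t * rhom (rr j) (t - s) \<partial>lborel))\<bar> \<le> 1 / Suc j"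
      then show ?thesis by (intro exI[of _ \<zeta>] conjI allI impI)
    qed
  qed
  from choice[OF allI, OF this] obtain \<zeta> where z: "\<forall>j. test_function (\<zeta> j) \<and> (\<forall>x. \<bar>\<zeta> j x - (\<psi> x - mollify (rr j) \<psi> x)\<bar> \<le> 1 / Suc j) \<and> (\<forall>x. norm x > R + 1 \<longrightarrow> \<zeta> j x = 0) \<and>
    (\<forall>s. norm s \<le> a \<longrightarrow> \<bar>conv_check (\<zeta> j) \<rho> s - (conv_check \<psi> \<rho> s - (\<integral>t. \<psi> t * rhom (rr j) (t - s) \<partial>lborel))\<bar> \<le> 1 / Suc j)" ..
  have \<zeta>: "\<And>j. test_function (\<zeta> j)" "\<And>j x. \<bar>\<zeta> j x - (\<psi> x - mollify (rr j) \<psi> x)\<bar> \<le> 1 / Suc j"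
    "\<And>j x. norm x > R + 1 \<Longrightarrow> \<zeta> j x = 0"
    "\<And>j s. norm s \<le> a \<Longrightarrow> \<bar>conv_check (\<zeta> j) \<rho> s - (conv_check \<psi> \<rho> s - (\<integral>t. \<psi> t * rhom (rr j) (t - s) \<partial>lborel))\<bar> \<le> 1 / Suc j"
    using z by simp_all
  have N0: "(\<lambda>j. N (conv_check (\<zeta> j) \<rho>)) \<longlonglongrightarrow> 0"
  proof (rule N_conv_check_tendsto_0[OF \<zeta>(1,3)])
    fix e :: real assume e: "e > 0"
    have "\<forall>\<^sub>F j in sequentially. 1 / real (Suc j) < e / 2"
      using order_tendstoD(2)[OF LIMSEQ_inverse_real_of_nat, of "e / 2"] e by (simp add: inverse_eq_divide)
    moreover have "\<forall>\<^sub>F j in sequentially. \<forall>x. \<bar>mollify (rr j) \<psi> x - \<psi> x\<bar> \<le> e / 2"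
      by (rule mollify_uniform[OF \<psi>]) (use e in simp)
    ultimately show "\<forall>\<^sub>F j in sequentially. \<forall>x. \<bar>\<zeta> j x\<bar> \<le> e"
    proof eventually_elim
      case (elim j)
      show ?case
      proof
        fix x
        have "\<bar>mollify (rr j) \<psi> x - \<psi> x\<bar> \<le> e / 2" using elim by blast
        then show "\<bar>\<zeta> j x\<bar> \<le> e" using \<zeta>(2)[of j x] elim(1) by linarith
      qed
    qed
  qed
  have lim: "(\<lambda>j. conv_check (\<zeta> j) \<rho> s) \<longlonglongrightarrow> H s" if s: "norm s \<le> a" for s
  proof -
    have i1: "integrable lborel (\<lambda>t. \<psi> t * rhom (rr j) (t - s))" for j
    proof -
      have "integrable lborel (\<lambda>t. indicator (cball 0 R) t *\<^sub>R (\<psi> t * rhom (rr j) (t - s)))"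
        by (intro borel_integrable_compact continuous_intros compact_cball continuous_on_compose2[OF rhom_continuous[OF rr_pos], where t = UNIV])
          (auto simp: smooth_continuous test_function_smooth \<psi>)
      also have "(\<lambda>t. indicator (cball 0 R) t *\<^sub>R (\<psi> t * rhom (rr j) (t - s))) = (\<lambda>t. \<psi> t * rhom (rr j) (t - s))"
        using R by (auto simp: fun_eq_iff indicator_def)
      finally show ?thesis .
    qed
    have i2: "integrable lborel (\<lambda>t. \<psi> t * r (t - s))"
    proof -
      have "integrable lborel (\<lambda>x. r x * \<psi> (s + x))"
        by (rule locally_integrable_mult_test[OF r_loc test_function_translate[OF \<psi>]])
      then have "integrable (distr lborel borel ((+) (- s))) (\<lambda>x. r x * \<psi> (s + x))" by (simp add: lborel_distr_plus)
      then have "integrable lborel (\<lambda>t. r (- s + t) * \<psi> (s + (- s + t)))" by (subst (asm) integrable_distr_eq) auto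
      then show ?thesis by (simp add: mult.commute)
    qed
    \<comment> \<open>The ball of radius R + a contains t - s for every t in the support of \<psi>
      and every s considered.\<close>
    let ?E = "\<lambda>j. \<integral>\<^sup>+y. ennreal \<bar>rhom (rr j) y - r y\<bar> * indicator (cball 0 (R + a)) y \<partial>lborel"
    have "(\<lambda>j. ennreal B * ?E j) \<longlonglongrightarrow> 0" using ennreal_tendsto_cmult[OF _ r_L1[of "R + a"], of "ennreal B"] by simp
    then have "(\<lambda>j. ennreal \<bar>(\<integral>t. \<psi> t * rhom (rr j) (t - s) \<partial>lborel) - (\<integral>t. \<psi> t * r (t - s) \<partial>lborel)\<bar>) \<longlonglongrightarrow> 0"
    proof (rule tendsto_sandwich[OF _ _ tendsto_const, rotated 2])
      show "\<forall>\<^sub>F j in sequentially. ennreal \<bar>(\<integral>t. \<psi> t * rhom (rr j) (t - s) \<partial>lborel) - (\<integral>t. \<psi> t * r (t - s) \<partial>lborel)\<bar> \<le> ennreal B * ?E j"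
      proof (intro always_eventually allI)
        fix j
        have "ennreal \<bar>(\<integral>t. \<psi> t * rhom (rr j) (t - s) \<partial>lborel) - (\<integral>t. \<psi> t * r (t - s) \<partial>lborel)\<bar> =
          ennreal (norm (\<integral>t. \<psi> t * rhom (rr j) (t - s) - \<psi> t * r (t - s) \<partial>lborel))"
          using i1 i2 by simp
        also have "\<dots> \<le> (\<integral>\<^sup>+t. ennreal (norm (\<psi> t * rhom (rr j) (t - s) - \<psi> t * r (t - s))) \<partial>lborel)"
          by (rule integral_norm_bound_ennreal) (use i1 i2 in simp)
        also have "\<dots> \<le> (\<integral>\<^sup>+t. ennreal B * (ennreal \<bar>rhom (rr j) (- s + t) - r (- s + t)\<bar> * indicator (cball 0 (R + a)) (- s + t)) \<partial>lborel)"
        proof (rule nn_integral_mono)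
          fix t
          show "ennreal (norm (\<psi> t * rhom (rr j) (t - s) - \<psi> t * r (t - s))) \<le>
            ennreal B * (ennreal \<bar>rhom (rr j) (- s + t) - r (- s + t)\<bar> * indicator (cball 0 (R + a)) (- s + t))"
          proof (cases "\<psi> t = 0")
            case False
            then have "norm t \<le> R" by (rule R)
            then have "norm (- s + t) \<le> R + a" using s norm_triangle_ineq4[of t s] by simp
            moreover have "norm (\<psi> t * rhom (rr j) (t - s) - \<psi> t * r (t - s)) \<le> B * \<bar>rhom (rr j) (t - s) - r (t - s)\<bar>"
              unfolding right_diff_distrib[symmetric] real_norm_def abs_mult using B by (intro mult_right_mono) auto
            ultimately show ?thesis using B by (simp add: ennreal_mult[symmetric] ennreal_leI)
          qed simp
        qed
        also have "\<dots> = (\<integral>\<^sup>+t. ennreal B * (ennreal \<bar>rhom (rr j) t - r t\<bar> * indicator (cball 0 (R + a)) t) \<partial>lborel)"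
          by (rule nn_integral_lborel_translate) measurable
        also have "\<dots> = ennreal B * ?E j" by (rule nn_integral_cmult) measurable
        finally show "ennreal \<bar>(\<integral>t. \<psi> t * rhom (rr j) (t - s) \<partial>lborel) - (\<integral>t. \<psi> t * r (t - s) \<partial>lborel)\<bar> \<le> ennreal B * ?E j" .
      qed
    qed simp
    then have "(\<lambda>j. \<bar>(\<integral>t. \<psi> t * rhom (rr j) (t - s) \<partial>lborel) - (\<integral>t. \<psi> t * r (t - s) \<partial>lborel)\<bar>) \<longlonglongrightarrow> 0"
      by (simp add: ennreal_tendsto_0_iff)
    then have "(\<lambda>j. (\<integral>t. \<psi> t * rhom (rr j) (t - s) \<partial>lborel) - (\<integral>t. \<psi> t * r (t - s) \<partial>lborel)) \<longlonglongrightarrow> 0"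
      by (rule tendsto_rabs_zero_cancel)
    then have l1: "(\<lambda>j. \<integral>t. \<psi> t * rhom (rr j) (t - s) \<partial>lborel) \<longlonglongrightarrow> (\<integral>t. \<psi> t * r (t - s) \<partial>lborel)"
      by (rule LIM_zero_cancel)
    have "(\<lambda>j. conv_check (\<zeta> j) \<rho> s - (conv_check \<psi> \<rho> s - (\<integral>t. \<psi> t * rhom (rr j) (t - s) \<partial>lborel))) \<longlonglongrightarrow> 0"
      by (rule Lim_null_comparison[OF _ LIMSEQ_inverse_real_of_nat])
        (use \<zeta>(4)[OF s] in \<open>auto simp: inverse_eq_divide intro!: always_eventually\<close>)
    from tendsto_add[OF this tendsto_diff[OF tendsto_const[of "conv_check \<psi> \<rho> s"] l1]]
    show ?thesis by (simp add: H_def)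
  qed
  have Hc: "continuous_on UNIV H" unfolding H_def pairing_translate[OF \<psi>]
    by (intro continuous_on_diff conv_check_continuous[OF distr_rho \<psi>] pairing_continuous[OF \<psi>])
  have [measurable]: "H \<in> borel_measurable borel" by (rule borel_measurable_continuous_onI[OF Hc])
  have [measurable]: "conv_check (\<zeta> j) \<rho> \<in> borel_measurable borel" for j
    by (rule borel_measurable_continuous_onI[OF conv_check_continuous[OF distr_rho \<zeta>(1)]])
  have "N (\<lambda>s. H s * indicator A s) \<le> 0"
  proof (rule ennreal_le_epsilon)
    fix e :: real assume e: "0 < e"
    have "N (\<lambda>s. H s * indicator A s) \<le> ennreal e"
    proof (rule N_Fatou[where gs = "\<lambda>j s. conv_check (\<zeta> j) \<rho> s * indicator A s"])
      show "AE s in leb. (\<lambda>m. conv_check (\<zeta> m) \<rho> s * indicator A s) \<longlonglongrightarrow> H s * indicator A s"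
      proof (rule AE_I2)
        fix s
        show "(\<lambda>m. conv_check (\<zeta> m) \<rho> s * indicator A s) \<longlonglongrightarrow> H s * indicator A s"
        proof (cases "s \<in> A")
          case True
          then have "norm s \<le> a" using A(2) by auto
          from lim[OF this] show ?thesis using True by simp
        qed simp
      qed
      have "\<forall>\<^sub>F j in sequentially. N (conv_check (\<zeta> j) \<rho>) < ennreal e" using N0 by (rule order_tendstoD) (use e in simp)
      then show "\<forall>\<^sub>F j in sequentially. N (\<lambda>s. conv_check (\<zeta> j) \<rho> s * indicator A s) \<le> ennreal e"
      proof eventually_elim
        case (elim j)
        have "N (\<lambda>s. conv_check (\<zeta> j) \<rho> s * indicator A s) \<le> N (conv_check (\<zeta> j) \<rho>)" by (rule N_mono) (simp add: indicator_def)
        then show ?case using elim by simp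
      qed
    qed auto
    then show "N (\<lambda>s. H s * indicator A s) \<le> 0 + ennreal e" by simp
  qed
  then have "N (\<lambda>s. H s * indicator A s) = 0" by simp
  then have "AE s in leb. H s * indicator A s = 0" by (intro N_zero_AE[OF _ _ nu_pos]) auto
  then show ?thesis unfolding H_def .
qed

text \<open>The two sides agree almost everywhere on A and are continuous, so they agree at a point
  s0 all of whose neighbourhoods meet A in positive measure. Translating the test function by s0
  turns the convolution at s0 into a value of \<rho>.\<close>

lemma rho_is_function: "distribution_is_function \<rho> r"
  unfolding distribution_is_function_def
proof (intro conjI allI impI r_loc)
  fix \<psi>0 :: "real ^ 'd \<Rightarrow> real" assume \<psi>0: "test_function \<psi>0"
  obtain a A B \<epsilon> where A: "A \<in> noise_sets S" "A \<subseteq> cball 0 a" "emeasure lborel A > 0"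
    by (rule choose_sets)
  have Ab: "A \<in> sets borel" "A \<subseteq> S" using A by (auto simp: noise_sets_D)
  obtain s0 where s0: "s0 \<in> A" "\<And>U. open U \<Longrightarrow> s0 \<in> U \<Longrightarrow> emeasure lborel (A \<inter> U) > 0"
    using support_point[OF Ab(1) A(3)] by blast
  define \<psi> where "\<psi> = (\<lambda>x. \<psi>0 (- s0 + x))"
  have \<psi>: "test_function \<psi>" unfolding \<psi>_def by (rule test_function_translate[OF \<psi>0])
  define H where "H = (\<lambda>s. conv_check \<psi> \<rho> s - (\<integral>t. \<psi> t * r (t - s) \<partial>lborel))"
  have Hc: "continuous_on UNIV H" unfolding H_def pairing_translate[OF \<psi>]
    by (intro continuous_on_diff conv_check_continuous[OF distr_rho \<psi>] pairing_continuous[OF \<psi>])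
  have "H s0 = 0"
  proof (rule ccontr)
    assume "H s0 \<noteq> 0"
    define U where "U = H -` (- {0})"
    have U: "open U" unfolding U_def by (rule open_vimage[OF _ Hc]) auto
    have "s0 \<in> U" using \<open>H s0 \<noteq> 0\<close> by (simp add: U_def)
    have "AE s in leb. H s * indicator A s = 0" unfolding H_def by (rule rho_eq_AE[OF \<psi> A(1,2)])
    then have "AE s in leb. s \<notin> A \<inter> U" by eventually_elim (auto simp: U_def)
    moreover have mem: "A \<inter> U \<in> sets leb" and eq: "{s \<in> space leb. \<not> s \<notin> A \<inter> U} = A \<inter> U"
      using Ab U by (auto simp: sets_leb)
    ultimately have "emeasure leb (A \<inter> U) = 0" using AE_iff_measurable[OF mem eq] by simp
    then have "emeasure lborel (A \<inter> U) = 0"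
      using Ab by (subst (asm) emeasure_restrict_space) auto
    then show False using s0(2)[OF U \<open>s0 \<in> U\<close>] by simp
  qed
  moreover have "conv_check \<psi> \<rho> s0 = \<rho> \<psi>0" by (simp add: conv_check_def \<psi>_def)
  moreover have "(\<integral>t. \<psi> t * r (t - s0) \<partial>lborel) = (\<integral>x. r x * \<psi>0 x \<partial>lborel)"
    unfolding pairing_translate[OF \<psi>] by (simp add: \<psi>_def mult.commute)
  ultimately show "\<rho> \<psi>0 = (\<integral>x. r x * \<psi>0 x \<partial>lborel)" by (simp add: H_def)
qed

section \<open>The mild solution\<close>

text \<open>Tonelli exchanges the mean over \<omega> with the integral over t; the rates are
  summable, so for almost every t the whole sequence of distances tends to 0.\<close>

lemma AE_pdist_mollified:
  "AE t in lborel. (\<lambda>j. pdist M (Ym (rr j) t) (Y t)) \<longlonglongrightarrow> 0"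
proof -
  have [measurable]: "cball (0 :: real ^ 'd) q \<in> sets borel" for q by simp
  have [measurable]: "(\<lambda>(t, \<omega>). Ym (rr j) t \<omega>) \<in> borel_measurable (borel \<Otimes>\<^sub>M M)" for j
    by (rule Ym_measurable[OF rr_pos])
  have [measurable]: "dev (rr j) q \<in> borel_measurable M" for q j using rr_pos by simp
  interpret MT: pair_sigma_finite M "lborel :: (real ^ 'd) measure" ..
  have "AE t in lborel. t \<in> cball 0 (real n) \<longrightarrow> (\<lambda>j. pdist M (Ym (rr j) t) (Y t)) \<longlonglongrightarrow> 0" for n
  proof -
    let ?B = "cball (0 :: real ^ 'd) (real n)"
    let ?v = "emeasure lborel ?B"
    have v: "?v < \<top>" using emeasure_lborel_cball_finite[of "0 :: real ^ 'd" "real n"] by simp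
    \<comment> \<open>The shift by n places the ball of radius n inside the ball of radius j + n, on
      which the deviation is controlled.\<close>
    have le: "(\<integral>\<^sup>+t. pdist M (Ym (rr (j + n)) t) (Y t) * indicator ?B t \<partial>lborel) \<le> (1 + ?v) * ennreal ((1/4) ^ j)" for j
    proof -
      let ?h = "\<lambda>t \<omega>. ennreal (min 1 \<bar>Ym (rr (j + n)) t \<omega> - Y t \<omega>\<bar>) * indicator ?B t"
      have "(\<integral>\<^sup>+t. pdist M (Ym (rr (j + n)) t) (Y t) * indicator ?B t \<partial>lborel) = (\<integral>\<^sup>+t. (\<integral>\<^sup>+\<omega>. ?h t \<omega> \<partial>M) \<partial>lborel)"
        unfolding pdist_def by (intro nn_integral_cong nn_integral_multc[symmetric]) measurable
      also have "\<dots> = (\<integral>\<^sup>+\<omega>. (\<integral>\<^sup>+t. ?h t \<omega> \<partial>lborel) \<partial>M)"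
        by (rule MT.Fubini') measurable
      also have "\<dots> \<le> (\<integral>\<^sup>+\<omega>. (1 + ?v) * min 1 (dev (rr (j + n)) (real (j + n)) \<omega>) \<partial>M)"
      proof (rule nn_integral_mono)
        fix \<omega>
        let ?I = "\<integral>\<^sup>+t. ?h t \<omega> \<partial>lborel" and ?d = "dev (rr (j + n)) (real (j + n)) \<omega>"
        have "?I \<le> (\<integral>\<^sup>+t. indicator ?B t \<partial>lborel)"
          by (intro nn_integral_mono) (auto simp: indicator_def)
        then have Iv: "?I \<le> ?v" by simp
        have "?I \<le> dev (rr (j + n)) (real n) \<omega>" unfolding dev_def
          by (intro nn_integral_mono mult_right_mono ennreal_leI) auto
        also have "\<dots> \<le> ?d" by (rule dev_mono) simp
        finally have Id: "?I \<le> ?d" .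
        show "?I \<le> (1 + ?v) * min 1 ?d"
        proof (cases "?d \<le> 1")
          case True
          have "1 * ?d \<le> (1 + ?v) * ?d" by (intro mult_right_mono) auto
          with Id True show ?thesis by (simp only: min_absorb2 mult_1_left order_trans[OF Id])
        next
          case False
          then have "min 1 ?d = 1" by (simp add: min_absorb1)
          moreover have "?I \<le> 1 + ?v" by (rule add_increasing[OF zero_le_one Iv])
          ultimately show ?thesis by (simp only: mult_1_right)
        qed
      qed
      also have "\<dots> = (1 + ?v) * (\<integral>\<^sup>+\<omega>. min 1 (dev (rr (j + n)) (real (j + n)) \<omega>) \<partial>M)"
        by (rule nn_integral_cmult) measurable
      also have "\<dots> \<le> (1 + ?v) * ennreal ((1/4) ^ (j + n))"
        by (intro mult_left_mono rr_dev) auto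
      also have "\<dots> \<le> (1 + ?v) * ennreal ((1/4) ^ j)"
        by (intro mult_left_mono ennreal_leI power_decreasing) auto
      finally show ?thesis .
    qed
    have [measurable]: "(\<lambda>t. pdist M (Ym (rr j) t) (Y t)) \<in> borel_measurable borel" for j
      unfolding pdist_def by measurable
    have "(\<integral>\<^sup>+t. (\<Sum>j. pdist M (Ym (rr (j + n)) t) (Y t) * indicator ?B t) \<partial>lborel)
      = (\<Sum>j. \<integral>\<^sup>+t. pdist M (Ym (rr (j + n)) t) (Y t) * indicator ?B t \<partial>lborel)"
      by (rule nn_integral_suminf) measurable
    also have "\<dots> \<le> (\<Sum>j. (1 + ?v) * ennreal ((1/4) ^ j))"
      by (intro suminf_le le) auto
    also have "\<dots> = (1 + ?v) * ennreal (\<Sum>j. (1/4) ^ j)"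
      by (simp add: suminf_ennreal2 summable_geometric)
    also have "\<dots> < \<top>" using v by (simp add: ennreal_mult_less_top)
    finally have fin: "(\<integral>\<^sup>+t. (\<Sum>j. pdist M (Ym (rr (j + n)) t) (Y t) * indicator ?B t) \<partial>lborel) < \<top>" .
    have "AE t in lborel. (\<Sum>j. pdist M (Ym (rr (j + n)) t) (Y t) * indicator ?B t) \<noteq> \<top>"
      by (rule nn_integral_PInf_AE[unfolded infinity_ennreal_def]) (measurable, use fin in simp)
    then show ?thesis
    proof eventually_elim
      case (elim t)
      show ?case
      proof
        assume t: "t \<in> ?B"
        let ?g = "\<lambda>j. enn2real (pdist M (Ym (rr (j + n)) t) (Y t))"
        have eq: "pdist M (Ym (rr (j + n)) t) (Y t) = ennreal (?g j)" for j
          using pdist_finite by (simp add: ennreal_enn2real)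
        have "(\<Sum>j. ennreal (?g j)) \<noteq> \<top>" using elim t by (simp add: eq[symmetric])
        then have "?g \<longlonglongrightarrow> 0"
          by (intro summable_LIMSEQ_zero summable_suminf_not_top) auto
        from tendsto_ennrealI[OF this]
        have "(\<lambda>j. pdist M (Ym (rr (j + n)) t) (Y t)) \<longlonglongrightarrow> 0" by (simp add: eq[symmetric])
        then show "(\<lambda>j. pdist M (Ym (rr j) t) (Y t)) \<longlonglongrightarrow> 0" by (rule LIMSEQ_offset)
      qed
    qed
  qed
  then have "AE t in lborel. \<forall>n. t \<in> cball 0 (real n) \<longrightarrow> (\<lambda>j. pdist M (Ym (rr j) t) (Y t)) \<longlonglongrightarrow> 0"
    unfolding AE_all_countable by (rule allI)
  then show ?thesis
  proof eventually_elim
    case (elim t)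
    obtain n where "norm t \<le> real n" using real_arch_simple by blast
    then show ?case using elim by auto
  qed
qed

text \<open>The stochastic integrals of the mollified kernels are versions of
  \<open>Ym (rr j) t\<close>. Their convergence to Y t gives, by \<open>charac_cauchy_limit\<close>,
  both membership of the limit kernel in \<open>L_noise\<close> and convergence for
  \<open>N\<close>. The same integrals therefore converge to the stochastic integral of the limit
  kernel, and limits in probability agree almost surely.\<close>

lemma mild_solution:
  assumes lim: "(\<lambda>j. pdist M (Ym (rr j) t) (Y t)) \<longlonglongrightarrow> 0"
  shows "(\<lambda>s. r (t - s)) \<in> L_noise S \<nu>" "AE \<omega> in M. Y t \<omega> = u_mild M S X r t \<omega>"
proof -
  define fs where "fs = (\<lambda>j s. rhom (rr j) (t - s))"
  define V where "V = (\<lambda>j. stoch_integral M S X (fs j))"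
  have fs_conv: "fs j = conv_check (kernel (rr j) t) \<rho>" for j
    by (rule ext) (simp add: fs_def conv_check_kernel)
  have fs: "fs j \<in> L_noise S \<nu>" for j
    unfolding fs_conv by (rule conv_L[OF test_function_kernel[OF rr_pos]])
  have V[measurable]: "V j \<in> borel_measurable M" for j
    unfolding V_def by (rule characD(1)[OF charac_stoch_integral[OF fs]])
  have Yt[measurable]: "Y t \<in> borel_measurable M" by measurable
  have "AE \<omega> in M. V j \<omega> = Ym (rr j) t \<omega>" for j
    using Y_rep[OF test_function_kernel[OF rr_pos[of j], of t]]
    by (simp add: V_def u_gen_def fs_conv I_kernel[symmetric] I_def)
  then have "pdist M (V j) (Y t) = pdist M (Ym (rr j) t) (Y t)" for j
    by (intro pdist_cong_AE) auto
  with lim have Vlim: "(\<lambda>j. pdist M (V j) (Y t)) \<longlonglongrightarrow> 0" by simp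
  have c: "charac (\<lambda>\<omega>. V i \<omega> - V j \<omega>) (\<lambda>s. fs i s - fs j s)" for i j
    unfolding V_def by (rule charac_stoch_integral_diff[OF fs fs])
  have f[measurable]: "(\<lambda>s. r (t - s)) \<in> borel_measurable leb" by (rule measurable_leb) measurable
  have "AE s in lborel. (\<lambda>j. fs j s) \<longlonglongrightarrow> r (t - s)"
    unfolding fs_def by (rule AE_lborel_reflect[OF r_AE])
  then have AE: "AE s in leb. (\<lambda>j. fs j s) \<longlonglongrightarrow> r (t - s)"
    by (subst AE_restrict_space_iff) auto
  note * = charac_cauchy_limit[OF c fs V Yt f AE Vlim]
  show L: "(\<lambda>s. r (t - s)) \<in> L_noise S \<nu>" by (rule *(1))
  let ?Z = "stoch_integral M S X (\<lambda>s. r (t - s))"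
  have Z[measurable]: "?Z \<in> borel_measurable M" by (rule characD(1)[OF charac_stoch_integral[OF L]])
  have sq: "(pdist M (V j) ?Z)\<^sup>2 \<le> 20 * N (\<lambda>s. fs j s - r (t - s))" for j
    using charac_pdist_le[OF charac_stoch_integral_diff[OF fs[of j] L]] unfolding pdist_zero V_def .
  have VZ: "(\<lambda>j. pdist M (V j) ?Z) \<longlonglongrightarrow> 0"
    by (rule ennreal_sq_tendsto_0[OF sq _ *(2)]) simp
  have "pdist M (Y t) ?Z \<le> pdist M (V j) (Y t) + pdist M (V j) ?Z" for j
    using pdist_triangle[OF Yt V[of j] Z] by (simp add: pdist_commute[of M "V j" "Y t"])
  then have "pdist M (Y t) ?Z \<le> 0 + 0"
    by (intro LIMSEQ_le_const[OF tendsto_add[OF Vlim VZ]]) auto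
  then have "pdist M (Y t) ?Z = 0" by simp
  from pdist_zero_AE[OF Yt Z this] show "AE \<omega> in M. Y t \<omega> = u_mild M S X r t \<omega>"
    unfolding u_mild_def .
qed

end

theorem theorem5p3:
  fixes M :: "'w measure"
    and S :: "(real ^ 'd::finite) set"
    and \<nu> :: "real measure"
    and J :: "'w \<Rightarrow> ((real ^ 'd) \<times> real) measure"
    and X :: "(real ^ 'd) set \<Rightarrow> 'w \<Rightarrow> real"
    and m :: nat
    and a :: "'d list \<Rightarrow> real ^ 'd \<Rightarrow> real"
    and \<rho> :: "(real ^ 'd \<Rightarrow> real) \<Rightarrow> real"
    and Y :: "real ^ 'd \<Rightarrow> 'w \<Rightarrow> real"
  assumes "prob_space M"
    and "S \<in> sets borel"
    and "symmetric_pure_jump_levy_noise M S \<nu> J X"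
    and nondegenerate: "emeasure lborel S > 0" "emeasure \<nu> UNIV > 0"
    and "pdo_coeffs m a"
    and "fundamental_solution m a \<rho>"
    and "\<And>\<phi>. test_function \<phi> \<Longrightarrow> conv_check \<phi> \<rho> \<in> L_noise S \<nu>"
    and "random_field_representation M (u_gen M S X \<rho>) Y"
  shows "\<exists>r. distribution_is_function \<rho> r \<and>
           (AE t in lborel. (\<lambda>s. r (t - s)) \<in> L_noise S \<nu>) \<and>
           (AE t in lborel. AE \<omega> in M. Y t \<omega> = u_mild M S X r t \<omega>)"
proof -
  interpret levy_noise M S \<nu> J X
    using assms(1-3) by (intro levy_noise.intro levy_noise_axioms.intro)
  have "schwartz_distribution \<rho>" using assms(7) by (simp add: fundamental_solution_def)
  moreover note rep = assms(9)[unfolded random_field_representation_def]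
  ultimately interpret random_field M S \<nu> J X \<rho> Y
    by unfold_locales (use nondegenerate assms(8) in auto)
  obtain rr :: "nat \<Rightarrow> real" where rr: "\<And>j. rr j > 0" "\<And>j. rr j \<le> 1 / Suc j"
    "\<And>j. (\<integral>\<^sup>+\<omega>. min 1 (dev (rr j) (real j) \<omega>) \<partial>M) \<le> ennreal ((1/4) ^ j)"
    using choose_radii by blast
  interpret random_field_radii M S \<nu> J X \<rho> Y rr
    by unfold_locales (fact rr)+
  \<comment> \<open>The limit is fixed before any t, so one function represents \<rho> and supplies
    all the kernels r(t - .).\<close>
  obtain r where r: "locally_integrable r" "AE y in lborel. (\<lambda>j. rhom (rr j) y) \<longlonglongrightarrow> r y"
    "\<And>R. (\<lambda>j. \<integral>\<^sup>+y. ennreal \<bar>rhom (rr j) y - r y\<bar> * indicator (cball 0 R) y \<partial>lborel) \<longlonglongrightarrow> 0"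
    by (rule L1_loc_limit[of "\<lambda>j. rhom (rr j)"]) (auto intro: rhom_continuous rhom_summable rr)
  interpret random_field_limit M S \<nu> J X \<rho> Y rr r
    by unfold_locales (fact r)+
  show ?thesis
  proof (intro exI conjI)
    show "distribution_is_function \<rho> r" by (rule rho_is_function)
    show "AE t in lborel. (\<lambda>s. r (t - s)) \<in> L_noise S \<nu>"
      using AE_pdist_mollified by eventually_elim (rule mild_solution)
    show "AE t in lborel. AE \<omega> in M. Y t \<omega> = u_mild M S X r t \<omega>"
      using AE_pdist_mollified by eventually_elim (rule mild_solution)
  qed
qed

end
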